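(* Let $G/H$ be a compact homogeneous space and $T$ a positive-definite $G$-invariant $(0,2)$-tensor field on $G/H$. If $H$ is not maximal in $G$, then the set of intermediate subgroups $K$ (with Lie algebra $\mathfrak k$) satisfying $\alpha_{\mathfrak k}=\alpha_{G/H}$ is non-empty. If $K$ is such a subgroup of the lowest possible dimension and $\beta_{\mathfrak k}-\alpha_{\mathfrak k}>0$, then the restriction of $S$ to $\mathcal M_T$ achieves its supremum at some metric $g\in\mathcal M_T$, and hence $\operatorname{Ric}(g)=cT$ for some constant $c>0$.
   Context: Standing setting: $H\subset G$ are compact connected Lie groups with Lie algebras $\mathfrak h\subset\mathfrak g$, the homogeneous space $G/H$ is almost effective (the subgroup of $G$ acting trivially is discrete) and is not a torus. Fix an $\operatorname{Ad}_G$-invariant inner product $Q$ on $\mathfrak g$ (bi-invariant metric) and let $\mathfrak m=\mathfrak h^\perp$ be the $Q$-orthogonal complement, identified with the tangent space of $G/H$ at $eH$. All tensor fields $T$ are symmetric. $G$-invariant Riemannian metrics and $G$-invariant symmetric $(0,2)$-tensor fields on $G/H$ are identified with $\operatorname{Ad}_H$-invariant inner products, respectively symmetric bilinear forms, on $\mathfrak m$. $\mathcal M=\mathcal M(G/H)$ is the set of $G$-invariant metrics, $S(g)$ is the scalar curvature of $g$, and $\mathcal M_T=\{g\in\mathcal M\mid \operatorname{tr}_gT=1\}$. An intermediate subalgebra is a Lie algebra $\mathfrak k$ with $\mathfrak h\subsetneq\mathfrak k\subsetneq\mathfrak g$; the corresponding intermediate subgroup $K$ is the connected Lie subgroup of $G$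 with Lie algebra $\mathfrak k$ (so $H\subset K\subset G$; $K$ is not required to be closed). $H$ is maximal in $G$ if there is no intermediate subgroup. $\mathfrak k^\perp\subset\mathfrak m$ is the $Q$-orthogonal complement of $\mathfrak k$ in $\mathfrak g$. $\mathcal M(K/H)$ is the set of $\operatorname{Ad}_H$-invariant inner products on $\mathfrak k\cap\mathfrak m$ (homogeneous metrics on $K/H$), and $\mathcal M(G/K)$ is the set of $\operatorname{Ad}_K$-invariant inner products on $\mathfrak k^\perp$ (homogeneous metrics on $G/K$; if $K$ is not closed these are understood locally). The scalar curvature of a homogeneous metric $h$ on $L/L'$, given by an inner product on the $Q$-orthogonal complement $\mathfrak p$ of $\mathfrak l'$ in $\mathfrak l$, is $S(h)=-\frac12\sum_a B_{\mathfrak l}(e_a,e_a)-\frac14\sum_{a,b}|[e_a,e_b]_{\mathfrak p}|_h^2$, where $(e_a)$ is an $h$-orthonormal basis of $\mathfrak p$, $B_{\mathfrak l}$ is the Killing form of $\mathfrak l$ and the subscript $\mathfrak p$ denotes the $Q$-orthogonal projection to $\mathfrak p$; this also defines $S(h)$ when $K$ is not closed. Set $$\alpha_{\mathfrak k}=\sup\{S(h)\mid h\in\mathcal M(K/H),\ \operatorname{tr}_h(T_{|\mathfrak k\cap\mathfrak m})=1\},\qquad \beta_{\mathfrak k}=\sup\{S(h)\mid h\in\mathcal M(G/K),\ \operatorname{tr}_h(T_{|\mathfrak k^\perp})=1\},$$ $$\alpha_{G/H}=\sup_{\mathfrak k}\alpha_{\mathfrak k},$$ where the last supremum is over all intermediate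 subalgebras $\mathfrak k$. *)

theory Defs
  imports "HOL-Analysis.Analysis" "HOL-Algebra.Generated_Groups"
begin

section \<open>Lie groups\<close>

primrec Ck_on :: "nat \<Rightarrow> 'a::real_normed_vector set \<Rightarrow> ('a \<Rightarrow> 'b::real_normed_vector) \<Rightarrow> bool" where
  "Ck_on 0 S f \<longleftrightarrow> continuous_on S f"
| "Ck_on (Suc k) S f \<longleftrightarrow>
     (\<forall>x\<in>S. f differentiable (at x)) \<and> (\<forall>v. Ck_on k S (\<lambda>x. frechet_derivative f (at x) v))"

text \<open>Only used for open \<open>S\<close>.\<close>

definition smooth_on :: "'a::real_normed_vector set \<Rightarrow> ('a \<Rightarrow> 'b::real_normed_vector) \<Rightarrow> bool" where
  "smooth_on S f \<longleftrightarrow> (\<forall>k. Ck_on k S f)"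

type_synonym ('g, 'a) chart = "'g set \<times> ('g \<Rightarrow> 'a)"

definition inv_chart :: "('g, 'a) chart \<Rightarrow> 'a \<Rightarrow> 'g" where
  "inv_chart c = inv_into (fst c) (snd c)"

definition is_chart :: "'g topology \<Rightarrow> ('g, 'a::euclidean_space) chart \<Rightarrow> bool" where
  "is_chart X c \<longleftrightarrow> openin X (fst c) \<and> open (snd c ` fst c) \<and>
     homeomorphic_map (subtopology X (fst c)) (top_of_set (snd c ` fst c)) (snd c)"

definition compatible :: "('g, 'a::euclidean_space) chart \<Rightarrow> ('g, 'a) chart \<Rightarrow> bool" where
  "compatible c d \<longleftrightarrow>
     smooth_on (snd c ` (fst c \<inter> fst d)) (snd d \<circ> inv_chart c) \<and>
     smooth_on (snd d ` (fst c \<inter> fst d)) (snd c \<circ> inv_chart d)"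

text \<open>
  The model space \<open>'a\<close> of the charts has positive dimension because it is a
  \<open>euclidean_space\<close>.  The field \<open>base_chart\<close> is a chart of the atlas around the identity; its
  differential identifies the tangent space at the identity, that is the Lie algebra of \<open>G\<close>,
  with the vector space \<open>'a\<close>.
\<close>

record ('g, 'a) lie_data = "'g monoid" +
  topol :: "'g topology"
  atlas :: "('g, 'a) chart set"
  base_chart :: "('g, 'a) chart"

locale lie_group = group G for G :: "('g, 'a::euclidean_space, 'm) lie_data_scheme" (structure) +
  assumes topspace_carrier: "topspace (topol G) = carrier G"
    and hausdorff: "Hausdorff_space (topol G)"
    and second_countable: "second_countable (topol G)"
    and charts: "\<And>c. c \<in> atlas G \<Longrightarrow> is_chart (topol G) c"
    and charts_cover: "(\<Union>c\<in>atlas G. fst c) = carrier G"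
    and charts_compatible: "\<And>c d. c \<in> atlas G \<Longrightarrow> d \<in> atlas G \<Longrightarrow> compatible c d"
    and base_chart_atlas: "base_chart G \<in> atlas G"
    and base_chart_one: "\<one> \<in> fst (base_chart G)"
    and continuous_mult:
      "continuous_map (prod_topology (topol G) (topol G)) (topol G) (\<lambda>(x, y). x \<otimes> y)"
    and smooth_mult: "\<And>c d e. c \<in> atlas G \<Longrightarrow> d \<in> atlas G \<Longrightarrow> e \<in> atlas G \<Longrightarrow>
      smooth_on {(x, y). x \<in> snd c ` fst c \<and> y \<in> snd d ` fst d \<and>
                         inv_chart c x \<otimes> inv_chart d y \<in> fst e}
                (\<lambda>(x, y). snd e (inv_chart c x \<otimes> inv_chart d y))"
    and continuous_inv: "continuous_map (topol G) (topol G) (\<lambda>x. inv x)"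
    and smooth_inv: "\<And>c e. c \<in> atlas G \<Longrightarrow> e \<in> atlas G \<Longrightarrow>
      smooth_on {x. x \<in> snd c ` fst c \<and> inv (inv_chart c x) \<in> fst e}
                (\<lambda>x. snd e (inv (inv_chart c x)))"

text \<open>\<open>Ad G a\<close> is the differential at the identity of \<open>x \<mapsto> a x a\<^sup>-\<^sup>1\<close>, and the Lie bracket is
  the differential of \<open>Ad\<close> at the identity: \<open>[v, w] = (d Ad)(v) w\<close>.\<close>

definition Ad :: "('g, 'a::euclidean_space, 'm) lie_data_scheme \<Rightarrow> 'g \<Rightarrow> 'a \<Rightarrow> 'a" where
  "Ad G a v = frechet_derivative
     (\<lambda>x. snd (base_chart G) (a \<otimes>\<^bsub>G\<^esub> inv_chart (base_chart G) x \<otimes>\<^bsub>G\<^esub> inv\<^bsub>G\<^esub> a))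
     (at (snd (base_chart G) \<one>\<^bsub>G\<^esub>)) v"

definition bracket :: "('g, 'a::euclidean_space, 'm) lie_data_scheme \<Rightarrow> 'a \<Rightarrow> 'a \<Rightarrow> 'a" where
  "bracket G v w = frechet_derivative
     (\<lambda>x. Ad G (inv_chart (base_chart G) x) w) (at (snd (base_chart G) \<one>\<^bsub>G\<^esub>)) v"

text \<open>A subgroup that is an embedded submanifold (every compact Lie subgroup is embedded).\<close>

definition embedded_lie_subgroup ::
  "('g, 'a::euclidean_space, 'm) lie_data_scheme \<Rightarrow> 'g set \<Rightarrow> bool" where
  "embedded_lie_subgroup G H \<longleftrightarrow> subgroup H G \<and>
     (\<forall>p\<in>H. \<exists>c E. is_chart (topol G) c \<and> (\<forall>d\<in>atlas G. compatible c d) \<and> p \<in> fst c \<and>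
        subspace E \<and> snd c ` (fst c \<inter> H) = snd c ` fst c \<inter> E)"

text \<open>The tangent space of \<open>H\<close> at the identity.\<close>

definition lie_alg :: "('g, 'a::euclidean_space, 'm) lie_data_scheme \<Rightarrow> 'g set \<Rightarrow> 'a set" where
  "lie_alg G H = {v. \<exists>\<gamma> \<epsilon>::real. \<epsilon> > 0 \<and>
     \<gamma> ` {-\<epsilon><..<\<epsilon>} \<subseteq> H \<inter> fst (base_chart G) \<and> \<gamma> 0 = \<one>\<^bsub>G\<^esub> \<and>
     smooth_on {-\<epsilon><..<\<epsilon>} (snd (base_chart G) \<circ> \<gamma>) \<and>
     ((snd (base_chart G) \<circ> \<gamma>) has_vector_derivative v) (at 0)}"

definition lie_subalgebra :: "('g, 'a::euclidean_space, 'm) lie_data_scheme \<Rightarrow> 'a set \<Rightarrow> bool" where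
  "lie_subalgebra G \<kk> \<longleftrightarrow> subspace \<kk> \<and> (\<forall>x\<in>\<kk>. \<forall>y\<in>\<kk>. bracket G x y \<in> \<kk>)"

definition one_parameter_subgroup ::
  "('g, 'a::euclidean_space, 'm) lie_data_scheme \<Rightarrow> (real \<Rightarrow> 'g) \<Rightarrow> 'a \<Rightarrow> bool" where
  "one_parameter_subgroup G \<gamma> v \<longleftrightarrow>
     continuous_map euclideanreal (topol G) \<gamma> \<and> (\<forall>s t. \<gamma> (s + t) = \<gamma> s \<otimes>\<^bsub>G\<^esub> \<gamma> t) \<and>
     ((snd (base_chart G) \<circ> \<gamma>) has_vector_derivative v) (at 0)"

text \<open>The connected Lie subgroup with Lie algebra \<open>\<kk>\<close>, generated by \<open>exp \<kk>\<close>; it need not be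
  closed in \<open>G\<close>.\<close>

definition connected_lie_subgroup ::
  "('g, 'a::euclidean_space, 'm) lie_data_scheme \<Rightarrow> 'a set \<Rightarrow> 'g set" where
  "connected_lie_subgroup G \<kk> =
     generate G {\<gamma> 1 | \<gamma> v. v \<in> \<kk> \<and> one_parameter_subgroup G \<gamma> v}"

definition intermediate_subalgebra ::
  "('g, 'a::euclidean_space, 'm) lie_data_scheme \<Rightarrow> 'g set \<Rightarrow> 'a set \<Rightarrow> bool" where
  "intermediate_subalgebra G H \<kk> \<longleftrightarrow>
     lie_subalgebra G \<kk> \<and> lie_alg G H \<subset> \<kk> \<and> \<kk> \<subset> UNIV"

text \<open>\<open>K\<close> is an intermediate subgroup with Lie algebra \<open>\<kk>\<close>; its dimension is \<open>dim \<kk>\<close>.\<close>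

definition intermediate_subgroup ::
  "('g, 'a::euclidean_space, 'm) lie_data_scheme \<Rightarrow> 'g set \<Rightarrow> 'g set \<Rightarrow> 'a set \<Rightarrow> bool" where
  "intermediate_subgroup G H K \<kk> \<longleftrightarrow>
     intermediate_subalgebra G H \<kk> \<and> K = connected_lie_subgroup G \<kk>"

definition maximal_subgroup_in ::
  "('g, 'a::euclidean_space, 'm) lie_data_scheme \<Rightarrow> 'g set \<Rightarrow> bool" where
  "maximal_subgroup_in G H \<longleftrightarrow> \<not> (\<exists>K \<kk>. intermediate_subgroup G H K \<kk>)"


section \<open>The homogeneous space\<close>

definition ineffective_kernel ::
  "('g, 'a::euclidean_space, 'm) lie_data_scheme \<Rightarrow> 'g set \<Rightarrow> 'g set" where
  "ineffective_kernel G H =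
     {a \<in> carrier G. \<forall>x\<in>carrier G. (a \<otimes>\<^bsub>G\<^esub> x) <#\<^bsub>G\<^esub> H = x <#\<^bsub>G\<^esub> H}"

definition almost_effective ::
  "('g, 'a::euclidean_space, 'm) lie_data_scheme \<Rightarrow> 'g set \<Rightarrow> bool" where
  "almost_effective G H \<longleftrightarrow>
     subtopology (topol G) (ineffective_kernel G H) = discrete_topology (ineffective_kernel G H)"

definition torus_topology :: "nat \<Rightarrow> (nat \<Rightarrow> complex) topology" where
  "torus_topology n = product_topology (\<lambda>_. top_of_set (sphere 0 1)) {..<n}"

text \<open>\<open>Y\<close> is the set of left cosets with the quotient topology.\<close>

definition quotient_is_torus ::
  "('g, 'a::euclidean_space, 'm) lie_data_scheme \<Rightarrow> 'g set \<Rightarrow> bool" where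
  "quotient_is_torus G H \<longleftrightarrow>
     (\<exists>Y n. quotient_map (topol G) Y (\<lambda>x. x <#\<^bsub>G\<^esub> H) \<and> Y homeomorphic_space torus_topology n)"

definition compact_homogeneous_space ::
  "('g, 'a::euclidean_space, 'm) lie_data_scheme \<Rightarrow> 'g set \<Rightarrow> bool" where
  "compact_homogeneous_space G H \<longleftrightarrow>
     lie_group G \<and> compact_space (topol G) \<and> connected_space (topol G) \<and>
     embedded_lie_subgroup G H \<and> compactin (topol G) H \<and> connectedin (topol G) H \<and>
     almost_effective G H \<and> \<not> quotient_is_torus G H"


section \<open>Invariant bilinear forms\<close>

definition sym_bilinear_on :: "'a::real_vector set \<Rightarrow> ('a \<Rightarrow> 'a \<Rightarrow> real) \<Rightarrow> bool" where
  "sym_bilinear_on V b \<longleftrightarrow>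
     (\<forall>x\<in>V. \<forall>y\<in>V. b x y = b y x) \<and>
     (\<forall>x\<in>V. \<forall>y\<in>V. \<forall>z\<in>V. b (x + y) z = b x z + b y z) \<and>
     (\<forall>r. \<forall>x\<in>V. \<forall>y\<in>V. b (r *\<^sub>R x) y = r * b x y)"

definition pos_def_on :: "'a::real_vector set \<Rightarrow> ('a \<Rightarrow> 'a \<Rightarrow> real) \<Rightarrow> bool" where
  "pos_def_on V b \<longleftrightarrow> (\<forall>x\<in>V. x \<noteq> 0 \<longrightarrow> b x x > 0)"

definition inner_product_on :: "'a::real_vector set \<Rightarrow> ('a \<Rightarrow> 'a \<Rightarrow> real) \<Rightarrow> bool" where
  "inner_product_on V b \<longleftrightarrow> sym_bilinear_on V b \<and> pos_def_on V b"

definition Ad_invariant_on ::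
  "('g, 'a::euclidean_space, 'm) lie_data_scheme \<Rightarrow> 'g set \<Rightarrow> 'a set \<Rightarrow> ('a \<Rightarrow> 'a \<Rightarrow> real) \<Rightarrow> bool" where
  "Ad_invariant_on G A V b \<longleftrightarrow> (\<forall>a\<in>A. \<forall>x\<in>V. \<forall>y\<in>V. b (Ad G a x) (Ad G a y) = b x y)"

text \<open>Inner products on \<open>V\<close> are represented by functions on all of \<open>'a\<close> whose values outside
  \<open>V\<close> are irrelevant.\<close>

definition invariant_metrics ::
  "('g, 'a::euclidean_space, 'm) lie_data_scheme \<Rightarrow> 'g set \<Rightarrow> 'a set \<Rightarrow> ('a \<Rightarrow> 'a \<Rightarrow> real) set" where
  "invariant_metrics G A V = {h. inner_product_on V h \<and> Ad_invariant_on G A V h}"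

definition perp :: "('a::real_vector \<Rightarrow> 'a \<Rightarrow> real) \<Rightarrow> 'a set \<Rightarrow> 'a set" where
  "perp Q V = {x. \<forall>y\<in>V. Q x y = 0}"

definition proj :: "('a::real_vector \<Rightarrow> 'a \<Rightarrow> real) \<Rightarrow> 'a set \<Rightarrow> 'a \<Rightarrow> 'a" where
  "proj Q V x = (THE y. y \<in> V \<and> x - y \<in> perp Q V)"

definition orthonormal_basis ::
  "('a::real_vector \<Rightarrow> 'a \<Rightarrow> real) \<Rightarrow> 'a set \<Rightarrow> 'a set \<Rightarrow> bool" where
  "orthonormal_basis h V E \<longleftrightarrow>
     E \<subseteq> V \<and> span E = V \<and> (\<forall>x\<in>E. \<forall>y\<in>E. h x y = (if x = y then 1 else 0))"

definition some_onb :: "('a::real_vector \<Rightarrow> 'a \<Rightarrow> real) \<Rightarrow> 'a set \<Rightarrow> 'a set" where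
  "some_onb h V = (SOME E. orthonormal_basis h V E)"

definition metric_trace ::
  "('a::real_vector \<Rightarrow> 'a \<Rightarrow> real) \<Rightarrow> 'a set \<Rightarrow> ('a \<Rightarrow> 'a \<Rightarrow> real) \<Rightarrow> real" where
  "metric_trace h V T = (\<Sum>e\<in>some_onb h V. T e e)"

definition trace_on :: "'a::real_vector set \<Rightarrow> ('a \<Rightarrow> 'a) \<Rightarrow> real" where
  "trace_on V F =
     (let B = (SOME B. independent B \<and> span B = V) in \<Sum>b\<in>B. representation B (F b) b)"

definition killing_form ::
  "('g, 'a::euclidean_space, 'm) lie_data_scheme \<Rightarrow> 'a set \<Rightarrow> 'a \<Rightarrow> 'a \<Rightarrow> real" where
  "killing_form G \<ll> x y = trace_on \<ll> (\<lambda>z. bracket G x (bracket G y z))"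


section \<open>Curvature\<close>

text \<open>Scalar curvature of the homogeneous metric on \<open>L/L'\<close> given by an inner product \<open>h\<close> on
  \<open>\<ll> \<inter> perp Q \<ll>'\<close>.\<close>

definition scal ::
  "('g, 'a::euclidean_space, 'm) lie_data_scheme \<Rightarrow> ('a \<Rightarrow> 'a \<Rightarrow> real) \<Rightarrow> 'a set \<Rightarrow> 'a set \<Rightarrow>
   ('a \<Rightarrow> 'a \<Rightarrow> real) \<Rightarrow> real" where
  "scal G Q \<ll> \<ll>' h =
     (let \<pp> = \<ll> \<inter> perp Q \<ll>'; E = some_onb h \<pp> in
        - (1/2) * (\<Sum>a\<in>E. killing_form G \<ll> a a)
        - (1/4) * (\<Sum>a\<in>E. \<Sum>b\<in>E. h (proj Q \<pp> (bracket G a b)) (proj Q \<pp> (bracket G a b))))"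

text \<open>
  \<open>levi_civita\<close> is Nomizu's operator of the Levi-Civita connection of the \<open>G\<close>-invariant metric
  \<open>g\<close> on \<open>\<mm>\<close>:  \<open>\<Lambda>(x) y = 1/2 [x,y]\<^sub>\<mm> + U(x,y)\<close>  where
  \<open>2 g(U(x,y), z) = g([z,x]\<^sub>\<mm>, y) + g(x, [z,y]\<^sub>\<mm>)\<close>.
  The curvature tensor at the base point is
  \<open>R(x,y) z = \<Lambda>(x)\<Lambda>(y)z - \<Lambda>(y)\<Lambda>(x)z - \<Lambda>([x,y]\<^sub>\<mm>)z - [[x,y]\<^sub>\<hh>, z]\<close>
  (Kobayashi--Nomizu, vol. II, Ch. X), and  \<open>Ric(x,y) = tr (w \<mapsto> R(w,x) y)\<close>.
\<close>

definition levi_civita ::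
  "('g, 'a::euclidean_space, 'm) lie_data_scheme \<Rightarrow> ('a \<Rightarrow> 'a \<Rightarrow> real) \<Rightarrow> 'a set \<Rightarrow>
   ('a \<Rightarrow> 'a \<Rightarrow> real) \<Rightarrow> 'a \<Rightarrow> 'a \<Rightarrow> 'a" where
  "levi_civita G Q \<mm> g x y = (THE w. w \<in> \<mm> \<and> (\<forall>z\<in>\<mm>.
     2 * g w z = g (proj Q \<mm> (bracket G x y)) z + g (proj Q \<mm> (bracket G z x)) y
                 + g x (proj Q \<mm> (bracket G z y))))"

definition riemann ::
  "('g, 'a::euclidean_space, 'm) lie_data_scheme \<Rightarrow> ('a \<Rightarrow> 'a \<Rightarrow> real) \<Rightarrow> 'a set \<Rightarrow>
   ('a \<Rightarrow> 'a \<Rightarrow> real) \<Rightarrow> 'a \<Rightarrow> 'a \<Rightarrow> 'a \<Rightarrow> 'a" where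
  "riemann G Q \<hh> g x y z =
     (let \<mm> = perp Q \<hh>; D = levi_civita G Q \<mm> g in
        D x (D y z) - D y (D x z) - D (proj Q \<mm> (bracket G x y)) z
        - bracket G (proj Q \<hh> (bracket G x y)) z)"

definition ricci ::
  "('g, 'a::euclidean_space, 'm) lie_data_scheme \<Rightarrow> ('a \<Rightarrow> 'a \<Rightarrow> real) \<Rightarrow> 'a set \<Rightarrow>
   ('a \<Rightarrow> 'a \<Rightarrow> real) \<Rightarrow> 'a \<Rightarrow> 'a \<Rightarrow> real" where
  "ricci G Q \<hh> g x y = trace_on (perp Q \<hh>) (\<lambda>w. riemann G Q \<hh> g w x y)"

text \<open>\<open>metrics_T G H Q T\<close> is \<open>\<M>\<^sub>T\<close>.  The suprema are taken in the extended reals, so that no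
  boundedness has to be presupposed.\<close>

definition metrics_T ::
  "('g, 'a::euclidean_space, 'm) lie_data_scheme \<Rightarrow> 'g set \<Rightarrow> ('a \<Rightarrow> 'a \<Rightarrow> real) \<Rightarrow>
   ('a \<Rightarrow> 'a \<Rightarrow> real) \<Rightarrow> ('a \<Rightarrow> 'a \<Rightarrow> real) set" where
  "metrics_T G H Q T =
     {g \<in> invariant_metrics G H (perp Q (lie_alg G H)). metric_trace g (perp Q (lie_alg G H)) T = 1}"

definition alpha ::
  "('g, 'a::euclidean_space, 'm) lie_data_scheme \<Rightarrow> 'g set \<Rightarrow> ('a \<Rightarrow> 'a \<Rightarrow> real) \<Rightarrow>
   ('a \<Rightarrow> 'a \<Rightarrow> real) \<Rightarrow> 'a set \<Rightarrow> ereal" where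
  "alpha G H Q T \<kk> =
     (let \<hh> = lie_alg G H; \<pp> = \<kk> \<inter> perp Q \<hh> in
        SUP h \<in> {h \<in> invariant_metrics G H \<pp>. metric_trace h \<pp> T = 1}. ereal (scal G Q \<kk> \<hh> h))"

definition beta ::
  "('g, 'a::euclidean_space, 'm) lie_data_scheme \<Rightarrow> ('a \<Rightarrow> 'a \<Rightarrow> real) \<Rightarrow>
   ('a \<Rightarrow> 'a \<Rightarrow> real) \<Rightarrow> 'a set \<Rightarrow> ereal" where
  "beta G Q T \<kk> =
     (SUP h \<in> {h \<in> invariant_metrics G (connected_lie_subgroup G \<kk>) (perp Q \<kk>).
                 metric_trace h (perp Q \<kk>) T = 1}. ereal (scal G Q UNIV \<kk> h))"

definition alpha_GH ::
  "('g, 'a::euclidean_space, 'm) lie_data_scheme \<Rightarrow> 'g set \<Rightarrow> ('a \<Rightarrow> 'a \<Rightarrow> real) \<Rightarrow>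
   ('a \<Rightarrow> 'a \<Rightarrow> real) \<Rightarrow> ereal" where
  "alpha_GH G H Q T = (SUP \<kk> \<in> {\<kk>. intermediate_subalgebra G H \<kk>}. alpha G H Q T \<kk>)"

end

(*
  The homogeneity of S under scaling, T > 0 and tr_g T = 1 bound the eigenvalues of g from below.
  Hence a sequence of metrics, even on varying K_i/H with H < K_i, subconverges in the following
  sense: in Q-orthonormal frames diagonalising the metrics, the frames and the inverse eigenvalues
  converge, the directions whose inverse eigenvalue has a positive limit span, together with h, a
  Lie algebra k, and the limit metric on K/H has trace 1 and scalar curvature at least the limit of
  the scalar curvatures.  Applied to the intermediate subalgebras this yields k with
  alpha_k = alpha_{G/H}; applied to a fixed such k of minimal dimension it yields a metric on K/H
  attaining alpha_k; applied to K_i = G it shows that S attains its supremum on M_T as soon as the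
  supremum exceeds alpha_{G/H}.  The latter follows from beta_k > alpha_k by scaling the fibres K/H and
  the base G/K against each other: with weights 1 - s and s the scalar curvature is
  (1 - s) alpha_k + s S(h) - O(s^2).  Finally S(g) > alpha_k >= 0 by comparison with the normal
  metric, and the first variation at the maximum gives Ric(g) = S(g) T.
*)
theory Submission
  imports Defs
begin

section \<open>Calculus of \<open>C\<^sup>k\<close> maps\<close>

text \<open>The scaling argument has to start from a metric attaining alpha_k: the constant in its
  O(s^2) term depends on the metric on K/H, so a maximising sequence would give no uniform gain.
  Such a sequence may however lose directions and converge on a smaller algebra inside k; that
  algebra has at least the same alpha, and minimality of the dimension forces it to be k. In the
  compactness step the norm term of S can blow up. Brackets of two surviving directions have no
  component in a vanishing one, since it would drive S to minus infinity. Brackets of a surviving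
  with a vanishing direction stay visible in the Killing term of the limit, but cross terms of the
  norm term cancel them, because t + 1/t >= 2. The computations use Lie algebras, while the metrics
  are invariant under groups. Connectedness of H and constancy of the Q-norm along linear flows lead
  from infinitesimal invariance to invariance under H. One-parameter subgroups, constructed from the
  compactness of G, give the converse for the possibly non-closed K, and also the antisymmetry of
  the bracket, which is defined as a derivative of Ad.\<close>

lemma Ck_on_subset: "Ck_on k S f \<Longrightarrow> U \<subseteq> S \<Longrightarrow> Ck_on k U f"
  by (induction k arbitrary: f) (auto intro: continuous_on_subset)

text \<open>Openness of \<open>S\<close> matters because \<open>frechet_derivative\<close> is taken
  in the full space: equality on \<open>S\<close> determines derivatives only at interior
  points.\<close>

lemma Ck_on_cong:
  assumes "open S" "\<And>x. x \<in> S \<Longrightarrow> f x = g x" "Ck_on k S f"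
  shows "Ck_on k S g"
  using assms(2,3)
proof (induction k arbitrary: f g)
  case 0
  then show ?case using continuous_on_cong by force
next
  case (Suc k)
  have g: "(g has_derivative frechet_derivative f (at x)) (at x)" if "x \<in> S" for x
    using Suc.prems that assms(1)
    by (metis Ck_on.simps(2) frechet_derivative_works has_derivative_transform_within_open)
  have eq: "frechet_derivative g (at x) = frechet_derivative f (at x)" if "x \<in> S" for x
    using g[OF that] frechet_derivative_at by metis
  show ?case
    using Suc.IH[of "\<lambda>x. frechet_derivative f (at x) v" "\<lambda>x. frechet_derivative g (at x) v" for v]
      g eq Suc.prems(2)
    by (auto simp: differentiable_def)
qed

lemma Ck_on_Suc_imp: "Ck_on (Suc k) S f \<Longrightarrow> Ck_on k S f"
proof (induction k arbitrary: f)
  case 0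
  then show ?case
    by (metis Ck_on.simps differentiable_at_withinI differentiable_imp_continuous_on
        differentiable_on_def)
next
  case (Suc k)
  then show ?case by (metis Ck_on.simps(2))
qed

lemma Ck_on_0: "Ck_on k S f \<Longrightarrow> continuous_on S f"
  by (induction k) (use Ck_on.simps(1) Ck_on_Suc_imp in blast)+

text \<open>Lets a calculation supply any derivative \<open>f'\<close>; uniqueness identifies it
  with the choice made by \<open>frechet_derivative\<close> in the definition.\<close>

lemma Ck_on_SucI:
  assumes "open S" "\<And>x. x \<in> S \<Longrightarrow> (f has_derivative f' x) (at x)"
    and "\<And>v. Ck_on k S (\<lambda>x. f' x v)"
  shows "Ck_on (Suc k) S f"
proof -
  have "frechet_derivative f (at x) = f' x" if "x \<in> S" for x
    using assms(2)[OF that] frechet_derivative_at by metis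
  then have "Ck_on k S (\<lambda>x. frechet_derivative f (at x) v)" for v
    by (intro Ck_on_cong[OF assms(1) _ assms(3)[of v]]) simp
  then show ?thesis using assms(2) by (auto simp: differentiable_def)
qed

lemma Ck_on_SucD:
  assumes "Ck_on (Suc k) S f"
  shows "x \<in> S \<Longrightarrow> (f has_derivative frechet_derivative f (at x)) (at x)"
    and "Ck_on k S (\<lambda>x. frechet_derivative f (at x) v)"
  using assms by (auto simp: frechet_derivative_works)

lemma Ck_on_const: "Ck_on k S (\<lambda>x. c)"
  by (induction k arbitrary: c) auto

lemma Ck_on_linear:
  assumes "bounded_linear f" "open S" shows "Ck_on k S f"
proof (cases k)
  case 0
  then show ?thesis using assms by (simp add: linear_continuous_on)
next
  case (Suc n)
  show ?thesis
    unfolding Suc by (rule Ck_on_SucI[of S f "\<lambda>x. f"])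
      (use assms Ck_on_const in \<open>auto simp: bounded_linear_imp_has_derivative\<close>)
qed

lemma Ck_on_add:
  assumes "open S" "Ck_on k S f" "Ck_on k S g" shows "Ck_on k S (\<lambda>x. f x + g x)"
  using assms(2,3)
proof (induction k arbitrary: f g)
  case 0
  then show ?case by (simp add: continuous_on_add)
next
  case (Suc k)
  show ?case
    by (rule Ck_on_SucI[OF assms(1)
          has_derivative_add[OF Ck_on_SucD(1)[OF Suc.prems(1)] Ck_on_SucD(1)[OF Suc.prems(2)]]])
      (auto intro: Suc.IH Ck_on_SucD(2)[OF Suc.prems(1)] Ck_on_SucD(2)[OF Suc.prems(2)])
qed

lemma Ck_on_sum:
  assumes "open S" "\<And>i. i \<in> I \<Longrightarrow> Ck_on k S (f i)"
  shows "Ck_on k S (\<lambda>x. \<Sum>i\<in>I. f i x)"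
  using assms(2)
proof (induction I rule: infinite_finite_induct)
  case (insert i I)
  then have "Ck_on k S (\<lambda>x. f i x + (\<Sum>i\<in>I. f i x))" by (intro Ck_on_add assms(1)) auto
  then show ?case using insert by simp
qed (auto intro: Ck_on_const)

lemma Ck_on_Pair:
  assumes "open S" "Ck_on k S f" "Ck_on k S g" shows "Ck_on k S (\<lambda>x. (f x, g x))"
  using assms(2,3)
proof (induction k arbitrary: f g)
  case 0
  then show ?case by (simp add: continuous_on_Pair)
next
  case (Suc k)
  show ?case
    by (rule Ck_on_SucI[OF assms(1)
          has_derivative_Pair[OF Ck_on_SucD(1)[OF Suc.prems(1)] Ck_on_SucD(1)[OF Suc.prems(2)]]])
      (auto intro: Suc.IH Ck_on_SucD(2)[OF Suc.prems(1)] Ck_on_SucD(2)[OF Suc.prems(2)])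
qed

lemma Ck_on_bilinear:
  assumes "bounded_bilinear pr" "open S" "Ck_on k S f" "Ck_on k S g"
  shows "Ck_on k S (\<lambda>x. pr (f x) (g x))"
  using assms(3,4)
proof (induction k arbitrary: f g)
  case 0
  then show ?case using bounded_bilinear.continuous_on[OF assms(1)] by simp
next
  case (Suc k)
  show ?case
  proof (rule Ck_on_SucI[OF assms(2)])
    fix x assume "x \<in> S"
    then show "((\<lambda>x. pr (f x) (g x)) has_derivative
        (\<lambda>v. pr (f x) (frechet_derivative g (at x) v) + pr (frechet_derivative f (at x) v) (g x))) (at x)"
      using bounded_bilinear.FDERIV[OF assms(1) Ck_on_SucD(1)[OF Suc.prems(1)] Ck_on_SucD(1)[OF Suc.prems(2)]]
      by blast
  next
    fix v
    show "Ck_on k S (\<lambda>x. pr (f x) (frechet_derivative g (at x) v) + pr (frechet_derivative f (at x) v) (g x))"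
      by (intro Ck_on_add assms(2) Suc.IH Ck_on_Suc_imp[OF Suc.prems(1)] Ck_on_Suc_imp[OF Suc.prems(2)]
          Ck_on_SucD(2)[OF Suc.prems(1)] Ck_on_SucD(2)[OF Suc.prems(2)])
  qed
qed

lemma Ck_on_compose:
  fixes f :: "'a::real_normed_vector \<Rightarrow> 'b::euclidean_space" and g :: "'b \<Rightarrow> 'c::real_normed_vector"
  assumes "open S" "open U" "f ` S \<subseteq> U" "Ck_on k S f" "Ck_on k U g"
  shows "Ck_on k S (\<lambda>x. g (f x))"
  using assms(3-5)
proof (induction k arbitrary: f g)
  case 0
  then show ?case by (auto intro: continuous_on_compose2)
next
  case (Suc k)
  let ?Df = "\<lambda>x. frechet_derivative f (at x)" and ?Dg = "\<lambda>y. frechet_derivative g (at y)"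
  have Dg: "(g has_derivative ?Dg (f x)) (at (f x))" if "x \<in> S" for x
    using Suc.prems that Ck_on_SucD(1) by blast
  show ?case
  proof (rule Ck_on_SucI[OF assms(1)])
    fix x assume x: "x \<in> S"
    have lin: "linear (?Dg (f x))" using Dg[OF x] has_derivative_linear by blast
    have "((\<lambda>x. g (f x)) has_derivative (\<lambda>v. ?Dg (f x) (?Df x v))) (at x)"
      using has_derivative_compose[OF Ck_on_SucD(1)[OF Suc.prems(2) x] Dg[OF x]] .
    \<comment> \<open>In the chain rule both the point and the direction of \<open>?Dg\<close> vary.
      Expanding the direction in \<open>Basis\<close> leaves directional derivatives of
      \<open>g\<close> in fixed directions, to which the induction hypothesis applies; hence the
      Euclidean middle space.\<close>
    moreover have "?Dg (f x) (?Df x v) = (\<Sum>b\<in>Basis. (?Df x v \<bullet> b) *\<^sub>R ?Dg (f x) b)" for v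
      by (subst euclidean_representation[symmetric]) (simp add: linear_sum[OF lin] linear_scale[OF lin])
    ultimately show "((\<lambda>x. g (f x)) has_derivative
        (\<lambda>v. \<Sum>b\<in>Basis. (?Df x v \<bullet> b) *\<^sub>R ?Dg (f x) b)) (at x)" by simp
  next
    fix v
    show "Ck_on k S (\<lambda>x. \<Sum>b\<in>Basis. (?Df x v \<bullet> b) *\<^sub>R ?Dg (f x) b)"
    proof (rule Ck_on_sum[OF assms(1)])
      fix b :: 'b
      have 1: "Ck_on k S (\<lambda>x. ?Df x v \<bullet> b)"
        by (rule Ck_on_bilinear[OF bounded_bilinear_inner assms(1) Ck_on_SucD(2)[OF Suc.prems(2)] Ck_on_const])
      have 2: "Ck_on k S (\<lambda>x. ?Dg (f x) b)"
        using Suc.IH[OF Suc.prems(1) Ck_on_Suc_imp[OF Suc.prems(2)] Ck_on_SucD(2)[OF Suc.prems(3)]] .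
      show "Ck_on k S (\<lambda>x. (?Df x v \<bullet> b) *\<^sub>R ?Dg (f x) b)"
        by (rule Ck_on_bilinear[OF bounded_bilinear_scaleR assms(1) 1 2])
    qed
  qed
qed

lemma smooth_on_subset: "smooth_on S f \<Longrightarrow> U \<subseteq> S \<Longrightarrow> smooth_on U f"
  unfolding smooth_on_def using Ck_on_subset by blast

lemma smooth_on_cong:
  "open S \<Longrightarrow> (\<And>x. x \<in> S \<Longrightarrow> f x = g x) \<Longrightarrow> smooth_on S f \<Longrightarrow> smooth_on S g"
  unfolding smooth_on_def using Ck_on_cong by blast

lemma smooth_on_continuous: "smooth_on S f \<Longrightarrow> continuous_on S f"
  unfolding smooth_on_def using Ck_on_0 by blast

lemma smooth_on_const: "smooth_on S (\<lambda>x. c)"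
  unfolding smooth_on_def using Ck_on_const by blast

lemma smooth_on_linear: "bounded_linear f \<Longrightarrow> open S \<Longrightarrow> smooth_on S f"
  unfolding smooth_on_def using Ck_on_linear by blast

lemma smooth_on_add:
  "open S \<Longrightarrow> smooth_on S f \<Longrightarrow> smooth_on S g \<Longrightarrow> smooth_on S (\<lambda>x. f x + g x)"
  unfolding smooth_on_def using Ck_on_add by blast

lemma smooth_on_Pair:
  "open S \<Longrightarrow> smooth_on S f \<Longrightarrow> smooth_on S g \<Longrightarrow> smooth_on S (\<lambda>x. (f x, g x))"
  unfolding smooth_on_def using Ck_on_Pair by blast

lemma smooth_on_compose:
  fixes f :: "'a::real_normed_vector \<Rightarrow> 'b::euclidean_space"
  shows "open S \<Longrightarrow> open U \<Longrightarrow> f ` S \<subseteq> U \<Longrightarrow> smooth_on S f \<Longrightarrow> smooth_on U g \<Longrightarrow>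
    smooth_on S (\<lambda>x. g (f x))"
  unfolding smooth_on_def using Ck_on_compose by blast

lemma smooth_on_derivative:
  assumes "smooth_on S f"
  shows "x \<in> S \<Longrightarrow> (f has_derivative frechet_derivative f (at x)) (at x)"
    and "smooth_on S (\<lambda>x. frechet_derivative f (at x) v)"
  using assms Ck_on_SucD unfolding smooth_on_def by blast+

section \<open>Lie groups\<close>

lemma inv_chart_left: "is_chart X c \<Longrightarrow> x \<in> fst c \<Longrightarrow> inv_chart c (snd c x) = x"
  unfolding is_chart_def inv_chart_def
  by (metis homeomorphic_imp_injective_map inv_into_f_f openin_subset topspace_subtopology_subset)

lemma inv_chart_right: "y \<in> snd c ` fst c \<Longrightarrow> snd c (inv_chart c y) = y"
  unfolding inv_chart_def by (simp add: f_inv_into_f)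

lemma inv_chart_in: "y \<in> snd c ` fst c \<Longrightarrow> inv_chart c y \<in> fst c"
  unfolding inv_chart_def by (simp add: inv_into_into)

lemma continuous_map_inv_chart:
  assumes "is_chart X c" shows "continuous_map (top_of_set (snd c ` fst c)) X (inv_chart c)"
proof -
  obtain g where g: "homeomorphic_maps (subtopology X (fst c)) (top_of_set (snd c ` fst c)) (snd c) g"
    using assms unfolding is_chart_def homeomorphic_map_maps by blast
  have top: "topspace (subtopology X (fst c)) = fst c"
    using assms unfolding is_chart_def by (metis openin_subset topspace_subtopology_subset)
  have "continuous_map (top_of_set (snd c ` fst c)) X g"
    using g unfolding homeomorphic_maps_def by (meson continuous_map_in_subtopology)
  moreover have "g y = inv_chart c y" if y: "y \<in> snd c ` fst c" for y
  proof -
    obtain x where x: "x \<in> fst c" "y = snd c x" using y by blast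
    then have "g y = x" using g top unfolding homeomorphic_maps_def by auto
    then show ?thesis using x inv_chart_left[OF assms] by simp
  qed
  ultimately show ?thesis by (auto elim!: continuous_map_eq)
qed

lemma chart_image_open:
  assumes "is_chart X c" "openin X U" shows "open (snd c ` (fst c \<inter> U))"
proof -
  have "openin (subtopology X (fst c)) (fst c \<inter> U)"
    using assms unfolding is_chart_def by (simp add: openin_subtopology_Int2)
  then have "openin (top_of_set (snd c ` fst c)) (snd c ` (fst c \<inter> U))"
    using assms unfolding is_chart_def by (metis homeomorphic_map_openness_eq)
  then show ?thesis using assms unfolding is_chart_def by (meson openin_open_trans)
qed

lemma has_vector_derivative_eventually_cong:
  assumes "(f has_vector_derivative v) (at x)" "\<forall>\<^sub>F s in nhds x. f s = g s"
  shows "(g has_vector_derivative v) (at x)"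
proof -
  have "\<forall>\<^sub>F s in nhds x. s \<in> UNIV \<longrightarrow> f s = g s" using assms(2) by eventually_elim simp
  then show ?thesis
    using assms(1) has_vector_derivative_cong_ev[where S=UNIV and x=x and f=f and g=g and f'=v] eventually_nhds_x_imp_x[OF assms(2)]
    by blast
qed

lemma tendsto_eventually_nhds:
  assumes "isCont f x" "open U" "f x \<in> U" shows "\<forall>\<^sub>F s in nhds x. f s \<in> U"
  using assms unfolding continuous_at_open eventually_nhds by blast

section \<open>Smooth maps into the group\<close>

context lie_group
begin

abbreviation "\<phi> \<equiv> snd (base_chart G)"
abbreviation "\<psi> \<equiv> inv_chart (base_chart G)"
abbreviation "U0 \<equiv> fst (base_chart G)"
abbreviation "e0 \<equiv> \<phi> \<one>"

lemma chart_subset: "c \<in> atlas G \<Longrightarrow> fst c \<subseteq> carrier G"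
  using charts_cover by blast

lemma chart_open: "c \<in> atlas G \<Longrightarrow> open (snd c ` fst c)"
  using charts is_chart_def by metis

lemma base_chart_is_chart: "is_chart (topol G) (base_chart G)"
  using charts base_chart_atlas by blast

lemma psi_e0: "\<psi> e0 = \<one>"
  using inv_chart_left base_chart_is_chart base_chart_one by metis

lemma e0_in: "e0 \<in> \<phi> ` U0"
  using base_chart_one by blast

text \<open>One chart of the atlas suffices here, and requiring a whole neighbourhood to land in its
  domain builds continuity into the notion. Independence of the chart is
  \<open>gsmooth_in_chart\<close>.\<close>

definition gsmooth_at :: "'x::real_normed_vector \<Rightarrow> ('x \<Rightarrow> 'g) \<Rightarrow> bool" where
  "gsmooth_at x f \<longleftrightarrow>
    (\<exists>c\<in>atlas G. \<exists>U. open U \<and> x \<in> U \<and> f ` U \<subseteq> fst c \<and> smooth_on U (\<lambda>y. snd c (f y)))"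

lemma gsmooth_atI:
  assumes "c \<in> atlas G" "open U" "x \<in> U" "\<And>y. y \<in> U \<Longrightarrow> f y \<in> fst c" "smooth_on U (\<lambda>y. snd c (f y))"
  shows "gsmooth_at x f"
  unfolding gsmooth_at_def using assms by (intro bexI[of _ c] exI[of _ U]) auto

lemma gsmooth_at_const:
  assumes "a \<in> carrier G" shows "gsmooth_at x (\<lambda>_. a)"
proof -
  obtain c where "c \<in> atlas G" "a \<in> fst c" using assms charts_cover by blast
  then show ?thesis by (intro gsmooth_atI[OF _ open_UNIV UNIV_I _ smooth_on_const])
qed

lemma gsmooth_at_inv_chart:
  assumes "c \<in> atlas G" "x \<in> snd c ` fst c" shows "gsmooth_at x (inv_chart c)"
proof -
  have "smooth_on (snd c ` fst c) (\<lambda>y. snd c (inv_chart c y))"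
    using smooth_on_cong[OF chart_open[OF assms(1)] _ smooth_on_linear[OF bounded_linear_ident]]
      chart_open[OF assms(1)] inv_chart_right by metis
  then show ?thesis
    using gsmooth_atI[OF assms(1) chart_open[OF assms(1)] assms(2)] inv_chart_in by metis
qed

lemma gsmooth_at_compose:
  fixes h :: "'x::real_normed_vector \<Rightarrow> 'y::euclidean_space"
  assumes "open U" "x \<in> U" "smooth_on U h" "gsmooth_at (h x) f"
  shows "gsmooth_at x (\<lambda>y. f (h y))"
proof -
  obtain c V where c: "c \<in> atlas G" "open V" "h x \<in> V" "f ` V \<subseteq> fst c" "smooth_on V (\<lambda>y. snd c (f y))"
    using assms(4) unfolding gsmooth_at_def by blast
  have o: "open (U \<inter> h -` V)"
    using continuous_open_preimage[OF smooth_on_continuous[OF assms(3)]] assms c by blast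
  have "smooth_on (U \<inter> h -` V) (\<lambda>y. snd c (f (h y)))"
    by (rule smooth_on_compose[OF o c(2) _ smooth_on_subset[OF assms(3)] c(5)]) auto
  then show ?thesis
    using gsmooth_atI[OF c(1) o, of x "\<lambda>y. f (h y)"] c assms by auto
qed

text \<open>The axiom \<open>smooth_mult\<close> speaks of smoothness on this set, and the
  composition rule for smooth maps wants an open domain; openness comes from the separate continuity
  axiom.\<close>

lemma open_mult_domain:
  assumes "c \<in> atlas G" "d \<in> atlas G" "e \<in> atlas G"
  shows "open {(x, y). x \<in> snd c ` fst c \<and> y \<in> snd d ` fst d \<and>
                         inv_chart c x \<otimes> inv_chart d y \<in> fst e}" (is "open ?M")
proof -
  let ?S = "snd c ` fst c" and ?T = "snd d ` fst d"
  have o: "open (?S \<times> ?T)" using assms chart_open by (simp add: open_Times)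
  have "continuous_map (top_of_set (?S \<times> ?T)) (top_of_set ?S) fst"
    "continuous_map (top_of_set (?S \<times> ?T)) (top_of_set ?T) snd"
    by (auto simp: continuous_map_in_subtopology continuous_on_fst continuous_on_snd)
  then have 1: "continuous_map (top_of_set (?S \<times> ?T)) (topol G) (\<lambda>p. inv_chart c (fst p))"
    and 2: "continuous_map (top_of_set (?S \<times> ?T)) (topol G) (\<lambda>p. inv_chart d (snd p))"
    using continuous_map_compose continuous_map_inv_chart charts assms(1,2) unfolding o_def by blast+
  have "continuous_map (top_of_set (?S \<times> ?T)) (topol G) (\<lambda>p. inv_chart c (fst p) \<otimes> inv_chart d (snd p))"
    using continuous_map_compose[OF continuous_map_pairedI[OF 1 2] continuous_mult]
    by (simp add: o_def)
  moreover have "openin (topol G) (fst e)" using charts[OF assms(3)] unfolding is_chart_def by blast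
  ultimately have "openin (top_of_set (?S \<times> ?T)) {p \<in> topspace (top_of_set (?S \<times> ?T)).
      inv_chart c (fst p) \<otimes> inv_chart d (snd p) \<in> fst e}"
    by (rule openin_continuous_map_preimage)
  then have "openin (top_of_set (?S \<times> ?T))
      {p \<in> ?S \<times> ?T. inv_chart c (fst p) \<otimes> inv_chart d (snd p) \<in> fst e}" by simp
  then have "open {p \<in> ?S \<times> ?T. inv_chart c (fst p) \<otimes> inv_chart d (snd p) \<in> fst e}"
    using o by (rule openin_open_trans)
  moreover have "{p \<in> ?S \<times> ?T. inv_chart c (fst p) \<otimes> inv_chart d (snd p) \<in> fst e} = ?M" by auto
  ultimately show ?thesis by (simp only:)
qed

lemma open_inv_domain:
  assumes "c \<in> atlas G" "e \<in> atlas G"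
  shows "open {x. x \<in> snd c ` fst c \<and> inv (inv_chart c x) \<in> fst e}" (is "open ?M")
proof -
  let ?S = "snd c ` fst c"
  have "continuous_map (top_of_set ?S) (topol G) (\<lambda>p. inv (inv_chart c p))"
    using continuous_map_compose[OF continuous_map_inv_chart[OF charts[OF assms(1)]] continuous_inv]
    by (simp add: o_def)
  moreover have "openin (topol G) (fst e)" using charts[OF assms(2)] unfolding is_chart_def by blast
  ultimately have "openin (top_of_set ?S) {p \<in> topspace (top_of_set ?S). inv (inv_chart c p) \<in> fst e}"
    by (rule openin_continuous_map_preimage)
  then have "openin (top_of_set ?S) {p \<in> ?S. inv (inv_chart c p) \<in> fst e}" by simp
  then show ?thesis using chart_open[OF assms(1)] by (rule openin_open_trans)
qed

lemma gsmooth_mult_chart: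
  fixes x :: "'x::real_normed_vector"
  assumes "gsmooth_at x f" "gsmooth_at x g" "e \<in> atlas G" "f x \<otimes> g x \<in> fst e"
  obtains U where "open U" "x \<in> U" "\<forall>y\<in>U. f y \<otimes> g y \<in> fst e"
    "smooth_on U (\<lambda>y. snd e (f y \<otimes> g y))"
proof -
  obtain c U where c: "c \<in> atlas G" "open U" "x \<in> U" "f ` U \<subseteq> fst c" "smooth_on U (\<lambda>y. snd c (f y))"
    using assms(1) unfolding gsmooth_at_def by blast
  obtain d V where d: "d \<in> atlas G" "open V" "x \<in> V" "g ` V \<subseteq> fst d" "smooth_on V (\<lambda>y. snd d (g y))"
    using assms(2) unfolding gsmooth_at_def by blast
  define M where "M = {(x, y). x \<in> snd c ` fst c \<and> y \<in> snd d ` fst d \<and>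
                         inv_chart c x \<otimes> inv_chart d y \<in> fst e}"
  have M: "open M" "smooth_on M (\<lambda>(x, y). snd e (inv_chart c x \<otimes> inv_chart d y))"
    unfolding M_def using open_mult_domain smooth_mult c(1) d(1) assms(3) by blast+
  define F where "F = (\<lambda>y. (snd c (f y), snd d (g y)))"
  have F: "smooth_on (U \<inter> V) F"
    unfolding F_def using c d by (intro smooth_on_Pair smooth_on_subset[OF c(5)] smooth_on_subset[OF d(5)]) auto
  define W where "W = (U \<inter> V) \<inter> F -` M"
  have W: "open W"
    unfolding W_def using continuous_open_preimage[OF smooth_on_continuous[OF F]] M c d by blast
  have bk: "inv_chart c (snd c (f y)) = f y" "inv_chart d (snd d (g y)) = g y" if "y \<in> U \<inter> V" for y
    using that c(4) d(4) inv_chart_left[OF charts[OF c(1)]] inv_chart_left[OF charts[OF d(1)]] by blast+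
  have in_M: "F y \<in> M \<longleftrightarrow> f y \<otimes> g y \<in> fst e" if "y \<in> U \<inter> V" for y
  proof -
    have "snd c (f y) \<in> snd c ` fst c" "snd d (g y) \<in> snd d ` fst d" using that c(4) d(4) by blast+
    then show ?thesis unfolding M_def F_def by (simp add: bk[OF that])
  qed
  have "smooth_on W (\<lambda>y. (\<lambda>(x, y). snd e (inv_chart c x \<otimes> inv_chart d y)) (F y))"
    by (rule smooth_on_compose[OF W M(1) _ smooth_on_subset[OF F] M(2)]) (auto simp: W_def)
  then have "smooth_on W (\<lambda>y. snd e (f y \<otimes> g y))"
    by (rule smooth_on_cong[OF W, rotated]) (auto simp: W_def F_def bk)
  show thesis
  proof (rule that[OF W])
    show "x \<in> W" "\<forall>y\<in>W. f y \<otimes> g y \<in> fst e"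
      using in_M c(3) d(3) assms(4) unfolding W_def by blast+
  qed fact
qed

lemma gsmooth_inv_chart:
  fixes x :: "'x::real_normed_vector"
  assumes "gsmooth_at x f" "e \<in> atlas G" "inv (f x) \<in> fst e"
  obtains U where "open U" "x \<in> U" "\<forall>y\<in>U. inv (f y) \<in> fst e"
    "smooth_on U (\<lambda>y. snd e (inv (f y)))"
proof -
  obtain c U where c: "c \<in> atlas G" "open U" "x \<in> U" "f ` U \<subseteq> fst c" "smooth_on U (\<lambda>y. snd c (f y))"
    using assms(1) unfolding gsmooth_at_def by blast
  define M where "M = {x. x \<in> snd c ` fst c \<and> inv (inv_chart c x) \<in> fst e}"
  have M: "open M" "smooth_on M (\<lambda>x. snd e (inv (inv_chart c x)))"
    unfolding M_def using open_inv_domain smooth_inv c(1) assms(2) by blast+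
  define W where "W = U \<inter> (\<lambda>y. snd c (f y)) -` M"
  have W: "open W"
    unfolding W_def using continuous_open_preimage[OF smooth_on_continuous[OF c(5)]] M c by blast
  have bk: "inv_chart c (snd c (f y)) = f y" if "y \<in> U" for y
    using that c(4) inv_chart_left[OF charts[OF c(1)]] by blast
  have in_M: "snd c (f y) \<in> M \<longleftrightarrow> inv (f y) \<in> fst e" if "y \<in> U" for y
  proof -
    have "snd c (f y) \<in> snd c ` fst c" using that c(4) by blast
    then show ?thesis unfolding M_def by (simp add: bk[OF that])
  qed
  have "smooth_on W (\<lambda>y. snd e (inv (inv_chart c (snd c (f y)))))"
    by (rule smooth_on_compose[OF W M(1) _ smooth_on_subset[OF c(5)] M(2)]) (auto simp: W_def)
  then have "smooth_on W (\<lambda>y. snd e (inv (f y)))"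
    by (rule smooth_on_cong[OF W, rotated]) (auto simp: W_def bk)
  show thesis
  proof (rule that[OF W])
    show "x \<in> W" "\<forall>y\<in>W. inv (f y) \<in> fst e"
      using in_M c(3) assms(3) unfolding W_def by auto
  qed fact
qed

lemma gsmooth_at_carrier:
  assumes "gsmooth_at x f"
  obtains U where "open U" "x \<in> U" "\<forall>y\<in>U. f y \<in> carrier G"
proof -
  obtain c U where c: "c \<in> atlas G" "open U" "x \<in> U" "f ` U \<subseteq> fst c"
    using assms unfolding gsmooth_at_def by blast
  then show thesis using that[of U] chart_subset[OF c(1)] by blast
qed

lemma gsmooth_at_in_carrier: "gsmooth_at x f \<Longrightarrow> f x \<in> carrier G"
  using gsmooth_at_carrier by metis

lemma gsmooth_at_mult:
  assumes "gsmooth_at x f" "gsmooth_at x g" shows "gsmooth_at x (\<lambda>y. f y \<otimes> g y)"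
proof -
  obtain e where e: "e \<in> atlas G" "f x \<otimes> g x \<in> fst e"
    using gsmooth_at_in_carrier[OF assms(1)] gsmooth_at_in_carrier[OF assms(2)] charts_cover
    by (metis UN_E m_closed)
  show ?thesis
    by (rule gsmooth_mult_chart[OF assms e]) (rule gsmooth_atI[OF e(1)], auto)
qed

lemma gsmooth_at_inv:
  assumes "gsmooth_at x f" shows "gsmooth_at x (\<lambda>y. inv (f y))"
proof -
  obtain e where e: "e \<in> atlas G" "inv (f x) \<in> fst e"
    using gsmooth_at_in_carrier[OF assms(1)] charts_cover by (metis UN_E inv_closed)
  show ?thesis
    by (rule gsmooth_inv_chart[OF assms e]) (rule gsmooth_atI[OF e(1)], auto)
qed

text \<open>Multiplying by the constant \<open>\<one>\<close> turns
  \<open>gsmooth_mult_chart\<close> into a change of charts, since a product may be read in any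
  chart around its value.\<close>

lemma gsmooth_in_chart:
  fixes x :: "'x::real_normed_vector"
  assumes "gsmooth_at x f" "e \<in> atlas G" "f x \<in> fst e"
  obtains U where "open U" "x \<in> U" "\<forall>y\<in>U. f y \<in> fst e" "smooth_on U (\<lambda>y. snd e (f y))"
proof -
  obtain V where V: "open V" "x \<in> V" "\<forall>y\<in>V. f y \<in> carrier G"
    using gsmooth_at_carrier[OF assms(1)] by blast
  obtain U where U: "open U" "x \<in> U" "\<forall>y\<in>U. f y \<otimes> \<one> \<in> fst e"
    "smooth_on U (\<lambda>y. snd e (f y \<otimes> \<one>))"
    using gsmooth_mult_chart[OF assms(1) gsmooth_at_const[OF one_closed] assms(2)] assms
      gsmooth_at_in_carrier[OF assms(1)] by (metis r_one)
  have "smooth_on (U \<inter> V) (\<lambda>y. snd e (f y))"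
    by (rule smooth_on_cong[OF _ _ smooth_on_subset[OF U(4)]]) (use V U in auto)
  then show thesis using that[of "U \<inter> V"] U V by fastforce
qed

section \<open>Curves through the identity, the adjoint action and the bracket\<close>

lemma gsmooth_at_psi: "gsmooth_at e0 \<psi>"
  using gsmooth_at_inv_chart base_chart_atlas e0_in by blast

text \<open>Velocity at the identity in the coordinates of the base chart. Staying in
  \<open>U0\<close> near 0 is demanded because \<open>\<phi>\<close> carries no information outside
  \<open>U0\<close>.\<close>

definition tang :: "(real \<Rightarrow> 'g) \<Rightarrow> 'a \<Rightarrow> bool" where
  "tang \<sigma> v \<longleftrightarrow> \<sigma> 0 = \<one> \<and> (\<forall>\<^sub>F s in nhds 0. \<sigma> s \<in> U0) \<and>
    ((\<lambda>s. \<phi> (\<sigma> s)) has_vector_derivative v) (at 0)"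

lemma tang_unique: "tang \<sigma> v \<Longrightarrow> tang \<sigma> w \<Longrightarrow> v = w"
  unfolding tang_def using vector_derivative_unique_at by blast

lemma tang_cong:
  assumes "tang \<sigma> v" "\<forall>\<^sub>F s in nhds 0. \<sigma> s = \<tau> s" shows "tang \<tau> v"
proof -
  have "\<tau> 0 = \<one>" using assms(1) eventually_nhds_x_imp_x[OF assms(2)] unfolding tang_def by simp
  moreover have "\<forall>\<^sub>F s in nhds 0. \<tau> s \<in> U0"
    using assms(2) assms(1)[unfolded tang_def, THEN conjunct2, THEN conjunct1]
    by eventually_elim simp
  moreover have "((\<lambda>s. \<phi> (\<tau> s)) has_vector_derivative v) (at 0)"
  proof -
    have "\<forall>\<^sub>F s in nhds 0. \<phi> (\<sigma> s) = \<phi> (\<tau> s)" using assms(2) by eventually_elim simp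
    then show ?thesis
      by (rule has_vector_derivative_eventually_cong[OF assms(1)[unfolded tang_def, THEN conjunct2, THEN conjunct2]])
  qed
  ultimately show ?thesis unfolding tang_def by blast
qed

lemma tang_carrier: "tang \<sigma> v \<Longrightarrow> \<forall>\<^sub>F s in nhds 0. \<sigma> s \<in> carrier G"
  unfolding tang_def using chart_subset[OF base_chart_atlas] by (auto elim: eventually_mono)

lemma tang_continuous: "tang \<sigma> v \<Longrightarrow> isCont (\<lambda>s. \<phi> (\<sigma> s)) 0"
  unfolding tang_def using has_vector_derivative_continuous by blast

lemma gsmooth_tang:
  assumes "gsmooth_at 0 \<sigma>" "\<sigma> 0 = \<one>"
  obtains v where "tang \<sigma> v"
proof -
  have "\<sigma> 0 \<in> U0" using assms(2) base_chart_one by simp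
  then obtain U where U: "open U" "0 \<in> U" "\<forall>y\<in>U. \<sigma> y \<in> U0" "smooth_on U (\<lambda>y. \<phi> (\<sigma> y))"
    by (rule gsmooth_in_chart[OF assms(1) base_chart_atlas])
  have "(\<lambda>y. \<phi> (\<sigma> y)) differentiable (at 0)"
    using smooth_on_derivative(1)[OF U(4,2)] differentiable_def by blast
  then have "((\<lambda>y. \<phi> (\<sigma> y)) has_vector_derivative vector_derivative (\<lambda>y. \<phi> (\<sigma> y)) (at 0)) (at 0)"
    using vector_derivative_works by blast
  then show thesis using that U assms(2) unfolding tang_def eventually_nhds by blast
qed

text \<open>The straight line in the base chart realises every vector as a velocity; it is the
  standard representative when an identity for \<open>Ad\<close> or \<open>bracket\<close> is tested
  on curves.\<close>

lemma tang_psi: "tang (\<lambda>s. \<psi> (e0 + s *\<^sub>R v)) v"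
proof -
  have "isCont (\<lambda>s. e0 + s *\<^sub>R v) 0" by simp
  then have ev: "\<forall>\<^sub>F s in nhds 0. e0 + s *\<^sub>R v \<in> \<phi> ` U0"
    using tendsto_eventually_nhds[where f="\<lambda>s. e0 + s *\<^sub>R v" and x=0, OF _ chart_open[OF base_chart_atlas]] e0_in by simp
  have d: "((\<lambda>s. e0 + s *\<^sub>R v) has_vector_derivative v) (at 0)"
    by (auto intro!: derivative_eq_intros simp: has_vector_derivative_def)
  have ev2: "\<forall>\<^sub>F s in nhds 0. e0 + s *\<^sub>R v = \<phi> (\<psi> (e0 + s *\<^sub>R v))"
    using ev by eventually_elim (simp add: inv_chart_right)
  have "((\<lambda>s. \<phi> (\<psi> (e0 + s *\<^sub>R v))) has_vector_derivative v) (at 0)"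
    using d ev2 by (rule has_vector_derivative_eventually_cong)
  then show ?thesis
    unfolding tang_def using psi_e0 ev by (auto elim!: eventually_mono intro: inv_chart_in)
qed

lemma conj_gsmooth: "a \<in> carrier G \<Longrightarrow> gsmooth_at e0 (\<lambda>x. a \<otimes> \<psi> x \<otimes> inv a)"
  by (intro gsmooth_at_mult gsmooth_at_const gsmooth_at_psi) auto

lemma conj_chart:
  assumes "a \<in> carrier G"
  obtains U where "open U" "e0 \<in> U" "\<forall>y\<in>U. a \<otimes> \<psi> y \<otimes> inv a \<in> U0"
    "smooth_on U (\<lambda>y. \<phi> (a \<otimes> \<psi> y \<otimes> inv a))"
  using gsmooth_in_chart[OF conj_gsmooth[OF assms] base_chart_atlas] assms
  by (metis base_chart_one inv_closed m_assoc psi_e0 r_inv r_one)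

lemma Ad_has_derivative:
  assumes "a \<in> carrier G"
  shows "((\<lambda>x. \<phi> (a \<otimes> \<psi> x \<otimes> inv a)) has_derivative Ad G a) (at e0)"
proof -
  have "Ad G a = frechet_derivative (\<lambda>x. \<phi> (a \<otimes> \<psi> x \<otimes> inv a)) (at e0)"
    unfolding Ad_def by auto
  then show ?thesis
    using conj_chart[OF assms] smooth_on_derivative(1) by metis
qed

lemma Ad_linear: "a \<in> carrier G \<Longrightarrow> linear (Ad G a)"
  using Ad_has_derivative has_derivative_linear by blast

text \<open>The chain rule for the differential that defines \<open>Ad\<close>. It characterises
  \<open>Ad G a v\<close> through curves, so that algebraic laws for \<open>Ad\<close> reduce to
  equalities of curves together with \<open>tang_unique\<close>.\<close>

lemma tang_conj:
  assumes "a \<in> carrier G" "tang \<sigma> v"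
  shows "tang (\<lambda>s. a \<otimes> \<sigma> s \<otimes> inv a) (Ad G a v)"
proof -
  obtain U where U: "open U" "e0 \<in> U" "\<forall>y\<in>U. a \<otimes> \<psi> y \<otimes> inv a \<in> U0"
    using conj_chart[OF assms(1)] by metis
  have s0: "\<sigma> 0 = \<one>" and ev0: "\<forall>\<^sub>F s in nhds 0. \<sigma> s \<in> U0" using assms(2) unfolding tang_def by auto
  have "\<forall>\<^sub>F s in nhds 0. \<phi> (\<sigma> s) \<in> U"
    using tendsto_eventually_nhds[OF tang_continuous[OF assms(2)] U(1)] U(2) s0 by simp
  with ev0 have ev: "\<forall>\<^sub>F s in nhds 0. a \<otimes> \<sigma> s \<otimes> inv a \<in> U0"
    by eventually_elim (use U(3) inv_chart_left[OF base_chart_is_chart] in metis)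
  have d: "((\<lambda>s. \<phi> (\<sigma> s)) has_derivative (\<lambda>h. h *\<^sub>R v)) (at 0)"
    using assms(2) unfolding tang_def has_vector_derivative_def by blast
  have "((\<lambda>s. \<phi> (a \<otimes> \<psi> (\<phi> (\<sigma> s)) \<otimes> inv a)) has_derivative (\<lambda>h. Ad G a (h *\<^sub>R v))) (at 0)"
    using has_derivative_compose[OF d, of "\<lambda>x. \<phi> (a \<otimes> \<psi> x \<otimes> inv a)" "Ad G a"]
      Ad_has_derivative[OF assms(1)] s0 by simp
  then have "((\<lambda>s. \<phi> (a \<otimes> \<psi> (\<phi> (\<sigma> s)) \<otimes> inv a)) has_vector_derivative Ad G a v) (at 0)"
    unfolding has_vector_derivative_def by (simp add: linear_scale[OF Ad_linear[OF assms(1)]])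
  moreover have "\<forall>\<^sub>F s in nhds 0. \<phi> (a \<otimes> \<psi> (\<phi> (\<sigma> s)) \<otimes> inv a) = \<phi> (a \<otimes> \<sigma> s \<otimes> inv a)"
    using ev0 by eventually_elim (simp add: inv_chart_left[OF base_chart_is_chart])
  ultimately have "((\<lambda>s. \<phi> (a \<otimes> \<sigma> s \<otimes> inv a)) has_vector_derivative Ad G a v) (at 0)"
    by (rule has_vector_derivative_eventually_cong)
  then show ?thesis unfolding tang_def using ev s0 assms(1) by simp
qed

lemma Ad_mult:
  assumes "a \<in> carrier G" "b \<in> carrier G"
  shows "Ad G (a \<otimes> b) v = Ad G a (Ad G b v)"
proof -
  have "tang (\<lambda>s. a \<otimes> (b \<otimes> \<psi> (e0 + s *\<^sub>R v) \<otimes> inv b) \<otimes> inv a) (Ad G a (Ad G b v))"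
    by (intro tang_conj assms tang_psi)
  moreover have "\<forall>\<^sub>F s in nhds 0. a \<otimes> (b \<otimes> \<psi> (e0 + s *\<^sub>R v) \<otimes> inv b) \<otimes> inv a
      = (a \<otimes> b) \<otimes> \<psi> (e0 + s *\<^sub>R v) \<otimes> inv (a \<otimes> b)"
    using tang_carrier[OF tang_psi[of v]]
    by eventually_elim (simp add: assms m_assoc inv_mult_group)
  ultimately have "tang (\<lambda>s. (a \<otimes> b) \<otimes> \<psi> (e0 + s *\<^sub>R v) \<otimes> inv (a \<otimes> b)) (Ad G a (Ad G b v))"
    by (rule tang_cong)
  moreover have "tang (\<lambda>s. (a \<otimes> b) \<otimes> \<psi> (e0 + s *\<^sub>R v) \<otimes> inv (a \<otimes> b)) (Ad G (a \<otimes> b) v)"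
    by (intro tang_conj assms tang_psi m_closed)
  ultimately show ?thesis using tang_unique by blast
qed

lemma Ad_one: "Ad G \<one> v = v"
proof -
  have "tang (\<lambda>s. \<one> \<otimes> \<psi> (e0 + s *\<^sub>R v) \<otimes> inv \<one>) (Ad G \<one> v)"
    by (intro tang_conj tang_psi one_closed)
  moreover have "\<forall>\<^sub>F s in nhds 0. \<one> \<otimes> \<psi> (e0 + s *\<^sub>R v) \<otimes> inv \<one> = \<psi> (e0 + s *\<^sub>R v)"
    using tang_carrier[OF tang_psi[of v]] by eventually_elim simp
  ultimately have "tang (\<lambda>s. \<psi> (e0 + s *\<^sub>R v)) (Ad G \<one> v)" by (rule tang_cong)
  then show ?thesis using tang_psi by (rule tang_unique)
qed

text \<open>\<open>Ad G (\<psi> x) w\<close> is the partial derivative at \<open>(x, e0)\<close> in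
  direction \<open>(0, w)\<close> of the conjugation map in both variables, which is smooth. Hence
  it is smooth in \<open>x\<close>, and the derivative in the definition of \<open>bracket\<close>
  exists.\<close>

lemma Ad_psi_smooth:
  obtains A where "open A" "e0 \<in> A" "A \<subseteq> \<phi> ` U0" "\<And>w. smooth_on A (\<lambda>x. Ad G (\<psi> x) w)"
proof -
  let ?K = "\<lambda>p. \<psi> (fst p) \<otimes> \<psi> (snd p) \<otimes> inv (\<psi> (fst p))"
  have f: "gsmooth_at (e0, e0) (\<lambda>p. \<psi> (fst p))"
    by (rule gsmooth_at_compose[OF open_UNIV UNIV_I smooth_on_linear[OF bounded_linear_fst open_UNIV]])
      (simp add: gsmooth_at_psi)
  have s: "gsmooth_at (e0, e0) (\<lambda>p. \<psi> (snd p))"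
    by (rule gsmooth_at_compose[OF open_UNIV UNIV_I smooth_on_linear[OF bounded_linear_snd open_UNIV]])
      (simp add: gsmooth_at_psi)
  have K: "gsmooth_at (e0, e0) ?K"
    by (intro gsmooth_at_mult gsmooth_at_inv f s)
  have "?K (e0, e0) \<in> U0" using base_chart_one psi_e0 by simp
  then obtain U where U: "open U" "(e0, e0) \<in> U" "\<forall>p\<in>U. ?K p \<in> U0"
    "smooth_on U (\<lambda>p. \<phi> (?K p))"
    by (rule gsmooth_in_chart[OF K base_chart_atlas])
  obtain A B where AB: "open A" "open B" "(e0, e0) \<in> A \<times> B" "A \<times> B \<subseteq> U"
    using open_prod_elim[OF U(1,2)] by blast
  define A' where "A' = A \<inter> \<phi> ` U0"
  have A': "open A'" using AB chart_open[OF base_chart_atlas] A'_def by blast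
  have *: "Ad G (\<psi> x) w = frechet_derivative (\<lambda>p. \<phi> (?K p)) (at (x, e0)) (0, w)" if x: "x \<in> A'" for x w
  proof -
    have "(x, e0) \<in> U" using x AB A'_def by blast
    note d = smooth_on_derivative(1)[OF U(4) this]
    have "((\<lambda>y. (x, y)) has_derivative (\<lambda>h. (0, h))) (at e0)"
      by (auto intro!: derivative_eq_intros)
    from has_derivative_compose[OF this d]
    have "((\<lambda>y. \<phi> (\<psi> x \<otimes> \<psi> y \<otimes> inv (\<psi> x))) has_derivative
        (\<lambda>h. frechet_derivative (\<lambda>p. \<phi> (?K p)) (at (x, e0)) (0, h))) (at e0)" by simp
    then show ?thesis
      unfolding Ad_def by (metis (no_types, lifting) frechet_derivative_at)
  qed
  have "smooth_on A' (\<lambda>x. Ad G (\<psi> x) w)" for w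
  proof -
    have "smooth_on A' (\<lambda>x. (x, e0))"
      by (intro smooth_on_Pair[OF A'] smooth_on_linear[OF bounded_linear_ident A'] smooth_on_const)
    moreover have "(\<lambda>x. (x, e0)) ` A' \<subseteq> U" using AB A'_def by auto
    ultimately have "smooth_on A' (\<lambda>x. frechet_derivative (\<lambda>p. \<phi> (?K p)) (at (x, e0)) (0, w))"
      using smooth_on_compose[OF A' U(1) _ _ smooth_on_derivative(2)[OF U(4)], of "\<lambda>x. (x, e0)" "(0, w)"]
      by blast
    then show ?thesis by (rule smooth_on_cong[OF A', rotated]) (simp add: *)
  qed
  then show thesis using that[of A'] A' AB e0_in A'_def by blast
qed

lemma bracket_has_derivative:
  "((\<lambda>x. Ad G (\<psi> x) w) has_derivative (\<lambda>v. bracket G v w)) (at e0)"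
proof -
  have "(\<lambda>v. bracket G v w) = frechet_derivative (\<lambda>x. Ad G (\<psi> x) w) (at e0)"
    unfolding bracket_def by auto
  then show ?thesis using Ad_psi_smooth smooth_on_derivative(1) by metis
qed

lemma bracket_tang:
  assumes "tang \<sigma> v"
  shows "((\<lambda>s. Ad G (\<sigma> s) w) has_vector_derivative bracket G v w) (at 0)"
proof -
  have s0: "\<sigma> 0 = \<one>" and ev0: "\<forall>\<^sub>F s in nhds 0. \<sigma> s \<in> U0" using assms unfolding tang_def by auto
  have d: "((\<lambda>s. \<phi> (\<sigma> s)) has_derivative (\<lambda>h. h *\<^sub>R v)) (at 0)"
    using assms unfolding tang_def has_vector_derivative_def by blast
  have "((\<lambda>s. Ad G (\<psi> (\<phi> (\<sigma> s))) w) has_derivative (\<lambda>h. bracket G (h *\<^sub>R v) w)) (at 0)"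
    using has_derivative_compose[OF d, of "\<lambda>x. Ad G (\<psi> x) w" "\<lambda>v. bracket G v w"]
      bracket_has_derivative[of w] s0 by simp
  then have "((\<lambda>s. Ad G (\<psi> (\<phi> (\<sigma> s))) w) has_vector_derivative bracket G v w) (at 0)"
    unfolding has_vector_derivative_def
    by (simp add: linear_scale[OF has_derivative_linear[OF bracket_has_derivative]])
  moreover have "\<forall>\<^sub>F s in nhds 0. Ad G (\<psi> (\<phi> (\<sigma> s))) w = Ad G (\<sigma> s) w"
    using ev0 by eventually_elim (simp add: inv_chart_left[OF base_chart_is_chart])
  ultimately show ?thesis
    by (rule has_vector_derivative_eventually_cong)
qed

lemma bracket_linear_left: "linear (\<lambda>v. bracket G v w)"
  using bracket_has_derivative has_derivative_linear by blast

text \<open>The second argument enters through the linear maps \<open>Ad\<close>, so linearity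
  passes to the derivative along one curve with velocity \<open>v\<close>.\<close>

lemma bracket_linear_right: "linear (\<lambda>w. bracket G v w)"
proof (rule linearI)
  note t = tang_psi[of v]
  have ev: "\<forall>\<^sub>F s in nhds 0. linear (Ad G (\<psi> (e0 + s *\<^sub>R v)))"
    using tang_carrier[OF t] by eventually_elim (rule Ad_linear)
  fix w w' :: 'a and r :: real
  have "((\<lambda>s. Ad G (\<psi> (e0 + s *\<^sub>R v)) w + Ad G (\<psi> (e0 + s *\<^sub>R v)) w')
      has_vector_derivative bracket G v w + bracket G v w') (at 0)"
    by (intro has_vector_derivative_add bracket_tang[OF t])
  moreover have "\<forall>\<^sub>F s in nhds 0. Ad G (\<psi> (e0 + s *\<^sub>R v)) w + Ad G (\<psi> (e0 + s *\<^sub>R v)) w'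
      = Ad G (\<psi> (e0 + s *\<^sub>R v)) (w + w')"
    using ev by eventually_elim (simp add: linear_add)
  ultimately have "((\<lambda>s. Ad G (\<psi> (e0 + s *\<^sub>R v)) (w + w'))
      has_vector_derivative bracket G v w + bracket G v w') (at 0)"
    by (rule has_vector_derivative_eventually_cong)
  then show "bracket G v (w + w') = bracket G v w + bracket G v w'"
    using bracket_tang[OF t] vector_derivative_unique_at by blast
  have "((\<lambda>s. r *\<^sub>R Ad G (\<psi> (e0 + s *\<^sub>R v)) w) has_vector_derivative r *\<^sub>R bracket G v w) (at 0)"
    using bounded_linear.has_vector_derivative[OF bounded_linear_scaleR_right bracket_tang[OF t]] .
  moreover have "\<forall>\<^sub>F s in nhds 0. r *\<^sub>R Ad G (\<psi> (e0 + s *\<^sub>R v)) w = Ad G (\<psi> (e0 + s *\<^sub>R v)) (r *\<^sub>R w)"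
    using ev by eventually_elim (simp add: linear_scale)
  ultimately have "((\<lambda>s. Ad G (\<psi> (e0 + s *\<^sub>R v)) (r *\<^sub>R w)) has_vector_derivative r *\<^sub>R bracket G v w) (at 0)"
    by (rule has_vector_derivative_eventually_cong)
  then show "bracket G v (r *\<^sub>R w) = r *\<^sub>R bracket G v w"
    using bracket_tang[OF t] vector_derivative_unique_at by blast
qed

text \<open>\<open>\<eta>\<close> is the right logarithmic derivative of \<open>\<gamma>\<close> at
  \<open>t\<close>. Multiplicativity of \<open>Ad\<close> moves the derivative from the identity to
  \<open>t\<close>, and the orbit of \<open>w\<close> solves a linear equation with generator
  \<open>bracket G \<eta>\<close>.\<close>

lemma Ad_curve_derivative:
  assumes "tang (\<lambda>s. \<gamma> (t + s) \<otimes> inv (\<gamma> t)) \<eta>" "\<gamma> t \<in> carrier G"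
    and "\<forall>\<^sub>F s in nhds 0. \<gamma> (t + s) \<in> carrier G"
  shows "((\<lambda>s. Ad G (\<gamma> s) w) has_vector_derivative bracket G \<eta> (Ad G (\<gamma> t) w)) (at t)"
proof -
  have "\<forall>\<^sub>F s in nhds 0. Ad G (\<gamma> (t + s) \<otimes> inv (\<gamma> t)) (Ad G (\<gamma> t) w) = Ad G (\<gamma> (t + s)) w"
    using assms(3)
  proof eventually_elim
    case (elim s)
    then have "\<gamma> (t + s) \<otimes> inv (\<gamma> t) \<otimes> \<gamma> t = \<gamma> (t + s)" using assms(2) by (simp add: m_assoc)
    then show ?case using elim assms(2) Ad_mult by (metis inv_closed m_closed)
  qed
  then have "((\<lambda>s. Ad G (\<gamma> (t + s)) w) has_vector_derivative bracket G \<eta> (Ad G (\<gamma> t) w)) (at 0)"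
    using has_vector_derivative_eventually_cong[OF bracket_tang[OF assms(1), of "Ad G (\<gamma> t) w"]]
    by (simp add: Ad_one assms(2))
  then have "((\<lambda>s. Ad G (\<gamma> (s + t)) w) has_vector_derivative bracket G \<eta> (Ad G (\<gamma> t) w)) (at (t - t))"
    by (simp add: add.commute)
  moreover have "((\<lambda>s. s - t) has_vector_derivative 1) (at t)"
    by (auto intro!: derivative_eq_intros simp: has_vector_derivative_def)
  ultimately have "((\<lambda>s. Ad G (\<gamma> (s + t)) w) \<circ> (\<lambda>s. s - t) has_vector_derivative
      1 *\<^sub>R bracket G \<eta> (Ad G (\<gamma> t) w)) (at t)"
    using vector_diff_chain_at by blast
  then show ?thesis by (simp add: o_def)
qed

lemma Ad_inv_cancel:
  assumes "a \<in> carrier G"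
  shows "Ad G a (Ad G (inv a) v) = v" "Ad G (inv a) (Ad G a v) = v"
  using assms Ad_mult[of a "inv a" v] Ad_mult[of "inv a" a v] Ad_one by auto

text \<open>Differentiate the identity Ad(a) Ad(sigma) w = Ad(a sigma a^-1) Ad(a) w along a curve
  sigma with velocity \<open>v\<close>; the conjugated curve has velocity
  \<open>Ad G a v\<close>.\<close>

lemma Ad_bracket:
  assumes a: "a \<in> carrier G"
  shows "Ad G a (bracket G v w) = bracket G (Ad G a v) (Ad G a w)"
proof -
  let ?\<sigma> = "\<lambda>s. \<psi> (e0 + s *\<^sub>R v)"
  have lin: "bounded_linear (Ad G a)"
    using Ad_linear[OF a] linear_conv_bounded_linear by blast
  have 1: "((\<lambda>s. Ad G a (Ad G (?\<sigma> s) w)) has_vector_derivative Ad G a (bracket G v w)) (at 0)"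
    using bounded_linear.has_vector_derivative[OF lin bracket_tang[OF tang_psi]] .
  have 2: "((\<lambda>s. Ad G (a \<otimes> ?\<sigma> s \<otimes> inv a) (Ad G a w)) has_vector_derivative
      bracket G (Ad G a v) (Ad G a w)) (at 0)"
    by (rule bracket_tang[OF tang_conj[OF a tang_psi]])
  have "\<forall>\<^sub>F s in nhds 0. Ad G a (Ad G (?\<sigma> s) w) = Ad G (a \<otimes> ?\<sigma> s \<otimes> inv a) (Ad G a w)"
    using tang_carrier[OF tang_psi[of v]]
    by eventually_elim (simp add: a Ad_mult Ad_inv_cancel)
  then have "((\<lambda>s. Ad G (a \<otimes> ?\<sigma> s \<otimes> inv a) (Ad G a w)) has_vector_derivative Ad G a (bracket G v w)) (at 0)"
    by (rule has_vector_derivative_eventually_cong[OF 1])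
  then show ?thesis using 2 vector_derivative_unique_at by blast
qed

end

section \<open>Derivatives and forms on subspaces\<close>

lemma subspace_projection:
  fixes V :: "'a::euclidean_space set"
  assumes "subspace V"
  obtains P where "linear P" "\<And>x. P x \<in> V" "\<And>x. x \<in> V \<Longrightarrow> P x = x"
proof -
  obtain B where B: "B \<subseteq> V" "independent B" "V \<subseteq> span B" using basis_exists by metis
  have span: "span B = V" using B span_minimal[OF _ assms] by blast
  obtain P where P: "linear P" "\<forall>x\<in>B. P x = id x" "range P = span (id ` B)"
    using linear_independent_extend_subspace[OF B(2), of id] by blast
  have "P x \<in> V" for x using P(3) span by auto
  moreover have "P x = x" if "x \<in> V" for x
    using linear_eq_on[OF P(1) linear_id, of x B] P(2) that span by simp
  ultimately show thesis using that P(1) by blast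
qed

text \<open>A linear retraction onto \<open>V\<close> fixes \<open>f\<close> near \<open>t\<close>,
  hence also its derivative.\<close>

lemma derivative_in_subspace:
  fixes f :: "real \<Rightarrow> 'a::euclidean_space"
  assumes "(f has_vector_derivative d) (at t)" "\<forall>\<^sub>F s in nhds t. f s \<in> V" "subspace V"
  shows "d \<in> V"
proof -
  obtain P where P: "linear P" "\<And>x. P x \<in> V" "\<And>x. x \<in> V \<Longrightarrow> P x = x"
    using subspace_projection[OF assms(3)] by metis
  have "\<forall>\<^sub>F s in nhds t. f s = P (f s)" using assms(2) by eventually_elim (simp add: P(3))
  with assms(1) have "((\<lambda>s. P (f s)) has_vector_derivative d) (at t)"
    by (rule has_vector_derivative_eventually_cong)
  moreover have "((\<lambda>s. P (f s)) has_vector_derivative P d) (at t)"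
    using bounded_linear.has_vector_derivative[OF _ assms(1)] P(1) linear_conv_bounded_linear by blast
  ultimately have "d = P d" by (rule vector_derivative_unique_at)
  then show ?thesis using P(2) by metis
qed

text \<open>Precomposition with a projection onto \<open>V\<close>. Forms are meaningful on
  \<open>V\<close> only, while limits and product rules call for a bounded bilinear form on the
  whole space.\<close>

lemma sym_bilinear_on_extend:
  fixes V :: "'a::euclidean_space set"
  assumes "sym_bilinear_on V b" "subspace V"
  obtains b' where "bounded_bilinear b'" "\<And>x y. x \<in> V \<Longrightarrow> y \<in> V \<Longrightarrow> b' x y = b x y"
    "\<And>x y. b' x y = b' y x"
proof -
  obtain P where P: "linear P" and PV: "\<And>x. P x \<in> V" and Pid: "\<And>x. x \<in> V \<Longrightarrow> P x = x"
    using subspace_projection[OF assms(2)] by metis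
  let ?b = "\<lambda>x y. b (P x) (P y)"
  have sym: "b x y = b y x" and add: "b (x + z) y = b x y + b z y" and scale: "b (r *\<^sub>R x) y = r * b x y"
    if "x \<in> V" "y \<in> V" "z \<in> V" for x y z r
    using assms(1) that unfolding sym_bilinear_on_def by blast+
  have addr: "b y (x + z) = b y x + b y z" and scaler: "b y (r *\<^sub>R x) = r * b y x"
    if "x \<in> V" "y \<in> V" "z \<in> V" for x y z r
    using sym add scale that subspace_add[OF assms(2)] subspace_scale[OF assms(2)] by metis+
  have "bilinear ?b"
    unfolding bilinear_def
    by (intro allI conjI linearI)
      (simp_all add: linear_add[OF P] linear_scale[OF P] add[OF PV PV PV] scale[OF PV PV PV]
        addr[OF PV PV PV] scaler[OF PV PV PV])
  then show thesis
    using that[of ?b] Pid sym[OF PV PV PV] by (simp add: bilinear_conv_bounded_bilinear)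
qed

section \<open>Lie algebras of subgroups and connectedness\<close>

context lie_group
begin

lemma mult_chart:
  obtains U where "open U" "(e0, e0) \<in> U" "U \<subseteq> \<phi> ` U0 \<times> \<phi> ` U0"
    "\<forall>p\<in>U. \<psi> (fst p) \<otimes> \<psi> (snd p) \<in> U0"
    "smooth_on U (\<lambda>p. \<phi> (\<psi> (fst p) \<otimes> \<psi> (snd p)))"
proof -
  have f: "gsmooth_at (e0, e0) (\<lambda>p. \<psi> (fst p))"
    by (rule gsmooth_at_compose[OF open_UNIV UNIV_I smooth_on_linear[OF bounded_linear_fst open_UNIV]])
      (simp add: gsmooth_at_psi)
  have s: "gsmooth_at (e0, e0) (\<lambda>p. \<psi> (snd p))"
    by (rule gsmooth_at_compose[OF open_UNIV UNIV_I smooth_on_linear[OF bounded_linear_snd open_UNIV]])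
      (simp add: gsmooth_at_psi)
  have "\<psi> (fst (e0, e0)) \<otimes> \<psi> (snd (e0, e0)) \<in> U0" using base_chart_one psi_e0 by simp
  then obtain U where U: "open U" "(e0, e0) \<in> U" "\<forall>p\<in>U. \<psi> (fst p) \<otimes> \<psi> (snd p) \<in> U0"
    "smooth_on U (\<lambda>p. \<phi> (\<psi> (fst p) \<otimes> \<psi> (snd p)))"
    by (rule gsmooth_mult_chart[OF f s base_chart_atlas])
  let ?W = "U \<inter> \<phi> ` U0 \<times> \<phi> ` U0"
  show thesis
  proof (rule that)
    show "open ?W" using U(1) chart_open[OF base_chart_atlas] by (intro open_Int open_Times)
    show "smooth_on ?W (\<lambda>p. \<phi> (\<psi> (fst p) \<otimes> \<psi> (snd p)))" using smooth_on_subset[OF U(4)] by blast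
  qed (use U e0_in in auto)
qed

text \<open>With the other factor held at the identity, multiplication is the identity map near
  \<open>e0\<close>; this fixes both partial derivatives and therefore the differential. It makes
  velocities of products add, whence \<open>lie_alg\<close> is a subspace.\<close>

lemma mult_has_derivative:
  "((\<lambda>p. \<phi> (\<psi> (fst p) \<otimes> \<psi> (snd p))) has_derivative (\<lambda>h. fst h + snd h)) (at (e0, e0))"
proof -
  obtain U where U: "open U" "(e0, e0) \<in> U" "U \<subseteq> \<phi> ` U0 \<times> \<phi> ` U0"
    "smooth_on U (\<lambda>p. \<phi> (\<psi> (fst p) \<otimes> \<psi> (snd p)))"
    by (rule mult_chart)
  obtain D where D: "((\<lambda>p. \<phi> (\<psi> (fst p) \<otimes> \<psi> (snd p))) has_derivative D) (at (e0, e0))"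
    using smooth_on_derivative(1)[OF U(4,2)] by blast
  note o = chart_open[OF base_chart_atlas]
  have psi: "\<psi> x \<in> carrier G" "\<phi> (\<psi> x) = x" if "x \<in> \<phi> ` U0" for x
    using inv_chart_in[OF that] chart_subset[OF base_chart_atlas] inv_chart_right[OF that] by auto
  have "((\<lambda>x. (x, e0)) has_derivative (\<lambda>h. (h, 0))) (at e0)" by (auto intro!: derivative_eq_intros)
  from has_derivative_compose[OF this D]
  have 1: "((\<lambda>x. \<phi> (\<psi> x \<otimes> \<psi> e0)) has_derivative (\<lambda>h. D (h, 0))) (at e0)" by simp
  have "((\<lambda>x. x) has_derivative (\<lambda>h. D (h, 0))) (at e0)"
    by (rule has_derivative_transform_within_open[OF 1 o e0_in]) (simp add: psi_e0 psi)
  then have D1: "D (h, 0) = h" for h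
    using has_derivative_unique[OF _ has_derivative_ident] by metis
  have "((\<lambda>x. (e0, x)) has_derivative (\<lambda>h. (0, h))) (at e0)" by (auto intro!: derivative_eq_intros)
  from has_derivative_compose[OF this D]
  have 2: "((\<lambda>x. \<phi> (\<psi> e0 \<otimes> \<psi> x)) has_derivative (\<lambda>h. D (0, h))) (at e0)" by simp
  have "((\<lambda>x. x) has_derivative (\<lambda>h. D (0, h))) (at e0)"
    by (rule has_derivative_transform_within_open[OF 2 o e0_in]) (simp add: psi_e0 psi)
  then have D2: "D (0, h) = h" for h
    using has_derivative_unique[OF _ has_derivative_ident] by metis
  have "D h = fst h + snd h" for h
    using linear_add[OF has_derivative_linear[OF D], of "(fst h, 0)" "(0, snd h)"] D1 D2 by simp
  then have "D = (\<lambda>h. fst h + snd h)" by blast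
  then show ?thesis using D by simp
qed

lemma tang_mult:
  assumes "tang \<sigma> v" "tang \<tau> w" shows "tang (\<lambda>s. \<sigma> s \<otimes> \<tau> s) (v + w)"
proof -
  obtain U where U: "open U" "(e0, e0) \<in> U" "\<forall>p\<in>U. \<psi> (fst p) \<otimes> \<psi> (snd p) \<in> U0"
    by (rule mult_chart)
  have \<sigma>: "\<sigma> 0 = \<one>" "\<forall>\<^sub>F s in nhds 0. \<sigma> s \<in> U0" "((\<lambda>s. \<phi> (\<sigma> s)) has_derivative (\<lambda>h. h *\<^sub>R v)) (at 0)"
    and \<tau>: "\<tau> 0 = \<one>" "\<forall>\<^sub>F s in nhds 0. \<tau> s \<in> U0" "((\<lambda>s. \<phi> (\<tau> s)) has_derivative (\<lambda>h. h *\<^sub>R w)) (at 0)"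
    using assms unfolding tang_def has_vector_derivative_def by auto
  have P: "((\<lambda>s. (\<phi> (\<sigma> s), \<phi> (\<tau> s))) has_derivative (\<lambda>h. (h *\<^sub>R v, h *\<^sub>R w))) (at 0)"
    by (rule has_derivative_Pair[OF \<sigma>(3) \<tau>(3)])
  have "\<forall>\<^sub>F s in nhds 0. (\<phi> (\<sigma> s), \<phi> (\<tau> s)) \<in> U"
    using tendsto_eventually_nhds[OF has_derivative_continuous[OF P] U(1)] U(2) \<sigma>(1) \<tau>(1) by simp
  with \<sigma>(2) \<tau>(2) have ev: "\<forall>\<^sub>F s in nhds 0. \<sigma> s \<otimes> \<tau> s \<in> U0"
    by eventually_elim (use U(3) inv_chart_left[OF base_chart_is_chart] in fastforce)
  have "((\<lambda>s. \<phi> (\<psi> (\<phi> (\<sigma> s)) \<otimes> \<psi> (\<phi> (\<tau> s)))) has_derivative (\<lambda>h. h *\<^sub>R v + h *\<^sub>R w)) (at 0)"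
    using has_derivative_compose[OF P, of "\<lambda>p. \<phi> (\<psi> (fst p) \<otimes> \<psi> (snd p))" "\<lambda>h. fst h + snd h"]
      mult_has_derivative \<sigma>(1) \<tau>(1) by simp
  then have "((\<lambda>s. \<phi> (\<psi> (\<phi> (\<sigma> s)) \<otimes> \<psi> (\<phi> (\<tau> s)))) has_vector_derivative v + w) (at 0)"
    unfolding has_vector_derivative_def by (simp add: scaleR_add_right)
  moreover have "\<forall>\<^sub>F s in nhds 0. \<phi> (\<psi> (\<phi> (\<sigma> s)) \<otimes> \<psi> (\<phi> (\<tau> s))) = \<phi> (\<sigma> s \<otimes> \<tau> s)"
    using \<sigma>(2) \<tau>(2) by eventually_elim (simp add: inv_chart_left[OF base_chart_is_chart])
  ultimately have "((\<lambda>s. \<phi> (\<sigma> s \<otimes> \<tau> s)) has_vector_derivative v + w) (at 0)"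
    by (rule has_vector_derivative_eventually_cong)
  then show ?thesis unfolding tang_def using ev \<sigma>(1) \<tau>(1) by simp
qed

lemma eventually_nhds_scale:
  assumes "\<forall>\<^sub>F s in nhds (0::real). P s" shows "\<forall>\<^sub>F s in nhds 0. P (r * s)"
proof -
  have "((\<lambda>s. r * s) \<longlongrightarrow> r * 0) (nhds 0)" by (intro tendsto_intros filterlim_ident)
  then show ?thesis using assms filterlim_iff by fastforce
qed

lemma tang_scale:
  assumes "tang \<sigma> v" shows "tang (\<lambda>s. \<sigma> (r * s)) (r *\<^sub>R v)"
proof -
  have "((\<lambda>s. \<phi> (\<sigma> s)) has_vector_derivative v) (at (r * 0))" using assms unfolding tang_def by simp
  moreover have "((\<lambda>s. r * s) has_vector_derivative r) (at 0)"
    by (auto intro!: derivative_eq_intros simp: has_vector_derivative_def)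
  ultimately have "((\<lambda>s. \<phi> (\<sigma> s)) \<circ> (\<lambda>s. r * s) has_vector_derivative r *\<^sub>R v) (at 0)"
    using vector_diff_chain_at[of "\<lambda>s. r * s" r 0] by blast
  then show ?thesis
    using assms eventually_nhds_scale[of "\<lambda>s. \<sigma> s \<in> U0"] unfolding tang_def by (simp add: o_def)
qed

lemma tang_const: "tang (\<lambda>_. \<one>) 0"
  unfolding tang_def using base_chart_one by (simp add: has_vector_derivative_const)

text \<open>Translates germs of curves into the symmetric interval used by \<open>lie_alg\<close>.
  With its converse \<open>lie_algD\<close>, all further work can be done with
  \<open>gsmooth_at\<close> and \<open>tang\<close>.\<close>

lemma lie_algI:
  assumes "gsmooth_at 0 \<gamma>" "tang \<gamma> v" "\<forall>\<^sub>F s in nhds 0. \<gamma> s \<in> H"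
  shows "v \<in> lie_alg G H"
proof -
  have \<gamma>: "\<gamma> 0 = \<one>" "((\<lambda>s. \<phi> (\<gamma> s)) has_vector_derivative v) (at 0)" using assms(2) unfolding tang_def by auto
  have "\<gamma> 0 \<in> U0" using \<gamma> base_chart_one by simp
  then obtain U where U: "open U" "0 \<in> U" "\<forall>y\<in>U. \<gamma> y \<in> U0" "smooth_on U (\<lambda>s. \<phi> (\<gamma> s))"
    by (rule gsmooth_in_chart[OF assms(1) base_chart_atlas])
  obtain S where S: "open S" "0 \<in> S" "\<forall>s\<in>S. \<gamma> s \<in> H" using assms(3) unfolding eventually_nhds by blast
  obtain e where e: "e > 0" "ball 0 e \<subseteq> U \<inter> S"
    using openE[OF open_Int[OF U(1) S(1)]] U(2) S(2) by blast
  have "ball 0 e = {-e<..<e}" by (auto simp: dist_real_def)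
  then have sub: "{-e<..<e} \<subseteq> U \<inter> S" using e by simp
  then have "smooth_on {-e<..<e} (\<phi> \<circ> \<gamma>)"
    using smooth_on_subset[OF U(4)] by (simp add: o_def)
  then show ?thesis
    unfolding lie_alg_def using e(1) sub U(3) S(3) \<gamma>
    by (intro CollectI exI[of _ \<gamma>] exI[of _ e]) (auto simp: o_def)
qed

lemma lie_algD:
  assumes "v \<in> lie_alg G H"
  obtains \<gamma> where "gsmooth_at 0 \<gamma>" "tang \<gamma> v" "\<forall>\<^sub>F s in nhds 0. \<gamma> s \<in> H"
proof -
  obtain \<gamma> e where \<gamma>: "e > (0::real)" "\<gamma> ` {-e<..<e} \<subseteq> H \<inter> U0" "\<gamma> 0 = \<one>"
    "smooth_on {-e<..<e} (\<phi> \<circ> \<gamma>)" "((\<phi> \<circ> \<gamma>) has_vector_derivative v) (at 0)"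
    using assms unfolding lie_alg_def by blast
  have ev: "\<forall>\<^sub>F s in nhds 0. \<gamma> s \<in> H \<inter> U0"
    unfolding eventually_nhds by (rule exI[of _ "{-e<..<e}"]) (use \<gamma>(1,2) in auto)
  show thesis
  proof (rule that[of \<gamma>])
    show "gsmooth_at 0 \<gamma>"
      by (rule gsmooth_atI[OF base_chart_atlas, of "{-e<..<e}"]) (use \<gamma> in \<open>auto simp: o_def\<close>)
    show "tang \<gamma> v" unfolding tang_def using \<gamma>(3,5) ev by (auto simp: o_def elim: eventually_mono)
    show "\<forall>\<^sub>F s in nhds 0. \<gamma> s \<in> H" using ev by (auto elim: eventually_mono)
  qed
qed

lemma gsmooth_at_scale:
  fixes \<gamma> :: "real \<Rightarrow> 'g"
  assumes "gsmooth_at (r * t) \<gamma>" shows "gsmooth_at t (\<lambda>s. \<gamma> (r * s))"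
  by (rule gsmooth_at_compose[OF open_UNIV UNIV_I smooth_on_linear[OF bounded_linear_mult_right open_UNIV] assms])

lemma gsmooth_at_shift:
  fixes \<gamma> :: "real \<Rightarrow> 'g"
  assumes "gsmooth_at t \<gamma>" shows "gsmooth_at 0 (\<lambda>s. \<gamma> (t + s))"
proof (rule gsmooth_at_compose[OF open_UNIV UNIV_I])
  show "smooth_on UNIV (\<lambda>s. t + s)"
    by (intro smooth_on_add open_UNIV smooth_on_const smooth_on_linear bounded_linear_ident)
qed (simp add: assms)

lemma subspace_lie_alg:
  assumes "subgroup H G" shows "subspace (lie_alg G H)"
proof (rule subspaceI)
  have 1: "\<one> \<in> H" using assms subgroup.one_closed by blast
  show "0 \<in> lie_alg G H"
    by (rule lie_algI[OF gsmooth_at_const[OF one_closed] tang_const]) (simp add: 1)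
next
  fix v w assume v: "v \<in> lie_alg G H" and w: "w \<in> lie_alg G H"
  obtain \<gamma> where \<gamma>: "gsmooth_at 0 \<gamma>" "tang \<gamma> v" "\<forall>\<^sub>F s in nhds 0. \<gamma> s \<in> H" by (rule lie_algD[OF v])
  obtain \<delta> where \<delta>: "gsmooth_at 0 \<delta>" "tang \<delta> w" "\<forall>\<^sub>F s in nhds 0. \<delta> s \<in> H" by (rule lie_algD[OF w])
  have "\<forall>\<^sub>F s in nhds 0. \<gamma> s \<otimes> \<delta> s \<in> H"
    using \<gamma>(3) \<delta>(3) by eventually_elim (rule subgroup.m_closed[OF assms])
  then show "v + w \<in> lie_alg G H"
    by (rule lie_algI[OF gsmooth_at_mult[OF \<gamma>(1) \<delta>(1)] tang_mult[OF \<gamma>(2) \<delta>(2)]])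
next
  fix r :: real and v assume v: "v \<in> lie_alg G H"
  obtain \<gamma> where \<gamma>: "gsmooth_at 0 \<gamma>" "tang \<gamma> v" "\<forall>\<^sub>F s in nhds 0. \<gamma> s \<in> H" by (rule lie_algD[OF v])
  have "gsmooth_at 0 (\<lambda>s. \<gamma> (r * s))" by (rule gsmooth_at_scale) (simp add: \<gamma>(1))
  then show "r *\<^sub>R v \<in> lie_alg G H"
    by (rule lie_algI[OF _ tang_scale[OF \<gamma>(2)] eventually_nhds_scale[OF \<gamma>(3)]])
qed

lemma Ad_lie_alg:
  assumes "subgroup H G" "a \<in> H" "v \<in> lie_alg G H" shows "Ad G a v \<in> lie_alg G H"
proof -
  obtain \<gamma> where \<gamma>: "gsmooth_at 0 \<gamma>" "tang \<gamma> v" "\<forall>\<^sub>F s in nhds 0. \<gamma> s \<in> H" by (rule lie_algD[OF assms(3)])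
  have a: "a \<in> carrier G" using assms subgroup.mem_carrier by metis
  have "\<forall>\<^sub>F s in nhds 0. a \<otimes> \<gamma> s \<otimes> inv a \<in> H"
    using \<gamma>(3) by eventually_elim
      (intro subgroup.m_closed[OF assms(1)] assms(2) subgroup.m_inv_closed[OF assms(1)])
  moreover have "gsmooth_at 0 (\<lambda>s. a \<otimes> \<gamma> s \<otimes> inv a)"
    by (intro gsmooth_at_mult gsmooth_at_const a inv_closed \<gamma>(1))
  ultimately show ?thesis using lie_algI tang_conj[OF a \<gamma>(2)] by metis
qed

lemma bracket_in_invariant:
  assumes "subspace V" "\<And>a x. a \<in> H \<Longrightarrow> x \<in> V \<Longrightarrow> Ad G a x \<in> V" "v \<in> lie_alg G H" "w \<in> V"
  shows "bracket G v w \<in> V"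
proof -
  obtain \<gamma> where \<gamma>: "gsmooth_at 0 \<gamma>" "tang \<gamma> v" "\<forall>\<^sub>F s in nhds 0. \<gamma> s \<in> H" by (rule lie_algD[OF assms(3)])
  have "\<forall>\<^sub>F s in nhds 0. Ad G (\<gamma> s) w \<in> V" using \<gamma>(3) by eventually_elim (rule assms(2)[OF _ assms(4)])
  then show ?thesis by (rule derivative_in_subspace[OF bracket_tang[OF \<gamma>(2)] _ assms(1)])
qed

text \<open>Differentiate at 0 the function
  \<open>b (Ad G (\<gamma> s) x) (Ad G (\<gamma> s) y)\<close>, which is constant near 0. The
  hypothesis \<open>inV\<close> puts the brackets into \<open>V\<close>, so that the bounded
  extension of \<open>b\<close> may be replaced by \<open>b\<close> itself.\<close>

lemma tang_invariant_skew:
  assumes b: "sym_bilinear_on V b" "subspace V" and "tang \<gamma> v"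
    and inV: "\<And>x. x \<in> V \<Longrightarrow> \<forall>\<^sub>F s in nhds 0. Ad G (\<gamma> s) x \<in> V"
    and inv: "\<And>x y. x \<in> V \<Longrightarrow> y \<in> V \<Longrightarrow> \<forall>\<^sub>F s in nhds 0. b (Ad G (\<gamma> s) x) (Ad G (\<gamma> s) y) = b x y"
    and xy: "x \<in> V" "y \<in> V"
  shows "b (bracket G v x) y + b x (bracket G v y) = 0"
proof -
  obtain b' where b': "bounded_bilinear b'" "\<And>x y. x \<in> V \<Longrightarrow> y \<in> V \<Longrightarrow> b' x y = b x y"
    using sym_bilinear_on_extend[OF b] by metis
  have br: "bracket G v x \<in> V" "bracket G v y \<in> V"
    using derivative_in_subspace[OF bracket_tang[OF assms(3)] inV b(2)] xy by auto
  have g0: "\<gamma> 0 = \<one>" using assms(3) tang_def by blast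
  have "((\<lambda>s. b' (Ad G (\<gamma> s) x) (Ad G (\<gamma> s) y)) has_vector_derivative
      (b' (Ad G (\<gamma> 0) x) (bracket G v y) + b' (bracket G v x) (Ad G (\<gamma> 0) y))) (at 0)"
    by (rule bounded_bilinear.has_vector_derivative[OF b'(1) bracket_tang[OF assms(3)] bracket_tang[OF assms(3)]])
  moreover have "\<forall>\<^sub>F s in nhds 0. b' (Ad G (\<gamma> s) x) (Ad G (\<gamma> s) y) = b x y"
    using inV[OF xy(1)] inV[OF xy(2)] inv[OF xy] by eventually_elim (simp add: b'(2))
  ultimately have "((\<lambda>s. b x y) has_vector_derivative
      (b' (Ad G (\<gamma> 0) x) (bracket G v y) + b' (bracket G v x) (Ad G (\<gamma> 0) y))) (at 0)"
    by (rule has_vector_derivative_eventually_cong)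
  then have "b' (Ad G (\<gamma> 0) x) (bracket G v y) + b' (bracket G v x) (Ad G (\<gamma> 0) y) = 0"
    using vector_derivative_unique_at has_vector_derivative_const by blast
  then show ?thesis by (simp add: g0 Ad_one b'(2) br xy)
qed

lemma continuous_map_left_mult:
  assumes "a \<in> carrier G" shows "continuous_map (topol G) (topol G) (\<lambda>y. a \<otimes> y)"
proof -
  have "continuous_map (topol G) (prod_topology (topol G) (topol G)) (\<lambda>y. (a, y))"
    using assms topspace_carrier by (intro continuous_map_pairedI) auto
  from continuous_map_compose[OF this continuous_mult] show ?thesis by (simp add: o_def)
qed

lemma openin_left_mult:
  assumes "a \<in> carrier G" "openin (topol G) N"
  shows "openin (topol G) {y \<in> carrier G. a \<otimes> y \<in> N}"
  using openin_continuous_map_preimage[OF continuous_map_left_mult[OF assms(1)] assms(2)]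
  by (simp add: topspace_carrier)

text \<open>In a slice chart \<open>H\<close> becomes the linear subspace \<open>E\<close>, and
  \<open>E\<close> meets a ball in a convex set. The straight segment starting at the identity
  therefore stays in \<open>H\<close>.\<close>

lemma slice_paths:
  assumes "embedded_lie_subgroup G H"
  obtains N where "openin (topol G) N" "\<one> \<in> N"
    "\<And>x. x \<in> N \<inter> H \<Longrightarrow> \<exists>\<gamma>::real \<Rightarrow> 'g. \<gamma> 0 = \<one> \<and> \<gamma> 1 = x \<and>
       (\<forall>t\<in>{0..1}. gsmooth_at t \<gamma> \<and> (\<forall>\<^sub>F s in nhds t. \<gamma> s \<in> H))"
proof -
  have sub: "subgroup H G" using assms embedded_lie_subgroup_def by blast
  have 1: "\<one> \<in> H" using sub subgroup.one_closed by blast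
  obtain c E where c: "is_chart (topol G) c" "\<forall>d\<in>atlas G. compatible c d" "\<one> \<in> fst c" "subspace E"
    "snd c ` (fst c \<inter> H) = snd c ` fst c \<inter> E"
    using assms 1 unfolding embedded_lie_subgroup_def by blast
  let ?x0 = "snd c \<one>"
  have x0: "?x0 \<in> E" using c 1 by blast
  have oc: "open (snd c ` fst c)" and ofc: "openin (topol G) (fst c)" using c(1) is_chart_def by blast+
  obtain r where r: "r > 0" "ball ?x0 r \<subseteq> snd c ` fst c"
    using oc c(3) open_contains_ball by blast
  define N where "N = {x \<in> fst c. snd c x \<in> ball ?x0 r}"
  have "continuous_map (subtopology (topol G) (fst c)) (top_of_set (snd c ` fst c)) (snd c)"
    using c(1) unfolding is_chart_def by (simp add: homeomorphic_imp_continuous_map)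
  then have "continuous_map (subtopology (topol G) (fst c)) euclidean (snd c)"
    using continuous_map_in_subtopology by blast
  from openin_continuous_map_preimage[OF this, of "ball ?x0 r"]
  have "openin (subtopology (topol G) (fst c)) {x \<in> topspace (subtopology (topol G) (fst c)). snd c x \<in> ball ?x0 r}"
    by simp
  moreover have "topspace (subtopology (topol G) (fst c)) = fst c"
    by (rule topspace_subtopology_subset[OF openin_subset[OF ofc]])
  ultimately have "openin (subtopology (topol G) (fst c)) N" by (simp only: N_def)
  then have oN: "openin (topol G) N" by (rule openin_trans_full[OF _ ofc])
  show thesis
  proof (rule that[OF oN])
    show "\<one> \<in> N" using c(3) r(1) by (simp add: N_def)
    fix x assume x: "x \<in> N \<inter> H"
    define z where "z = (\<lambda>t::real. ?x0 + t *\<^sub>R (snd c x - ?x0))"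
    define \<gamma> where "\<gamma> = (\<lambda>t. inv_chart c (z t))"
    have xE: "snd c x \<in> E" using x c(5) N_def by blast
    have zE: "z t \<in> E" for t
      unfolding z_def by (intro subspace_add[OF c(4)] subspace_scale[OF c(4)] subspace_diff[OF c(4)] x0 xE)
    have zc: "isCont z t" for t unfolding z_def by simp
    have zb: "z t \<in> ball ?x0 r" if "t \<in> {0..1}" for t
    proof -
      have "snd c x \<in> ball ?x0 r" using x N_def by blast
      then have "norm (snd c x - ?x0) < r" by (simp add: dist_norm norm_minus_commute)
      moreover have "\<bar>t\<bar> * norm (snd c x - ?x0) \<le> 1 * norm (snd c x - ?x0)"
        using that by (intro mult_right_mono) auto
      ultimately show ?thesis by (simp add: z_def dist_norm)
    qed
    have inH: "inv_chart c y \<in> H" if "y \<in> ball ?x0 r" "y \<in> E" for y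
    proof -
      have "y \<in> snd c ` (fst c \<inter> H)" using that r(2) c(5) by blast
      then show ?thesis using inv_chart_left[OF c(1)] by auto
    qed
    have smooth: "gsmooth_at t \<gamma>" if "t \<in> {0..1}" for t
    proof -
      have "\<gamma> t \<in> carrier G"
        unfolding \<gamma>_def using inH[OF zb[OF that] zE] subgroup.mem_carrier[OF sub] by blast
      \<comment> \<open>The slice chart \<open>c\<close> need not belong to the atlas, whereas
        \<open>gsmooth_at\<close> asks for an atlas chart; compatibility of \<open>c\<close> and
        \<open>d\<close> transfers smoothness.\<close>
      then obtain d where d: "d \<in> atlas G" "\<gamma> t \<in> fst d" using charts_cover by blast
      let ?A = "snd c ` (fst c \<inter> fst d)"
      have "openin (topol G) (fst d)" using charts[OF d(1)] is_chart_def by blast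
      then have oA: "open ?A" using chart_image_open[OF c(1)] by blast
      have zt: "z t \<in> snd c ` fst c" using zb[OF that] r(2) by blast
      have ztA: "z t \<in> ?A" using d(2) inv_chart_in[OF zt] inv_chart_right[OF zt] unfolding \<gamma>_def by force
      have sm: "smooth_on ?A (\<lambda>y. snd d (inv_chart c y))"
        using c(2) d(1) unfolding compatible_def by (auto simp: o_def)
      have oz: "open (z -` ?A)" using zc oA by (simp add: continuous_at_imp_continuous_on open_vimage)
      have sz: "smooth_on (z -` ?A) z"
        unfolding z_def
        by (intro smooth_on_add smooth_on_const smooth_on_linear bounded_linear_scaleR_left
            oz[unfolded z_def])
      have "smooth_on (z -` ?A) (\<lambda>s. snd d (\<gamma> s))"
        unfolding \<gamma>_def by (rule smooth_on_compose[OF oz oA _ sz sm]) blast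
      moreover have "\<gamma> s \<in> fst d" if "s \<in> z -` ?A" for s
        using that inv_chart_left[OF c(1)] unfolding \<gamma>_def by auto
      ultimately show ?thesis using gsmooth_atI[OF d(1) oz, of t \<gamma>] ztA by simp
    qed
    \<comment> \<open>Openness of the ball keeps the line in \<open>H\<close> slightly beyond both
      endpoints, so two-sided derivatives at 0 and 1 make sense.\<close>
    have ev: "\<forall>\<^sub>F s in nhds t. \<gamma> s \<in> H" if "t \<in> {0..1}" for t
      using tendsto_eventually_nhds[OF zc open_ball zb[OF that]] zE
      by (auto elim!: eventually_mono simp: \<gamma>_def intro: inH)
    have "\<gamma> 0 = \<one>" "\<gamma> 1 = x"
      using inv_chart_left[OF c(1)] c(3) x by (auto simp: \<gamma>_def z_def N_def)
    then show "\<exists>\<gamma>::real \<Rightarrow> 'g. \<gamma> 0 = \<one> \<and> \<gamma> 1 = x \<and>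
       (\<forall>t\<in>{0..1}. gsmooth_at t \<gamma> \<and> (\<forall>\<^sub>F s in nhds t. \<gamma> s \<in> H))"
      using smooth ev by blast
  qed
qed

text \<open>By \<open>slice_paths\<close>, \<open>R\<close> contains a neighbourhood of the identity
  in \<open>H\<close>. Translating it makes both \<open>H \<inter> R\<close> and
  \<open>H - R\<close> relatively open, and connectedness leaves only
  \<open>H \<subseteq> R\<close>. This carries conclusions of differential equations along paths
  over to all of \<open>H\<close>.\<close>

lemma connected_subgroup_induct:
  assumes H: "embedded_lie_subgroup G H" "connectedin (topol G) H"
    and one: "\<one> \<in> R"
    and mult: "\<And>a b. a \<in> R \<Longrightarrow> b \<in> R \<Longrightarrow> a \<in> carrier G \<Longrightarrow> b \<in> carrier G \<Longrightarrow> a \<otimes> b \<in> R"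
    and inv: "\<And>a. a \<in> R \<Longrightarrow> a \<in> carrier G \<Longrightarrow> inv a \<in> R"
    and path: "\<And>\<gamma>::real \<Rightarrow> 'g. \<gamma> 0 = \<one> \<Longrightarrow>
       (\<And>t. t \<in> {0..1} \<Longrightarrow> gsmooth_at t \<gamma> \<and> (\<forall>\<^sub>F s in nhds t. \<gamma> s \<in> H)) \<Longrightarrow> \<gamma> 1 \<in> R"
  shows "H \<subseteq> R"
proof (rule ccontr)
  assume neg: "\<not> H \<subseteq> R"
  have sub: "subgroup H G" using H embedded_lie_subgroup_def by blast
  have HG: "H \<subseteq> carrier G" using sub subgroup.subset by blast
  obtain N where N: "openin (topol G) N" "\<one> \<in> N"
    "\<And>x. x \<in> N \<inter> H \<Longrightarrow> \<exists>\<gamma>::real \<Rightarrow> 'g. \<gamma> 0 = \<one> \<and> \<gamma> 1 = x \<and>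
       (\<forall>t\<in>{0..1}. gsmooth_at t \<gamma> \<and> (\<forall>\<^sub>F s in nhds t. \<gamma> s \<in> H))"
    using slice_paths[OF H(1)] by metis
  have NR: "x \<in> R" if "x \<in> N" "x \<in> H" for x
    using N(3)[of x] that path by blast
  define nb where "nb = (\<lambda>x. H \<inter> {y \<in> carrier G. inv x \<otimes> y \<in> N})"
  have nb: "openin (subtopology (topol G) H) (nb x)" "x \<in> nb x" if "x \<in> H" for x
    unfolding nb_def using that HG N(1,2) openin_left_mult[of "inv x" N] by (auto intro: openin_subtopology_Int2)
  have nbR: "inv x \<otimes> y \<in> R" "inv x \<otimes> y \<in> carrier G" "x \<in> carrier G" "y \<in> carrier G" if "x \<in> H" "y \<in> nb x" for x y
    using that NR HG subgroup.m_closed[OF sub] subgroup.m_inv_closed[OF sub] unfolding nb_def by blast+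
  have sub1: "nb x \<subseteq> H \<inter> R" if x: "x \<in> H" "x \<in> R" for x
  proof
    fix y assume y: "y \<in> nb x"
    note n = nbR[OF x(1) y]
    have "x \<otimes> (inv x \<otimes> y) \<in> R" using mult[OF x(2) n(1) n(3) n(2)] .
    then show "y \<in> H \<inter> R" using y n by (simp add: nb_def m_assoc[symmetric])
  qed
  have sub2: "nb x \<subseteq> H - R" if x: "x \<in> H" "x \<notin> R" for x
  proof
    fix y assume y: "y \<in> nb x"
    note n = nbR[OF x(1) y]
    have "y \<notin> R"
    proof
      assume yR: "y \<in> R"
      have "y \<otimes> inv (inv x \<otimes> y) \<in> R" using mult[OF yR inv[OF n(1,2)] n(4)] n(2) by blast
      moreover have "y \<otimes> inv (inv x \<otimes> y) = x"
        using n(3,4) by (simp add: inv_mult_group m_assoc[symmetric])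
      ultimately show False using x by simp
    qed
    then show "y \<in> H - R" using y by (simp add: nb_def)
  qed
  have o1: "openin (subtopology (topol G) H) (H \<inter> R)"
    by (subst openin_subopen) (use nb sub1 in blast)
  have o2: "openin (subtopology (topol G) H) (H - R)"
    by (subst openin_subopen) (use nb sub2 in blast)
  have "connected_space (subtopology (topol G) H)" using H(2) connectedin_def by blast
  then have "H \<inter> R = {} \<or> H - R = {}"
    using o1 o2 HG unfolding connected_space_def
    by (metis (no_types, lifting) Diff_disjoint Diff_Int_distrib2 Int_Diff_Un Int_Diff_disjoint
        order_refl topspace_carrier topspace_subtopology_subset)
  moreover have "\<one> \<in> H \<inter> R" using one sub subgroup.one_closed by blast
  ultimately show False using neg by blast
qed

end

subsection \<open>One-parameter subgroups\<close>

text \<open>The compact product to which this is applied has uncountably many factors, so convergent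
  subsequences cannot be expected. A cluster point suffices: it inherits every closed condition
  satisfied by all late members.\<close>

lemma compact_space_cluster_point:
  assumes "compact_space X" "\<And>n::nat. f n \<in> topspace X"
  obtains x where "x \<in> topspace X" "\<And>U N. openin X U \<Longrightarrow> x \<in> U \<Longrightarrow> \<exists>n\<ge>N. f n \<in> U"
proof (rule ccontr)
  assume "\<not> thesis"
  with that have "\<forall>x\<in>topspace X. \<exists>U N. openin X U \<and> x \<in> U \<and> (\<forall>n\<ge>N. f n \<notin> U)" by metis
  then obtain U N where UN: "\<And>x. x \<in> topspace X \<Longrightarrow> openin X (U x) \<and> x \<in> U x \<and> (\<forall>n\<ge>(N x::nat). f n \<notin> U x)"
    by metis
  have "\<exists>F. finite F \<and> F \<subseteq> U ` topspace X \<and> topspace X \<subseteq> \<Union>F"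
  proof -
    have "\<forall>V\<in>U ` topspace X. openin X V" "topspace X \<subseteq> \<Union>(U ` topspace X)" using UN by blast+
    then show ?thesis using assms(1)[unfolded compact_space_alt, rule_format, of "U ` topspace X"] by blast
  qed
  then obtain A where A: "finite A" "A \<subseteq> topspace X" "topspace X \<subseteq> \<Union>(U ` A)"
    by (metis finite_subset_image)
  define M where "M = Max (insert 0 (N ` A))"
  have "N x \<le> M" if "x \<in> A" for x using that A(1) unfolding M_def by (intro Max_ge) auto
  then have "f M \<notin> \<Union>(U ` A)" using UN A(2) by blast
  then show False using assms(2)[of M] A(3) by blast
qed

context lie_group
begin

text \<open>The second partial derivative of multiplication is the identity at
  \<open>(e0, e0)\<close> and hence within \<open>\<epsilon>\<close> of it nearby. The mean value
  inequality in the second variable then gives an error proportional to the small factor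
  \<open>y - e0\<close>, uniformly in \<open>x\<close>.\<close>

lemma mult_estimate:
  assumes "\<epsilon> > 0"
  obtains r where "r > 0" "cball e0 r \<subseteq> \<phi> ` U0"
    "\<And>x y. norm (x - e0) \<le> r \<Longrightarrow> norm (y - e0) \<le> r \<Longrightarrow> \<psi> x \<otimes> \<psi> y \<in> U0 \<and>
       norm (\<phi> (\<psi> x \<otimes> \<psi> y) - x - (y - e0)) \<le> \<epsilon> * norm (y - e0)"
proof -
  let ?F = "\<lambda>p. \<phi> (\<psi> (fst p) \<otimes> \<psi> (snd p))"
  obtain U where U: "open U" "(e0, e0) \<in> U" "U \<subseteq> \<phi> ` U0 \<times> \<phi> ` U0"
    "\<forall>p\<in>U. \<psi> (fst p) \<otimes> \<psi> (snd p) \<in> U0" "smooth_on U ?F"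
    by (rule mult_chart)
  define D where "D = (\<lambda>p. frechet_derivative ?F (at p))"
  have D: "(?F has_derivative D p) (at p)" if "p \<in> U" for p
    unfolding D_def using smooth_on_derivative(1)[OF U(5) that] .
  have D0: "D (e0, e0) (0, b) = b" for b
    using has_derivative_unique[OF D[OF U(2)] mult_has_derivative] by (metis add_0 fst_conv snd_conv)
  \<comment> \<open>The sum over \<open>Basis\<close> dominates the operator norm of
    \<open>k \<mapsto> D p (0, k) - k\<close> and is visibly continuous in \<open>p\<close>.\<close>
  define g where "g = (\<lambda>p. \<Sum>b\<in>Basis. norm (D p (0, b) - b))"
  have "continuous_on U g"
    unfolding g_def D_def
    by (intro continuous_on_sum continuous_on_norm continuous_on_diff continuous_on_const
        smooth_on_continuous[OF smooth_on_derivative(2)[OF U(5)]])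
  then have "open (U \<inter> g -` {..<\<epsilon>})"
    using continuous_open_preimage U(1) open_lessThan by blast
  moreover have "(e0, e0) \<in> U \<inter> g -` {..<\<epsilon>}" using U(2) assms by (simp add: g_def D0)
  ultimately obtain d where d: "d > 0" "ball (e0, e0) d \<subseteq> U \<inter> g -` {..<\<epsilon>}"
    by (rule openE)
  define r where "r = d / 3"
  have r: "r > 0" using d by (simp add: r_def)
  have near: "(x, y) \<in> U \<and> g (x, y) < \<epsilon>" if "norm (x - e0) \<le> r" "norm (y - e0) \<le> r" for x y
  proof -
    have "dist (e0, e0) (x, y) \<le> dist e0 x + dist e0 y"
      by (simp add: dist_Pair_Pair sqrt_sum_squares_le_sum)
    also have "\<dots> < d" using that d(1) by (simp add: dist_norm norm_minus_commute r_def)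
    finally show ?thesis using d(2) by (auto simp: subset_iff)
  qed
  have bnd: "norm (D p (0, k) - k) \<le> \<epsilon> * norm k" if p: "p \<in> U" "g p < \<epsilon>" for p k
  proof -
    have "linear (D p)" using D[OF p(1)] has_derivative_linear by blast
    then have l: "linear (\<lambda>k. D p (0, k) - k)"
      by (intro linearI) (simp_all add: linear_add[symmetric] linear_scale[symmetric] algebra_simps
          flip: linear_add linear_scale)
    have "D p (0, k) - k = (\<Sum>b\<in>Basis. (k \<bullet> b) *\<^sub>R (D p (0, b) - b))"
      using linear_sum[OF l, of "\<lambda>b. (k \<bullet> b) *\<^sub>R b" Basis]
      by (simp add: euclidean_representation linear_scale[OF l])
    also have "norm \<dots> \<le> (\<Sum>b\<in>Basis. norm k * norm (D p (0, b) - b))"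
      by (rule sum_norm_le) (simp add: mult_right_mono Basis_le_norm)
    also have "\<dots> = norm k * g p" by (simp add: g_def sum_distrib_left)
    also have "\<dots> \<le> norm k * \<epsilon>" using p(2) by (intro mult_left_mono) auto
    finally show ?thesis by (simp add: mult.commute)
  qed
  show thesis
  proof (rule that[OF r])
    show "cball e0 r \<subseteq> \<phi> ` U0"
    proof
      fix x assume "x \<in> cball e0 r"
      then have "(x, e0) \<in> U" using near[of x e0] r by (simp add: dist_norm norm_minus_commute)
      then show "x \<in> \<phi> ` U0" using U(3) by blast
    qed
    fix x y assume x: "norm (x - e0) \<le> r" and y: "norm (y - e0) \<le> r"
    have "norm ((?F (x, y) - y) - (?F (x, e0) - e0)) \<le> \<epsilon> * norm (y - e0)"
    proof (rule differentiable_bound[where S="cball e0 r" and f'="\<lambda>z k. D (x, z) (0, k) - k"])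
      fix z assume "z \<in> cball e0 r"
      then have z: "(x, z) \<in> U" "g (x, z) < \<epsilon>" using near[OF x] by (simp_all add: dist_norm norm_minus_commute)
      have "((\<lambda>z. (x, z)) has_derivative (\<lambda>h. (0, h))) (at z)" by (auto intro!: derivative_eq_intros)
      from has_derivative_compose[OF this D[OF z(1)]]
      have "((\<lambda>z. ?F (x, z) - z) has_derivative (\<lambda>k. D (x, z) (0, k) - k)) (at z)"
        by (intro has_derivative_diff has_derivative_ident)
      then show "((\<lambda>z. ?F (x, z) - z) has_derivative (\<lambda>k. D (x, z) (0, k) - k)) (at z within cball e0 r)"
        by (rule has_derivative_at_withinI)
      show "onorm (\<lambda>k. D (x, z) (0, k) - k) \<le> \<epsilon>" using bnd[OF z] assms by (intro onorm_bound) auto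
    qed (use y r in \<open>auto simp: dist_norm norm_minus_commute\<close>)
    moreover have "?F (x, e0) = x"
    proof -
      have "(x, e0) \<in> U" using near[OF x, of e0] r by simp
      then have "x \<in> \<phi> ` U0" using U(3) by blast
      then show ?thesis
        using inv_chart_in[of x "base_chart G"] inv_chart_right[of x "base_chart G"] chart_subset[OF base_chart_atlas]
        by (auto simp: psi_e0)
    qed
    ultimately have "norm (?F (x, y) - x - (y - e0)) \<le> \<epsilon> * norm (y - e0)" by (simp add: algebra_simps)
    then show "\<psi> x \<otimes> \<psi> y \<in> U0 \<and> norm (\<phi> (\<psi> x \<otimes> \<psi> y) - x - (y - e0)) \<le> \<epsilon> * norm (y - e0)"
      using near[OF x y] U(4) by auto
  qed
qed

text \<open>Each further factor contributes an error of at most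
  \<open>\<epsilon> * (h * norm v)\<close>, and errors add up. The bound \<open>r / 2\<close>
  together with \<open>\<epsilon> \<le> 1\<close> keeps the powers within distance \<open>r\<close>
  of \<open>e0\<close>, where \<open>est\<close> may be applied again.\<close>

lemma power_estimate:
  assumes r: "r > 0" "cball e0 r \<subseteq> \<phi> ` U0"
    and est: "\<And>x y. norm (x - e0) \<le> r \<Longrightarrow> norm (y - e0) \<le> r \<Longrightarrow> \<psi> x \<otimes> \<psi> y \<in> U0 \<and>
       norm (\<phi> (\<psi> x \<otimes> \<psi> y) - x - (y - e0)) \<le> \<epsilon> * norm (y - e0)"
    and \<epsilon>: "0 < \<epsilon>" "\<epsilon> \<le> 1" and h: "h \<ge> 0" "real m * h * norm v \<le> r / 2"
  shows "\<psi> (e0 + h *\<^sub>R v) [^] m \<in> U0 \<and>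
    norm (\<phi> (\<psi> (e0 + h *\<^sub>R v) [^] m) - e0 - (real m * h) *\<^sub>R v) \<le> \<epsilon> * (real m * h * norm v)"
  using h(2)
proof (induction m)
  case 0
  then show ?case using base_chart_one by simp
next
  case (Suc m)
  let ?c = "\<psi> (e0 + h *\<^sub>R v)" and ?y = "e0 + h *\<^sub>R v" and ?x = "\<phi> (\<psi> (e0 + h *\<^sub>R v) [^] m)"
  have hv: "h * norm v \<ge> 0" using h(1) by simp
  have le: "real m * h * norm v \<le> r / 2" "h * norm v \<le> r / 2"
  proof -
    have e: "real (Suc m) * h * norm v = real m * h * norm v + h * norm v" by (simp add: algebra_simps)
    have "real m * h * norm v \<ge> 0" using h(1) by simp
    then show "real m * h * norm v \<le> r / 2" "h * norm v \<le> r / 2" using Suc.prems e hv by linarith+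
  qed
  have IH: "?c [^] m \<in> U0" "norm (?x - e0 - (real m * h) *\<^sub>R v) \<le> \<epsilon> * (real m * h * norm v)"
    using Suc.IH[OF le(1)] by auto
  have "norm (?x - e0) \<le> norm (?x - e0 - (real m * h) *\<^sub>R v) + norm ((real m * h) *\<^sub>R v)"
    by (metis diff_add_cancel norm_triangle_ineq)
  also have "\<dots> \<le> \<epsilon> * (real m * h * norm v) + real m * h * norm v" using IH(2) h(1) by simp
  also have "\<dots> \<le> 1 * (real m * h * norm v) + real m * h * norm v"
    using \<epsilon> h(1) by (intro add_right_mono mult_right_mono) auto
  also have "\<dots> \<le> r" using le(1) by linarith
  finally have x: "norm (?x - e0) \<le> r" .
  have y: "norm (?y - e0) \<le> r" using le(2) h(1) r(1) by simp
  have px: "\<psi> ?x = ?c [^] m" using inv_chart_left[OF base_chart_is_chart IH(1)] .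
  from est[OF x y] have e: "?c [^] Suc m \<in> U0"
    "norm (\<phi> (?c [^] Suc m) - ?x - h *\<^sub>R v) \<le> \<epsilon> * (h * norm v)"
    using h(1) by (simp_all add: px)
  have "\<phi> (?c [^] Suc m) - e0 - (real (Suc m) * h) *\<^sub>R v =
      (\<phi> (?c [^] Suc m) - ?x - h *\<^sub>R v) + (?x - e0 - (real m * h) *\<^sub>R v)"
    by (simp add: algebra_simps)
  also have "norm \<dots> \<le> \<epsilon> * (h * norm v) + \<epsilon> * (real m * h * norm v)"
    using e(2) IH(2) norm_triangle_mono by blast
  also have "\<dots> = \<epsilon> * (real (Suc m) * h * norm v)" by (simp add: algebra_simps)
  finally show ?case using e(1) by simp
qed

lemma psi_line_in_carrier:
  obtains d where "d > 0" "\<And>h. \<bar>h\<bar> < d \<Longrightarrow> \<psi> (e0 + h *\<^sub>R v) \<in> carrier G"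
proof -
  obtain S where S: "open S" "0 \<in> S" "\<forall>s\<in>S. \<psi> (e0 + s *\<^sub>R v) \<in> carrier G"
    using tang_carrier[OF tang_psi[of v]] unfolding eventually_nhds by blast
  obtain d where d: "d > 0" "ball 0 d \<subseteq> S" using S openE by blast
  then show thesis using that[of d] S(3) by (auto simp: dist_real_def subset_iff)
qed

lemma eventually_in_open:
  assumes "tang \<sigma> v" "openin (topol G) W" "\<one> \<in> W"
  shows "\<forall>\<^sub>F s in nhds 0. \<sigma> s \<in> W"
proof -
  have s0: "\<sigma> 0 = \<one>" and ev0: "\<forall>\<^sub>F s in nhds 0. \<sigma> s \<in> U0" using assms(1) unfolding tang_def by auto
  have "open (\<phi> ` (U0 \<inter> W))" by (rule chart_image_open[OF base_chart_is_chart assms(2)])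
  then have "\<forall>\<^sub>F s in nhds 0. \<phi> (\<sigma> s) \<in> \<phi> ` (U0 \<inter> W)"
    using tendsto_eventually_nhds[OF tang_continuous[OF assms(1)]] s0 assms(3) base_chart_one by auto
  with ev0 show ?thesis
  proof eventually_elim
    case (elim s)
    then obtain w where "w \<in> U0" "w \<in> W" "\<phi> (\<sigma> s) = \<phi> w" by blast
    then have "\<sigma> s = w" using elim(1) inv_chart_left[OF base_chart_is_chart] by metis
    then show ?case using \<open>w \<in> W\<close> by simp
  qed
qed

text \<open>The semigroup is a cluster point, in the compact product space of all maps into \<open>G\<close>, of the
  step functions \<open>t \<mapsto> c(1/n)\<^bsup>\<lfloor>nt\<rfloor>\<^esup>\<close>, where \<open>c\<close> is the straight line with
  direction \<open>v\<close> in the base chart.\<close>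

lemma one_parameter_semigroup:
  assumes comp: "compact_space (topol G)"
  obtains f :: "real \<Rightarrow> 'g" where "\<And>t. t \<ge> 0 \<Longrightarrow> f t \<in> carrier G"
    "\<And>s t. s \<ge> 0 \<Longrightarrow> t \<ge> 0 \<Longrightarrow> f (s + t) = f s \<otimes> f t"
    "\<And>e. 0 < e \<Longrightarrow> e \<le> 1 \<Longrightarrow> \<exists>d>0. \<forall>t. 0 \<le> t \<longrightarrow> t < d \<longrightarrow>
       f t \<in> U0 \<and> norm (\<phi> (f t) - e0 - t *\<^sub>R v) \<le> e * (t * norm v)"
proof -
  define c where "c = (\<lambda>h. \<psi> (e0 + h *\<^sub>R v))"
  obtain d0 where d0: "d0 > 0" "\<And>h. \<bar>h\<bar> < d0 \<Longrightarrow> c h \<in> carrier G"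
    using psi_line_in_carrier unfolding c_def by metis
  obtain n0 :: nat where n0: "1 / real (Suc n0) < d0"
    using d0(1) reals_Archimedean by (metis inverse_eq_divide)
  \<comment> \<open>The shift by \<open>n0\<close> makes every step size \<open>1 / N n\<close>
    small enough for \<open>c (1 / N n)\<close> to lie in the group.\<close>
  define N where "N = (\<lambda>n. real (Suc (n + n0)))"
  have N: "N n \<ge> 1" "N n > real n" for n by (simp_all add: N_def)
  have cN: "c (1 / N n) \<in> carrier G" for n
  proof (rule d0(2))
    have "1 / N n \<le> 1 / real (Suc n0)" unfolding N_def by (intro divide_left_mono) auto
    then show "\<bar>1 / N n\<bar> < d0" using n0 N(1)[of n] by simp
  qed
  define k where "k = (\<lambda>n t. nat \<lfloor>N n * t\<rfloor>)"
  have k: "real (k n t) / N n \<le> t" "t - 1 / N n \<le> real (k n t) / N n" if "t \<ge> 0" for n t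
  proof -
    have p: "N n * t \<ge> 0" using that N(1)[of n] by simp
    then have "real (k n t) = of_int \<lfloor>N n * t\<rfloor>" unfolding k_def by simp
    then have "real (k n t) \<le> N n * t" "N n * t - 1 \<le> real (k n t)" by linarith+
    then have "real (k n t) / N n \<le> N n * t / N n" "(N n * t - 1) / N n \<le> real (k n t) / N n"
      using N(1)[of n] by (intro divide_right_mono; simp)+
    then show "real (k n t) / N n \<le> t" "t - 1 / N n \<le> real (k n t) / N n"
      using N(1)[of n] by (simp_all add: diff_divide_distrib)
  qed
  let ?X = "product_topology (\<lambda>_. topol G) {0::real..}"
  define F where "F = (\<lambda>n. restrict (\<lambda>t. c (1 / N n) [^] k n t) {0..})"
  have Ft: "F n t = c (1 / N n) [^] k n t" if "t \<ge> 0" for n t unfolding F_def using that by simp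
  have "compact_space ?X" using comp by (simp add: compact_space_product_topology)
  moreover have "F n \<in> topspace ?X" for n
    using cN by (auto simp: F_def topspace_carrier)
  ultimately obtain f where f: "f \<in> topspace ?X" "\<And>U M. openin ?X U \<Longrightarrow> f \<in> U \<Longrightarrow> \<exists>n\<ge>M. F n \<in> U"
    using compact_space_cluster_point[of ?X F] by metis
  have fc: "f t \<in> carrier G" if "t \<ge> 0" for t
    using f(1) that topspace_carrier by (auto simp: PiE_iff)
  have proj: "continuous_map ?X (topol G) (\<lambda>g. g t)" if "t \<ge> 0" for t
    using that by (intro continuous_map_product_projection) simp
  have gmult: "continuous_map ?X (topol G) (\<lambda>g. a g \<otimes> b g)"
    if "continuous_map ?X (topol G) a" "continuous_map ?X (topol G) b" for a b
    using continuous_map_compose[OF continuous_map_pairedI[OF that] continuous_mult] by (simp add: o_def)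
  have ginv: "continuous_map ?X (topol G) (\<lambda>g. inv (a g))" if "continuous_map ?X (topol G) a" for a
    using continuous_map_compose[OF that continuous_inv] by (simp add: o_def)
  have mult: "f (s + t) = f s \<otimes> f t" if st: "s \<ge> 0" "t \<ge> 0" for s t
  proof (rule ccontr)
    assume ne: "f (s + t) \<noteq> f s \<otimes> f t"
    \<comment> \<open>The defect from additivity. On a step function it is a power of
      \<open>c (1 / N n)\<close> with exponent 0 or 1, because floors are additive up to one. Such
      powers enter every neighbourhood of the identity, so Hausdorff separation excludes a
      nontrivial defect at the cluster point.\<close>
    let ?\<Phi> = "\<lambda>g. inv (g s \<otimes> g t) \<otimes> g (s + t)"
    have car: "f s \<in> carrier G" "f t \<in> carrier G" "f (s + t) \<in> carrier G" using fc st by auto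
    have "?\<Phi> f \<noteq> \<one>"
    proof
      assume "?\<Phi> f = \<one>"
      then have "(f s \<otimes> f t) \<otimes> (inv (f s \<otimes> f t) \<otimes> f (s + t)) = f s \<otimes> f t" using car by simp
      then show False using ne car by (simp add: m_assoc[symmetric] del: inv_mult_group)
    qed
    then obtain W1 W2 where W: "openin (topol G) W1" "openin (topol G) W2" "?\<Phi> f \<in> W1" "\<one> \<in> W2" "W1 \<inter> W2 = {}"
      using hausdorff car unfolding Hausdorff_space_def topspace_carrier disjnt_def
      by (metis inv_closed m_closed one_closed)
    have "continuous_map ?X (topol G) ?\<Phi>" using st by (intro gmult ginv proj) auto
    from openin_continuous_map_preimage[OF this W(1)]
    have o: "openin ?X {g \<in> topspace ?X. ?\<Phi> g \<in> W1}" .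
    obtain S where S: "open S" "0 \<in> S" "\<forall>s\<in>S. c s \<in> W2"
      using eventually_in_open[OF tang_psi W(2,4), of v] unfolding eventually_nhds c_def by blast
    obtain d where d: "d > 0" "ball 0 d \<subseteq> S" using S openE by blast
    obtain M :: nat where M: "1 / real (Suc M) < d" using d(1) reals_Archimedean by (metis inverse_eq_divide)
    obtain n where n: "n \<ge> Suc M" "F n \<in> {g \<in> topspace ?X. ?\<Phi> g \<in> W1}"
      using f(2)[OF o, of "Suc M"] f(1) W(3) by blast
    let ?c = "c (1 / N n)"
    have "1 / N n \<le> 1 / real (Suc M)" using N(2)[of n] n(1) by (intro divide_left_mono) auto
    then have "1 / N n \<in> ball 0 d" using M N(1)[of n] by (simp add: dist_real_def)
    then have cW: "?c \<in> W2" using S(3) d(2) by blast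
    define j where "j = k n (s + t) - (k n s + k n t)"
    have "N n * s \<ge> 0" "N n * t \<ge> 0" using st N(1)[of n] by auto
    then have "k n s + k n t \<le> k n (s + t)" "k n (s + t) \<le> k n s + k n t + 1"
      unfolding k_def distrib_left by linarith+
    then have j: "k n (s + t) = (k n s + k n t) + j" "j = 0 \<or> j = 1" by (auto simp: j_def)
    have "?\<Phi> (F n) = inv (?c [^] (k n s + k n t)) \<otimes> ?c [^] ((k n s + k n t) + j)"
      using st j(1) by (simp add: Ft nat_pow_mult[OF cN])
    also have "?c [^] ((k n s + k n t) + j) = ?c [^] (k n s + k n t) \<otimes> ?c [^] j"
      by (rule nat_pow_mult[OF cN, symmetric])
    also have "inv (?c [^] (k n s + k n t)) \<otimes> (?c [^] (k n s + k n t) \<otimes> ?c [^] j) = ?c [^] j"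
    proof -
      have "inv A \<otimes> (A \<otimes> B) = B" if "A \<in> carrier G" "B \<in> carrier G" for A B
        using that by (simp add: m_assoc[symmetric])
      then show ?thesis using cN[of n] by blast
    qed
    also have "\<dots> \<in> W2" using j(2) W(4) cW cN by auto
    finally show False using n(2) W(5) by blast
  qed
  have est: "\<exists>d>0. \<forall>t. 0 \<le> t \<longrightarrow> t < d \<longrightarrow> f t \<in> U0 \<and> norm (\<phi> (f t) - e0 - t *\<^sub>R v) \<le> e * (t * norm v)"
    if e: "0 < e" "e \<le> 1" for e
  proof -
    obtain r where r: "r > 0" "cball e0 r \<subseteq> \<phi> ` U0"
      "\<And>x y. norm (x - e0) \<le> r \<Longrightarrow> norm (y - e0) \<le> r \<Longrightarrow> \<psi> x \<otimes> \<psi> y \<in> U0 \<and>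
       norm (\<phi> (\<psi> x \<otimes> \<psi> y) - x - (y - e0)) \<le> e * norm (y - e0)"
      using mult_estimate[OF e(1)] by metis
    \<comment> \<open>For \<open>t < d\<close> this gives \<open>t * norm v \<le> r / 4\<close>,
      which leaves room inside the ball of radius \<open>r\<close> for the two error terms; the
      added 1 avoids division by zero.\<close>
    define d where "d = r / (4 * (norm v + 1))"
    have nv: "norm v + 1 > 0" by (simp add: add_nonneg_pos)
    have d: "d > 0" "d * norm v \<le> r / 4"
    proof -
      show "d > 0" using r(1) nv by (simp add: d_def)
      have "d * norm v \<le> d * (norm v + 1)" using \<open>d > 0\<close> by (intro mult_left_mono) auto
      also have "\<dots> = r / 4"
      proof -
        have "r / (4 * q) * q = r / 4" if "q > 0" for q :: real using that by simp
        then show ?thesis using nv d_def by blast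
      qed
      finally show "d * norm v \<le> r / 4" .
    qed
    have "f t \<in> U0 \<and> norm (\<phi> (f t) - e0 - t *\<^sub>R v) \<le> e * (t * norm v)" if t: "0 \<le> t" "t < d" for t
    proof -
      have tv: "t * norm v \<le> r / 4" using t d(2) mult_right_mono[of t d "norm v"] by simp
      have etv: "e * (t * norm v) \<le> t * norm v" using e t mult_right_mono[of e 1 "t * norm v"] by simp
      have sub: "cball (e0 + t *\<^sub>R v) (e * (t * norm v) + \<delta>) \<subseteq> \<phi> ` U0" if "\<delta> \<le> r / 4" for \<delta>
      proof
        fix z assume "z \<in> cball (e0 + t *\<^sub>R v) (e * (t * norm v) + \<delta>)"
        then have "norm (z - (e0 + t *\<^sub>R v)) \<le> e * (t * norm v) + \<delta>"
          by (simp add: dist_norm norm_minus_commute)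
        moreover have "norm (z - e0) \<le> norm (z - (e0 + t *\<^sub>R v)) + norm (t *\<^sub>R v)"
          using norm_triangle_ineq[of "z - (e0 + t *\<^sub>R v)" "t *\<^sub>R v"] by (simp add: algebra_simps)
        ultimately have "norm (z - e0) \<le> r" using tv etv that t r(1) by simp
        then have "z \<in> cball e0 r" by (simp add: dist_norm norm_minus_commute)
        then show "z \<in> \<phi> ` U0" using r(2) by blast
      qed
      \<comment> \<open>The closed ball has a compact, hence closed, image in the group. If
        \<open>f t\<close> lay outside, so would \<open>F n t\<close> for some late
        \<open>n\<close>. The slack \<open>\<delta>\<close> absorbs the rounding of \<open>t\<close>
        to a multiple of \<open>1 / N n\<close>.\<close>
      have step: "f t \<in> \<psi> ` cball (e0 + t *\<^sub>R v) (e * (t * norm v) + \<delta>)" if \<delta>: "0 < \<delta>" "\<delta> \<le> r / 4" for \<delta>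
      proof (rule ccontr)
        let ?B = "cball (e0 + t *\<^sub>R v) (e * (t * norm v) + \<delta>)"
        assume nin: "f t \<notin> \<psi> ` ?B"
        have "?B \<subseteq> \<phi> ` U0" by (rule sub[OF \<delta>(2)])
        then have "compactin (top_of_set (\<phi> ` U0)) ?B" by (simp add: compactin_subtopology)
        then have "compactin (topol G) (\<psi> ` ?B)"
          by (rule image_compactin[OF _ continuous_map_inv_chart[OF base_chart_is_chart]])
        then have "closedin (topol G) (\<psi> ` ?B)" by (rule compactin_imp_closedin[OF hausdorff])
        then have o: "openin (topol G) (topspace (topol G) - \<psi> ` ?B)" by (rule openin_diff[OF openin_topspace])
        have o2: "openin ?X {g \<in> topspace ?X. g t \<in> topspace (topol G) - \<psi> ` ?B}"
          by (rule openin_continuous_map_preimage[OF proj[OF t(1)] o])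
        have "norm v / \<delta> \<ge> 0" using \<delta> by simp
        then obtain M :: nat where M: "norm v / \<delta> < real M" using reals_Archimedean2 by blast
        obtain n where n: "n \<ge> M" "F n t \<notin> \<psi> ` ?B"
          using f(2)[OF o2, of M] f(1) fc[OF t(1)] nin topspace_carrier by blast
        have Nn: "norm v / N n \<le> \<delta>"
        proof -
          have "norm v / \<delta> < N n" using M n(1) N(2)[of n] by simp
          then show ?thesis using \<delta>(1) N(1)[of n] by (simp add: field_simps)
        qed
        note kk = k[OF t(1), of n]
        have m: "real (k n t) * (1 / N n) * norm v \<le> t * norm v"
          using mult_right_mono[OF kk(1), of "norm v"] by simp
        have pe: "F n t \<in> U0"
          "norm (\<phi> (F n t) - e0 - (real (k n t) * (1 / N n)) *\<^sub>R v) \<le> e * (real (k n t) * (1 / N n) * norm v)"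
          using power_estimate[OF r(1,2,3) e, of "1 / N n" "k n t" v] m tv r(1) N(1)[of n]
          by (simp_all add: Ft[OF t(1)] c_def)
        have "norm (\<phi> (F n t) - (e0 + t *\<^sub>R v)) \<le>
            norm (\<phi> (F n t) - e0 - (real (k n t) * (1 / N n)) *\<^sub>R v) + norm ((real (k n t) * (1 / N n) - t) *\<^sub>R v)"
          using norm_triangle_ineq[of "\<phi> (F n t) - e0 - (real (k n t) * (1 / N n)) *\<^sub>R v" "(real (k n t) * (1 / N n) - t) *\<^sub>R v"]
          by (simp add: algebra_simps)
        also have "norm ((real (k n t) * (1 / N n) - t) *\<^sub>R v) \<le> (1 / N n) * norm v"
          unfolding norm_scaleR using kk by (intro mult_right_mono) (auto simp: abs_le_iff)
        also have "\<dots> \<le> \<delta>" using Nn by simp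
        also have "norm (\<phi> (F n t) - e0 - (real (k n t) * (1 / N n)) *\<^sub>R v) \<le> e * (t * norm v)"
          using pe(2) mult_left_mono[OF m, of e] e(1) by linarith
        finally have "\<phi> (F n t) \<in> ?B" by (simp add: dist_norm norm_minus_commute)
        then have "\<psi> (\<phi> (F n t)) \<in> \<psi> ` ?B" by blast
        then show False using n(2) inv_chart_left[OF base_chart_is_chart pe(1)] by simp
      qed
      have both: "f t \<in> U0 \<and> norm (\<phi> (f t) - e0 - t *\<^sub>R v) \<le> e * (t * norm v) + \<delta>"
        if \<delta>: "0 < \<delta>" "\<delta> \<le> r / 4" for \<delta>
      proof -
        obtain z where z: "z \<in> cball (e0 + t *\<^sub>R v) (e * (t * norm v) + \<delta>)" "f t = \<psi> z"
          using step[OF \<delta>] by blast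
        then have zz: "z \<in> \<phi> ` U0" using sub[OF \<delta>(2)] by blast
        show ?thesis
          using z inv_chart_in[OF zz] inv_chart_right[OF zz]
          by (simp add: dist_norm norm_minus_commute algebra_simps)
      qed
      have "norm (\<phi> (f t) - e0 - t *\<^sub>R v) \<le> e * (t * norm v)"
      proof (rule field_le_epsilon)
        fix \<delta> :: real assume "\<delta> > 0"
        then have m: "0 < min \<delta> (r / 4)" "min \<delta> (r / 4) \<le> r / 4" "min \<delta> (r / 4) \<le> \<delta>" using r(1) by auto
        then show "norm (\<phi> (f t) - e0 - t *\<^sub>R v) \<le> e * (t * norm v) + \<delta>"
          using both[OF m(1,2)] by linarith
      qed
      then show ?thesis using both[of "r / 4"] r(1) by simp
    qed
    then show ?thesis using d(1) by blast
  qed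
  show thesis using that[of f] fc mult est by blast
qed

lemma inv_chart_small:
  assumes "r > 0"
  obtains \<rho> where "\<rho> > 0" "\<And>a. a \<in> U0 \<Longrightarrow> norm (\<phi> a - e0) < \<rho> \<Longrightarrow> inv a \<in> U0 \<and> norm (\<phi> (inv a) - e0) < r"
proof -
  have g: "gsmooth_at e0 (\<lambda>x. inv (\<psi> x))" by (rule gsmooth_at_inv[OF gsmooth_at_psi])
  have "inv (\<psi> e0) \<in> U0" by (simp add: psi_e0 base_chart_one)
  then obtain U where U: "open U" "e0 \<in> U" "\<forall>y\<in>U. inv (\<psi> y) \<in> U0" "smooth_on U (\<lambda>y. \<phi> (inv (\<psi> y)))"
    by (rule gsmooth_in_chart[OF g base_chart_atlas])
  have "open (U \<inter> (\<lambda>y. \<phi> (inv (\<psi> y))) -` ball e0 r)"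
    using continuous_open_preimage[OF smooth_on_continuous[OF U(4)] U(1) open_ball] .
  moreover have "e0 \<in> U \<inter> (\<lambda>y. \<phi> (inv (\<psi> y))) -` ball e0 r" using U(2) assms by (simp add: psi_e0)
  ultimately obtain \<rho> where \<rho>: "\<rho> > 0" "ball e0 \<rho> \<subseteq> U \<inter> (\<lambda>y. \<phi> (inv (\<psi> y))) -` ball e0 r"
    by (rule openE)
  show thesis
  proof (rule that[OF \<rho>(1)])
    fix a assume a: "a \<in> U0" "norm (\<phi> a - e0) < \<rho>"
    then have "\<phi> a \<in> U \<inter> (\<lambda>y. \<phi> (inv (\<psi> y))) -` ball e0 r"
      using \<rho>(2) by (auto simp: dist_norm norm_minus_commute)
    then show "inv a \<in> U0 \<and> norm (\<phi> (inv a) - e0) < r"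
      using U(3) inv_chart_left[OF base_chart_is_chart a(1)] by (auto simp: dist_norm norm_minus_commute)
  qed
qed

text \<open>The semigroup is extended to negative times by inverses, and the commutativity of its
  values makes the extension a homomorphism. The estimate at 0 yields the derivative, and
  translation spreads continuity from 0 to all times.\<close>

lemma one_parameter_subgroup_exists:
  assumes comp: "compact_space (topol G)"
  obtains \<gamma> where "one_parameter_subgroup G \<gamma> v" "tang \<gamma> v"
proof -
  obtain f :: "real \<Rightarrow> 'g" where f: "\<And>t. t \<ge> 0 \<Longrightarrow> f t \<in> carrier G"
    "\<And>s t. s \<ge> 0 \<Longrightarrow> t \<ge> 0 \<Longrightarrow> f (s + t) = f s \<otimes> f t"
    "\<And>e. 0 < e \<Longrightarrow> e \<le> 1 \<Longrightarrow> \<exists>d>0. \<forall>t. 0 \<le> t \<longrightarrow> t < d \<longrightarrow>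
       f t \<in> U0 \<and> norm (\<phi> (f t) - e0 - t *\<^sub>R v) \<le> e * (t * norm v)"
    using one_parameter_semigroup[OF comp] by metis
  define \<gamma> where "\<gamma> = (\<lambda>t. if t \<ge> 0 then f t else inv (f (- t)))"
  have f0: "f 0 = \<one>" using f(2)[of 0 0] f(1)[of 0] by (metis add.right_neutral order_refl r_cancel_one')
  have \<gamma>c: "\<gamma> t \<in> carrier G" for t unfolding \<gamma>_def using f(1) by auto
  have \<gamma>0: "\<gamma> 0 = \<one>" by (simp add: \<gamma>_def f0)
  have comm: "f s \<otimes> f t = f t \<otimes> f s" if "s \<ge> 0" "t \<ge> 0" for s t
    using f(2)[of s t] f(2)[of t s] that by (simp add: add.commute)
  have diff: "\<gamma> (s - t) = f s \<otimes> inv (f t)" if st: "s \<ge> 0" "t \<ge> 0" for s t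
  proof (cases "s \<ge> t")
    case True
    have "f s = f (s - t) \<otimes> f t" using f(2)[of "s - t" t] st True by simp
    then show ?thesis using True st f(1) by (simp add: \<gamma>_def m_assoc)
  next
    case False
    have e: "f t = f (t - s) \<otimes> f s" using f(2)[of "t - s" s] st False by simp
    have "inv (f t) = inv (f s) \<otimes> inv (f (t - s))" unfolding e using f(1) st False by (simp add: inv_mult_group)
    then have "f s \<otimes> inv (f t) = inv (f (t - s))" using f(1) st False by (simp add: m_assoc[symmetric])
    then show ?thesis using False by (simp add: \<gamma>_def)
  qed
  have hom: "\<gamma> (s + t) = \<gamma> s \<otimes> \<gamma> t" for s t
  proof -
    \<comment> \<open>Positive and negative parts reduce all sign cases to the single formula
      \<open>diff\<close>.\<close>
    define s1 s2 t1 t2 where "s1 = max s 0" and "s2 = max (-s) 0" and "t1 = max t 0" and "t2 = max (-t) 0"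
    have nn: "s1 \<ge> 0" "s2 \<ge> 0" "t1 \<ge> 0" "t2 \<ge> 0" by (auto simp: s1_def s2_def t1_def t2_def)
    have e: "s = s1 - s2" "t = t1 - t2" "s + t = (s1 + t1) - (s2 + t2)"
      by (auto simp: s1_def s2_def t1_def t2_def)
    note c = f(1)[OF nn(1)] f(1)[OF nn(2)] f(1)[OF nn(3)] f(1)[OF nn(4)]
    have cm: "f t1 \<otimes> inv (f s2) = inv (f s2) \<otimes> f t1"
    proof -
      have "f s2 \<otimes> (f t1 \<otimes> inv (f s2)) = f t1"
        using comm[OF nn(2,3)] c by (simp add: m_assoc[symmetric]) (simp add: m_assoc)
      then show ?thesis using c by (metis inv_solve_left m_closed inv_closed)
    qed
    have "\<gamma> (s + t) = (f s1 \<otimes> f t1) \<otimes> inv (f t2 \<otimes> f s2)"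
      unfolding e(3) using nn diff[of "s1 + t1" "s2 + t2"] f(2) comm by simp
    also have "\<dots> = f s1 \<otimes> (f t1 \<otimes> inv (f s2)) \<otimes> inv (f t2)"
      using c by (simp add: inv_mult_group m_assoc)
    also have "\<dots> = (f s1 \<otimes> inv (f s2)) \<otimes> (f t1 \<otimes> inv (f t2))"
      unfolding cm using c by (simp add: m_assoc)
    also have "\<dots> = \<gamma> s \<otimes> \<gamma> t" unfolding e(1,2) using nn diff by simp
    finally show ?thesis .
  qed
  \<comment> \<open>For a negative time, \<open>mult_estimate\<close> is applied to the product of
    \<open>inv (f u)\<close> and \<open>f u\<close>, which is the identity. Its error
    \<open>2 * e * (u * norm v)\<close> and the error \<open>e * (u * norm v)\<close> of
    \<open>f u\<close> add up to the factor 3.\<close>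
  have est: "\<exists>d>0. \<forall>t. \<bar>t\<bar> < d \<longrightarrow> \<gamma> t \<in> U0 \<and> norm (\<phi> (\<gamma> t) - e0 - t *\<^sub>R v) \<le> 3 * e * (\<bar>t\<bar> * norm v)"
    if e: "0 < e" "e \<le> 1" for e
  proof -
    obtain d1 where d1: "d1 > 0" "\<And>t. 0 \<le> t \<Longrightarrow> t < d1 \<Longrightarrow>
       f t \<in> U0 \<and> norm (\<phi> (f t) - e0 - t *\<^sub>R v) \<le> e * (t * norm v)" using f(3)[OF e] by blast
    obtain r where r: "r > 0"
      "\<And>x y. norm (x - e0) \<le> r \<Longrightarrow> norm (y - e0) \<le> r \<Longrightarrow> \<psi> x \<otimes> \<psi> y \<in> U0 \<and>
       norm (\<phi> (\<psi> x \<otimes> \<psi> y) - x - (y - e0)) \<le> e * norm (y - e0)"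
      using mult_estimate[OF e(1)] by metis
    obtain \<rho> where \<rho>: "\<rho> > 0" "\<And>a. a \<in> U0 \<Longrightarrow> norm (\<phi> a - e0) < \<rho> \<Longrightarrow> inv a \<in> U0 \<and> norm (\<phi> (inv a) - e0) < r"
      using inv_chart_small[OF r(1)] by metis
    define d where "d = min d1 (min r \<rho> / (2 * (norm v + 1)))"
    have nv: "norm v + 1 > 0" by (simp add: add_nonneg_pos)
    have d: "d > 0" using d1 r \<rho> nv by (simp add: d_def)
    have "\<gamma> t \<in> U0 \<and> norm (\<phi> (\<gamma> t) - e0 - t *\<^sub>R v) \<le> 3 * e * (\<bar>t\<bar> * norm v)" if t: "\<bar>t\<bar> < d" for t
    proof (cases "t \<ge> 0")
      case True
      then have "f t \<in> U0" "norm (\<phi> (f t) - e0 - t *\<^sub>R v) \<le> e * (t * norm v)" using d1(2)[of t] t d_def by auto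
      moreover have "e * (t * norm v) \<ge> 0" using e True by simp
      ultimately show ?thesis using True by (simp add: \<gamma>_def)
    next
      case False
      define u where "u = - t"
      have u: "u > 0" "u < d" using False t by (auto simp: u_def)
      have fu: "f u \<in> U0" "norm (\<phi> (f u) - e0 - u *\<^sub>R v) \<le> e * (u * norm v)" using d1(2)[of u] u d_def by auto
      have nuv: "norm (u *\<^sub>R v) = u * norm v" using u by simp
      have euv: "e * (u * norm v) \<le> u * norm v" using e u mult_right_mono[of e 1 "u * norm v"] by simp
      have "norm (\<phi> (f u) - e0) \<le> norm (\<phi> (f u) - e0 - u *\<^sub>R v) + norm (u *\<^sub>R v)"
        by (metis diff_add_cancel norm_triangle_ineq)
      then have n1: "norm (\<phi> (f u) - e0) \<le> 2 * (u * norm v)" using fu(2) nuv euv by linarith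
      have "2 * (u * norm v) < min r \<rho>"
      proof -
        have "u * (2 * (norm v + 1)) < min r \<rho>"
          using u(2) nv unfolding d_def by (simp add: pos_less_divide_eq)
        moreover have "2 * (u * norm v) \<le> u * (2 * (norm v + 1))" using u by (simp add: algebra_simps)
        ultimately show ?thesis by linarith
      qed
      then have n2: "norm (\<phi> (f u) - e0) < \<rho>" "norm (\<phi> (f u) - e0) \<le> r" using n1 by auto
      note iv = \<rho>(2)[OF fu(1) n2(1)]
      have fuc: "f u \<in> carrier G" using f(1) u by simp
      have "\<psi> (\<phi> (inv (f u))) \<otimes> \<psi> (\<phi> (f u)) = \<one>"
        using iv fu(1) fuc inv_chart_left[OF base_chart_is_chart] by simp
      then have "norm (e0 - \<phi> (inv (f u)) - (\<phi> (f u) - e0)) \<le> e * norm (\<phi> (f u) - e0)"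
        using r(2)[of "\<phi> (inv (f u))" "\<phi> (f u)"] iv n2(2) by simp
      also have "\<dots> \<le> e * (2 * (u * norm v))" using n1 e(1) by (intro mult_left_mono) auto
      finally have A: "norm (e0 - \<phi> (inv (f u)) - (\<phi> (f u) - e0)) \<le> e * (2 * (u * norm v))" .
      have "norm (\<phi> (inv (f u)) - e0 + u *\<^sub>R v) =
          norm ((e0 - \<phi> (inv (f u)) - (\<phi> (f u) - e0)) + (\<phi> (f u) - e0 - u *\<^sub>R v))"
        by (subst norm_minus_cancel[symmetric]) (simp add: algebra_simps)
      also have "\<dots> \<le> e * (2 * (u * norm v)) + e * (u * norm v)"
        using A fu(2) norm_triangle_mono by blast
      finally have "norm (\<phi> (inv (f u)) - e0 + u *\<^sub>R v) \<le> 3 * e * (u * norm v)" by (simp add: algebra_simps)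
      moreover have "\<gamma> t = inv (f u)" "\<bar>t\<bar> = u" "t *\<^sub>R v = - (u *\<^sub>R v)" using False by (auto simp: \<gamma>_def u_def)
      ultimately show ?thesis using iv by simp
    qed
    then show ?thesis using d by blast
  qed
  have evU: "\<forall>\<^sub>F s in nhds 0. \<gamma> s \<in> U0"
  proof -
    obtain d where d: "d > 0" "\<forall>t. \<bar>t\<bar> < d \<longrightarrow> \<gamma> t \<in> U0" using est[of 1] by auto
    show ?thesis unfolding eventually_nhds
      by (rule exI[of _ "ball 0 d"]) (use d in \<open>auto simp: dist_real_def\<close>)
  qed
  have der: "((\<lambda>s. \<phi> (\<gamma> s)) has_vector_derivative v) (at 0)"
    unfolding has_vector_derivative_def has_derivative_at_alt
  proof (intro conjI allI impI)
    show "bounded_linear (\<lambda>x. x *\<^sub>R v)" by (rule bounded_linear_scaleR_left)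
    fix e :: real assume e: "e > 0"
    define e' where "e' = min 1 (e / (3 * (norm v + 1)))"
    have nv: "norm v + 1 > 0" by (simp add: add_nonneg_pos)
    have e': "0 < e'" "e' \<le> 1" using e nv by (auto simp: e'_def)
    have le: "3 * e' * norm v \<le> e"
    proof -
      have "e' * (3 * (norm v + 1)) \<le> e" using nv unfolding e'_def
        by (metis min.cobounded2 mult_pos_pos pos_le_divide_eq zero_less_numeral)
      moreover have "3 * e' * norm v \<le> e' * (3 * (norm v + 1))" using e'(1) by (simp add: algebra_simps)
      ultimately show ?thesis by linarith
    qed
    obtain d where d: "d > 0" "\<And>t. \<bar>t\<bar> < d \<Longrightarrow> norm (\<phi> (\<gamma> t) - e0 - t *\<^sub>R v) \<le> 3 * e' * (\<bar>t\<bar> * norm v)"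
      using est[OF e'] by blast
    have "norm (\<phi> (\<gamma> y) - \<phi> (\<gamma> 0) - (y - 0) *\<^sub>R v) \<le> e * norm (y - 0)" if "norm (y - 0) < d" for y
    proof -
      have "norm (\<phi> (\<gamma> y) - e0 - y *\<^sub>R v) \<le> (3 * e' * norm v) * \<bar>y\<bar>" using d(2)[of y] that by (simp add: algebra_simps)
      also have "\<dots> \<le> e * \<bar>y\<bar>" using le by (intro mult_right_mono) auto
      finally show ?thesis by (simp add: \<gamma>0)
    qed
    then show "\<exists>d>0. \<forall>y. norm (y - 0) < d \<longrightarrow> norm (\<phi> (\<gamma> y) - \<phi> (\<gamma> 0) - (y - 0) *\<^sub>R v) \<le> e * norm (y - 0)"
      using d(1) by blast
  qed
  have tang: "tang \<gamma> v" unfolding tang_def using \<gamma>0 evU der by blast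
  have cont: "continuous_map euclideanreal (topol G) \<gamma>"
    unfolding continuous_map_def
  proof (intro conjI allI impI)
    show "\<gamma> \<in> topspace euclideanreal \<rightarrow> topspace (topol G)" using \<gamma>c topspace_carrier by auto
    fix W assume W: "openin (topol G) W"
    have "open {x. \<gamma> x \<in> W}"
    proof (subst open_subopen, intro ballI)
      fix t assume t: "t \<in> {x. \<gamma> x \<in> W}"
      let ?W = "{y \<in> carrier G. \<gamma> t \<otimes> y \<in> W}"
      have "openin (topol G) ?W" "\<one> \<in> ?W" using openin_left_mult[OF \<gamma>c W] t \<gamma>c by auto
      then have "\<forall>\<^sub>F s in nhds 0. \<gamma> s \<in> ?W" by (rule eventually_in_open[OF tang])
      then obtain S where S: "open S" "0 \<in> S" "\<forall>s\<in>S. \<gamma> s \<in> ?W" unfolding eventually_nhds by blast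
      have "open ((\<lambda>s. s - t) -` S)" by (intro open_vimage S(1) continuous_intros)
      moreover have "t \<in> (\<lambda>s. s - t) -` S" using S(2) by simp
      moreover have "(\<lambda>s. s - t) -` S \<subseteq> {x. \<gamma> x \<in> W}"
      proof
        fix s assume "s \<in> (\<lambda>s. s - t) -` S"
        then have "\<gamma> t \<otimes> \<gamma> (s - t) \<in> W" using S(3) by auto
        then show "s \<in> {x. \<gamma> x \<in> W}" using hom[of t "s - t"] by simp
      qed
      ultimately show "\<exists>T. open T \<and> t \<in> T \<and> T \<subseteq> {x. \<gamma> x \<in> W}" by blast
    qed
    then show "openin euclideanreal {x \<in> topspace euclideanreal. \<gamma> x \<in> W}" by simp
  qed
  have "one_parameter_subgroup G \<gamma> v"
    unfolding one_parameter_subgroup_def using cont hom der by (simp add: o_def)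
  then show thesis using that tang by blast
qed

text \<open>A one-parameter subgroup with velocity \<open>v\<close> is commutative, so
  \<open>Ad\<close> along it fixes \<open>v\<close>; differentiation gives the claim.\<close>

lemma bracket_self:
  assumes "compact_space (topol G)" shows "bracket G v v = 0"
proof -
  obtain \<gamma> where \<gamma>: "one_parameter_subgroup G \<gamma> v" "tang \<gamma> v"
    using one_parameter_subgroup_exists[OF assms] .
  have c: "\<gamma> t \<in> carrier G" for t
    using \<gamma>(1) topspace_carrier unfolding one_parameter_subgroup_def continuous_map_def by auto
  have hom: "\<gamma> (s + t) = \<gamma> s \<otimes> \<gamma> t" for s t using \<gamma>(1) unfolding one_parameter_subgroup_def by blast
  have "Ad G (\<gamma> t) v = v" for t
  proof -
    have "\<gamma> t \<otimes> \<gamma> s \<otimes> inv (\<gamma> t) = \<gamma> s" for s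
    proof -
      have "\<gamma> t \<otimes> \<gamma> s = \<gamma> s \<otimes> \<gamma> t" using hom[of t s] hom[of s t] by (simp add: add.commute)
      then show ?thesis using c by (simp add: m_assoc)
    qed
    then have "tang \<gamma> (Ad G (\<gamma> t) v)" using tang_conj[OF c \<gamma>(2), of t] by simp
    then show ?thesis using \<gamma>(2) tang_unique by blast
  qed
  then have "((\<lambda>s. v) has_vector_derivative bracket G v v) (at 0)" using bracket_tang[OF \<gamma>(2), of v] by simp
  then show ?thesis using vector_derivative_unique_at has_vector_derivative_const by blast
qed

lemma bracket_skew:
  assumes "compact_space (topol G)" shows "bracket G v w = - bracket G w v"
proof -
  have "bracket G (v + w) (v + w) = bracket G v v + bracket G w v + (bracket G v w + bracket G w w)"
    by (simp add: linear_add[OF bracket_linear_left] linear_add[OF bracket_linear_right])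
  then have "bracket G v w + bracket G w v = 0"
    by (simp add: bracket_self[OF assms] add.commute)
  then show ?thesis by (simp add: eq_neg_iff_add_eq_0)
qed

end

section \<open>Inner products on subspaces\<close>

definition bilin_on :: "'a::real_vector set \<Rightarrow> ('a \<Rightarrow> 'a \<Rightarrow> real) \<Rightarrow> bool" where
  "bilin_on V b \<longleftrightarrow> (\<forall>x\<in>V. \<forall>y\<in>V. \<forall>z\<in>V. b (x + y) z = b x z + b y z \<and> b z (x + y) = b z x + b z y) \<and>
     (\<forall>r. \<forall>x\<in>V. \<forall>y\<in>V. b (r *\<^sub>R x) y = r * b x y \<and> b x (r *\<^sub>R y) = r * b x y)"

definition lin_on :: "'a::real_vector set \<Rightarrow> ('a \<Rightarrow> 'b::real_vector) \<Rightarrow> bool" where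
  "lin_on V f \<longleftrightarrow> (\<forall>x\<in>V. \<forall>y\<in>V. f (x + y) = f x + f y) \<and> (\<forall>r. \<forall>x\<in>V. f (r *\<^sub>R x) = r *\<^sub>R f x)"

lemma lin_on_sum:
  assumes "subspace V" "lin_on V f" "\<And>i. i \<in> I \<Longrightarrow> x i \<in> V"
  shows "f (\<Sum>i\<in>I. c i *\<^sub>R x i) = (\<Sum>i\<in>I. c i *\<^sub>R f (x i))"
  using assms(3)
proof (induction I rule: infinite_finite_induct)
  case (insert i I)
  have "(\<Sum>i\<in>I. c i *\<^sub>R x i) \<in> V"
    using insert.prems by (intro subspace_sum assms(1) subspace_scale) auto
  then show ?case
    using insert assms(2) subspace_scale[OF assms(1)] unfolding lin_on_def by simp
next
  case (infinite I)
  have "f (0 *\<^sub>R 0) = 0 *\<^sub>R f 0" using assms(2) subspace_0[OF assms(1)] unfolding lin_on_def by blast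
  then show ?case using infinite by simp
next
  case empty
  have "f (0 *\<^sub>R 0) = 0 *\<^sub>R f 0" using assms(2) subspace_0[OF assms(1)] unfolding lin_on_def by blast
  then show ?case by simp
qed

lemma linear_imp_lin_on: "linear f \<Longrightarrow> lin_on V f"
  unfolding lin_on_def by (simp add: linear_add linear_scale)

lemma bilin_on_left: "bilin_on V b \<Longrightarrow> y \<in> V \<Longrightarrow> lin_on V (\<lambda>x. b x y)"
  unfolding bilin_on_def lin_on_def by simp

lemma bilin_on_right: "bilin_on V b \<Longrightarrow> y \<in> V \<Longrightarrow> lin_on V (\<lambda>x. b y x)"
  unfolding bilin_on_def lin_on_def by simp

lemma bilin_onI:
  assumes "\<And>y. y \<in> V \<Longrightarrow> lin_on V (\<lambda>x. b x y)" "\<And>y. y \<in> V \<Longrightarrow> lin_on V (\<lambda>x. b y x)"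
  shows "bilin_on V b"
  using assms unfolding bilin_on_def lin_on_def by simp

lemma sym_bilinear_imp_bilin:
  assumes "sym_bilinear_on V b" "subspace V" shows "bilin_on V b"
proof -
  have s: "b x y = b y x" if "x \<in> V" "y \<in> V" for x y using assms(1) that unfolding sym_bilinear_on_def by blast
  have l: "lin_on V (\<lambda>x. b x y)" if "y \<in> V" for y
    using assms(1) that unfolding lin_on_def sym_bilinear_on_def by simp
  have "lin_on V (\<lambda>x. b y x)" if "y \<in> V" for y
    using l[OF that] s[OF that] subspace_add[OF assms(2)] subspace_scale[OF assms(2)]
    unfolding lin_on_def by simp
  then show ?thesis using l by (rule bilin_onI[rotated])
qed

lemma bilin_on_subset: "bilin_on V b \<Longrightarrow> W \<subseteq> V \<Longrightarrow> bilin_on W b"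
  unfolding bilin_on_def by (meson subset_eq)

lemma sym_bilinear_on_subset: "sym_bilinear_on V b \<Longrightarrow> W \<subseteq> V \<Longrightarrow> sym_bilinear_on W b"
  unfolding sym_bilinear_on_def by (meson subset_eq)

lemma inner_product_on_subset: "inner_product_on V b \<Longrightarrow> W \<subseteq> V \<Longrightarrow> inner_product_on W b"
  unfolding inner_product_on_def pos_def_on_def using sym_bilinear_on_subset by blast

lemma lin_on_compose_bilin:
  assumes "bilin_on W b" "lin_on V f" "lin_on V g" "\<And>x. x \<in> V \<Longrightarrow> f x \<in> W" "\<And>x. x \<in> V \<Longrightarrow> g x \<in> W"
    "subspace V"
  shows "bilin_on V (\<lambda>x y. b (f x) (g y))"
  using assms unfolding bilin_on_def lin_on_def by simp

lemma bilin_on_sum: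
  assumes "\<And>i. i \<in> I \<Longrightarrow> bilin_on V (b i)" shows "bilin_on V (\<lambda>x y. \<Sum>i\<in>I. b i x y)"
  using assms unfolding bilin_on_def
  by (simp add: sum.distrib sum_distrib_left)

lemma bilin_on_uminus: "bilin_on V b \<Longrightarrow> bilin_on V (\<lambda>x y. - b x y)"
  unfolding bilin_on_def by simp

locale ip_space =
  fixes V :: "'a::euclidean_space set" and h :: "'a \<Rightarrow> 'a \<Rightarrow> real"
  assumes sub: "subspace V" and ip: "inner_product_on V h"
begin

lemma bil: "bilin_on V h"
  using ip sub sym_bilinear_imp_bilin unfolding inner_product_on_def by blast

lemma symm: "x \<in> V \<Longrightarrow> y \<in> V \<Longrightarrow> h x y = h y x"
  using ip unfolding inner_product_on_def sym_bilinear_on_def by blast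

lemma pos: "x \<in> V \<Longrightarrow> x \<noteq> 0 \<Longrightarrow> h x x > 0"
  using ip unfolding inner_product_on_def pos_def_on_def by blast

lemma add_left: "x \<in> V \<Longrightarrow> y \<in> V \<Longrightarrow> z \<in> V \<Longrightarrow> h (x + y) z = h x z + h y z"
  using bil unfolding bilin_on_def by blast

lemma add_right: "x \<in> V \<Longrightarrow> y \<in> V \<Longrightarrow> z \<in> V \<Longrightarrow> h z (x + y) = h z x + h z y"
  using bil unfolding bilin_on_def by blast

lemma scale_left: "x \<in> V \<Longrightarrow> y \<in> V \<Longrightarrow> h (r *\<^sub>R x) y = r * h x y"
  using bil unfolding bilin_on_def by blast

lemma scale_right: "x \<in> V \<Longrightarrow> y \<in> V \<Longrightarrow> h x (r *\<^sub>R y) = r * h x y"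
  using bil unfolding bilin_on_def by blast

lemma diff_left: "x \<in> V \<Longrightarrow> y \<in> V \<Longrightarrow> z \<in> V \<Longrightarrow> h (x - y) z = h x z - h y z"
  using add_left[of x "-1 *\<^sub>R y" z] scale_left[of y z "-1"] subspace_scale[OF sub, of y "-1"] by simp

lemma zero_left: "y \<in> V \<Longrightarrow> h 0 y = 0"
  using scale_left[of 0 y 0] subspace_0[OF sub] by simp

lemma sum_left:
  assumes "\<And>i. i \<in> I \<Longrightarrow> x i \<in> V" "y \<in> V"
  shows "h (\<Sum>i\<in>I. c i *\<^sub>R x i) y = (\<Sum>i\<in>I. c i * h (x i) y)"
  using lin_on_sum[OF sub bilin_on_left[OF bil assms(2)], of I x c] assms(1) by simp

lemma sum_right:
  assumes "\<And>i. i \<in> I \<Longrightarrow> x i \<in> V" "y \<in> V"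
  shows "h y (\<Sum>i\<in>I. c i *\<^sub>R x i) = (\<Sum>i\<in>I. c i * h y (x i))"
  using lin_on_sum[OF sub bilin_on_right[OF bil assms(2)], of I x c] assms(1) by simp

lemma nonneg: "x \<in> V \<Longrightarrow> h x x \<ge> 0"
  using pos zero_left by (metis less_eq_real_def order_refl)

definition orthonormal :: "'a set \<Rightarrow> bool" where
  "orthonormal E \<longleftrightarrow> E \<subseteq> V \<and> (\<forall>x\<in>E. \<forall>y\<in>E. h x y = (if x = y then 1 else 0))"

lemma orthonormal_independent:
  assumes "orthonormal E" shows "independent E"
proof (rule ccontr)
  assume "\<not> independent E"
  then obtain S u w where S: "finite S" "S \<subseteq> E" "(\<Sum>v\<in>S. u v *\<^sub>R v) = 0" "w \<in> S" "u w \<noteq> 0"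
    unfolding dependent_explicit by blast
  have SV: "v \<in> V" if "v \<in> S" for v using assms S(2) that unfolding orthonormal_def by blast
  have "0 = h (\<Sum>v\<in>S. u v *\<^sub>R v) w" using S(3) zero_left SV[OF S(4)] by simp
  also have "\<dots> = (\<Sum>v\<in>S. u v * h v w)" by (rule sum_left) (use SV S(4) in auto)
  also have "\<dots> = (\<Sum>v\<in>S. if v = w then u v else 0)"
  proof (intro sum.cong refl)
    fix v assume "v \<in> S"
    then have "h v w = (if v = w then 1 else 0)" using assms S(2,4) unfolding orthonormal_def by blast
    then show "u v * h v w = (if v = w then u v else 0)" by simp
  qed
  also have "\<dots> = u w" using S(1,4) by simp
  finally show False using S(5) by simp
qed

lemma onb_orthonormal: "orthonormal_basis h V E \<Longrightarrow> orthonormal E"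
  unfolding orthonormal_basis_def orthonormal_def by blast

lemma onb_finite: "orthonormal_basis h V E \<Longrightarrow> finite E"
  using onb_orthonormal orthonormal_independent independent_imp_finite by blast

lemma onb_card: "orthonormal_basis h V E \<Longrightarrow> card E = dim V"
  using onb_orthonormal orthonormal_independent unfolding orthonormal_basis_def
  by (metis dim_span dim_eq_card_independent)

lemma onb_in: "orthonormal_basis h V E \<Longrightarrow> e \<in> E \<Longrightarrow> e \<in> V"
  unfolding orthonormal_basis_def by blast

lemma onb_eq: "orthonormal_basis h V E \<Longrightarrow> e \<in> E \<Longrightarrow> f \<in> E \<Longrightarrow> h e f = (if e = f then 1 else 0)"
  unfolding orthonormal_basis_def by blast

lemma onb_expand:
  assumes E: "orthonormal_basis h V E" and x: "x \<in> V"
  shows "(\<Sum>e\<in>E. h x e *\<^sub>R e) = x"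
proof -
  have fin: "finite E" by (rule onb_finite[OF E])
  have "x \<in> span E" using E x unfolding orthonormal_basis_def by blast
  then obtain u where u: "x = (\<Sum>e\<in>E. u e *\<^sub>R e)" using span_finite[OF fin] by auto
  have "h x e = u e" if e: "e \<in> E" for e
  proof -
    have "h x e = (\<Sum>f\<in>E. u f * h f e)" unfolding u by (rule sum_left) (use onb_in[OF E] e in auto)
    also have "\<dots> = (\<Sum>f\<in>E. if f = e then u f else 0)"
      using onb_eq[OF E] e by (intro sum.cong) auto
    finally show ?thesis using fin e by simp
  qed
  then show ?thesis using u by simp
qed

lemma parseval:
  assumes E: "orthonormal_basis h V E" and xy: "x \<in> V" "y \<in> V"
  shows "h x y = (\<Sum>e\<in>E. h x e * h y e)"
proof -
  have "h x y = h (\<Sum>e\<in>E. h x e *\<^sub>R e) y" using onb_expand[OF E xy(1)] by simp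
  also have "\<dots> = (\<Sum>e\<in>E. h x e * h e y)" by (rule sum_left) (use onb_in[OF E] xy in auto)
  also have "\<dots> = (\<Sum>e\<in>E. h x e * h y e)" using onb_in[OF E] xy symm by (intro sum.cong) auto
  finally show ?thesis .
qed

text \<open>One Gram-Schmidt step.\<close>

lemma orthonormal_extend:
  assumes E: "orthonormal E" and x: "x \<in> V" "x \<notin> span E"
  obtains u where "orthonormal (insert u E)" "u \<notin> E"
proof -
  have fin: "finite E" using orthonormal_independent[OF E] independent_imp_finite by blast
  have EV: "e \<in> V" if "e \<in> E" for e using E that unfolding orthonormal_def by blast
  define p where "p = (\<Sum>e\<in>E. h x e *\<^sub>R e)"
  have pV: "p \<in> V" unfolding p_def by (intro subspace_sum sub subspace_scale EV)
  have ps: "p \<in> span E" unfolding p_def by (intro span_sum span_scale span_base)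
  define w where "w = x - p"
  have wV: "w \<in> V" unfolding w_def using x(1) pV subspace_diff[OF sub] by blast
  have w0: "w \<noteq> 0" using x(2) ps unfolding w_def by auto
  have we: "h w e = 0" if e: "e \<in> E" for e
  proof -
    have "h p e = (\<Sum>f\<in>E. h x f * h f e)" unfolding p_def by (rule sum_left) (use EV e in auto)
    also have "\<dots> = (\<Sum>f\<in>E. if f = e then h x f else 0)"
      using E e unfolding orthonormal_def by (intro sum.cong) auto
    also have "\<dots> = h x e" using fin e by simp
    finally show ?thesis using diff_left[OF x(1) pV EV[OF e]] by (simp add: w_def)
  qed
  define u where "u = (1 / sqrt (h w w)) *\<^sub>R w"
  have hw: "h w w > 0" using pos wV w0 by blast
  have uV: "u \<in> V" unfolding u_def using wV subspace_scale[OF sub] by blast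
  have uu: "h u u = 1"
  proof -
    have "h u u = (1 / sqrt (h w w)) * ((1 / sqrt (h w w)) * h w w)"
      unfolding u_def using wV subspace_scale[OF sub] by (simp add: scale_left scale_right)
    also have "\<dots> = h w w / (sqrt (h w w) * sqrt (h w w))" by simp
    also have "\<dots> = 1" using hw by simp
    finally show ?thesis .
  qed
  have ue: "h u e = 0" "h e u = 0" if e: "e \<in> E" for e
    using we[OF e] scale_left[OF wV EV[OF e]] symm[OF uV EV[OF e]] unfolding u_def by auto
  have nin: "u \<notin> E" using uu ue by force
  have "orthonormal (insert u E)"
    using E uV uu ue nin unfolding orthonormal_def by auto
  then show thesis using that nin by blast
qed

text \<open>Independence bounds the size of orthonormal sets, so one of maximal size exists, and
  \<open>orthonormal_extend\<close> shows that it spans.\<close>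

lemma onb_exists: obtains E where "orthonormal_basis h V E"
proof -
  let ?P = "\<lambda>E. orthonormal E"
  have bound: "card E \<le> DIM('a)" if "orthonormal E" for E
    using orthonormal_independent[OF that] independent_card_le by blast
  have "orthonormal {}" unfolding orthonormal_def by simp
  moreover have "\<forall>F. orthonormal F \<longrightarrow> card F < Suc (DIM('a))" using bound by (simp add: less_Suc_eq_le)
  ultimately obtain E where E: "orthonormal E" "\<And>F. orthonormal F \<Longrightarrow> card F \<le> card E"
    using ex_has_greatest_nat[of orthonormal "{}" card "Suc (DIM('a))"] by blast
  have fin: "finite E" using orthonormal_independent[OF E(1)] independent_imp_finite by blast
  have EV: "E \<subseteq> V" using E(1) unfolding orthonormal_def by blast
  have "V \<subseteq> span E"
  proof
    fix x assume "x \<in> V"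
    show "x \<in> span E"
    proof (rule ccontr)
      assume "x \<notin> span E"
      then obtain u where "orthonormal (insert u E)" "u \<notin> E" using orthonormal_extend[OF E(1) \<open>x \<in> V\<close>] by metis
      then show False using E(2)[of "insert u E"] fin by simp
    qed
  qed
  then have "span E = V" using EV span_minimal[OF EV sub] by blast
  then show thesis using that E(1) unfolding orthonormal_def orthonormal_basis_def by blast
qed

lemma some_onb: "orthonormal_basis h V (some_onb h V)"
  unfolding some_onb_def using onb_exists by (metis someI)

text \<open>Expand in \<open>F\<close> and apply Parseval in \<open>E\<close>. Quantities defined
  through \<open>some_onb\<close>, such as \<open>metric_trace\<close> and \<open>scal\<close>,
  thereby become computable in any convenient orthonormal basis.\<close>

lemma trace_quad:
  assumes E: "orthonormal_basis h V E" and F: "orthonormal_basis h V F" and B: "bilin_on V B"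
  shows "(\<Sum>e\<in>E. B e e) = (\<Sum>f\<in>F. B f f)"
proof -
  have "B e e = (\<Sum>f\<in>F. \<Sum>g\<in>F. h e f * h e g * B f g)" if e: "e \<in> E" for e
  proof -
    have eV: "e \<in> V" by (rule onb_in[OF E e])
    have "B e e = B (\<Sum>f\<in>F. h e f *\<^sub>R f) e" using onb_expand[OF F eV] by simp
    also have "\<dots> = (\<Sum>f\<in>F. h e f * B f e)"
      using lin_on_sum[OF sub bilin_on_left[OF B eV], of F "\<lambda>f. f" "h e"] onb_in[OF F] by simp
    also have "\<dots> = (\<Sum>f\<in>F. h e f * (\<Sum>g\<in>F. h e g * B f g))"
    proof (intro sum.cong refl)
      fix f assume f: "f \<in> F"
      have "B f e = B f (\<Sum>g\<in>F. h e g *\<^sub>R g)" using onb_expand[OF F eV] by simp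
      also have "\<dots> = (\<Sum>g\<in>F. h e g * B f g)"
        using lin_on_sum[OF sub bilin_on_right[OF B onb_in[OF F f]], of F "\<lambda>f. f" "h e"] onb_in[OF F] by simp
      finally show "h e f * B f e = h e f * (\<Sum>g\<in>F. h e g * B f g)" by simp
    qed
    finally show ?thesis by (simp add: sum_distrib_left mult.assoc)
  qed
  then have "(\<Sum>e\<in>E. B e e) = (\<Sum>e\<in>E. \<Sum>f\<in>F. \<Sum>g\<in>F. h e f * h e g * B f g)" by simp
  also have "\<dots> = (\<Sum>f\<in>F. \<Sum>e\<in>E. \<Sum>g\<in>F. h e f * h e g * B f g)" by (rule sum.swap)
  also have "\<dots> = (\<Sum>f\<in>F. \<Sum>g\<in>F. \<Sum>e\<in>E. h e f * h e g * B f g)" by (intro sum.cong refl sum.swap)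
  also have "\<dots> = (\<Sum>f\<in>F. \<Sum>g\<in>F. h f g * B f g)"
  proof (intro sum.cong refl)
    fix f g assume fg: "f \<in> F" "g \<in> F"
    have "(\<Sum>e\<in>E. h e f * h e g) = h f g"
      using parseval[OF E onb_in[OF F fg(1)] onb_in[OF F fg(2)]] symm onb_in[OF E] onb_in[OF F] fg
      by simp
    then show "(\<Sum>e\<in>E. h e f * h e g * B f g) = h f g * B f g" by (simp add: sum_distrib_right[symmetric])
  qed
  also have "\<dots> = (\<Sum>f\<in>F. \<Sum>g\<in>F. if f = g then B f g else 0)"
    using onb_eq[OF F] by (intro sum.cong) auto
  also have "\<dots> = (\<Sum>f\<in>F. B f f)" using onb_finite[OF F] by simp
  finally show ?thesis .
qed

text \<open>Removes the arbitrary basis hidden in \<open>trace_on\<close>. Since \<open>h\<close> is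
  arbitrary too, one trace can be evaluated with different inner products, which
  \<open>trace_g_Q\<close> exploits.\<close>

lemma trace_on_onb:
  assumes E: "orthonormal_basis h V E" and f: "lin_on V f" "\<And>x. x \<in> V \<Longrightarrow> f x \<in> V"
  shows "trace_on V f = (\<Sum>e\<in>E. h (f e) e)"
proof -
  define B where "B = (SOME B. independent B \<and> span B = V)"
  have "\<exists>B. independent B \<and> span B = V"
    using E onb_orthonormal[OF E] orthonormal_independent unfolding orthonormal_basis_def by blast
  then have B: "independent B" "span B = V" unfolding B_def using someI_ex[of "\<lambda>B. independent B \<and> span B = V"] by auto
  have finB: "finite B" using B(1) independent_imp_finite by blast
  have BV: "b \<in> V" if "b \<in> B" for b using that B(2) span_base by blast
  have rep: "(\<Sum>b\<in>B. representation B x b *\<^sub>R b) = x" if "x \<in> V" for x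
    using sum_representation_eq[OF B(1) _ finB] that B(2) by simp
  have "trace_on V f = (\<Sum>b\<in>B. representation B (f b) b)"
    unfolding trace_on_def Let_def B_def by simp
  also have "\<dots> = (\<Sum>b\<in>B. \<Sum>e\<in>E. h (f b) e * representation B e b)"
  proof (intro sum.cong refl)
    fix b assume b: "b \<in> B"
    have "representation B (f b) b = representation B (\<Sum>e\<in>E. h (f b) e *\<^sub>R e) b"
      using onb_expand[OF E f(2)[OF BV[OF b]]] by simp
    also have "\<dots> = (\<Sum>e\<in>E. representation B (h (f b) e *\<^sub>R e) b)"
    proof -
      have "h (f b) e *\<^sub>R e \<in> span B" if "e \<in> E" for e
        using onb_in[OF E that] B(2) subspace_scale[OF sub] by blast
      then show ?thesis by (simp only: real_vector.representation_sum[OF B(1)])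
    qed
    also have "\<dots> = (\<Sum>e\<in>E. h (f b) e * representation B e b)"
      using onb_in[OF E] B by (intro sum.cong) (auto simp: representation_scale)
    finally show "representation B (f b) b = (\<Sum>e\<in>E. h (f b) e * representation B e b)" .
  qed
  also have "\<dots> = (\<Sum>e\<in>E. \<Sum>b\<in>B. representation B e b * h (f b) e)"
    by (subst sum.swap) (simp add: mult.commute)
  also have "\<dots> = (\<Sum>e\<in>E. h (f e) e)"
  proof (intro sum.cong refl)
    fix e assume e: "e \<in> E"
    have "f e = f (\<Sum>b\<in>B. representation B e b *\<^sub>R b)" using rep[OF onb_in[OF E e]] by simp
    also have "\<dots> = (\<Sum>b\<in>B. representation B e b *\<^sub>R f b)" by (rule lin_on_sum[OF sub f(1) BV])
    finally have "h (f e) e = h (\<Sum>b\<in>B. representation B e b *\<^sub>R f b) e" by simp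
    also have "\<dots> = (\<Sum>b\<in>B. representation B e b * h (f b) e)"
      by (rule sum_left) (use f(2) BV onb_in[OF E e] in auto)
    finally show "(\<Sum>b\<in>B. representation B e b * h (f b) e) = h (f e) e" by simp
  qed
  finally show ?thesis .
qed

lemma metric_trace_onb:
  assumes "orthonormal_basis h V E" "bilin_on V B"
  shows "metric_trace h V B = (\<Sum>e\<in>E. B e e)"
  unfolding metric_trace_def by (rule trace_quad[OF some_onb assms])

lemma diag_onb:
  assumes q: "ip_space V q" and E: "orthonormal_basis q V E"
    and d: "\<And>e f. e \<in> E \<Longrightarrow> f \<in> E \<Longrightarrow> h e f = (if e = f then x e else 0)"
  shows "\<And>e. e \<in> E \<Longrightarrow> x e > 0"
    and "orthonormal_basis h V ((\<lambda>e. (1 / sqrt (x e)) *\<^sub>R e) ` E)"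
    and "inj_on (\<lambda>e. (1 / sqrt (x e)) *\<^sub>R e) E"
proof -
  interpret q: ip_space V q by (rule q)
  have EV: "e \<in> V" if "e \<in> E" for e by (rule q.onb_in[OF E that])
  have x: "x e > 0" if "e \<in> E" for e
  proof -
    have "e \<noteq> 0" using q.onb_eq[OF E that that] q.zero_left[OF EV[OF that]] by auto
    then show ?thesis using pos[OF EV[OF that]] d[OF that that] by simp
  qed
  then show "\<And>e. e \<in> E \<Longrightarrow> x e > 0" .
  let ?s = "\<lambda>e. (1 / sqrt (x e)) *\<^sub>R e"
  have s: "h (?s e) (?s f) = (if e = f then 1 else 0)" if e: "e \<in> E" and f: "f \<in> E" for e f
  proof -
    have "h (?s e) (?s f) = (1 / sqrt (x e)) * ((1 / sqrt (x f)) * h e f)"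
      using EV[OF e] EV[OF f] subspace_scale[OF sub] by (simp add: scale_left scale_right)
    also have "\<dots> = h e f / (sqrt (x e) * sqrt (x f))" by simp
    also have "\<dots> = (if e = f then 1 else 0)" using d[OF e f] x[OF e] by auto
    finally show ?thesis .
  qed
  show inj: "inj_on ?s E"
  proof (rule inj_onI)
    fix e f assume e: "e \<in> E" "f \<in> E" "?s e = ?s f"
    then show "e = f" using s[OF e(1,2)] s[OF e(1,1)] by (metis zero_neq_one)
  qed
  have "span (?s ` E) = V"
  proof
    have "?s ` E \<subseteq> V" using EV subspace_scale[OF sub] by blast
    then show "span (?s ` E) \<subseteq> V" using span_minimal sub by blast
    have "E \<subseteq> span (?s ` E)"
    proof
      fix e assume e: "e \<in> E"
      have "sqrt (x e) *\<^sub>R ?s e \<in> span (?s ` E)" using e by (intro span_scale span_base) blast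
      then show "e \<in> span (?s ` E)" using x[OF e] by simp
    qed
    then show "V \<subseteq> span (?s ` E)"
      using E span_minimal[OF _ subspace_span] unfolding orthonormal_basis_def by blast
  qed
  then show "orthonormal_basis h V (?s ` E)"
    unfolding orthonormal_basis_def using s inj EV subspace_scale[OF sub] by (auto simp: inj_on_def)
qed

text \<open>Rescaling the eigenvectors by \<open>1 / sqrt (x e)\<close> gives an
  \<open>h\<close>-orthonormal basis. Traces with respect to a varying \<open>h\<close> become
  weighted sums over a basis that is orthonormal for a fixed reference form.\<close>

lemma sum_onb_diag:
  assumes q: "ip_space V q" and E: "orthonormal_basis q V E"
    and d: "\<And>e f. e \<in> E \<Longrightarrow> f \<in> E \<Longrightarrow> h e f = (if e = f then x e else 0)"
    and F: "orthonormal_basis h V F" and B: "bilin_on V B"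
  shows "(\<Sum>f\<in>F. B f f) = (\<Sum>e\<in>E. B e e / x e)"
proof -
  have D: "\<And>e. e \<in> E \<Longrightarrow> x e > 0"
    "orthonormal_basis h V ((\<lambda>e. (1 / sqrt (x e)) *\<^sub>R e) ` E)"
    "inj_on (\<lambda>e. (1 / sqrt (x e)) *\<^sub>R e) E"
    using diag_onb[OF q E, of x] d by blast+
  have EV: "e \<in> V" if "e \<in> E" for e using E that unfolding orthonormal_basis_def by blast
  have "(\<Sum>f\<in>F. B f f) = (\<Sum>f\<in>(\<lambda>e. (1 / sqrt (x e)) *\<^sub>R e) ` E. B f f)"
    by (rule trace_quad[OF F D(2) B])
  also have "\<dots> = (\<Sum>e\<in>E. B ((1 / sqrt (x e)) *\<^sub>R e) ((1 / sqrt (x e)) *\<^sub>R e))"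
    using sum.reindex[OF D(3)] by simp
  also have "\<dots> = (\<Sum>e\<in>E. B e e / x e)"
  proof (intro sum.cong refl)
    fix e assume e: "e \<in> E"
    have "B ((1 / sqrt (x e)) *\<^sub>R e) ((1 / sqrt (x e)) *\<^sub>R e) = (1 / sqrt (x e)) * ((1 / sqrt (x e)) * B e e)"
      using B EV[OF e] subspace_scale[OF sub EV[OF e]] unfolding bilin_on_def by simp
    also have "\<dots> = B e e / (sqrt (x e) * sqrt (x e))" by simp
    finally show "B ((1 / sqrt (x e)) *\<^sub>R e) ((1 / sqrt (x e)) *\<^sub>R e) = B e e / x e"
      using D(1)[OF e] by simp
  qed
  finally show ?thesis .
qed

lemma ball_bounded:
  obtains M where "\<And>x. x \<in> V \<Longrightarrow> h x x \<le> 1 \<Longrightarrow> norm x \<le> M"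
proof -
  obtain E where E: "orthonormal_basis h V E" by (rule onb_exists)
  have "norm x \<le> (\<Sum>e\<in>E. norm e)" if x: "x \<in> V" "h x x \<le> 1" for x
  proof -
    have "(h x e)\<^sup>2 \<le> 1" if e: "e \<in> E" for e
    proof -
      have "(h x e)\<^sup>2 \<le> (\<Sum>e\<in>E. (h x e)\<^sup>2)" using onb_finite[OF E] e by (intro member_le_sum) auto
      also have "\<dots> = h x x" using parseval[OF E x(1) x(1)] by (simp add: power2_eq_square)
      finally show ?thesis using x(2) by simp
    qed
    then have le: "\<bar>h x e\<bar> \<le> 1" if "e \<in> E" for e using that abs_square_le_1 by blast
    have "norm x = norm (\<Sum>e\<in>E. h x e *\<^sub>R e)" using onb_expand[OF E x(1)] by simp
    also have "\<dots> \<le> (\<Sum>e\<in>E. norm e)"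
      by (rule sum_norm_le) (use le in \<open>simp add: mult_left_le_one_le\<close>)
    finally show ?thesis .
  qed
  then show thesis by (rule that)
qed

text \<open>Take a maximiser of \<open>b x x\<close> on the unit sphere of \<open>h\<close>; the
  first variation in every \<open>h\<close>-orthogonal direction vanishes. The bounded extensions of
  \<open>h\<close> and \<open>b\<close> provide closedness of the sphere and continuity.\<close>

lemma spectral_step:
  assumes b: "sym_bilinear_on V b" and ne: "V \<noteq> {0}"
  obtains u where "u \<in> V" "h u u = 1" "\<And>y. y \<in> V \<Longrightarrow> h u y = 0 \<Longrightarrow> b u y = 0"
proof -
  have hs: "sym_bilinear_on V h" using ip inner_product_on_def by blast
  obtain h' where h': "bounded_bilinear h'" "\<And>x y. x \<in> V \<Longrightarrow> y \<in> V \<Longrightarrow> h' x y = h x y"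
    using sym_bilinear_on_extend[OF hs sub] by metis
  obtain b' where b': "bounded_bilinear b'" "\<And>x y. x \<in> V \<Longrightarrow> y \<in> V \<Longrightarrow> b' x y = b x y"
    using sym_bilinear_on_extend[OF b sub] by metis
  have bs: "b x y = b y x" if "x \<in> V" "y \<in> V" for x y using b that unfolding sym_bilinear_on_def by blast
  note bb = sym_bilinear_imp_bilin[OF b sub]
  let ?S = "{x \<in> V. h' x x = 1}"
  obtain M where M: "\<And>x. x \<in> V \<Longrightarrow> h x x \<le> 1 \<Longrightarrow> norm x \<le> M" using ball_bounded by metis
  have "bounded ?S" unfolding bounded_iff using M h'(2) by (intro exI[of _ M]) auto
  moreover have "closed ?S"
  proof -
    have "closed {x. h' x x = 1}"
      by (intro closed_Collect_eq continuous_intros bounded_bilinear.continuous_on[OF h'(1)])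
    moreover have "?S = V \<inter> {x. h' x x = 1}" by blast
    ultimately show ?thesis using closed_subspace[OF sub] by auto
  qed
  ultimately have comp: "compact ?S" by (simp add: compact_eq_bounded_closed)
  obtain E where E: "orthonormal_basis h V E" by (rule onb_exists)
  have "E \<noteq> {}" using E ne unfolding orthonormal_basis_def by auto
  then obtain e where "e \<in> E" by blast
  then have "e \<in> ?S" using onb_in[OF E] onb_eq[OF E] h'(2) by simp
  then have "?S \<noteq> {}" by blast
  moreover have "continuous_on ?S (\<lambda>x. b' x x)"
    by (intro bounded_bilinear.continuous_on[OF b'(1)] continuous_intros)
  ultimately obtain u where u: "u \<in> ?S" "\<And>x. x \<in> ?S \<Longrightarrow> b' x x \<le> b' u u"
    using continuous_attains_sup[OF comp] by blast
  have uV: "u \<in> V" and uu: "h u u = 1" using u(1) h'(2) by auto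
  have max: "b x x \<le> b u u * h x x" if x: "x \<in> V" for x
  proof (cases "x = 0")
    case True
    then have "b x x = 0" using bb uV x unfolding bilin_on_def by (metis mult_zero_left scaleR_zero_left)
    then show ?thesis using True zero_left[OF x] by simp
  next
    case False
    then have hx: "h x x > 0" using pos x by blast
    define r where "r = 1 / sqrt (h x x)"
    have rr: "r * r * h x x = 1"
    proof -
      have "r * r * h x x = h x x / (sqrt (h x x) * sqrt (h x x))" by (simp add: r_def)
      then show ?thesis using hx by simp
    qed
    have rx: "r *\<^sub>R x \<in> V" using x subspace_scale[OF sub] by blast
    have "h (r *\<^sub>R x) (r *\<^sub>R x) = r * r * h x x" using x rx by (simp add: scale_left scale_right)
    then have "r *\<^sub>R x \<in> ?S" using rx rr h'(2) by simp
    then have "b (r *\<^sub>R x) (r *\<^sub>R x) \<le> b u u" using u(2) b'(2) rx uV by metis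
    moreover have "b (r *\<^sub>R x) (r *\<^sub>R x) = r * r * b x x" using bb x rx unfolding bilin_on_def by simp
    ultimately have "r * r * b x x * h x x \<le> b u u * h x x" using hx by (intro mult_right_mono) auto
    moreover have "r * r * b x x * h x x = b x x" using rr by (metis mult.commute mult.left_commute mult_1)
    ultimately show ?thesis by simp
  qed
  have "b u y = 0" if y: "y \<in> V" "h u y = 0" for y
  proof (rule ccontr)
    assume n: "b u y \<noteq> 0"
    define C where "C = b u u * h y y - b y y"
    have ineq: "2 * t * b u y \<le> t * t * C" for t
    proof -
      have ty: "t *\<^sub>R y \<in> V" using y(1) subspace_scale[OF sub] by blast
      have uty: "u + t *\<^sub>R y \<in> V" using uV ty subspace_add[OF sub] by blast
      have "b (u + t *\<^sub>R y) (u + t *\<^sub>R y) = b u u + t * b u y + (t * b y u + t * t * b y y)"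
        using bb uV ty y(1) uty unfolding bilin_on_def by (simp add: algebra_simps)
      moreover have "h (u + t *\<^sub>R y) (u + t *\<^sub>R y) = 1 + t * t * h y y"
        using uV ty y uty symm[OF uV y(1)] uu by (simp add: add_left add_right scale_left scale_right)
      ultimately show ?thesis
        using max[OF uty] bs[OF uV y(1)] by (simp add: C_def algebra_simps)
    qed
    have "C > 0"
      using ineq[of 1] ineq[of "-1"] n by (auto simp: not_less[symmetric])
    \<comment> \<open>The maximum point of \<open>2 * t * b u y - t * t * C\<close>, where
      \<open>ineq\<close> is violated most.\<close>
    define t where "t = b u y / C"
    have "2 * (b u y)\<^sup>2 / C \<le> (b u y)\<^sup>2 / C"
      using ineq[of t] \<open>C > 0\<close> by (simp add: t_def power2_eq_square)
    then have "(b u y)\<^sup>2 / C \<le> 0" by simp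
    moreover have "(b u y)\<^sup>2 / C > 0" using n \<open>C > 0\<close> by simp
    ultimately show False by linarith
  qed
  then show thesis using that uV uu by blast
qed

end

text \<open>Induction on the dimension: split off the vector of \<open>spectral_step\<close> and
  continue on its orthogonal complement, which is also \<open>b\<close>-orthogonal to it.\<close>

lemma spectral_theorem:
  fixes V :: "'a::euclidean_space set"
  assumes "ip_space V q" "sym_bilinear_on V b"
  obtains E where "orthonormal_basis q V E" "\<And>e f. e \<in> E \<Longrightarrow> f \<in> E \<Longrightarrow> e \<noteq> f \<Longrightarrow> b e f = 0"
proof -
  have "\<exists>E. orthonormal_basis q V E \<and> (\<forall>e\<in>E. \<forall>f\<in>E. e \<noteq> f \<longrightarrow> b e f = 0)"
    using assms
  proof (induction "dim V" arbitrary: V rule: less_induct)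
    case less
    interpret ip_space V q by (rule less.prems(1))
    have bs: "b x y = b y x" if "x \<in> V" "y \<in> V" for x y
      using less.prems(2) that unfolding sym_bilinear_on_def by blast
    show ?case
    proof (cases "V = {0}")
      case True
      then have "orthonormal_basis q V {}" unfolding orthonormal_basis_def by simp
      then show ?thesis by blast
    next
      case False
      obtain u where u: "u \<in> V" "q u u = 1" "\<And>y. y \<in> V \<Longrightarrow> q u y = 0 \<Longrightarrow> b u y = 0"
        using spectral_step[OF less.prems(2) False] by metis
      define W where "W = {y \<in> V. q u y = 0}"
      have "q u 0 = 0" using scale_right[OF u(1) u(1), of 0] by simp
      then have W: "subspace W"
        unfolding W_def subspace_def using sub u(1)
        by (auto simp: add_right scale_right subspace_0 subspace_add subspace_scale)
      have "u \<notin> W" using u(2) by (simp add: W_def)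
      then have "W \<subset> V" using u(1) unfolding W_def by blast
      then have "dim W < dim V" using sub W by (metis dim_psubset span_eq_iff)
      moreover have "ip_space W q"
        using W ip inner_product_on_subset \<open>W \<subset> V\<close> by unfold_locales auto
      moreover have "sym_bilinear_on W b" using less.prems(2) sym_bilinear_on_subset \<open>W \<subset> V\<close> by blast
      ultimately obtain E where E: "orthonormal_basis q W E" "\<forall>e\<in>E. \<forall>f\<in>E. e \<noteq> f \<longrightarrow> b e f = 0"
        using less.hyps by blast
      have EW: "E \<subseteq> W" using E(1) unfolding orthonormal_basis_def by blast
      have EV: "E \<subseteq> V" and uE: "\<And>e. e \<in> E \<Longrightarrow> q u e = 0" using EW unfolding W_def by auto
      have nu: "u \<notin> E" using uE u(2) by force
      have "V \<subseteq> span (insert u E)"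
      proof
        fix x assume x: "x \<in> V"
        define w where "w = x - q u x *\<^sub>R u"
        have qu: "q u x *\<^sub>R u \<in> V" using u(1) subspace_scale[OF sub] by blast
        have wV: "w \<in> V" unfolding w_def using x qu subspace_diff[OF sub] by blast
        have "q w u = 0"
          unfolding w_def using diff_left[OF x qu u(1)] scale_left[OF u(1) u(1)] u(2) symm[OF x u(1)] by simp
        then have "w \<in> W" unfolding W_def using wV symm[OF wV u(1)] by simp
        then have "w \<in> span E" using E(1) unfolding orthonormal_basis_def by blast
        then have "w \<in> span (insert u E)" using span_mono[of E "insert u E"] by blast
        moreover have "q u x *\<^sub>R u \<in> span (insert u E)" by (intro span_scale span_base) simp
        ultimately have "w + q u x *\<^sub>R u \<in> span (insert u E)" by (rule span_add)
        then show "x \<in> span (insert u E)" by (simp add: w_def)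
      qed
      moreover have iV: "insert u E \<subseteq> V" using u(1) EV by blast
      ultimately have sp: "span (insert u E) = V" using span_minimal[OF iV sub] by blast
      have "q e u = 0" if "e \<in> E" for e using uE[OF that] symm u(1) EV that by (metis subsetD)
      then have "orthonormal_basis q V (insert u E)"
        using sp iV u(2) uE nu E(1) unfolding orthonormal_basis_def by auto
      moreover have "b u e = 0" "b e u = 0" if "e \<in> E" for e
        using u(3) uE[OF that] EV that bs[OF u(1), of e] by auto
      ultimately show ?thesis using E(2) by (intro exI[of _ "insert u E"]) auto
    qed
  qed
  then show thesis using that by blast
qed

section \<open>Orthogonal projection for an inner product on the whole Lie algebra\<close>

locale ip_full =
  fixes Q :: "'a::euclidean_space \<Rightarrow> 'a \<Rightarrow> real"
  assumes Q: "inner_product_on UNIV Q"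
begin

lemma Qsub: "subspace V \<Longrightarrow> ip_space V Q"
  using Q inner_product_on_subset by unfold_locales auto

sublocale Q: ip_space UNIV Q
  by (rule Qsub[OF subspace_UNIV])

lemmas Qadd_left = Q.add_left[OF UNIV_I UNIV_I UNIV_I]
lemmas Qadd_right = Q.add_right[OF UNIV_I UNIV_I UNIV_I]
lemmas Qscale_left = Q.scale_left[OF UNIV_I UNIV_I]
lemmas Qscale_right = Q.scale_right[OF UNIV_I UNIV_I]
lemmas Qdiff_left = Q.diff_left[OF UNIV_I UNIV_I UNIV_I]
lemmas Qzero_left = Q.zero_left[OF UNIV_I]
lemmas Qsym = Q.symm[OF UNIV_I UNIV_I]
lemmas Qsum_left = Q.sum_left[OF UNIV_I UNIV_I]
lemmas Qsum_right = Q.sum_right[OF UNIV_I UNIV_I]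

lemma Qbounded_bilinear: "bounded_bilinear Q"
  unfolding bilinear_conv_bounded_bilinear[symmetric] bilinear_def
  by (auto intro!: linearI simp: Qadd_left Qadd_right Qscale_left Qscale_right)

lemma Qeq0: "Q x x = 0 \<Longrightarrow> x = 0"
  using Q.pos[OF UNIV_I, of x] by force

lemma subspace_perp: "subspace (perp Q V)"
  unfolding perp_def subspace_def by (simp add: Qadd_left Qscale_left Qzero_left)

text \<open>The difference of two candidates lies in \<open>V\<close> and is orthogonal to
  \<open>V\<close>, so it is orthogonal to itself.\<close>

lemma proj_eq:
  assumes V: "subspace V" and y: "y \<in> V" "x - y \<in> perp Q V"
  shows "proj Q V x = y"
  unfolding proj_def
proof (rule the_equality)
  fix z assume z: "z \<in> V \<and> x - z \<in> perp Q V"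
  have "z - y \<in> V" using z y V subspace_diff by blast
  then have "Q (x - y) (z - y) = 0" "Q (x - z) (z - y) = 0" using z y unfolding perp_def by auto
  then have "Q (z - y) (z - y) = 0" by (simp add: Qdiff_left)
  then show "z = y" using Qeq0 by fastforce
qed (use y in auto)

lemma proj_onb:
  assumes V: "subspace V" and E: "orthonormal_basis Q V E"
  shows "x - (\<Sum>e\<in>E. Q x e *\<^sub>R e) \<in> perp Q V" "proj Q V x = (\<Sum>e\<in>E. Q x e *\<^sub>R e)"
proof -
  interpret V: ip_space V Q by (rule Qsub[OF V])
  let ?p = "\<Sum>e\<in>E. Q x e *\<^sub>R e"
  have p: "?p \<in> V" by (intro subspace_sum V subspace_scale V.onb_in[OF E])
  have pe: "Q ?p e = Q x e" if e: "e \<in> E" for e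
  proof -
    have "Q ?p e = (\<Sum>f\<in>E. Q x f * Q f e)" by (rule Qsum_left)
    also have "\<dots> = (\<Sum>f\<in>E. if f = e then Q x f else 0)" using V.onb_eq[OF E] e by (intro sum.cong) auto
    finally show ?thesis using V.onb_finite[OF E] e by simp
  qed
  have "Q (x - ?p) y = 0" if y: "y \<in> V" for y
  proof -
    have "Q (x - ?p) y = Q (x - ?p) (\<Sum>e\<in>E. Q y e *\<^sub>R e)" using V.onb_expand[OF E y] by simp
    also have "\<dots> = (\<Sum>e\<in>E. Q y e * Q (x - ?p) e)" by (rule Qsum_right)
    also have "\<dots> = 0" using pe by (simp add: Qdiff_left)
    finally show ?thesis .
  qed
  then show perp: "x - ?p \<in> perp Q V" unfolding perp_def by blast
  show "proj Q V x = ?p" by (rule proj_eq[OF V p perp])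
qed

lemma proj_in: "subspace V \<Longrightarrow> proj Q V x \<in> V"
  and proj_perp: "subspace V \<Longrightarrow> x - proj Q V x \<in> perp Q V"
  and proj_linear: "subspace V \<Longrightarrow> linear (proj Q V)"
proof -
  assume V: "subspace V"
  interpret V: ip_space V Q by (rule Qsub[OF V])
  obtain E where E: "orthonormal_basis Q V E" by (rule V.onb_exists)
  note p = proj_onb(2)[OF V E]
  show "proj Q V x \<in> V" unfolding p by (intro subspace_sum V subspace_scale V.onb_in[OF E])
  show "x - proj Q V x \<in> perp Q V" unfolding p by (rule proj_onb(1)[OF V E])
  show "linear (proj Q V)"
    unfolding p[abs_def]
    by (intro linearI) (simp_all add: Qadd_left Qscale_left scaleR_add_left sum.distrib scaleR_sum_right)
qed

lemma proj_id: "subspace V \<Longrightarrow> x \<in> V \<Longrightarrow> proj Q V x = x"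
  by (rule proj_eq) (use subspace_0[OF subspace_perp] in auto)

lemma perp_perp:
  assumes V: "subspace V" shows "perp Q (perp Q V) = V"
proof
  show "V \<subseteq> perp Q (perp Q V)" unfolding perp_def using Qsym by (auto simp: Qsym)
  show "perp Q (perp Q V) \<subseteq> V"
  proof
    fix x assume x: "x \<in> perp Q (perp Q V)"
    let ?y = "x - proj Q V x"
    have y: "?y \<in> perp Q V" by (rule proj_perp[OF V])
    have "Q x ?y = 0" using x y unfolding perp_def by blast
    moreover have "Q (proj Q V x) ?y = 0" using y proj_in[OF V] Qsym unfolding perp_def by auto
    ultimately have "Q ?y ?y = 0" by (simp add: Qdiff_left)
    then show "x \<in> V" using Qeq0 proj_in[OF V, of x] by force
  qed
qed

lemma onb_union:
  assumes V: "subspace V" and L: "subspace L" and "V \<subseteq> L"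
    and E: "orthonormal_basis Q (L \<inter> perp Q V) E" and F: "orthonormal_basis Q V F"
  shows "orthonormal_basis Q L (E \<union> F)" "E \<inter> F = {}"
proof -
  have EL: "E \<subseteq> L" "E \<subseteq> perp Q V" and FV: "F \<subseteq> V" using E F unfolding orthonormal_basis_def by auto
  have o1: "Q e f = 0" if "e \<in> E" "f \<in> F" for e f
    using EL FV that unfolding perp_def by blast
  have o: "Q e f = 0" "Q f e = 0" if "e \<in> E" "f \<in> F" for e f
    using o1[OF that] Qsym[of e f] by simp_all
  have one: "Q e e = 1" if "e \<in> E \<union> F" for e using E F that unfolding orthonormal_basis_def by auto
  show d: "E \<inter> F = {}" using o one by force
  have s: "E \<union> F \<subseteq> L" using EL FV assms(3) by blast
  have "L \<subseteq> span (E \<union> F)"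
  proof
    fix x assume x: "x \<in> L"
    have "proj Q V x \<in> span F" using proj_in[OF V] F unfolding orthonormal_basis_def by blast
    then have 1: "proj Q V x \<in> span (E \<union> F)" using span_mono[of F "E \<union> F"] by blast
    have "x - proj Q V x \<in> L" using x proj_in[OF V] assms(3) subspace_diff[OF L] by blast
    then have "x - proj Q V x \<in> span E"
      using proj_perp[OF V] E unfolding orthonormal_basis_def by blast
    then have "x - proj Q V x \<in> span (E \<union> F)" using span_mono[of E "E \<union> F"] by blast
    from span_add[OF this 1] show "x \<in> span (E \<union> F)" by simp
  qed
  then have "span (E \<union> F) = L" using span_minimal[OF s L] by blast
  then show "orthonormal_basis Q L (E \<union> F)"
    using s o E F d unfolding orthonormal_basis_def by (auto split: if_splits)
qed

end

section \<open>Homogeneous spaces\<close>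

locale hom_space = lie_group G + ip_full Q
  for G :: "('g, 'a::euclidean_space, 'm) lie_data_scheme" (structure) and Q :: "'a \<Rightarrow> 'a \<Rightarrow> real" +
  fixes H :: "'g set"
  assumes comp: "compact_space (topol G)"
    and emb: "embedded_lie_subgroup G H"
    and connH: "connectedin (topol G) H"
    and Qinv: "Ad_invariant_on G (carrier G) UNIV Q"
begin

abbreviation "hh \<equiv> lie_alg G H"
abbreviation "br \<equiv> bracket G"

lemma H_sub: "subgroup H G"
  using emb embedded_lie_subgroup_def by blast

lemma H_car: "a \<in> H \<Longrightarrow> a \<in> carrier G"
  using H_sub subgroup.mem_carrier by metis

lemma hh_sub: "subspace hh"
  by (rule subspace_lie_alg[OF H_sub])

lemma br_skew: "br x y = - br y x"
  by (rule bracket_skew[OF comp])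

lemmas br_add_left = linear_add[OF bracket_linear_left]
lemmas br_add_right = linear_add[OF bracket_linear_right]
lemmas br_scale_left = linear_scale[OF bracket_linear_left]
lemmas br_scale_right = linear_scale[OF bracket_linear_right]

lemma Q_Ad: "a \<in> carrier G \<Longrightarrow> Q (Ad G a x) (Ad G a y) = Q x y"
  using Qinv unfolding Ad_invariant_on_def by blast

lemma Qsymbil: "sym_bilinear_on UNIV Q"
  using Q unfolding inner_product_on_def by blast

lemma Q_skew: "Q (br v x) y = - Q x (br v y)"
proof -
  have "Q (br v x) y + Q x (br v y) = 0"
  proof (rule tang_invariant_skew[OF Qsymbil subspace_UNIV tang_psi[of v]])
    show "\<forall>\<^sub>F s in nhds 0. Q (Ad G (\<psi> (e0 + s *\<^sub>R v)) x) (Ad G (\<psi> (e0 + s *\<^sub>R v)) y) = Q x y" for x y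
      using tang_carrier[OF tang_psi[of v]] by eventually_elim (rule Q_Ad)
  qed auto
  then show ?thesis by simp
qed

lemma Q_minus: "Q (- x) y = - Q x y" "Q x (- y) = - Q x y"
  using Qscale_left[of "-1" x y] Qscale_right[of x "-1" y] by simp_all

lemma Q_swap23: "Q (br x y) z = - Q (br x z) y"
  using Q_skew[of x y z] Qsym[of y "br x z"] by simp

lemma Q_swap12: "Q (br x y) z = - Q (br y x) z"
  using br_skew[of x y] Q_minus by simp

text \<open>With the two swap rules this says that \<open>Q (br x y) z\<close> is totally skew,
  which combines the bi-invariance of \<open>Q\<close> with the skewness of the bracket.\<close>

lemma Q_cyc: "Q (br x y) z = Q (br y z) x"
  using Q_swap23[of x y z] Q_swap12[of x z y] Q_swap23[of z x y] Q_swap12[of z y x] by simp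

text \<open>Properness is left out on purpose: \<open>hh\<close> and \<open>UNIV\<close> are
  instances, so that the compactness results treat K/H and G/H alike.\<close>

definition subalg :: "'a set \<Rightarrow> bool" where
  "subalg k \<longleftrightarrow> lie_subalgebra G k \<and> hh \<subseteq> k"

lemma subalg_sub: "subalg k \<Longrightarrow> subspace k"
  and subalg_br: "subalg k \<Longrightarrow> x \<in> k \<Longrightarrow> y \<in> k \<Longrightarrow> br x y \<in> k"
  and subalg_hh: "subalg k \<Longrightarrow> hh \<subseteq> k"
  unfolding subalg_def lie_subalgebra_def by auto

lemma subalg_hh_self: "subalg hh"
  unfolding subalg_def lie_subalgebra_def
  using hh_sub bracket_in_invariant[OF hh_sub Ad_lie_alg[OF H_sub]] by auto

lemma subalg_UNIV: "subalg UNIV"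
  unfolding subalg_def lie_subalgebra_def by simp

section \<open>From invariance under a Lie algebra to invariance under H\<close>

lemma br_perp:
  assumes "subalg k" "v \<in> k" "x \<in> perp Q k" shows "br v x \<in> perp Q k"
  using assms Q_skew[of v x] subalg_br[OF assms(1,2)] unfolding perp_def by auto

text \<open>\<open>br \<eta>\<close> is \<open>Q\<close>-skew, so \<open>Q (f t) (f t)\<close> is
  constant. This stands in for a uniqueness theorem for linear differential equations, with
  \<open>\<eta>\<close> varying in \<open>t\<close> in any manner.\<close>

lemma zero_flow:
  fixes f :: "real \<Rightarrow> 'a"
  assumes "f 0 = 0" "\<And>t. t \<in> {0..1} \<Longrightarrow> \<exists>\<eta>. (f has_vector_derivative br \<eta> (f t)) (at t)" "t \<in> {0..1}"
  shows "f t = 0"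
proof -
  have "((\<lambda>s. Q (f s) (f s)) has_vector_derivative 0) (at t within {0..1})" if t: "t \<in> {0..1}" for t
  proof -
    obtain \<eta> where \<eta>: "(f has_vector_derivative br \<eta> (f t)) (at t)" using assms(2)[OF t] by blast
    have "((\<lambda>s. Q (f s) (f s)) has_vector_derivative (Q (f t) (br \<eta> (f t)) + Q (br \<eta> (f t)) (f t))) (at t)"
      by (rule bounded_bilinear.has_vector_derivative[OF Qbounded_bilinear \<eta> \<eta>])
    moreover have "Q (f t) (br \<eta> (f t)) + Q (br \<eta> (f t)) (f t) = 0" using Q_skew[of \<eta> "f t" "f t"] by simp
    ultimately show ?thesis by (simp add: has_vector_derivative_at_within)
  qed
  then obtain c where c: "\<And>t. t \<in> {0..1} \<Longrightarrow> Q (f t) (f t) = c"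
    using has_vector_derivative_zero_constant[of "{0..1}" "\<lambda>s. Q (f s) (f s)"] by (auto simp: convex_real_interval)
  have "Q (f t) (f t) = Q (f 0) (f 0)" using c[OF assms(3)] c[of 0] by simp
  then show ?thesis using assms(1) Qeq0 Qzero_left by metis
qed

text \<open>Common abstraction of \<open>Ad\<close> along a path in \<open>H\<close> and along a
  one-parameter subgroup: only the linear equation with generators in \<open>k\<close> is
  retained.\<close>

definition Ad_flow :: "'a set \<Rightarrow> (real \<Rightarrow> 'a \<Rightarrow> 'a) \<Rightarrow> bool" where
  "Ad_flow k A \<longleftrightarrow> (\<forall>x. A 0 x = x) \<and>
     (\<forall>t\<in>{0..1}. \<exists>\<eta>\<in>k. \<forall>w. ((\<lambda>s. A s w) has_vector_derivative br \<eta> (A t w)) (at t))"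

lemma proj_br:
  assumes k: "subalg k" and v: "v \<in> k" shows "proj Q k (br v x) = br v (proj Q k x)"
proof (rule proj_eq[OF subalg_sub[OF k]])
  show "br v (proj Q k x) \<in> k" by (rule subalg_br[OF k v proj_in[OF subalg_sub[OF k]]])
  have "br v (x - proj Q k x) \<in> perp Q k" by (rule br_perp[OF k v proj_perp[OF subalg_sub[OF k]]])
  then show "br v x - br v (proj Q k x) \<in> perp Q k" by (simp add: linear_diff[OF bracket_linear_right])
qed

text \<open>Projection to \<open>k\<close> commutes with \<open>br \<eta>\<close> for
  \<open>\<eta>\<close> in \<open>k\<close>, so the \<open>k\<close>-component of
  \<open>A t x\<close> solves the same kind of equation, and it starts at 0.\<close>

lemma Ad_flow_perp:
  assumes k: "subalg k" and A: "Ad_flow k A" and t: "t \<in> {0..1}" and x: "x \<in> perp Q k"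
  shows "A t x \<in> perp Q k"
proof -
  note ks = subalg_sub[OF k]
  have bl: "bounded_linear (proj Q k)" using proj_linear[OF ks] linear_conv_bounded_linear by blast
  have "proj Q k (A t x) = 0"
  proof (rule zero_flow[OF _ _ t])
    have "proj Q k x = 0" by (rule proj_eq[OF ks]) (use x ks subspace_0 in auto)
    then show "proj Q k (A 0 x) = 0" using A unfolding Ad_flow_def by simp
    fix s :: real assume "s \<in> {0..1}"
    then obtain \<eta> where \<eta>: "\<eta> \<in> k" "((\<lambda>s. A s x) has_vector_derivative br \<eta> (A s x)) (at s)"
      using A unfolding Ad_flow_def by blast
    have "((\<lambda>s. proj Q k (A s x)) has_vector_derivative proj Q k (br \<eta> (A s x))) (at s)"
      by (rule bounded_linear.has_vector_derivative[OF bl \<eta>(2)])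
    then show "\<exists>\<eta>. ((\<lambda>s. proj Q k (A s x)) has_vector_derivative br \<eta> (proj Q k (A s x))) (at s)"
      using proj_br[OF k \<eta>(1)] by metis
  qed
  then show ?thesis using proj_perp[OF ks, of "A t x"] by simp
qed

lemma Ad_flow_in:
  assumes k: "subalg k" and A: "Ad_flow k A" and t: "t \<in> {0..1}" and x: "x \<in> k"
  shows "A t x \<in> k"
proof -
  note ks = subalg_sub[OF k]
  have bl: "bounded_linear (\<lambda>x. x - proj Q k x)"
    using proj_linear[OF ks] linear_conv_bounded_linear bounded_linear_sub bounded_linear_ident by blast
  have "A t x - proj Q k (A t x) = 0"
  proof (rule zero_flow[OF _ _ t])
    show "A 0 x - proj Q k (A 0 x) = 0" using A proj_id[OF ks x] unfolding Ad_flow_def by simp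
    fix s :: real assume "s \<in> {0..1}"
    then obtain \<eta> where \<eta>: "\<eta> \<in> k" "((\<lambda>s. A s x) has_vector_derivative br \<eta> (A s x)) (at s)"
      using A unfolding Ad_flow_def by blast
    have "((\<lambda>s. A s x - proj Q k (A s x)) has_vector_derivative br \<eta> (A s x) - proj Q k (br \<eta> (A s x))) (at s)"
      by (rule bounded_linear.has_vector_derivative[OF bl \<eta>(2)])
    then show "\<exists>\<eta>. ((\<lambda>s. A s x - proj Q k (A s x)) has_vector_derivative br \<eta> (A s x - proj Q k (A s x))) (at s)"
      using proj_br[OF k \<eta>(1)] by (metis linear_diff[OF bracket_linear_right])
  qed
  then show ?thesis using proj_in[OF ks, of "A t x"] by simp
qed

text \<open>The flow stays in \<open>perp Q k\<close>, where infinitesimal skewness makes the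
  derivative of \<open>b (A t x) (A t y)\<close> vanish.\<close>

lemma Ad_flow_metric:
  assumes k: "subalg k" and A: "Ad_flow k A" and t: "t \<in> {0..1}"
    and b: "sym_bilinear_on (perp Q k) b"
    and skew: "\<And>v x y. v \<in> k \<Longrightarrow> x \<in> perp Q k \<Longrightarrow> y \<in> perp Q k \<Longrightarrow> b (br v x) y + b x (br v y) = 0"
    and xy: "x \<in> perp Q k" "y \<in> perp Q k"
  shows "b (A t x) (A t y) = b x y"
proof -
  obtain b' where b': "bounded_bilinear b'" "\<And>x y. x \<in> perp Q k \<Longrightarrow> y \<in> perp Q k \<Longrightarrow> b' x y = b x y"
    using sym_bilinear_on_extend[OF b subspace_perp] by metis
  have in_perp: "A s x \<in> perp Q k" "A s y \<in> perp Q k" if "s \<in> {0..1}" for s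
    using Ad_flow_perp[OF k A that] xy by auto
  have "((\<lambda>s. b' (A s x) (A s y)) has_vector_derivative 0) (at s within {0..1})" if s: "s \<in> {0..1}" for s
  proof -
    obtain \<eta> where \<eta>: "\<eta> \<in> k" "\<And>w. ((\<lambda>s. A s w) has_vector_derivative br \<eta> (A s w)) (at s)"
      using A s unfolding Ad_flow_def by blast
    have "((\<lambda>s. b' (A s x) (A s y)) has_vector_derivative
        (b' (A s x) (br \<eta> (A s y)) + b' (br \<eta> (A s x)) (A s y))) (at s)"
      by (rule bounded_bilinear.has_vector_derivative[OF b'(1) \<eta>(2) \<eta>(2)])
    moreover have "b' (A s x) (br \<eta> (A s y)) + b' (br \<eta> (A s x)) (A s y) = 0"
      using skew[OF \<eta>(1) in_perp[OF s]] br_perp[OF k \<eta>(1)] in_perp[OF s] by (simp add: b'(2))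
    ultimately show ?thesis by (simp add: has_vector_derivative_at_within)
  qed
  then obtain c where c: "\<And>t. t \<in> {0..1} \<Longrightarrow> b' (A t x) (A t y) = c"
    using has_vector_derivative_zero_constant[of "{0..1}" "\<lambda>s. b' (A s x) (A s y)"]
    by (auto simp: convex_real_interval)
  have "b' (A t x) (A t y) = b' (A 0 x) (A 0 y)" using c[OF t] c[of 0] by simp
  then show ?thesis using A b'(2) in_perp[OF t] xy unfolding Ad_flow_def by simp
qed

text \<open>The logarithmic derivative of a path in \<open>H\<close> is the velocity of a curve in
  \<open>H\<close> through the identity, hence lies in \<open>hh\<close>.\<close>

lemma path_Ad_flow:
  assumes k: "subalg k" and g0: "\<gamma> 0 = \<one>"
    and \<gamma>: "\<And>t. t \<in> {0..1::real} \<Longrightarrow> gsmooth_at t \<gamma> \<and> (\<forall>\<^sub>F s in nhds t. \<gamma> s \<in> H)"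
  shows "Ad_flow k (\<lambda>t. Ad G (\<gamma> t))"
  unfolding Ad_flow_def
proof (intro conjI allI ballI)
  show "Ad G (\<gamma> 0) x = x" for x using g0 Ad_one by simp
  fix t :: real assume t: "t \<in> {0..1}"
  have gt: "\<gamma> t \<in> H" using \<gamma>[OF t] eventually_nhds_x_imp_x by blast
  have sh: "gsmooth_at 0 (\<lambda>s. \<gamma> (t + s))" by (rule gsmooth_at_shift) (use \<gamma>[OF t] in blast)
  let ?\<sigma> = "\<lambda>s. \<gamma> (t + s) \<otimes> inv (\<gamma> t)"
  have s: "gsmooth_at 0 ?\<sigma>"
    by (intro gsmooth_at_mult sh gsmooth_at_const inv_closed H_car gt)
  have "?\<sigma> 0 = \<one>" using H_car[OF gt] by simp
  then obtain \<eta> where \<eta>: "tang ?\<sigma> \<eta>" using gsmooth_tang[OF s] by blast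
  have ev: "\<forall>\<^sub>F s in nhds 0. \<gamma> (t + s) \<in> H"
  proof -
    have "((\<lambda>s. t + s) \<longlongrightarrow> t + 0) (nhds 0)" by (intro tendsto_intros filterlim_ident)
    then show ?thesis using \<gamma>[OF t] filterlim_iff by fastforce
  qed
  then have "\<forall>\<^sub>F s in nhds 0. ?\<sigma> s \<in> H"
    by eventually_elim (intro subgroup.m_closed[OF H_sub] subgroup.m_inv_closed[OF H_sub] gt)
  then have "\<eta> \<in> hh" by (rule lie_algI[OF s \<eta>])
  moreover have "\<forall>\<^sub>F s in nhds 0. \<gamma> (t + s) \<in> carrier G" using ev by eventually_elim (rule H_car)
  then have "((\<lambda>s. Ad G (\<gamma> s) w) has_vector_derivative br \<eta> (Ad G (\<gamma> t) w)) (at t)" for w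
    by (rule Ad_curve_derivative[OF \<eta> H_car[OF gt]])
  ultimately show "\<exists>\<eta>\<in>k. \<forall>w. ((\<lambda>s. Ad G (\<gamma> s) w) has_vector_derivative br \<eta> (Ad G (\<gamma> t) w)) (at t)"
    using subalg_hh[OF k] by blast
qed

lemma Ad_H_preserves:
  assumes k: "subalg k" and a: "a \<in> H"
  shows "x \<in> k \<Longrightarrow> Ad G a x \<in> k" "x \<in> perp Q k \<Longrightarrow> Ad G a x \<in> perp Q k"
proof -
  let ?R = "{a. (\<forall>x\<in>k. Ad G a x \<in> k) \<and> (\<forall>x\<in>perp Q k. Ad G a x \<in> perp Q k)}"
  have "H \<subseteq> ?R"
  proof (rule connected_subgroup_induct[OF emb connH])
    show "\<one> \<in> ?R" by (simp add: Ad_one)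
    show "a \<otimes> b \<in> ?R" if "a \<in> ?R" "b \<in> ?R" "a \<in> carrier G" "b \<in> carrier G" for a b
      using that by (simp add: Ad_mult)
    show "inv a \<in> ?R" if aR: "a \<in> ?R" and a: "a \<in> carrier G" for a
    proof -
      \<comment> \<open>\<open>Ad G (inv a)\<close> is the \<open>Q\<close>-adjoint of
        \<open>Ad G a\<close>. It therefore preserves \<open>k\<close> because \<open>Ad G a\<close>
        preserves the orthogonal complement, and vice versa.\<close>
      have adj: "Q (Ad G (inv a) x) y = Q x (Ad G a y)" for x y
        using Q_Ad[OF a, of "Ad G (inv a) x" y] Ad_inv_cancel[OF a] by simp
      have "Ad G (inv a) x \<in> k" if "x \<in> k" for x
      proof -
        have "Q (Ad G (inv a) x) y = 0" if y: "y \<in> perp Q k" for y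
        proof -
          have "Ad G a y \<in> perp Q k" using aR y by blast
          then have "Q (Ad G a y) x = 0" using \<open>x \<in> k\<close> unfolding perp_def by blast
          then show ?thesis using adj Qsym by simp
        qed
        then have "Ad G (inv a) x \<in> perp Q (perp Q k)" unfolding perp_def[of Q "perp Q k"] by blast
        then show ?thesis using perp_perp[OF subalg_sub[OF k]] by simp
      qed
      moreover have "Ad G (inv a) x \<in> perp Q k" if "x \<in> perp Q k" for x
        using that aR adj unfolding perp_def by simp
      ultimately show ?thesis by blast
    qed
    show "\<gamma> 1 \<in> ?R" if "\<gamma> 0 = \<one>"
      "\<And>t. t \<in> {0..1} \<Longrightarrow> gsmooth_at t \<gamma> \<and> (\<forall>\<^sub>F s in nhds t. \<gamma> s \<in> H)" for \<gamma> :: "real \<Rightarrow> 'g"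
      using Ad_flow_in[OF k path_Ad_flow[OF k that], of 1] Ad_flow_perp[OF k path_Ad_flow[OF k that], of 1]
      by simp
  qed
  then show "x \<in> k \<Longrightarrow> Ad G a x \<in> k" "x \<in> perp Q k \<Longrightarrow> Ad G a x \<in> perp Q k" using a by auto
qed

text \<open>Along paths in \<open>H\<close> this is \<open>Ad_flow_metric\<close>; connectedness
  does the rest. Combined with \<open>K_metric_skew\<close> it turns metrics on G/K into
  \<open>H\<close>-invariant forms without comparing the groups H and K directly.\<close>

lemma Ad_H_metric:
  assumes k: "subalg k" and b: "sym_bilinear_on (perp Q k) b"
    and skew: "\<And>v x y. v \<in> k \<Longrightarrow> x \<in> perp Q k \<Longrightarrow> y \<in> perp Q k \<Longrightarrow> b (br v x) y + b x (br v y) = 0"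
  shows "Ad_invariant_on G H (perp Q k) b"
proof -
  \<comment> \<open>That \<open>a\<close> and its inverse preserve \<open>perp Q k\<close> is
    carried along, because invariance of \<open>b\<close> is known on that subspace only; products
    and inverses rely on it.\<close>
  let ?R = "{a. (a \<in> carrier G \<longrightarrow> (\<forall>x\<in>perp Q k. Ad G a x \<in> perp Q k \<and> Ad G (inv a) x \<in> perp Q k)) \<and>
    (\<forall>x\<in>perp Q k. \<forall>y\<in>perp Q k. b (Ad G a x) (Ad G a y) = b x y)}"
  have "H \<subseteq> ?R"
  proof (rule connected_subgroup_induct[OF emb connH])
    show "\<one> \<in> ?R" by (simp add: Ad_one)
    show "a \<otimes> b \<in> ?R" if "a \<in> ?R" "b \<in> ?R" "a \<in> carrier G" "b \<in> carrier G" for a b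
      using that by (simp add: Ad_mult inv_mult_group)
    show "inv a \<in> ?R" if aR: "a \<in> ?R" and a: "a \<in> carrier G" for a
    proof -
      have p: "Ad G (inv a) x \<in> perp Q k" "Ad G a x \<in> perp Q k" if "x \<in> perp Q k" for x using aR a that by blast+
      have "b (Ad G (inv a) x) (Ad G (inv a) y) = b x y" if xy: "x \<in> perp Q k" "y \<in> perp Q k" for x y
      proof -
        have "b (Ad G a (Ad G (inv a) x)) (Ad G a (Ad G (inv a) y)) = b (Ad G (inv a) x) (Ad G (inv a) y)"
          using aR p xy by blast
        then show ?thesis by (simp add: Ad_inv_cancel[OF a])
      qed
      then show ?thesis using p a by simp
    qed
    show "\<gamma> 1 \<in> ?R" if g: "\<gamma> 0 = \<one>"
      "\<And>t. t \<in> {0..1} \<Longrightarrow> gsmooth_at t \<gamma> \<and> (\<forall>\<^sub>F s in nhds t. \<gamma> s \<in> H)" for \<gamma> :: "real \<Rightarrow> 'g"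
    proof -
      have "\<gamma> 1 \<in> H" using g(2)[of 1] eventually_nhds_x_imp_x[of "\<lambda>s. \<gamma> s \<in> H" 1] by simp
      then have "Ad G (\<gamma> 1) x \<in> perp Q k" "Ad G (inv (\<gamma> 1)) x \<in> perp Q k" if "x \<in> perp Q k" for x
        using Ad_H_preserves(2)[OF k _ that] subgroup.m_inv_closed[OF H_sub] by auto
      moreover have "b (Ad G (\<gamma> 1) x) (Ad G (\<gamma> 1) y) = b x y" if "x \<in> perp Q k" "y \<in> perp Q k" for x y
        by (rule Ad_flow_metric[OF k path_Ad_flow[OF k g] _ b skew that]) auto
      ultimately show ?thesis by blast
    qed
  qed
  then show ?thesis unfolding Ad_invariant_on_def by blast
qed

text \<open>\<open>\<gamma> t\<close> belongs to the group generated by the exponentials of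
  \<open>k\<close>, as the value at 1 of the one-parameter subgroup
  \<open>s \<mapsto> \<gamma> (t * s)\<close>. Invariance along \<open>\<gamma>\<close> is then
  differentiated at 0.\<close>

lemma K_metric_skew:
  assumes k: "subalg k" and b: "sym_bilinear_on (perp Q k) b"
    and inv: "Ad_invariant_on G (connected_lie_subgroup G k) (perp Q k) b"
    and v: "v \<in> k" and xy: "x \<in> perp Q k" "y \<in> perp Q k"
  shows "b (br v x) y + b x (br v y) = 0"
proof -
  obtain \<gamma> where \<gamma>: "one_parameter_subgroup G \<gamma> v" "tang \<gamma> v"
    using one_parameter_subgroup_exists[OF comp] .
  have c: "\<gamma> t \<in> carrier G" for t
    using \<gamma>(1) topspace_carrier unfolding one_parameter_subgroup_def continuous_map_def by auto
  have hom: "\<gamma> (s + t) = \<gamma> s \<otimes> \<gamma> t" for s t using \<gamma>(1) unfolding one_parameter_subgroup_def by blast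
  have g0: "\<gamma> 0 = \<one>" using \<gamma>(2) tang_def by blast
  have inK: "\<gamma> t \<in> connected_lie_subgroup G k" for t
  proof -
    let ?\<delta> = "\<lambda>s. \<gamma> (t * s)"
    have "continuous_map euclideanreal euclideanreal (\<lambda>s. t * s)" by (simp add: continuous_on_mult_left)
    from continuous_map_compose[OF this, of "topol G" \<gamma>] have "continuous_map euclideanreal (topol G) ?\<delta>"
      using \<gamma>(1) unfolding one_parameter_subgroup_def o_def by blast
    moreover have "((\<phi> \<circ> ?\<delta>) has_vector_derivative t *\<^sub>R v) (at 0)"
      using tang_scale[OF \<gamma>(2), of t] unfolding tang_def o_def by blast
    ultimately have "one_parameter_subgroup G ?\<delta> (t *\<^sub>R v)"
      unfolding one_parameter_subgroup_def using hom by (simp add: distrib_left)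
    moreover have "t *\<^sub>R v \<in> k" using v subspace_scale[OF subalg_sub[OF k]] by blast
    ultimately have "\<gamma> t \<in> {\<gamma> 1 | \<gamma> v. v \<in> k \<and> one_parameter_subgroup G \<gamma> v}"
      by (intro CollectI exI[of _ ?\<delta>] exI[of _ "t *\<^sub>R v"]) simp
    then show ?thesis unfolding connected_lie_subgroup_def by (rule generate.incl)
  qed
  \<comment> \<open>Rescaling brings every time of the one-parameter subgroup into the unit interval
    covered by \<open>Ad_flow_perp\<close>.\<close>
  have flow: "Ad_flow k (\<lambda>s. Ad G (\<gamma> (t * s)))" for t
    unfolding Ad_flow_def
  proof (intro conjI allI ballI)
    show "Ad G (\<gamma> (t * 0)) x = x" for x using g0 Ad_one by simp
    fix u :: real
    have "\<gamma> (t * (u + s)) \<otimes> inv (\<gamma> (t * u)) = \<gamma> (t * s)" for s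
      using hom[of "t * s" "t * u"] c by (simp add: distrib_left add.commute m_assoc)
    then have "tang (\<lambda>s. \<gamma> (t * (u + s)) \<otimes> inv (\<gamma> (t * u))) (t *\<^sub>R v)" using tang_scale[OF \<gamma>(2), of t] by simp
    then have "((\<lambda>s. Ad G (\<gamma> (t * s)) w) has_vector_derivative br (t *\<^sub>R v) (Ad G (\<gamma> (t * u)) w)) (at u)" for w
      by (rule Ad_curve_derivative) (use c in auto)
    moreover have "t *\<^sub>R v \<in> k" using v subspace_scale[OF subalg_sub[OF k]] by blast
    ultimately show "\<exists>\<eta>\<in>k. \<forall>w. ((\<lambda>s. Ad G (\<gamma> (t * s)) w) has_vector_derivative br \<eta> (Ad G (\<gamma> (t * u)) w)) (at u)"
      by blast
  qed
  show ?thesis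
  proof (rule tang_invariant_skew[OF b subspace_perp \<gamma>(2) _ _ xy])
    show "\<forall>\<^sub>F s in nhds 0. Ad G (\<gamma> s) x \<in> perp Q k" if "x \<in> perp Q k" for x
      using Ad_flow_perp[OF k flow, of 1 x] that by simp
    show "\<forall>\<^sub>F s in nhds 0. b (Ad G (\<gamma> s) x) (Ad G (\<gamma> s) y) = b x y" if "x \<in> perp Q k" "y \<in> perp Q k" for x y
      using inv inK that unfolding Ad_invariant_on_def by simp
  qed
qed

definition pp :: "'a set \<Rightarrow> 'a set" where "pp k = k \<inter> perp Q hh"

lemma pp_sub: "subalg k \<Longrightarrow> subspace (pp k)"
  unfolding pp_def by (intro subspace_inter subalg_sub subspace_perp)

lemma pp_Ad:
  assumes "subalg k" "a \<in> H" "x \<in> pp k" shows "Ad G a x \<in> pp k"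
  using assms Ad_H_preserves[OF assms(1,2)] Ad_H_preserves[OF subalg_hh_self assms(2)] unfolding pp_def by blast

subsection \<open>Scalar curvature in a diagonalising frame\<close>

text \<open>Evaluate the trace with \<open>Q\<close> and move one bracket across by
  \<open>Q_skew\<close>. The Killing form thereby becomes minus a sum of squares on the
  diagonal.\<close>

lemma killing_onb:
  assumes l: "lie_subalgebra G l" and F: "orthonormal_basis Q l F" and xy: "x \<in> l" "y \<in> l"
  shows "killing_form G l x y = - (\<Sum>f\<in>F. Q (br x f) (br y f))"
proof -
  have ls: "subspace l" and lb: "\<And>x y. x \<in> l \<Longrightarrow> y \<in> l \<Longrightarrow> br x y \<in> l"
    using l unfolding lie_subalgebra_def by auto
  interpret l: ip_space l Q by (rule Qsub[OF ls])
  have "linear (\<lambda>z. br x (br y z))"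
    using linear_compose[OF bracket_linear_right[of y] bracket_linear_right[of x]] by (simp add: o_def)
  then have "killing_form G l x y = (\<Sum>f\<in>F. Q (br x (br y f)) f)"
    unfolding killing_form_def using l.trace_on_onb[OF F linear_imp_lin_on] lb xy by blast
  also have "\<dots> = (\<Sum>f\<in>F. - Q (br x f) (br y f))"
    using Q_skew Qsym by (intro sum.cong refl) metis
  finally show ?thesis by (simp add: sum_negf)
qed

lemma Q_br_bilin: "bilin_on V (\<lambda>x y. Q (br x z) (br y w))" "bilin_on V (\<lambda>x y. Q (br z x) (br w y))"
  unfolding bilin_on_def
  by (simp_all add: br_add_left br_add_right br_scale_left br_scale_right Qadd_left Qadd_right Qscale_left Qscale_right)

lemma killing_bilin:
  assumes l: "lie_subalgebra G l" and "V \<subseteq> l" "subspace V"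
  shows "bilin_on V (killing_form G l)"
proof -
  have ls: "subspace l" using l unfolding lie_subalgebra_def by auto
  interpret l: ip_space l Q by (rule Qsub[OF ls])
  obtain F where F: "orthonormal_basis Q l F" by (rule l.onb_exists)
  have 1: "bilin_on V (\<lambda>x y. - (\<Sum>f\<in>F. Q (br x f) (br y f)))"
    by (intro bilin_on_uminus bilin_on_sum Q_br_bilin)
  have eq: "killing_form G l x y = - (\<Sum>f\<in>F. Q (br x f) (br y f))" if "x \<in> V" "y \<in> V" for x y
    using killing_onb[OF l F] that assms(2) by blast
  show ?thesis
    using 1 eq subspace_add[OF assms(3)] subspace_scale[OF assms(3)] unfolding bilin_on_def by simp
qed

text \<open>The reference inner product \<open>q\<close> is a parameter: \<open>Q\<close> serves
  when metrics degenerate, the metric itself when it is varied. The projection is by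
  \<open>Q\<close> in both cases.\<close>

lemma scal_diag_general:
  assumes l: "lie_subalgebra G l" and p: "p = l \<inter> perp Q l'" and l': "subspace l'"
    and h: "inner_product_on p h" and q: "inner_product_on p q"
    and E: "orthonormal_basis q p E"
    and d: "\<And>e f. e \<in> E \<Longrightarrow> f \<in> E \<Longrightarrow> h e f = (if e = f then x e else 0)"
  shows "scal G Q l l' h = - (1/2) * (\<Sum>e\<in>E. killing_form G l e e / x e)
     - (1/4) * (\<Sum>a\<in>E. \<Sum>b\<in>E. \<Sum>c\<in>E. x c / (x a * x b) * (q (proj Q p (br a b)) c)\<^sup>2)"
proof -
  have ls: "subspace l" using l unfolding lie_subalgebra_def by auto
  have ps: "subspace p" unfolding p by (intro subspace_inter ls subspace_perp)
  interpret h: ip_space p h using ps h by unfold_locales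
  interpret q: ip_space p q using ps q by unfold_locales
  have qs: "ip_space p q" by unfold_locales
  have pl: "p \<subseteq> l" unfolding p by blast
  let ?S = "some_onb h p"
  let ?P = "proj Q p"
  have S: "orthonormal_basis h p ?S" by (rule h.some_onb)
  have sd: "(\<Sum>f\<in>?S. B f f) = (\<Sum>e\<in>E. B e e / x e)" if "bilin_on p B" for B
    by (rule h.sum_onb_diag[OF qs E d S that])
  have K: "(\<Sum>a\<in>?S. killing_form G l a a) = (\<Sum>e\<in>E. killing_form G l e e / x e)"
    by (rule sd[OF killing_bilin[OF l pl ps]])
  have linP: "linear (\<lambda>v. ?P (br v z))" "linear (\<lambda>v. ?P (br z v))" for z
    using linear_compose[OF bracket_linear_left[of z] proj_linear[OF ps]]
      linear_compose[OF bracket_linear_right[of z] proj_linear[OF ps]] by (simp_all add: o_def)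
  have bl1: "bilin_on p (\<lambda>a a'. h (?P (br a z)) (?P (br a' z)))" for z
    by (rule lin_on_compose_bilin[OF h.bil linear_imp_lin_on[OF linP(1)] linear_imp_lin_on[OF linP(1)] proj_in[OF ps] proj_in[OF ps] ps])
  have bl2: "bilin_on p (\<lambda>a a'. h (?P (br z a)) (?P (br z a')))" for z
    by (rule lin_on_compose_bilin[OF h.bil linear_imp_lin_on[OF linP(2)] linear_imp_lin_on[OF linP(2)] proj_in[OF ps] proj_in[OF ps] ps])
  have "(\<Sum>a\<in>?S. \<Sum>b\<in>?S. h (?P (br a b)) (?P (br a b))) = (\<Sum>a\<in>?S. \<Sum>b\<in>E. h (?P (br a b)) (?P (br a b)) / x b)"
    by (intro sum.cong refl sd bl2)
  also have "\<dots> = (\<Sum>b\<in>E. \<Sum>a\<in>?S. h (?P (br a b)) (?P (br a b)) / x b)" by (rule sum.swap)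
  also have "\<dots> = (\<Sum>b\<in>E. (\<Sum>a\<in>?S. h (?P (br a b)) (?P (br a b))) / x b)" by (simp add: sum_divide_distrib)
  also have "\<dots> = (\<Sum>b\<in>E. (\<Sum>a\<in>E. h (?P (br a b)) (?P (br a b)) / x a) / x b)"
    using sd[OF bl1] by simp
  also have "\<dots> = (\<Sum>b\<in>E. \<Sum>a\<in>E. h (?P (br a b)) (?P (br a b)) / (x a * x b))"
    by (simp add: sum_divide_distrib)
  also have "\<dots> = (\<Sum>a\<in>E. \<Sum>b\<in>E. h (?P (br a b)) (?P (br a b)) / (x a * x b))" by (rule sum.swap)
  also have "\<dots> = (\<Sum>a\<in>E. \<Sum>b\<in>E. \<Sum>c\<in>E. x c / (x a * x b) * (q (?P (br a b)) c)\<^sup>2)"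
  proof (intro sum.cong refl)
    fix a b
    let ?v = "?P (br a b)"
    have v: "?v \<in> p" by (rule proj_in[OF ps])
    have "h ?v ?v = h (\<Sum>c\<in>E. q ?v c *\<^sub>R c) ?v" using q.onb_expand[OF E v] by simp
    also have "\<dots> = (\<Sum>c\<in>E. q ?v c * h c ?v)" by (rule h.sum_left) (use q.onb_in[OF E] v in auto)
    also have "\<dots> = (\<Sum>c\<in>E. x c * (q ?v c)\<^sup>2)"
    proof (intro sum.cong refl)
      fix c assume c: "c \<in> E"
      have "h c ?v = h c (\<Sum>e\<in>E. q ?v e *\<^sub>R e)" using q.onb_expand[OF E v] by simp
      also have "\<dots> = (\<Sum>e\<in>E. q ?v e * h c e)" by (rule h.sum_right) (use q.onb_in[OF E] c in auto)
      also have "\<dots> = (\<Sum>e\<in>E. if c = e then q ?v e * x c else 0)" using d c by (intro sum.cong) auto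
      also have "\<dots> = q ?v c * x c" using q.onb_finite[OF E] c by simp
      finally show "q ?v c * h c ?v = x c * (q ?v c)\<^sup>2" by (simp add: power2_eq_square)
    qed
    finally show "h ?v ?v / (x a * x b) = (\<Sum>c\<in>E. x c / (x a * x b) * (q ?v c)\<^sup>2)"
      by (simp add: sum_divide_distrib)
  qed
  finally show ?thesis unfolding scal_def Let_def p[symmetric] K by simp
qed

lemma proj_Q:
  assumes "subspace p" "c \<in> p" shows "Q (proj Q p v) c = Q v c"
  using proj_perp[OF assms(1), of v] assms(2) unfolding perp_def by (auto simp: Qdiff_left)

lemma scal_diag:
  assumes l: "lie_subalgebra G l" and p: "p = l \<inter> perp Q l'" and l': "subspace l'"
    and h: "inner_product_on p h" and E: "orthonormal_basis Q p E"
    and d: "\<And>e f. e \<in> E \<Longrightarrow> f \<in> E \<Longrightarrow> h e f = (if e = f then x e else 0)"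
    and F: "orthonormal_basis Q l F"
  shows "scal G Q l l' h = (1/2) * (\<Sum>e\<in>E. (\<Sum>f\<in>F. \<Sum>g\<in>F. (Q (br e f) g)\<^sup>2) / x e)
     - (1/4) * (\<Sum>a\<in>E. \<Sum>b\<in>E. \<Sum>c\<in>E. x c / (x a * x b) * (Q (br a b) c)\<^sup>2)"
proof -
  have ls: "subspace l" and lb: "\<And>x y. x \<in> l \<Longrightarrow> y \<in> l \<Longrightarrow> br x y \<in> l"
    using l unfolding lie_subalgebra_def by auto
  have ps: "subspace p" unfolding p by (intro subspace_inter ls subspace_perp)
  have Qp: "inner_product_on p Q" using Q inner_product_on_subset by blast
  interpret l: ip_space l Q by (rule Qsub[OF ls])
  have Ep: "e \<in> p" if "e \<in> E" for e using E that unfolding orthonormal_basis_def by blast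
  have K: "killing_form G l e e = - (\<Sum>f\<in>F. \<Sum>g\<in>F. (Q (br e f) g)\<^sup>2)" if e: "e \<in> E" for e
  proof -
    have el: "e \<in> l" using Ep[OF e] p by blast
    have "Q (br e f) (br e f) = (\<Sum>g\<in>F. (Q (br e f) g)\<^sup>2)" if "f \<in> F" for f
      using l.parseval[OF F lb[OF el l.onb_in[OF F that]] lb[OF el l.onb_in[OF F that]]]
      by (simp add: power2_eq_square)
    then show ?thesis using killing_onb[OF l F el el] by simp
  qed
  have "scal G Q l l' h = - (1/2) * (\<Sum>e\<in>E. killing_form G l e e / x e)
     - (1/4) * (\<Sum>a\<in>E. \<Sum>b\<in>E. \<Sum>c\<in>E. x c / (x a * x b) * (Q (proj Q p (br a b)) c)\<^sup>2)"
    by (rule scal_diag_general[OF l p l' h Qp E d])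
  also have "(\<Sum>a\<in>E. \<Sum>b\<in>E. \<Sum>c\<in>E. x c / (x a * x b) * (Q (proj Q p (br a b)) c)\<^sup>2) =
      (\<Sum>a\<in>E. \<Sum>b\<in>E. \<Sum>c\<in>E. x c / (x a * x b) * (Q (br a b) c)\<^sup>2)"
    by (intro sum.cong refl) (simp add: proj_Q[OF ps Ep])
  also have "(\<Sum>e\<in>E. killing_form G l e e / x e) = - (\<Sum>e\<in>E. (\<Sum>f\<in>F. \<Sum>g\<in>F. (Q (br e f) g)\<^sup>2) / x e)"
    by (simp add: K sum_negf)
  finally show ?thesis by simp
qed

lemma metric_trace_diag:
  assumes ps: "subspace p" and h: "inner_product_on p h" and E: "orthonormal_basis Q p E"
    and d: "\<And>e f. e \<in> E \<Longrightarrow> f \<in> E \<Longrightarrow> h e f = (if e = f then x e else 0)"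
    and T: "bilin_on p T"
  shows "metric_trace h p T = (\<Sum>e\<in>E. T e e / x e)"
proof -
  interpret h: ip_space p h using ps h by unfold_locales
  have "metric_trace h p T = (\<Sum>e\<in>some_onb h p. T e e)" by (rule h.metric_trace_onb[OF h.some_onb T])
  also have "\<dots> = (\<Sum>e\<in>E. T e e / x e)" by (rule h.sum_onb_diag[OF Qsub[OF ps] E d h.some_onb T])
  finally show ?thesis .
qed

end

section \<open>Degenerating sequences of metrics\<close>

lemma finite_family_convergent_subseq:
  fixes f :: "nat \<Rightarrow> nat \<Rightarrow> 'b::heine_borel"
  assumes "\<And>a. a < d \<Longrightarrow> bounded (range (\<lambda>i. f i a))"
  obtains r where "strict_mono r" "\<And>a. a < d \<Longrightarrow> convergent (\<lambda>i. f (r i) a)"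
proof -
  have "\<exists>r::nat \<Rightarrow> nat. strict_mono r \<and> (\<forall>a<d. convergent (\<lambda>i. f (r i) a))"
    using assms
  proof (induction d)
    case 0
    then show ?case by (intro exI[of _ id]) (simp add: strict_mono_def)
  next
    case (Suc d)
    then obtain r :: "nat \<Rightarrow> nat" where r: "strict_mono r" "\<forall>a<d. convergent (\<lambda>i. f (r i) a)" by auto
    have "bounded (range (\<lambda>i. f (r i) d))"
      by (rule bounded_subset[OF Suc.prems[of d]]) auto
    then obtain l s where s: "strict_mono s" "((\<lambda>i. f (r i) d) \<circ> s) \<longlonglongrightarrow> l"
      using bounded_imp_convergent_subsequence by blast
    have "convergent (\<lambda>i. f ((r \<circ> s) i) a)" if a: "a < Suc d" for a
    proof (cases "a = d")
      case True
      then show ?thesis using s(2) unfolding convergent_def by (auto simp: o_def)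
    next
      case False
      then have "convergent (\<lambda>i. f (r i) a)" using a r(2) by simp
      from convergent_subseq_convergent[OF this s(1)] show ?thesis by (simp add: o_def)
    qed
    moreover have "strict_mono (r \<circ> s)" using r(1) s(1) by (rule strict_mono_o)
    ultimately show ?case by blast
  qed
  then show thesis using that by blast
qed

text \<open>Applied with \<open>T\<close> as inner product and \<open>Q\<close> as form, it turns
  positivity of \<open>T\<close> into a lower bound for \<open>T\<close> on \<open>Q\<close>-unit
  vectors.\<close>

lemma (in ip_space) bilin_bound:
  assumes "bilin_on V b"
  obtains C where "C > 0" "\<And>x. x \<in> V \<Longrightarrow> \<bar>b x x\<bar> \<le> C * h x x"
proof -
  obtain E where E: "orthonormal_basis h V E" by (rule onb_exists)
  note fin = onb_finite[OF E]
  define C where "C = (\<Sum>e\<in>E. \<Sum>f\<in>E. \<bar>b e f\<bar>)"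
  have "\<bar>b x x\<bar> \<le> (C + 1) * h x x" if x: "x \<in> V" for x
  proof -
    have hx: "\<bar>h x e\<bar> \<le> sqrt (h x x)" if e: "e \<in> E" for e
    proof -
      have "(h x e)\<^sup>2 \<le> (\<Sum>e\<in>E. (h x e)\<^sup>2)" using fin e by (intro member_le_sum) auto
      also have "\<dots> = h x x" using parseval[OF E x x] by (simp add: power2_eq_square)
      finally show ?thesis using real_le_rsqrt abs_le_square_iff real_sqrt_abs real_sqrt_le_iff by metis
    qed
    have "b x x = (\<Sum>e\<in>E. h x e * b e x)"
      using lin_on_sum[OF sub bilin_on_left[OF assms x], of E "\<lambda>e. e" "h x"] onb_in[OF E] onb_expand[OF E x] by simp
    also have "\<dots> = (\<Sum>e\<in>E. \<Sum>f\<in>E. h x e * (h x f * b e f))"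
    proof (intro sum.cong refl)
      fix e assume e: "e \<in> E"
      have "b e x = (\<Sum>f\<in>E. h x f * b e f)"
        using lin_on_sum[OF sub bilin_on_right[OF assms onb_in[OF E e]], of E "\<lambda>e. e" "h x"] onb_in[OF E]
          onb_expand[OF E x] by simp
      then show "h x e * b e x = (\<Sum>f\<in>E. h x e * (h x f * b e f))" by (simp add: sum_distrib_left)
    qed
    finally have eq: "b x x = (\<Sum>e\<in>E. \<Sum>f\<in>E. h x e * (h x f * b e f))" .
    have "\<bar>b x x\<bar> \<le> (\<Sum>e\<in>E. \<Sum>f\<in>E. \<bar>h x e * (h x f * b e f)\<bar>)"
      unfolding eq by (intro order_trans[OF sum_abs] sum_mono sum_abs)
    also have "\<dots> \<le> (\<Sum>e\<in>E. \<Sum>f\<in>E. h x x * \<bar>b e f\<bar>)"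
    proof (intro sum_mono)
      fix e f assume ef: "e \<in> E" "f \<in> E"
      have "\<bar>h x e\<bar> * \<bar>h x f\<bar> \<le> sqrt (h x x) * sqrt (h x x)"
        using hx ef nonneg[OF x] by (intro mult_mono) auto
      then have "\<bar>h x e\<bar> * \<bar>h x f\<bar> \<le> h x x" using nonneg[OF x] by simp
      then have "\<bar>h x e\<bar> * \<bar>h x f\<bar> * \<bar>b e f\<bar> \<le> h x x * \<bar>b e f\<bar>" by (intro mult_right_mono) auto
      then show "\<bar>h x e * (h x f * b e f)\<bar> \<le> h x x * \<bar>b e f\<bar>" by (simp add: abs_mult mult.assoc)
    qed
    also have "\<dots> = C * h x x" by (simp add: C_def sum_distrib_left sum_distrib_right mult.commute)
    also have "\<dots> \<le> (C + 1) * h x x" using nonneg[OF x] by (simp add: distrib_right)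
    finally show ?thesis .
  qed
  moreover have "C + 1 > 0" unfolding C_def by (intro add_nonneg_pos sum_nonneg) auto
  ultimately show thesis using that by blast
qed

text \<open>The bound \<open>y\<^sub>b/y\<^sub>c + y\<^sub>c/y\<^sub>b \<ge> 2\<close> takes care of the terms with one index in \<open>A\<close> and two
  in \<open>B\<close>.\<close>

lemma structure_sum_bound:
  fixes N :: "nat \<Rightarrow> nat \<Rightarrow> nat \<Rightarrow> real" and y :: "nat \<Rightarrow> real"
  assumes fin: "finite A" "finite B" "A \<inter> B = {}"
    and y: "\<And>a. a \<in> A \<union> B \<Longrightarrow> y a > 0"
    and N: "\<And>a b c. N a b c = - N b a c" "\<And>a b c. N a b c = - N a c b"
  shows "(\<Sum>a\<in>A\<union>B. \<Sum>b\<in>A\<union>B. \<Sum>c\<in>A\<union>B. y a * y b / y c * (N a b c)\<^sup>2) \<ge>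
     (\<Sum>a\<in>A. \<Sum>b\<in>A. \<Sum>c\<in>A. y a * y b / y c * (N a b c)\<^sup>2) + 2 * (\<Sum>a\<in>A. y a * (\<Sum>b\<in>B. \<Sum>c\<in>B. (N a b c)\<^sup>2))"
proof -
  let ?t = "\<lambda>a b c. y a * y b / y c * (N a b c)\<^sup>2"
  have t0: "?t a b c \<ge> 0" if "a \<in> A \<union> B" "b \<in> A \<union> B" "c \<in> A \<union> B" for a b c
    using y[OF that(1)] y[OF that(2)] y[OF that(3)] by simp
  have sq1: "(N a b c)\<^sup>2 = (N b a c)\<^sup>2" and sq2: "(N a b c)\<^sup>2 = (N a c b)\<^sup>2" for a b c
    using N(1)[of a b c] N(2)[of a b c] by simp_all
  have split: "(\<Sum>x\<in>A\<union>B. g x) = (\<Sum>x\<in>A. g x) + (\<Sum>x\<in>B. g x)" for g :: "nat \<Rightarrow> real"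
    using fin by (rule sum.union_disjoint)
  have nn: "(\<Sum>a\<in>X. \<Sum>b\<in>Y. \<Sum>c\<in>Z. ?t a b c) \<ge> 0" if "X \<subseteq> A \<union> B" "Y \<subseteq> A \<union> B" "Z \<subseteq> A \<union> B" for X Y Z
    by (intro sum_nonneg t0) (use that in blast)+
  have "(\<Sum>a\<in>A\<union>B. \<Sum>b\<in>A\<union>B. \<Sum>c\<in>A\<union>B. ?t a b c) =
      (\<Sum>a\<in>A. \<Sum>b\<in>A. \<Sum>c\<in>A. ?t a b c) + (\<Sum>a\<in>A. \<Sum>b\<in>A. \<Sum>c\<in>B. ?t a b c) +
      (\<Sum>a\<in>A. \<Sum>b\<in>B. \<Sum>c\<in>A. ?t a b c) + (\<Sum>a\<in>A. \<Sum>b\<in>B. \<Sum>c\<in>B. ?t a b c) +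
      (\<Sum>a\<in>B. \<Sum>b\<in>A. \<Sum>c\<in>A. ?t a b c) + (\<Sum>a\<in>B. \<Sum>b\<in>A. \<Sum>c\<in>B. ?t a b c) +
      (\<Sum>a\<in>B. \<Sum>b\<in>B. \<Sum>c\<in>A. ?t a b c) + (\<Sum>a\<in>B. \<Sum>b\<in>B. \<Sum>c\<in>B. ?t a b c)"
    by (simp add: split sum.distrib)
  moreover have "(\<Sum>a\<in>A. \<Sum>b\<in>A. \<Sum>c\<in>B. ?t a b c) \<ge> 0" "(\<Sum>a\<in>A. \<Sum>b\<in>B. \<Sum>c\<in>A. ?t a b c) \<ge> 0"
    "(\<Sum>a\<in>B. \<Sum>b\<in>A. \<Sum>c\<in>A. ?t a b c) \<ge> 0" "(\<Sum>a\<in>B. \<Sum>b\<in>B. \<Sum>c\<in>A. ?t a b c) \<ge> 0"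
    "(\<Sum>a\<in>B. \<Sum>b\<in>B. \<Sum>c\<in>B. ?t a b c) \<ge> 0"
    by (intro nn; blast)+
  moreover have "(\<Sum>a\<in>B. \<Sum>b\<in>A. \<Sum>c\<in>B. ?t a b c) = (\<Sum>a\<in>A. \<Sum>b\<in>B. \<Sum>c\<in>B. ?t a b c)"
    by (subst sum.swap) (simp add: sq1 mult.commute)
  moreover have "(\<Sum>a\<in>A. \<Sum>b\<in>B. \<Sum>c\<in>B. ?t a b c) \<ge> (\<Sum>a\<in>A. y a * (\<Sum>b\<in>B. \<Sum>c\<in>B. (N a b c)\<^sup>2))"
  proof (rule sum_mono)
    fix a assume a: "a \<in> A"
    have sw: "(\<Sum>b\<in>B. \<Sum>c\<in>B. ?t a b c) = (\<Sum>b\<in>B. \<Sum>c\<in>B. ?t a c b)" by (rule sum.swap)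
    have "2 * (y a * (\<Sum>b\<in>B. \<Sum>c\<in>B. (N a b c)\<^sup>2)) = (\<Sum>b\<in>B. \<Sum>c\<in>B. 2 * y a * (N a b c)\<^sup>2)"
      by (simp add: sum_distrib_left mult.assoc)
    also have "\<dots> \<le> (\<Sum>b\<in>B. \<Sum>c\<in>B. ?t a b c + ?t a c b)"
    proof (intro sum_mono)
      fix b c assume bc: "b \<in> B" "c \<in> B"
      have p: "y a > 0" "y b > 0" "y c > 0" using y a bc by auto
      have "(y b - y c)\<^sup>2 / (y b * y c) \<ge> 0" using p by simp
      moreover have "(y b - y c)\<^sup>2 / (y b * y c) = y b / y c + y c / y b - 2"
        using p by (simp add: field_simps power2_eq_square)
      ultimately have "2 \<le> y b / y c + y c / y b" by simp
      then have "2 * (y a * (N a b c)\<^sup>2) \<le> (y b / y c + y c / y b) * (y a * (N a b c)\<^sup>2)"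
        using p by (intro mult_right_mono) auto
      also have "\<dots> = ?t a b c + ?t a c b" using sq2[of a b c] by (simp add: algebra_simps)
      finally show "2 * y a * (N a b c)\<^sup>2 \<le> ?t a b c + ?t a c b" by (simp add: mult.assoc)
    qed
    also have "\<dots> = 2 * (\<Sum>b\<in>B. \<Sum>c\<in>B. ?t a b c)" unfolding sum.distrib using sw by linarith
    finally show "y a * (\<Sum>b\<in>B. \<Sum>c\<in>B. (N a b c)\<^sup>2) \<le> (\<Sum>b\<in>B. \<Sum>c\<in>B. ?t a b c)" by simp
  qed
  ultimately show ?thesis by linarith
qed

section \<open>Frames and inverse eigenvalues of invariant metrics\<close>

context hom_space
begin

text \<open>Inverse eigenvalues \<open>y\<close> are the parameters because they stay bounded. In
  the Killing sum a basis of \<open>k\<close> splits into the frame and \<open>F\<close>: pairs from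
  \<open>F\<close> contribute nothing, and mixed pairs occur twice, whence the factor 2.\<close>

lemma scal_frame:
  assumes k: "subalg k" and h: "inner_product_on (pp k) h"
    and A: "finite A" "inj_on e A" "orthonormal_basis Q (pp k) (e ` A)"
    and d: "\<And>a b. a \<in> A \<Longrightarrow> b \<in> A \<Longrightarrow> h (e a) (e b) = (if a = b then 1 / y a else 0)"
    and F: "orthonormal_basis Q hh F"
  shows "scal G Q k hh h = (1/2) * (\<Sum>a\<in>A. y a * ((\<Sum>b\<in>A. \<Sum>c\<in>A. (Q (br (e a) (e b)) (e c))\<^sup>2)
       + 2 * (\<Sum>b\<in>A. \<Sum>f\<in>F. (Q (br (e a) (e b)) f)\<^sup>2)))
     - (1/4) * (\<Sum>a\<in>A. \<Sum>b\<in>A. \<Sum>c\<in>A. y a * y b / y c * (Q (br (e a) (e b)) (e c))\<^sup>2)"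
    and "bilin_on (pp k) T \<Longrightarrow> metric_trace h (pp k) T = (\<Sum>a\<in>A. y a * T (e a) (e a))"
proof -
  let ?E = "e ` A"
  define x where "x = (\<lambda>v. 1 / y (inv_into A e v))"
  have xe: "x (e a) = 1 / y a" if "a \<in> A" for a using A(2) that by (simp add: x_def)
  have d': "h u v = (if u = v then x u else 0)" if uv: "u \<in> ?E" "v \<in> ?E" for u v
  proof -
    obtain a b where ab: "a \<in> A" "b \<in> A" "u = e a" "v = e b" using uv by blast
    then show ?thesis using d[OF ab(1,2)] xe inj_on_eq_iff[OF A(2) ab(1,2)] by simp
  qed
  have kl: "lie_subalgebra G k" using k subalg_def by blast
  have un: "orthonormal_basis Q k (?E \<union> F)" "?E \<inter> F = {}"
    using onb_union[OF hh_sub subalg_sub[OF k] subalg_hh[OF k] A(3)[unfolded pp_def] F] by auto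
  have hhp: "ip_space hh Q" by (rule Qsub[OF hh_sub])
  have finF: "finite F" by (rule ip_space.onb_finite[OF hhp F])
  have Fh: "f \<in> hh" if "f \<in> F" for f by (rule ip_space.onb_in[OF hhp F that])
  have Ep: "e a \<in> perp Q hh" if "a \<in> A" for a
    using A(3) that unfolding orthonormal_basis_def pp_def by blast
  have re: "(\<Sum>v\<in>?E. g v) = (\<Sum>a\<in>A. g (e a))" for g :: "'a \<Rightarrow> real"
    using sum.reindex[OF A(2)] by simp
  have inner: "(\<Sum>f\<in>?E \<union> F. \<Sum>g\<in>?E \<union> F. (Q (br (e a) f) g)\<^sup>2) =
      (\<Sum>b\<in>A. \<Sum>c\<in>A. (Q (br (e a) (e b)) (e c))\<^sup>2) + 2 * (\<Sum>b\<in>A. \<Sum>f\<in>F. (Q (br (e a) (e b)) f)\<^sup>2)"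
    if a: "a \<in> A" for a
  proof -
    have sp: "(\<Sum>v\<in>?E \<union> F. g v) = (\<Sum>b\<in>A. g (e b)) + (\<Sum>f\<in>F. g f)" for g :: "'a \<Rightarrow> real"
      using sum.union_disjoint[OF _ finF un(2), of g] A(1) re[of g] by simp
    have z: "Q (br (e a) f) g = 0" if "f \<in> F" "g \<in> F" for f g
    proof -
      have "br f g \<in> hh" by (rule subalg_br[OF subalg_hh_self Fh Fh]) fact+
      then have "Q (e a) (br f g) = 0" using Ep[OF a] unfolding perp_def by blast
      then show ?thesis using Q_cyc[of "e a" f g] Qsym by metis
    qed
    have "(\<Sum>f\<in>F. \<Sum>b\<in>A. (Q (br (e a) f) (e b))\<^sup>2) = (\<Sum>b\<in>A. \<Sum>f\<in>F. (Q (br (e a) (e b)) f)\<^sup>2)"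
    proof (subst sum.swap, intro sum.cong refl)
      fix b f
      show "(Q (br (e a) f) (e b))\<^sup>2 = (Q (br (e a) (e b)) f)\<^sup>2" using Q_swap23[of "e a" f "e b"] by simp
    qed
    then show ?thesis by (simp add: sp sum.distrib z)
  qed
  have "scal G Q k hh h = (1/2) * (\<Sum>v\<in>?E. (\<Sum>f\<in>?E \<union> F. \<Sum>g\<in>?E \<union> F. (Q (br v f) g)\<^sup>2) / x v)
     - (1/4) * (\<Sum>a\<in>?E. \<Sum>b\<in>?E. \<Sum>c\<in>?E. x c / (x a * x b) * (Q (br a b) c)\<^sup>2)"
    by (rule scal_diag[OF kl pp_def hh_sub h A(3) d' un(1)])
  also have "(\<Sum>v\<in>?E. (\<Sum>f\<in>?E \<union> F. \<Sum>g\<in>?E \<union> F. (Q (br v f) g)\<^sup>2) / x v) =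
     (\<Sum>a\<in>A. y a * ((\<Sum>b\<in>A. \<Sum>c\<in>A. (Q (br (e a) (e b)) (e c))\<^sup>2)
       + 2 * (\<Sum>b\<in>A. \<Sum>f\<in>F. (Q (br (e a) (e b)) f)\<^sup>2)))"
    unfolding re by (intro sum.cong refl) (simp add: inner xe mult.commute)
  also have "(\<Sum>a\<in>?E. \<Sum>b\<in>?E. \<Sum>c\<in>?E. x c / (x a * x b) * (Q (br a b) c)\<^sup>2) =
     (\<Sum>a\<in>A. \<Sum>b\<in>A. \<Sum>c\<in>A. y a * y b / y c * (Q (br (e a) (e b)) (e c))\<^sup>2)"
    unfolding re by (intro sum.cong refl) (simp add: xe mult.commute)
  finally show "scal G Q k hh h = (1/2) * (\<Sum>a\<in>A. y a * ((\<Sum>b\<in>A. \<Sum>c\<in>A. (Q (br (e a) (e b)) (e c))\<^sup>2)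
       + 2 * (\<Sum>b\<in>A. \<Sum>f\<in>F. (Q (br (e a) (e b)) f)\<^sup>2)))
     - (1/4) * (\<Sum>a\<in>A. \<Sum>b\<in>A. \<Sum>c\<in>A. y a * y b / y c * (Q (br (e a) (e b)) (e c))\<^sup>2)" .
  show "metric_trace h (pp k) T = (\<Sum>a\<in>A. y a * T (e a) (e a))" if T: "bilin_on (pp k) T"
    using metric_trace_diag[OF pp_sub[OF k] h A(3) d' T]
    unfolding re by (simp add: xe mult.commute)
qed

text \<open>The last clause encodes invariance in a form that survives limits: \<open>Ad\<close>
  links only frame vectors with equal eigenvalues. Numbering the frame makes frames of different
  subalgebras comparable.\<close>

lemma frame_exists:
  assumes k: "subalg k" and h: "h \<in> invariant_metrics G H (pp k)" and n: "dim (pp k) = n"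
  obtains e y where "inj_on e {..<n}" "orthonormal_basis Q (pp k) (e ` {..<n::nat})"
    "\<And>a. a < n \<Longrightarrow> y a > (0::real)"
    "\<And>a b. a < n \<Longrightarrow> b < n \<Longrightarrow> h (e a) (e b) = (if a = b then 1 / y a else 0)"
    "\<And>a b g. a < n \<Longrightarrow> b < n \<Longrightarrow> g \<in> H \<Longrightarrow> (y a - y b) * Q (Ad G g (e a)) (e b) = 0"
proof -
  have ip: "inner_product_on (pp k) h" and inv: "Ad_invariant_on G H (pp k) h"
    using h unfolding invariant_metrics_def by auto
  interpret h: ip_space "pp k" h using ip pp_sub[OF k] by unfold_locales
  interpret q: ip_space "pp k" Q by (rule Qsub[OF pp_sub[OF k]])
  have sb: "sym_bilinear_on (pp k) h" using ip inner_product_on_def by blast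
  obtain E where E: "orthonormal_basis Q (pp k) E" "\<And>e f. e \<in> E \<Longrightarrow> f \<in> E \<Longrightarrow> e \<noteq> f \<Longrightarrow> h e f = 0"
    using spectral_theorem[OF Qsub[OF pp_sub[OF k]] sb] by metis
  have "card E = n" using q.onb_card[OF E(1)] n by simp
  then obtain e where e: "bij_betw e {..<n} E"
    using ex_bij_betw_nat_finite[OF q.onb_finite[OF E(1)]] by (auto simp: atLeast0LessThan)
  have inj: "inj_on e {..<n}" and im: "e ` {..<n} = E" using e unfolding bij_betw_def by auto
  have eE: "e a \<in> E" if "a < n" for a using im that by blast
  have ep: "e a \<in> pp k" if "a < n" for a using q.onb_in[OF E(1) eE[OF that]] .
  define y where "y = (\<lambda>a. 1 / h (e a) (e a))"
  have hp: "h (e a) (e a) > 0" if "a < n" for a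
  proof -
    have "e a \<noteq> 0" using q.onb_eq[OF E(1) eE[OF that] eE[OF that]] Qzero_left by force
    then show ?thesis using h.pos[OF ep[OF that]] by blast
  qed
  have d: "h (e a) (e b) = (if a = b then 1 / y a else 0)" if ab: "a < n" "b < n" for a b
    using E(2)[OF eE[OF ab(1)] eE[OF ab(2)]] inj_on_eq_iff[OF inj, of a b] ab by (auto simp: y_def)
  have hQ: "h (e a) x = Q x (e a) / y a" if a: "a < n" and x: "x \<in> pp k" for a x
  proof -
    have "h (e a) x = h (e a) (\<Sum>v\<in>E. Q x v *\<^sub>R v)" using q.onb_expand[OF E(1) x] by simp
    also have "\<dots> = (\<Sum>v\<in>E. Q x v * h (e a) v)" by (rule h.sum_right) (use q.onb_in[OF E(1)] ep[OF a] in auto)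
    also have "\<dots> = (\<Sum>v\<in>E. if v = e a then Q x (e a) * h (e a) (e a) else 0)"
      using E(2)[OF eE[OF a]] by (intro sum.cong refl) auto
    also have "\<dots> = Q x (e a) / y a" using q.onb_finite[OF E(1)] eE[OF a] by (simp add: y_def)
    finally show ?thesis .
  qed
  have "(y a - y b) * Q (Ad G g (e a)) (e b) = 0" if ab: "a < n" "b < n" and g: "g \<in> H" for a b g
  proof -
    have gc: "g \<in> carrier G" and gi: "inv g \<in> H" using H_car[OF g] subgroup.m_inv_closed[OF H_sub g] by auto
    have Aa: "Ad G g (e a) \<in> pp k" and Ab: "Ad G (inv g) (e b) \<in> pp k" using pp_Ad[OF k] g gi ep ab by auto
    have "h (e b) (Ad G g (e a)) = h (Ad G g (e a)) (e b)" using h.symm Aa ep ab by blast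
    also have "\<dots> = h (Ad G g (e a)) (Ad G g (Ad G (inv g) (e b)))" by (simp add: Ad_inv_cancel[OF gc])
    also have "\<dots> = h (e a) (Ad G (inv g) (e b))" using inv g ep[OF ab(1)] Ab unfolding Ad_invariant_on_def by blast
    finally have "Q (Ad G g (e a)) (e b) / y b = Q (Ad G (inv g) (e b)) (e a) / y a"
      using hQ[OF ab(2) Aa] hQ[OF ab(1) Ab] by simp
    moreover have "Q (Ad G (inv g) (e b)) (e a) = Q (Ad G g (e a)) (e b)"
      using Q_Ad[OF gc, of "Ad G (inv g) (e b)" "e a"] Ad_inv_cancel[OF gc] Qsym by metis
    ultimately have "Q (Ad G g (e a)) (e b) / y b = Q (Ad G g (e a)) (e b) / y a" by simp
    moreover have "y a > 0" "y b > 0" using hp ab by (auto simp: y_def)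
    ultimately show ?thesis by (simp add: field_simps) algebra
  qed
  moreover have "y a > 0" if "a < n" for a using hp[OF that] by (simp add: y_def)
  ultimately show thesis using that[of e y] inj E(1) im d by blast
qed

lemma br_bounded_bilinear: "bounded_bilinear br"
  unfolding bilinear_conv_bounded_bilinear[symmetric] bilinear_def
  using bracket_linear_left bracket_linear_right by blast

text \<open>Converse to the last clause of \<open>frame_exists\<close>: a form that is diagonal in
  an orthonormal basis of an invariant metric is invariant as soon as \<open>Ad\<close> does not mix
  its eigenspaces.\<close>

lemma diagonal_metric:
  assumes V: "subspace V" and AdV: "\<And>a v. a \<in> H \<Longrightarrow> v \<in> V \<Longrightarrow> Ad G a v \<in> V"
    and g: "g \<in> invariant_metrics G H V" and E: "orthonormal_basis g V E" and x: "\<And>e. e \<in> E \<Longrightarrow> x e > 0"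
    and com: "\<And>a b k. a \<in> E \<Longrightarrow> b \<in> E \<Longrightarrow> k \<in> H \<Longrightarrow> (x a - x b) * g (Ad G k a) b = 0"
  defines "h \<equiv> (\<lambda>u w. \<Sum>e\<in>E. x e * (g u e * g w e))"
  shows "h \<in> invariant_metrics G H V"
    and "\<And>a b. a \<in> E \<Longrightarrow> b \<in> E \<Longrightarrow> h a b = (if a = b then x a else 0)"
proof -
  have gip: "inner_product_on V g" and ginv: "Ad_invariant_on G H V g"
    using g unfolding invariant_metrics_def by auto
  interpret g: ip_space V g using V gip by unfold_locales
  have Em: "e \<in> V" if "e \<in> E" for e by (rule g.onb_in[OF E that])
  note fin = g.onb_finite[OF E]
  show "h a b = (if a = b then x a else 0)" if ab: "a \<in> E" "b \<in> E" for a b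
  proof -
    have "h a b = (\<Sum>e\<in>E. if e = a then x e * g b e else 0)"
      unfolding h_def using g.onb_eq[OF E] ab by (intro sum.cong refl) auto
    then show ?thesis using fin ab g.onb_eq[OF E ab(2,1)] by simp
  qed
  have sb: "sym_bilinear_on V h"
    unfolding sym_bilinear_on_def
  proof (intro conjI ballI allI)
    fix u w assume uw: "u \<in> V" "w \<in> V"
    show "h u w = h w u" unfolding h_def by (simp add: mult.commute)
    show "h (r *\<^sub>R u) w = r * h u w" for r
      unfolding h_def sum_distrib_left using uw Em
      by (intro sum.cong refl) (simp add: g.scale_left)
    show "h (u + w) z = h u z + h w z" if "z \<in> V" for z
      unfolding h_def sum.distrib[symmetric] using uw Em
      by (intro sum.cong refl) (simp add: g.add_left algebra_simps)
  qed
  have pd: "pos_def_on V h"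
    unfolding pos_def_on_def
  proof (intro ballI impI)
    fix u assume u: "u \<in> V" "u \<noteq> 0"
    have "\<exists>a\<in>E. g u a \<noteq> 0"
    proof (rule ccontr)
      assume "\<not> ?thesis"
      then have "(\<Sum>e\<in>E. g u e *\<^sub>R e) = 0" by (intro sum.neutral) auto
      then show False using g.onb_expand[OF E u(1)] u(2) by simp
    qed
    then obtain a where a: "a \<in> E" "g u a \<noteq> 0" by blast
    have "0 < g u a * g u a" using a(2) by (metis not_real_square_gt_zero)
    then have "0 < x a * (g u a * g u a)" using x[OF a(1)] by simp
    also have "\<dots> \<le> h u u"
      unfolding h_def
    proof (rule member_le_sum[where f="\<lambda>e. x e * (g u e * g u e)"])
      show "0 \<le> x e * (g u e * g u e)" if "e \<in> E - {a}" for e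
        using x[of e] that by (intro mult_nonneg_nonneg[OF less_imp_le zero_le_square]) auto
    qed (use a fin in auto)
    finally show "h u u > 0" .
  qed
  have "Ad_invariant_on G H V h"
    unfolding Ad_invariant_on_def
  proof (intro ballI)
    fix k u w assume k: "k \<in> H" and u: "u \<in> V" and w: "w \<in> V"
    note lin = Ad_linear[OF H_car[OF k]]
    \<comment> \<open>The image of \<open>u\<close> under the operator that represents
      \<open>h\<close> with respect to \<open>g\<close>, so that \<open>h u w = g D w\<close>. The
      fact \<open>key\<close> says that this operator commutes with \<open>Ad G k\<close>.\<close>
    define D where "D = (\<Sum>b\<in>E. (x b * g u b) *\<^sub>R b)"
    have DV: "D \<in> V" unfolding D_def by (intro subspace_sum V subspace_scale Em)
    have gA: "g (Ad G k (\<Sum>b\<in>E. c b *\<^sub>R b)) z = (\<Sum>b\<in>E. c b * g (Ad G k b) z)" if z: "z \<in> V" for c z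
    proof -
      have "Ad G k (\<Sum>b\<in>E. c b *\<^sub>R b) = (\<Sum>b\<in>E. c b *\<^sub>R Ad G k b)"
        by (simp add: linear_sum[OF lin] linear_scale[OF lin])
      then show ?thesis using g.sum_left[of E "Ad G k" z c] AdV[OF k] Em z by simp
    qed
    have key: "g (Ad G k D) a = x a * g (Ad G k u) a" if a: "a \<in> E" for a
    proof -
      have "g (Ad G k u) a = g (Ad G k (\<Sum>b\<in>E. g u b *\<^sub>R b)) a" using g.onb_expand[OF E u] by simp
      also have "\<dots> = (\<Sum>b\<in>E. g u b * g (Ad G k b) a)" by (rule gA[OF Em[OF a]])
      finally have "x a * g (Ad G k u) a = (\<Sum>b\<in>E. x a * (g u b * g (Ad G k b) a))"
        by (simp add: sum_distrib_left)
      also have "\<dots> = (\<Sum>b\<in>E. (x b * g u b) * g (Ad G k b) a)"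
      proof (intro sum.cong refl)
        fix b assume b: "b \<in> E"
        show "x a * (g u b * g (Ad G k b) a) = (x b * g u b) * g (Ad G k b) a"
          using com[OF b a k] by auto
      qed
      also have "\<dots> = g (Ad G k D) a" unfolding D_def by (rule gA[OF Em[OF a], symmetric])
      finally show ?thesis by simp
    qed
    have "h (Ad G k u) (Ad G k w) = (\<Sum>a\<in>E. g (Ad G k D) a * g (Ad G k w) a)"
      unfolding h_def by (intro sum.cong refl) (simp add: key)
    also have "\<dots> = g (Ad G k D) (Ad G k w)"
      using g.parseval[OF E AdV[OF k DV] AdV[OF k w]] by simp
    also have "\<dots> = g D w" using ginv k DV w unfolding Ad_invariant_on_def by blast
    also have "\<dots> = (\<Sum>b\<in>E. (x b * g u b) * g b w)" unfolding D_def by (rule g.sum_left) (use Em w in auto)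
    also have "\<dots> = h u w"
      unfolding h_def using g.symm[OF Em w] by (intro sum.cong refl) simp
    finally show "h (Ad G k u) (Ad G k w) = h u w" .
  qed
  then show "h \<in> invariant_metrics G H V"
    unfolding invariant_metrics_def inner_product_on_def using sb pd by blast
qed

lemma sum_frame_metric:
  assumes A: "finite A" and e: "\<And>a b. a \<in> A \<Longrightarrow> b \<in> A \<Longrightarrow> Q (e a) (e b) = (if a = b then 1 else 0)"
    and y: "\<And>a. a \<in> A \<Longrightarrow> y a > 0"
    and inv: "\<And>a g. a \<in> A \<Longrightarrow> g \<in> H \<Longrightarrow> Ad G g (e a) \<in> span (e ` A)"
    and com: "\<And>a b g. a \<in> A \<Longrightarrow> b \<in> A \<Longrightarrow> g \<in> H \<Longrightarrow> (y a - y b) * Q (Ad G g (e a)) (e b) = 0"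
  obtains h where "h \<in> invariant_metrics G H (span (e ` A))"
    "\<And>a b. a \<in> A \<Longrightarrow> b \<in> A \<Longrightarrow> h (e a) (e b) = (if a = b then 1 / y a else 0)"
    "orthonormal_basis Q (span (e ` A)) (e ` A)" "inj_on e A"
proof -
  let ?V = "span (e ` A)"
  have inj: "inj_on e A" using e by (metis inj_onI zero_neq_one)
  have onb: "orthonormal_basis Q ?V (e ` A)"
    unfolding orthonormal_basis_def using e inj by (auto intro: span_base simp: inj_on_def)
  define x where "x = (\<lambda>v. 1 / y (inv_into A e v))"
  have xe: "x (e a) = 1 / y a" if "a \<in> A" for a using inj that by (simp add: x_def)
  have AdV: "Ad G g v \<in> ?V" if g: "g \<in> H" and v: "v \<in> ?V" for g v
  proof -
    have "subspace (Ad G g -` ?V)" by (rule linear_subspace_vimage[OF Ad_linear[OF H_car[OF g]] subspace_span])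
    then have "?V \<subseteq> Ad G g -` ?V" using inv[OF _ g] by (intro span_minimal) auto
    then show ?thesis using v by blast
  qed
  have QV: "Q \<in> invariant_metrics G H ?V"
    unfolding invariant_metrics_def Ad_invariant_on_def
    using inner_product_on_subset[OF Q subset_UNIV] Q_Ad[OF H_car] by blast
  have x: "x v > 0" if "v \<in> e ` A" for v using that xe y by auto
  have xcom: "(x u - x v) * Q (Ad G g u) v = 0" if uv: "u \<in> e ` A" "v \<in> e ` A" and g: "g \<in> H" for u v g
  proof -
    obtain a b where ab: "a \<in> A" "b \<in> A" "u = e a" "v = e b" using uv by blast
    then show ?thesis using com[OF ab(1,2) g] xe by auto
  qed
  note D = diagonal_metric[OF subspace_span AdV QV onb x xcom]
  show thesis
  proof (rule that[OF _ _ onb inj])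
    show "(\<lambda>u w. \<Sum>v\<in>e ` A. x v * (Q u v * Q w v)) \<in> invariant_metrics G H ?V" by (rule D(1)) auto
    show "(\<Sum>v\<in>e ` A. x v * (Q (e a) v * Q (e b) v)) = (if a = b then 1 / y a else 0)"
      if "a \<in> A" "b \<in> A" for a b
      using D(2)[of "e a" "e b"] that xe inj_on_eq_iff[OF inj] by auto
  qed
qed

text \<open>The directions with \<open>Y a > 0\<close> span the tangent space of the limit. The
  lower bound \<open>s\<close> makes it, together with \<open>hh\<close>, closed under brackets, and
  \<open>structure_sum_bound\<close> compares \<open>L\<close> with the limit scalar curvature. The
  clause on \<open>W\<close> confines the limit to subspaces containing all
  \<open>k i\<close>.\<close>

lemma limit_core:
  fixes e :: "nat \<Rightarrow> nat \<Rightarrow> 'a" and y :: "nat \<Rightarrow> nat \<Rightarrow> real" and E :: "nat \<Rightarrow> 'a" and Y :: "nat \<Rightarrow> real"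
  assumes k: "\<And>i. subalg (k i)" and h: "\<And>i. h i \<in> invariant_metrics G H (pp (k i))"
    and inj: "\<And>i. inj_on (e i) {..<n}" and onb: "\<And>i. orthonormal_basis Q (pp (k i)) (e i ` {..<n})"
    and y: "\<And>i a. a < n \<Longrightarrow> y i a > 0"
    and diag: "\<And>i a b. a < n \<Longrightarrow> b < n \<Longrightarrow> h i (e i a) (e i b) = (if a = b then 1 / y i a else 0)"
    and com: "\<And>i a b g. a < n \<Longrightarrow> b < n \<Longrightarrow> g \<in> H \<Longrightarrow> (y i a - y i b) * Q (Ad G g (e i a)) (e i b) = 0"
    and limE: "\<And>a. a < n \<Longrightarrow> (\<lambda>i. e i a) \<longlonglongrightarrow> E a" and limY: "\<And>a. a < n \<Longrightarrow> (\<lambda>i. y i a) \<longlonglongrightarrow> Y a"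
    and T: "sym_bilinear_on (perp Q hh) T"
    and tr: "\<And>i. metric_trace (h i) (pp (k i)) T = 1"
    and s: "\<And>i. scal G Q (k i) hh (h i) \<ge> s"
    and L: "(\<lambda>i. ereal (scal G Q (k i) hh (h i))) \<longlonglongrightarrow> L"
  obtains k' h' where "subalg k'" "hh \<subset> k'" "dim (pp k') \<le> n"
    "\<And>W. subspace W \<Longrightarrow> (\<And>i. k i \<subseteq> W) \<Longrightarrow> k' \<subseteq> W"
    "h' \<in> invariant_metrics G H (pp k')" "metric_trace h' (pp k') T = 1" "L \<le> ereal (scal G Q k' hh h')"
proof -
  obtain T' where T': "bounded_bilinear T'" "\<And>x y. x \<in> perp Q hh \<Longrightarrow> y \<in> perp Q hh \<Longrightarrow> T' x y = T x y"
    using sym_bilinear_on_extend[OF T subspace_perp] by metis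
  note Tbil = sym_bilinear_imp_bilin[OF T subspace_perp]
  interpret hq: ip_space hh Q by (rule Qsub[OF hh_sub])
  obtain F where F: "orthonormal_basis Q hh F" by (rule hq.onb_exists)
  have finF: "finite F" by (rule hq.onb_finite[OF F])
  have ip: "inner_product_on (pp (k i)) (h i)" for i using h unfolding invariant_metrics_def by blast
  have epp: "e i a \<in> pp (k i)" if "a < n" for i a
    using onb[of i] that unfolding orthonormal_basis_def by blast
  have eperp: "e i a \<in> perp Q hh" if "a < n" for i a using epp[OF that] unfolding pp_def by blast
  have eQ: "Q (e i a) (e i b) = (if a = b then 1 else 0)" if "a < n" "b < n" for i a b
    using onb[of i] that inj_on_eq_iff[OF inj[of i], of a b] unfolding orthonormal_basis_def by auto
  let ?N = "\<lambda>i a b c. Q (br (e i a) (e i b)) (e i c)"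
  let ?M = "\<lambda>i a b f. Q (br (e i a) (e i b)) f"
  let ?NE = "\<lambda>a b c. Q (br (E a) (E b)) (E c)"
  let ?ME = "\<lambda>a b f. Q (br (E a) (E b)) f"
  have limbr: "(\<lambda>i. br (e i a) (e i b)) \<longlonglongrightarrow> br (E a) (E b)" if "a < n" "b < n" for a b
    by (rule bounded_bilinear.tendsto[OF br_bounded_bilinear limE[OF that(1)] limE[OF that(2)]])
  have limN: "(\<lambda>i. ?N i a b c) \<longlonglongrightarrow> ?NE a b c" if "a < n" "b < n" "c < n" for a b c
    by (rule bounded_bilinear.tendsto[OF Qbounded_bilinear limbr[OF that(1,2)] limE[OF that(3)]])
  have limM: "(\<lambda>i. ?M i a b f) \<longlonglongrightarrow> ?ME a b f" if "a < n" "b < n" for a b f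
    by (rule bounded_bilinear.tendsto[OF Qbounded_bilinear limbr[OF that] tendsto_const])
  define S where "S = (\<lambda>i. scal G Q (k i) hh (h i))"
  define V where "V = (\<lambda>i. \<Sum>a<n. y i a * ((\<Sum>b<n. \<Sum>c<n. (?N i a b c)\<^sup>2) + 2 * (\<Sum>b<n. \<Sum>f\<in>F. (?M i a b f)\<^sup>2)))"
  define VE where "VE = (\<Sum>a<n. Y a * ((\<Sum>b<n. \<Sum>c<n. (?NE a b c)\<^sup>2) + 2 * (\<Sum>b<n. \<Sum>f\<in>F. (?ME a b f)\<^sup>2)))"
  define C where "C = (\<lambda>i. \<Sum>a<n. \<Sum>b<n. \<Sum>c<n. y i a * y i b / y i c * (?N i a b c)\<^sup>2)"
  have SVC: "S i = (1/2) * V i - (1/4) * C i" for i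
    unfolding S_def V_def C_def
    by (rule scal_frame(1)[OF k ip finite_lessThan inj onb _ F]) (simp add: diag)
  have trF: "(\<Sum>a<n. y i a * T (e i a) (e i a)) = 1" for i
    using scal_frame(2)[OF k ip finite_lessThan inj onb _ F, of i "y i" T] diag tr[of i]
      bilin_on_subset[OF Tbil, of "pp (k i)"] unfolding pp_def by simp
  have limV: "V \<longlonglongrightarrow> VE"
    unfolding V_def VE_def
    by (intro tendsto_sum tendsto_mult tendsto_add tendsto_power tendsto_const limN limM limY) auto
  \<comment> \<open>The complementary set \<open>B\<close> collects the directions in which the
    metrics blow up; there \<open>Y\<close> vanishes, being a nonnegative limit that is not
    positive.\<close>
  define A where "A = {a. a < n \<and> Y a > 0}"
  define B where "B = {a. a < n \<and> \<not> Y a > 0}"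
  have AB: "finite A" "finite B" "A \<inter> B = {}" "A \<union> B = {..<n}" by (auto simp: A_def B_def)
  have An: "a < n" "Y a > 0" if "a \<in> A" for a using that by (auto simp: A_def)
  have Bn: "a < n" "Y a = 0" if "a \<in> B" for a
  proof -
    show an: "a < n" using that by (simp add: B_def)
    have "Y a \<ge> 0" by (rule LIMSEQ_le_const[OF limY[OF an]]) (use y[OF an] less_imp_le in blast)
    then show "Y a = 0" using that by (simp add: B_def)
  qed
  have Cnn: "0 \<le> y i a * y i b / y i c * (?N i a b c)\<^sup>2" if "a < n" "b < n" "c < n" for i a b c
    using y[OF that(1)] y[OF that(2)] y[OF that(3)] by (simp add: less_imp_le)
  have term_le: "y i a * y i b / y i c * (?N i a b c)\<^sup>2 \<le> C i" if abc: "a < n" "b < n" "c < n" for i a b c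
  proof -
    have "y i a * y i b / y i c * (?N i a b c)\<^sup>2 \<le> (\<Sum>c<n. y i a * y i b / y i c * (?N i a b c)\<^sup>2)"
      using abc Cnn by (intro member_le_sum) auto
    also have "\<dots> \<le> (\<Sum>b<n. \<Sum>c<n. y i a * y i b / y i c * (?N i a b c)\<^sup>2)"
      using abc Cnn by (intro member_le_sum[where f="\<lambda>b. \<Sum>c<n. y i a * y i b / y i c * (?N i a b c)\<^sup>2"] sum_nonneg) auto
    also have "\<dots> \<le> C i"
      unfolding C_def
      using abc Cnn by (intro member_le_sum[where f="\<lambda>a. \<Sum>b<n. \<Sum>c<n. y i a * y i b / y i c * (?N i a b c)\<^sup>2"] sum_nonneg) auto
    finally show ?thesis .
  qed
  \<comment> \<open>From S = V/2 - C/4 and S >= s follows C <= 2V - 4s, and V converges. A term of C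
    with \<open>c\<close> in \<open>B\<close> has the divisor \<open>y i c\<close> tending to 0, so
    the limit of its numerator must be 0.\<close>
  have N0: "?NE a b c = 0" if abc: "a \<in> A" "b \<in> A" "c \<in> B" for a b c
  proof -
    have lt: "a < n" "b < n" "c < n" using An Bn abc by auto
    have "y i a * y i b * (?N i a b c)\<^sup>2 \<le> (2 * V i - 4 * s) * y i c" for i
    proof -
      have "C i \<le> 2 * V i - 4 * s" using SVC[of i] s[of i] unfolding S_def by linarith
      then have "y i a * y i b / y i c * (?N i a b c)\<^sup>2 \<le> 2 * V i - 4 * s"
        using term_le[OF lt, of i] by linarith
      then have "y i a * y i b / y i c * (?N i a b c)\<^sup>2 * y i c \<le> (2 * V i - 4 * s) * y i c"
        using y[OF lt(3), of i] by (intro mult_right_mono) auto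
      then show ?thesis using y[OF lt(3), of i] by simp
    qed
    moreover have "(\<lambda>i. y i a * y i b * (?N i a b c)\<^sup>2) \<longlonglongrightarrow> Y a * Y b * (?NE a b c)\<^sup>2"
      by (intro tendsto_mult tendsto_power limN limY lt)
    moreover have "(\<lambda>i. (2 * V i - 4 * s) * y i c) \<longlonglongrightarrow> (2 * VE - 4 * s) * Y c"
      by (intro tendsto_mult tendsto_diff tendsto_const limV limY lt)
    ultimately have "Y a * Y b * (?NE a b c)\<^sup>2 \<le> (2 * VE - 4 * s) * Y c"
      using LIMSEQ_le by blast
    then have "Y a * Y b * (?NE a b c)\<^sup>2 \<le> 0" using Bn(2)[OF abc(3)] by simp
    moreover have pos: "Y a * Y b > 0" using An abc by simp
    ultimately show ?thesis using mult_pos_pos[OF pos, of "(?NE a b c)\<^sup>2"] by (metis not_le zero_less_power2)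
  qed
  have EQ: "Q (E a) (E b) = (if a = b then 1 else 0)" if ab: "a < n" "b < n" for a b
  proof -
    have "(\<lambda>i. Q (e i a) (e i b)) \<longlonglongrightarrow> Q (E a) (E b)"
      by (rule bounded_bilinear.tendsto[OF Qbounded_bilinear limE[OF ab(1)] limE[OF ab(2)]])
    then show ?thesis unfolding eQ[OF ab] by (rule LIMSEQ_unique[OF _ tendsto_const])
  qed
  have in_sub: "E a \<in> W" if W: "subspace W" "\<And>i. e i a \<in> W" and a: "a < n" for W a
    using closed_sequentially[OF closed_subspace[OF W(1)] W(2) limE[OF a]] .
  have Eperp: "E a \<in> perp Q hh" if "a < n" for a by (rule in_sub[OF subspace_perp eperp]) fact+
  have EF: "Q (E a) f = 0" if "a < n" "f \<in> F" for a f
    using Eperp[OF that(1)] hq.onb_in[OF F that(2)] unfolding perp_def by blast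
  have expand: "x = (\<Sum>c<n. Q x (e i c) *\<^sub>R e i c) + (\<Sum>f\<in>F. Q x f *\<^sub>R f)" if x: "x \<in> k i" for x i
  proof -
    interpret ki: ip_space "k i" Q by (rule Qsub[OF subalg_sub[OF k]])
    note un = onb_union[OF hh_sub subalg_sub[OF k] subalg_hh[OF k] onb[of i, unfolded pp_def] F]
    have "x = (\<Sum>v\<in>e i ` {..<n} \<union> F. Q x v *\<^sub>R v)" using ki.onb_expand[OF un(1) x] by simp
    also have "\<dots> = (\<Sum>v\<in>e i ` {..<n}. Q x v *\<^sub>R v) + (\<Sum>f\<in>F. Q x f *\<^sub>R f)"
      by (rule sum.union_disjoint) (use finF un(2) in auto)
    also have "(\<Sum>v\<in>e i ` {..<n}. Q x v *\<^sub>R v) = (\<Sum>c<n. Q x (e i c) *\<^sub>R e i c)"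
      using sum.reindex[OF inj[of i]] by simp
    finally show ?thesis .
  qed
  \<comment> \<open>The spaces \<open>k i\<close> move, but expansions in their orthonormal bases
    converge. A limit of elements of \<open>k i\<close> is therefore spanned by the limit frame and
    \<open>F\<close>.\<close>
  have lim_expand: "x = (\<Sum>c<n. Q x (E c) *\<^sub>R E c) + (\<Sum>f\<in>F. Q x f *\<^sub>R f)"
    if x: "\<And>i. xi i \<in> k i" "xi \<longlonglongrightarrow> x" for x xi
  proof -
    have "(\<lambda>i. (\<Sum>c<n. Q (xi i) (e i c) *\<^sub>R e i c) + (\<Sum>f\<in>F. Q (xi i) f *\<^sub>R f)) \<longlonglongrightarrow>
       (\<Sum>c<n. Q x (E c) *\<^sub>R E c) + (\<Sum>f\<in>F. Q x f *\<^sub>R f)"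
      by (intro tendsto_add tendsto_sum tendsto_scaleR bounded_bilinear.tendsto[OF Qbounded_bilinear] limE x(2) tendsto_const) auto
    then have "xi \<longlonglongrightarrow> (\<Sum>c<n. Q x (E c) *\<^sub>R E c) + (\<Sum>f\<in>F. Q x f *\<^sub>R f)"
      using expand[OF x(1)] by simp
    then show ?thesis using x(2) LIMSEQ_unique by blast
  qed
  have splitn: "(\<Sum>c<n. g c) = (\<Sum>c\<in>A. g c) + (\<Sum>c\<in>B. g c)" for g :: "nat \<Rightarrow> 'b::comm_monoid_add"
    using sum.union_disjoint[OF AB(1,2,3), of g] unfolding AB(4) .
  define p where "p = span (E ` A)"
  define k' where "k' = {u + v | u v. u \<in> hh \<and> v \<in> p}"
  have ps: "subspace p" unfolding p_def by (rule subspace_span)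
  have k's: "subspace k'" unfolding k'_def by (rule subspace_sums[OF hh_sub ps])
  have pk: "p \<subseteq> k'" unfolding k'_def using subspace_0[OF hh_sub] by force
  have hk: "hh \<subseteq> k'" unfolding k'_def using subspace_0[OF ps] by force
  have Ep: "E a \<in> p" if "a \<in> A" for a unfolding p_def using that by (intro span_base) blast
  have pperp: "p \<subseteq> perp Q hh"
    unfolding p_def using Eperp An by (intro span_minimal subspace_perp) auto
  have Fk: "(\<Sum>f\<in>F. c f *\<^sub>R f) \<in> hh" for c
    by (intro subspace_sum hh_sub subspace_scale hq.onb_in[OF F])
  have Ap: "(\<Sum>a\<in>A. c a *\<^sub>R E a) \<in> p" for c
    by (intro subspace_sum ps subspace_scale Ep)
  have brE: "br (E a) (E b) \<in> k'" if ab: "a \<in> A" "b \<in> A" for a b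
  proof -
    have "br (e i a) (e i b) \<in> k i" for i
      using subalg_br[OF k] epp An ab unfolding pp_def by blast
    then have "br (E a) (E b) = (\<Sum>c<n. ?NE a b c *\<^sub>R E c) + (\<Sum>f\<in>F. ?ME a b f *\<^sub>R f)"
      by (rule lim_expand) (intro limbr An ab)
    also have "(\<Sum>c<n. ?NE a b c *\<^sub>R E c) = (\<Sum>c\<in>A. ?NE a b c *\<^sub>R E c)"
      unfolding splitn using N0[OF ab] by simp
    finally have "br (E a) (E b) = (\<Sum>f\<in>F. ?ME a b f *\<^sub>R f) + (\<Sum>c\<in>A. ?NE a b c *\<^sub>R E c)"
      by (simp only: add.commute)
    then show ?thesis unfolding k'_def using Fk[of "?ME a b"] Ap[of "?NE a b"] by blast
  qed
  have comE: "(Y a - Y b) * Q (Ad G g (E a)) (E b) = 0" if ab: "a < n" "b < n" and g: "g \<in> H" for a b g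
  proof -
    have bl: "bounded_linear (Ad G g)" using Ad_linear[OF H_car[OF g]] linear_conv_bounded_linear by blast
    have "(\<lambda>i. (y i a - y i b) * Q (Ad G g (e i a)) (e i b)) \<longlonglongrightarrow> (Y a - Y b) * Q (Ad G g (E a)) (E b)"
      by (rule tendsto_mult[OF tendsto_diff[OF limY[OF ab(1)] limY[OF ab(2)]]
            bounded_bilinear.tendsto[OF Qbounded_bilinear bounded_linear.tendsto[OF bl limE[OF ab(1)]] limE[OF ab(2)]]])
    then have "(\<lambda>i. 0) \<longlonglongrightarrow> (Y a - Y b) * Q (Ad G g (E a)) (E b)" using com[OF ab g] by simp
    then show ?thesis by (rule LIMSEQ_unique[OF _ tendsto_const])
  qed
  \<comment> \<open>For \<open>c\<close> in \<open>B\<close>, \<open>comE\<close> reads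
    \<open>Y a * Q (Ad G g (E a)) (E c) = 0\<close> with \<open>Y a > 0\<close>; hence
    \<open>Ad\<close> does not mix surviving and vanishing directions.\<close>
  have AdE: "Ad G g (E a) \<in> p" if a: "a \<in> A" and g: "g \<in> H" for a g
  proof -
    have bl: "bounded_linear (Ad G g)" using Ad_linear[OF H_car[OF g]] linear_conv_bounded_linear by blast
    have an: "a < n" by (rule An(1)[OF a])
    have Ai: "Ad G g (e i a) \<in> k i" for i using Ad_H_preserves(1)[OF k g] epp[OF an] unfolding pp_def by blast
    have "Ad G g (E a) = (\<Sum>c<n. Q (Ad G g (E a)) (E c) *\<^sub>R E c) + (\<Sum>f\<in>F. Q (Ad G g (E a)) f *\<^sub>R f)"
      by (rule lim_expand[OF Ai]) (rule bounded_linear.tendsto[OF bl limE[OF an]])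
    moreover have "Q (Ad G g (E a)) f = 0" if "f \<in> F" for f
      using Ad_H_preserves(2)[OF subalg_hh_self g Eperp[OF an]] hq.onb_in[OF F that] unfolding perp_def by blast
    moreover have "Q (Ad G g (E a)) (E c) = 0" if c: "c \<in> B" for c
      using comE[OF an Bn(1)[OF c] g] An(2)[OF a] Bn(2)[OF c] by simp
    ultimately have "Ad G g (E a) = (\<Sum>c\<in>A. Q (Ad G g (E a)) (E c) *\<^sub>R E c)" by (simp add: splitn)
    then show ?thesis using Ap by metis
  qed
  have Adp: "Ad G g x \<in> p" if g: "g \<in> H" and x: "x \<in> p" for g x
  proof -
    have "subspace (Ad G g -` p)" by (rule linear_subspace_vimage[OF Ad_linear[OF H_car[OF g]] ps])
    then have "span (E ` A) \<subseteq> Ad G g -` p" using AdE[OF _ g] by (intro span_minimal) auto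
    then show ?thesis using x unfolding p_def by blast
  qed
  have hp: "br u v \<in> p" if "u \<in> hh" "v \<in> p" for u v
    by (rule bracket_in_invariant[OF ps Adp that])
  have hhh: "br u v \<in> hh" if "u \<in> hh" "v \<in> hh" for u v by (rule subalg_br[OF subalg_hh_self that])
  have ppk: "br u v \<in> k'" if u: "u \<in> p" and v: "v \<in> p" for u v
  proof -
    have 1: "br (E a) v \<in> k'" if a: "a \<in> A" for a
    proof -
      have "subspace ((\<lambda>v. br (E a) v) -` k')" by (rule linear_subspace_vimage[OF bracket_linear_right k's])
      then have "span (E ` A) \<subseteq> (\<lambda>v. br (E a) v) -` k'" using brE[OF a] by (intro span_minimal) auto
      then show ?thesis using v unfolding p_def by blast
    qed
    have "subspace ((\<lambda>u. br u v) -` k')" by (rule linear_subspace_vimage[OF bracket_linear_left k's])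
    then have "span (E ` A) \<subseteq> (\<lambda>u. br u v) -` k'" using 1 by (intro span_minimal) auto
    then show ?thesis using u unfolding p_def by blast
  qed
  have sub': "subalg k'"
    unfolding subalg_def lie_subalgebra_def
  proof (intro conjI ballI k's hk)
    fix x z assume "x \<in> k'" "z \<in> k'"
    then obtain u v u' v' where uv: "x = u + v" "z = u' + v'" "u \<in> hh" "v \<in> p" "u' \<in> hh" "v' \<in> p"
      unfolding k'_def by blast
    have "br u u' \<in> k'" "br u v' \<in> k'" "br v v' \<in> k'" using hhh hp ppk uv hk pk by blast+
    moreover have "br v u' \<in> k'"
      using hp[OF uv(5,4)] pk br_skew[of v u'] subspace_neg[OF k's] by auto
    ultimately show "br x z \<in> k'"
      unfolding uv(1,2) by (simp add: br_add_left br_add_right subspace_add[OF k's])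
  qed
  have pp': "pp k' = p"
  proof
    show "p \<subseteq> pp k'" unfolding pp_def using pk pperp by blast
    show "pp k' \<subseteq> p"
    proof
      fix x assume "x \<in> pp k'"
      then obtain u v where uv: "x = u + v" "u \<in> hh" "v \<in> p" "x \<in> perp Q hh" unfolding pp_def k'_def by blast
      have "u \<in> perp Q hh" using subspace_diff[OF subspace_perp, of x hh v] uv pperp by auto
      then have "Q u u = 0" using uv(2) unfolding perp_def by blast
      then have "u = 0" by (rule Qeq0)
      then show "x \<in> p" using uv by simp
    qed
  qed
  have AdEs: "Ad G g (E a) \<in> span (E ` A)" if "a \<in> A" "g \<in> H" for a g using AdE[OF that] unfolding p_def .
  obtain h' where fr: "h' \<in> invariant_metrics G H p"
    "\<And>a b. a \<in> A \<Longrightarrow> b \<in> A \<Longrightarrow> h' (E a) (E b) = (if a = b then 1 / Y a else 0)"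
    "orthonormal_basis Q p (E ` A)" "inj_on E A"
    unfolding p_def
  proof (rule sum_frame_metric[of A E Y])
    show "finite A" by (rule AB(1))
    show "Q (E a) (E b) = (if a = b then 1 else 0)" if "a \<in> A" "b \<in> A" for a b
      using EQ An that by blast
    show "Y a > 0" if "a \<in> A" for a using An that by blast
    show "Ad G g (E a) \<in> span (E ` A)" if "a \<in> A" "g \<in> H" for a g using AdEs that by blast
    show "(Y a - Y b) * Q (Ad G g (E a)) (E b) = 0" if "a \<in> A" "b \<in> A" "g \<in> H" for a b g
      using comE An that by blast
  qed blast
  have ip': "inner_product_on (pp k') h'" using fr(1) unfolding pp' invariant_metrics_def by blast
  note sf = scal_frame[OF sub' ip' AB(1) fr(4) fr(3)[folded pp'] fr(2) F]
  have "bilin_on (pp k') T" using bilin_on_subset[OF Tbil] pperp unfolding pp' by blast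
  from sf(2)[OF _ _ this] have trE: "metric_trace h' (pp k') T = (\<Sum>a\<in>A. Y a * T (E a) (E a))" by simp
  have "(\<lambda>i. \<Sum>a<n. y i a * T' (e i a) (e i a)) \<longlonglongrightarrow> (\<Sum>a<n. Y a * T' (E a) (E a))"
    by (intro tendsto_sum tendsto_mult limY limE bounded_bilinear.tendsto[OF T'(1)]) auto
  moreover have "(\<Sum>a<n. y i a * T' (e i a) (e i a)) = 1" for i
    using trF[of i] T'(2)[OF eperp eperp] by simp
  ultimately have "(\<Sum>a<n. Y a * T' (E a) (E a)) = 1" using LIMSEQ_unique[OF tendsto_const] by fastforce
  then have trA: "(\<Sum>a\<in>A. Y a * T (E a) (E a)) = 1"
    using T'(2)[OF Eperp Eperp] Bn(2) An(1) by (simp add: splitn)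
  have tr1: "metric_trace h' (pp k') T = 1" using trE trA by simp
  define CA where "CA = (\<lambda>i. \<Sum>a\<in>A. \<Sum>b\<in>A. \<Sum>c\<in>A. y i a * y i b / y i c * (?N i a b c)\<^sup>2)"
  define CAE where "CAE = (\<Sum>a\<in>A. \<Sum>b\<in>A. \<Sum>c\<in>A. Y a * Y b / Y c * (?NE a b c)\<^sup>2)"
  define D where "D = (\<lambda>i. \<Sum>a\<in>A. y i a * (\<Sum>b\<in>B. \<Sum>c\<in>B. (?N i a b c)\<^sup>2))"
  define DE where "DE = (\<Sum>a\<in>A. Y a * (\<Sum>b\<in>B. \<Sum>c\<in>B. (?NE a b c)\<^sup>2))"
  \<comment> \<open>\<open>C\<close> itself may diverge. Only the part inside \<open>A\<close> and
    the lower bound \<open>2 * D i\<close> for the cross terms are kept, and both converge.\<close>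
  have upper: "S i \<le> (1/2) * V i - (1/4) * (CA i + 2 * D i)" for i
  proof -
    have "CA i + 2 * D i \<le> C i"
      unfolding CA_def D_def C_def
    proof (rule structure_sum_bound[OF AB(1,2,3), of "y i" "?N i", unfolded AB(4)])
      show "0 < y i a" if "a \<in> {..<n}" for a using that y by simp
      show "?N i a b c = - ?N i b a c" for a b c by (rule Q_swap12)
      show "?N i a b c = - ?N i a c b" for a b c by (rule Q_swap23)
    qed
    then have "(1/4) * (CA i + 2 * D i) \<le> (1/4) * C i" by (intro mult_left_mono) auto
    then show ?thesis using SVC[of i] by simp
  qed
  have limCA: "CA \<longlonglongrightarrow> CAE"
    unfolding CA_def CAE_def
    by (intro tendsto_sum tendsto_mult tendsto_divide tendsto_power limN limY An) (use An in fastforce)+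
  have limD: "D \<longlonglongrightarrow> DE"
    unfolding D_def DE_def
    by (intro tendsto_sum tendsto_mult tendsto_power limN limY An Bn)
  have "(\<lambda>i. ereal ((1/2) * V i - (1/4) * (CA i + 2 * D i))) \<longlonglongrightarrow> ereal ((1/2) * VE - (1/4) * (CAE + 2 * DE))"
    by (intro tendsto_ereal tendsto_diff tendsto_mult tendsto_add tendsto_const limV limCA limD)
  then have "L \<le> ereal ((1/2) * VE - (1/4) * (CAE + 2 * DE))"
    by (rule LIMSEQ_le[OF L]) (use upper S_def in auto)
  \<comment> \<open>\<open>VE\<close> exceeds the Killing sum of \<open>k'\<close> by
    \<open>DE\<close>, the brackets that stay within vanishing directions. The cross terms subtract
    exactly \<open>(1/2) * DE\<close>, so the formula of \<open>scal_frame\<close> for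
    \<open>k'\<close> remains.\<close>
  also have "(1/2) * VE - (1/4) * (CAE + 2 * DE) = scal G Q k' hh h'"
  proof -
    have zAB: "?NE a b c = 0" if "a \<in> A" "b \<in> A" "c \<in> B" for a b c by (rule N0[OF that])
    have zBA: "?NE a b c = 0" if "a \<in> A" "b \<in> B" "c \<in> A" for a b c
      using N0[OF that(1,3,2)] Q_swap23[of "E a" "E b" "E c"] by simp
    have zM: "?ME a b f = 0" if a: "a \<in> A" and b: "b \<in> B" and f: "f \<in> F" for a b f
    proof -
      have "br f (E a) \<in> span (E ` A)" using hp[OF hq.onb_in[OF F f] Ep[OF a]] unfolding p_def .
      moreover have "subspace {v. Q v (E b) = 0}"
        unfolding subspace_def by (simp add: Qadd_left Qscale_left Qzero_left)
      then have "span (E ` A) \<subseteq> {v. Q v (E b) = 0}"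
        using EQ[OF An(1) Bn(1)[OF b]] AB(3) b by (intro span_minimal) auto
      ultimately have "Q (br f (E a)) (E b) = 0" by blast
      then show ?thesis using Q_cyc[of f "E a" "E b"] by simp
    qed
    have "VE = (\<Sum>a\<in>A. Y a * ((\<Sum>b<n. \<Sum>c<n. (?NE a b c)\<^sup>2) + 2 * (\<Sum>b<n. \<Sum>f\<in>F. (?ME a b f)\<^sup>2)))"
    proof -
      have "(\<Sum>a<n. Y a * z a) = (\<Sum>a\<in>A. Y a * z a)" for z :: "nat \<Rightarrow> real"
        by (simp add: splitn Bn(2))
      then show ?thesis unfolding VE_def by simp
    qed
    also have "\<dots> = (\<Sum>a\<in>A. Y a * ((\<Sum>b\<in>A. \<Sum>c\<in>A. (?NE a b c)\<^sup>2) + 2 * (\<Sum>b\<in>A. \<Sum>f\<in>F. (?ME a b f)\<^sup>2))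
        + Y a * (\<Sum>b\<in>B. \<Sum>c\<in>B. (?NE a b c)\<^sup>2))"
      by (intro sum.cong refl) (simp add: splitn zAB zBA zM sum.distrib algebra_simps)
    also have "\<dots> = (\<Sum>a\<in>A. Y a * ((\<Sum>b\<in>A. \<Sum>c\<in>A. (?NE a b c)\<^sup>2) + 2 * (\<Sum>b\<in>A. \<Sum>f\<in>F. (?ME a b f)\<^sup>2))) + DE"
      unfolding DE_def sum.distrib ..
    finally have VE: "VE = (\<Sum>a\<in>A. Y a * ((\<Sum>b\<in>A. \<Sum>c\<in>A. (?NE a b c)\<^sup>2) + 2 * (\<Sum>b\<in>A. \<Sum>f\<in>F. (?ME a b f)\<^sup>2))) + DE" .
    have "scal G Q k' hh h' = (1/2) * (VE - DE) - (1/4) * CAE"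
      unfolding VE CAE_def using sf(1) by simp
    then show ?thesis by (simp add: field_simps)
  qed
  finally have Lle: "L \<le> ereal (scal G Q k' hh h')" .
  \<comment> \<open>The trace normalisation prevents all directions from vanishing; this makes the
    inclusion of \<open>hh\<close> in the limit algebra strict.\<close>
  have "A \<noteq> {}" using trA by auto
  then obtain a where a: "a \<in> A" by blast
  have "E a \<notin> hh"
  proof
    assume "E a \<in> hh"
    then have "Q (E a) (E a) = 0" using Eperp[OF An(1)[OF a]] unfolding perp_def by blast
    then show False using EQ[OF An(1)[OF a] An(1)[OF a]] by simp
  qed
  then have strict: "hh \<subset> k'" using hk Ep[OF a] pk by blast
  have "dim (pp k') \<le> card (E ` A)" unfolding pp' p_def by (simp add: dim_le_card' AB(1))
  also have "\<dots> \<le> card A" by (rule card_image_le[OF AB(1)])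
  also have "\<dots> \<le> n" using card_mono[of "{..<n}" A] AB(4) by auto
  finally have dimle: "dim (pp k') \<le> n" .
  have W: "k' \<subseteq> W" if W: "subspace W" "\<And>i. k i \<subseteq> W" for W
  proof -
    have "E a \<in> W" if "a \<in> A" for a
      by (rule in_sub[OF W(1) _ An(1)[OF that]]) (use epp[OF An(1)[OF that]] W(2) pp_def in blast)
    then have "p \<subseteq> W" unfolding p_def using W(1) by (intro span_minimal) auto
    moreover have "hh \<subseteq> W" using subalg_hh[OF k] W(2) by blast
    ultimately show ?thesis unfolding k'_def using subspace_add[OF W(1)] by blast
  qed
  show thesis
    by (rule that[OF sub' strict dimle W _ tr1 Lle]) (use fr(1) pp' in auto)
qed

definition unit_metrics :: "('a \<Rightarrow> 'a \<Rightarrow> real) \<Rightarrow> 'a set \<Rightarrow> ('a \<Rightarrow> 'a \<Rightarrow> real) set" where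
  "unit_metrics T k = {h \<in> invariant_metrics G H (pp k). metric_trace h (pp k) T = 1}"

lemma alpha_eq: "alpha G H Q T k = (SUP h \<in> unit_metrics T k. ereal (scal G Q k hh h))"
  unfolding alpha_def unit_metrics_def pp_def Let_def ..

text \<open>\<open>Q\<close>-unit vectors are bounded, and the trace condition bounds the inverse
  eigenvalues, so finitely many subsequence extractions produce the data for
  \<open>limit_core\<close>.\<close>

lemma limit_metric:
  fixes k :: "nat \<Rightarrow> 'a set"
  assumes k: "\<And>i. subalg (k i)" "\<And>i. dim (pp (k i)) = n" and h: "\<And>i. h i \<in> unit_metrics T (k i)"
    and T: "inner_product_on (perp Q hh) T"
    and s: "\<And>i. scal G Q (k i) hh (h i) \<ge> s"
    and L: "(\<lambda>i. ereal (scal G Q (k i) hh (h i))) \<longlonglongrightarrow> L"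
  obtains k' h' where "subalg k'" "hh \<subset> k'" "dim (pp k') \<le> n"
    "\<And>W. subspace W \<Longrightarrow> (\<And>i. k i \<subseteq> W) \<Longrightarrow> k' \<subseteq> W"
    "h' \<in> unit_metrics T k'" "L \<le> ereal (scal G Q k' hh h')"
proof -
  have Ts: "sym_bilinear_on (perp Q hh) T" using T inner_product_on_def by blast
  interpret Tp: ip_space "perp Q hh" T using T subspace_perp by unfold_locales
  have him: "h i \<in> invariant_metrics G H (pp (k i))" "metric_trace (h i) (pp (k i)) T = 1" for i
    using h unfolding unit_metrics_def by auto
  have ip: "inner_product_on (pp (k i)) (h i)" for i using him unfolding invariant_metrics_def by blast
  define P where "P = (\<lambda>i e y. inj_on e {..<n} \<and> orthonormal_basis Q (pp (k i)) (e ` {..<n}) \<and>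
    (\<forall>a<n. y a > (0::real)) \<and> (\<forall>a<n. \<forall>b<n. h i (e a) (e b) = (if a = b then 1 / y a else 0)) \<and>
    (\<forall>a<n. \<forall>b<n. \<forall>g\<in>H. (y a - y b) * Q (Ad G g (e a)) (e b) = 0))"
  have "\<exists>e y. P i e y" for i
    by (rule frame_exists[OF k(1)[of i] him(1)[of i] k(2)[of i]]) (unfold P_def, blast)
  then obtain e y where P: "\<And>i. P i (e i) (y i)" by metis
  have inj: "\<And>i. inj_on (e i) {..<n}" and onb: "\<And>i. orthonormal_basis Q (pp (k i)) (e i ` {..<n})"
    and y: "\<And>i a. a < n \<Longrightarrow> y i a > 0"
    and diag: "\<And>i a b. a < n \<Longrightarrow> b < n \<Longrightarrow> h i (e i a) (e i b) = (if a = b then 1 / y i a else 0)"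
    and com: "\<And>i a b g. a < n \<Longrightarrow> b < n \<Longrightarrow> g \<in> H \<Longrightarrow> (y i a - y i b) * Q (Ad G g (e i a)) (e i b) = 0"
    using P unfolding P_def by blast+
  have eperp: "e i a \<in> perp Q hh" if "a < n" for i a
    using onb[of i] that unfolding orthonormal_basis_def pp_def by blast
  have e1: "Q (e i a) (e i a) = 1" if "a < n" for i a
    using onb[of i] that unfolding orthonormal_basis_def by simp
  interpret hq: ip_space hh Q by (rule Qsub[OF hh_sub])
  obtain F where F: "orthonormal_basis Q hh F" by (rule hq.onb_exists)
  have trF: "(\<Sum>a<n. y i a * T (e i a) (e i a)) = 1" for i
    using scal_frame(2)[OF k(1) ip finite_lessThan inj onb _ F, of i "y i" T] diag him(2)[of i]
      bilin_on_subset[OF Tp.bil, of "pp (k i)"] unfolding pp_def by simp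
  obtain M where M: "\<And>x. x \<in> UNIV \<Longrightarrow> Q x x \<le> 1 \<Longrightarrow> norm x \<le> M" using Q.ball_bounded by metis
  obtain C where C: "C > 0" "\<And>x. x \<in> perp Q hh \<Longrightarrow> \<bar>Q x x\<bar> \<le> C * T x x"
    using Tp.bilin_bound[of Q] bilin_on_subset[OF Q.bil subset_UNIV] by metis
  \<comment> \<open>On \<open>Q\<close>-unit vectors of \<open>perp Q hh\<close>, \<open>T\<close>
    is at least \<open>1 / C\<close>, and every summand of the trace is at most 1. This is how
    \<open>T > 0\<close> bounds the metrics from below.\<close>
  have yC: "y i a \<le> C" if a: "a < n" for i a
  proof -
    have Tnn: "T (e i b) (e i b) \<ge> 0" if "b < n" for b by (rule Tp.nonneg[OF eperp[OF that]])
    have "y i a * T (e i a) (e i a) \<le> (\<Sum>a<n. y i a * T (e i a) (e i a))"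
    proof (rule member_le_sum[where f="\<lambda>a. y i a * T (e i a) (e i a)"])
      show "0 \<le> y i b * T (e i b) (e i b)" if "b \<in> {..<n} - {a}" for b
        using that y[of b i] Tnn[of b] by (intro mult_nonneg_nonneg) auto
    qed (use a in auto)
    then have le1: "y i a * T (e i a) (e i a) \<le> 1" using trF by simp
    have "1 \<le> C * T (e i a) (e i a)" using C(2)[OF eperp[OF a, of i]] e1[OF a] by simp
    then have "y i a * 1 \<le> y i a * (C * T (e i a) (e i a))" using y[OF a, of i] by (intro mult_left_mono) auto
    also have "\<dots> = C * (y i a * T (e i a) (e i a))" by simp
    also have "\<dots> \<le> C * 1" using le1 C(1) by (intro mult_left_mono) auto
    finally show ?thesis by simp
  qed
  have bd: "bounded (range (\<lambda>i. (e i a, y i a)))" if a: "a < n" for a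
  proof -
    have "norm (e i a, y i a) \<le> M + C" for i
    proof -
      have "norm (e i a, y i a) \<le> norm (e i a) + norm (y i a)" by (rule norm_Pair_le)
      moreover have "norm (e i a) \<le> M" using M e1[OF a] by simp
      moreover have "norm (y i a) \<le> C" using y[OF a, of i] yC[OF a, of i] by simp
      ultimately show ?thesis by linarith
    qed
    then show ?thesis unfolding bounded_iff by blast
  qed
  obtain r :: "nat \<Rightarrow> nat" where r: "strict_mono r" "\<And>a. a < n \<Longrightarrow> convergent (\<lambda>i. (e (r i) a, y (r i) a))"
  proof -
    have "\<exists>r::nat \<Rightarrow> nat. strict_mono r \<and> (\<forall>a<n. convergent (\<lambda>i. (e (r i) a, y (r i) a)))"
    proof (rule finite_family_convergent_subseq[of n "\<lambda>i a. (e i a, y i a)"])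
      show "bounded (range (\<lambda>i. (e i a, y i a)))" if "a < n" for a by (rule bd[OF that])
    qed blast
    then show thesis using that by blast
  qed
  define Z where "Z = (\<lambda>a. lim (\<lambda>i. (e (r i) a, y (r i) a)))"
  have Z: "(\<lambda>i. (e (r i) a, y (r i) a)) \<longlonglongrightarrow> Z a" if "a < n" for a
    unfolding Z_def using r(2)[OF that] by (simp add: convergent_LIMSEQ_iff)
  have limE: "(\<lambda>i. e (r i) a) \<longlonglongrightarrow> fst (Z a)" and limY: "(\<lambda>i. y (r i) a) \<longlonglongrightarrow> snd (Z a)" if "a < n" for a
    using tendsto_fst[OF Z[OF that]] tendsto_snd[OF Z[OF that]] by auto
  have L': "(\<lambda>i. ereal (scal G Q (k (r i)) hh (h (r i)))) \<longlonglongrightarrow> L"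
    using LIMSEQ_subseq_LIMSEQ[OF L r(1)] by (simp add: o_def)
  show thesis
  proof (rule limit_core[where k="\<lambda>i. k (r i)" and h="\<lambda>i. h (r i)" and e="\<lambda>i. e (r i)" and n=n
        and y="\<lambda>i. y (r i)" and E="\<lambda>a. fst (Z a)" and Y="\<lambda>a. snd (Z a)" and T=T and s=s and L=L])
    fix i
    show "subalg (k (r i))" by (rule k(1))
    show "h (r i) \<in> invariant_metrics G H (pp (k (r i)))" "metric_trace (h (r i)) (pp (k (r i))) T = 1"
      by (rule him)+
    show "inj_on (e (r i)) {..<n}" by (rule inj)
    show "orthonormal_basis Q (pp (k (r i))) (e (r i) ` {..<n})" by (rule onb)
    show "s \<le> scal G Q (k (r i)) hh (h (r i))" by (rule s)
    fix a assume a: "a < n"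
    show "0 < y (r i) a" by (rule y[OF a])
    show "(\<lambda>i. e (r i) a) \<longlonglongrightarrow> fst (Z a)" by (rule limE[OF a])
    show "(\<lambda>i. y (r i) a) \<longlonglongrightarrow> snd (Z a)" by (rule limY[OF a])
    fix b assume b: "b < n"
    show "h (r i) (e (r i) a) (e (r i) b) = (if a = b then 1 / y (r i) a else 0)" by (rule diag[OF a b])
    show "(y (r i) a - y (r i) b) * Q (Ad G g (e (r i) a)) (e (r i) b) = 0" if "g \<in> H" for g
      by (rule com[OF a b that])
  next
    fix k' h'
    assume kh: "subalg k'" "hh \<subset> k'" "dim (pp k') \<le> n"
      "\<And>W. subspace W \<Longrightarrow> (\<And>i. k (r i) \<subseteq> W) \<Longrightarrow> k' \<subseteq> W"
      "h' \<in> invariant_metrics G H (pp k')" "metric_trace h' (pp k') T = 1" "L \<le> ereal (scal G Q k' hh h')"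
    have "k' \<subseteq> W" if "subspace W" "\<And>i. k i \<subseteq> W" for W by (rule kh(4)[OF that(1)]) (rule that(2))
    moreover have "h' \<in> unit_metrics T k'" using kh(5,6) unfolding unit_metrics_def by blast
    ultimately show thesis using that[OF kh(1-3)] kh(7) by blast
  qed (rule Ts L')+
qed

text \<open>Using pairs of an algebra and a metric covers three suprema: over all intermediate
  subalgebras, over one of them, and over G/H. The dimension clause and the containment clause
  locate the limit algebra in the first and the second case.\<close>

lemma limit_sup:
  assumes X: "X \<noteq> {}" "\<And>k h. (k, h) \<in> X \<Longrightarrow> subalg k \<and> h \<in> unit_metrics T k"
    and T: "inner_product_on (perp Q hh) T"
  obtains k' h' where "subalg k'" "hh \<subset> k'" "h' \<in> unit_metrics T k'"
    "(SUP (k, h) \<in> X. ereal (scal G Q k hh h)) \<le> ereal (scal G Q k' hh h')"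
    "\<exists>(k, h) \<in> X. dim (pp k') \<le> dim (pp k)"
    "\<And>W. subspace W \<Longrightarrow> (\<And>k h. (k, h) \<in> X \<Longrightarrow> k \<subseteq> W) \<Longrightarrow> k' \<subseteq> W"
proof -
  let ?S = "\<lambda>(k, h). ereal (scal G Q k hh h)"
  obtain x :: "nat \<Rightarrow> ereal" where x: "range x \<subseteq> ?S ` X" "incseq x" "Sup (?S ` X) = (SUP i. x i)"
    using Sup_countable_SUP[of "?S ` X"] X(1) by auto
  have "\<forall>i. \<exists>kh. kh \<in> X \<and> x i = ?S kh" using x(1) by blast
  then obtain kh where kh: "\<And>i. kh i \<in> X" "\<And>i. x i = ?S (kh i)" by metis
  define d where "d = (\<lambda>i. dim (pp (fst (kh i))))"
  have "d ` UNIV \<subseteq> {..DIM('a)}" unfolding d_def using dim_subset_UNIV by auto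
  then have "finite (d ` UNIV)" using finite_subset by blast
  \<comment> \<open>Frames are indexed by a fixed range, so a subsequence of constant dimension is
    chosen. Monotonicity of \<open>x\<close> then makes its first value a lower bound for all
    others.\<close>
  then obtain i0 where i0: "infinite {i \<in> UNIV. d i = d i0}"
    using pigeonhole_infinite[of UNIV d] infinite_UNIV_nat by blast
  then obtain r :: "nat \<Rightarrow> nat" where r: "strict_mono r" "\<And>i. r i \<in> {i \<in> UNIV. d i = d i0}"
    using infinite_enumerate[of "{i \<in> UNIV. d i = d i0}"] by blast
  define k where "k = (\<lambda>i. fst (kh (r i)))"
  define h where "h = (\<lambda>i. snd (kh (r i)))"
  have inX: "(k i, h i) \<in> X" for i unfolding k_def h_def using kh(1) by simp
  have xr: "x (r i) = ereal (scal G Q (k i) hh (h i))" for i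
    unfolding kh(2) k_def h_def by (simp add: case_prod_beta)
  have kd: "subalg (k i)" "dim (pp (k i)) = d i0" "h i \<in> unit_metrics T (k i)" for i
    using X(2)[OF inX] r(2)[of i] unfolding d_def k_def by auto
  have lim: "(\<lambda>i. ereal (scal G Q (k i) hh (h i))) \<longlonglongrightarrow> (SUP i. x i)"
    using LIMSEQ_subseq_LIMSEQ[OF LIMSEQ_SUP[OF x(2)] r(1)] by (simp add: o_def xr)
  have lower: "scal G Q (k 0) hh (h 0) \<le> scal G Q (k i) hh (h i)" for i
  proof -
    have "x (r 0) \<le> x (r i)" using x(2) r(1) by (simp add: incseq_def strict_mono_less_eq)
    then show ?thesis by (simp add: xr)
  qed
  obtain k' h' where *: "subalg k'" "hh \<subset> k'" "dim (pp k') \<le> d i0"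
    "\<And>W. subspace W \<Longrightarrow> (\<And>i. k i \<subseteq> W) \<Longrightarrow> k' \<subseteq> W"
    "h' \<in> unit_metrics T k'" "(SUP i. x i) \<le> ereal (scal G Q k' hh h')"
    using limit_metric[OF kd T lower lim] by metis
  have ex: "\<exists>(k, h) \<in> X. dim (pp k') \<le> dim (pp k)"
    using *(3) kh(1)[of i0] unfolding d_def by (intro bexI[of _ "kh i0"]) (auto simp: case_prod_beta)
  have "k' \<subseteq> W" if W: "subspace W" "\<And>k h. (k, h) \<in> X \<Longrightarrow> k \<subseteq> W" for W
    by (rule *(4)[OF W(1)]) (rule W(2)[OF inX])
  moreover have "(SUP (k, h) \<in> X. ereal (scal G Q k hh h)) \<le> ereal (scal G Q k' hh h')"
    using *(6) x(3) by simp
  ultimately show thesis using that[OF *(1,2,5) _ ex] by blast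
qed

text \<open>For a multiple of \<open>Q\<close> the Killing and norm terms combine to a sum of
  squares. The metric shows that the sets of admissible metrics are nonempty and that
  \<open>alpha\<close> is nonnegative.\<close>

lemma normal_metric:
  assumes k: "subalg k" "hh \<subset> k" and T: "inner_product_on (perp Q hh) T"
  obtains h where "h \<in> unit_metrics T k" "scal G Q k hh h \<ge> 0"
proof -
  interpret Tp: ip_space "perp Q hh" T using T subspace_perp by unfold_locales
  interpret q: ip_space "pp k" Q by (rule Qsub[OF pp_sub[OF k(1)]])
  interpret hq: ip_space hh Q by (rule Qsub[OF hh_sub])
  obtain F where F: "orthonormal_basis Q hh F" by (rule hq.onb_exists)
  obtain E where E: "orthonormal_basis Q (pp k) E" by (rule q.onb_exists)
  have Eperp: "e \<in> perp Q hh" if "e \<in> E" for e using q.onb_in[OF E that] unfolding pp_def by blast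
  have fin: "finite E" by (rule q.onb_finite[OF E])
  have "E \<noteq> {}"
  proof
    assume "E = {}"
    then have "pp k = {0}" using E unfolding orthonormal_basis_def by simp
    then have z: "x - proj Q hh x = 0" if "x \<in> k" for x
      using proj_perp[OF hh_sub, of x] subspace_diff[OF subalg_sub[OF k(1)] that, of "proj Q hh x"]
        proj_in[OF hh_sub, of x] k(2) unfolding pp_def by blast
    then have "k \<subseteq> hh" using proj_in[OF hh_sub] by (metis eq_iff_diff_eq_0 subsetI)
    then show False using k(2) by blast
  qed
  \<comment> \<open>The \<open>Q\<close>-trace of \<open>T\<close>, so that \<open>c\<close> times
    \<open>Q\<close> has \<open>T\<close>-trace one.\<close>
  define c where "c = (\<Sum>e\<in>E. T e e)"
  have Tpos: "T e e > 0" if "e \<in> E" for e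
  proof -
    have "e \<noteq> 0" using q.onb_eq[OF E that that] Qzero_left by force
    then show ?thesis using Tp.pos[OF Eperp[OF that]] by blast
  qed
  have c: "c > 0" unfolding c_def using fin \<open>E \<noteq> {}\<close> Tpos by (intro sum_pos) auto
  define h where "h = (\<lambda>x y. c * Q x y)"
  have "sym_bilinear_on (pp k) h"
    unfolding sym_bilinear_on_def
  proof (intro conjI ballI allI)
    show "h x y = h y x" for x y unfolding h_def using Qsym[of x y] by simp
  qed (simp_all add: h_def Qadd_left Qscale_left distrib_left)
  moreover have "pos_def_on (pp k) h"
    unfolding pos_def_on_def h_def using c Q.pos by simp
  ultimately have "inner_product_on (pp k) h" unfolding inner_product_on_def by blast
  moreover have "Ad_invariant_on G H (pp k) h"
    unfolding Ad_invariant_on_def h_def using Q_Ad H_car by simp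
  ultimately have hm: "h \<in> invariant_metrics G H (pp k)" and ip: "inner_product_on (pp k) h"
    unfolding invariant_metrics_def by auto
  have d: "h e f = (if e = f then 1 / (1 / c) else 0)" if "e \<in> E" "f \<in> E" for e f
    using q.onb_eq[OF E that] by (simp add: h_def)
  have E': "orthonormal_basis Q (pp k) ((\<lambda>x. x) ` E)" using E by simp
  note sf = scal_frame[OF k(1) ip fin inj_on_id2 E', of "\<lambda>_. 1 / c", OF d F]
  have "metric_trace h (pp k) T = 1"
    using sf(2)[OF _ _ bilin_on_subset[OF Tp.bil, of "pp k"]] c unfolding pp_def
    by (simp add: c_def sum_divide_distrib[symmetric])
  then have "h \<in> unit_metrics T k" using hm unfolding unit_metrics_def by blast
  moreover have "scal G Q k hh h \<ge> 0"
  proof -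
    define N where "N = (\<Sum>a\<in>E. \<Sum>b\<in>E. \<Sum>e\<in>E. (Q (br a b) e)\<^sup>2)"
    define M where "M = (\<Sum>a\<in>E. \<Sum>b\<in>E. \<Sum>f\<in>F. (Q (br a b) f)\<^sup>2)"
    have "N \<ge> 0" "M \<ge> 0" unfolding N_def M_def by (intro sum_nonneg zero_le_power2)+
    have "scal G Q k hh h = (1/2) * ((1 / c) * (N + 2 * M)) - (1/4) * ((1 / c) * N)"
      using sf(1) c unfolding N_def M_def
      by (simp add: sum_distrib_left sum.distrib distrib_left)
    also have "\<dots> = (1 / c) * ((1/4) * N + M)" by (simp add: algebra_simps)
    also have "\<dots> \<ge> 0" using c \<open>N \<ge> 0\<close> \<open>M \<ge> 0\<close> by simp
    finally show ?thesis .
  qed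
  ultimately show thesis using that by blast
qed

end

section \<open>Ricci curvature\<close>

locale hom_metric = hom_space G Q H
  for G :: "('g, 'a::euclidean_space, 'm) lie_data_scheme" (structure) and Q :: "'a \<Rightarrow> 'a \<Rightarrow> real"
    and H :: "'g set" +
  fixes g :: "'a \<Rightarrow> 'a \<Rightarrow> real"
  assumes g: "g \<in> invariant_metrics G H (perp Q (lie_alg G H))"
begin

abbreviation "mm \<equiv> perp Q hh"
abbreviation "Pm \<equiv> proj Q mm"
abbreviation "Ph \<equiv> proj Q hh"
abbreviation "lc \<equiv> levi_civita G Q mm g"
abbreviation "Rc \<equiv> ricci G Q hh g"

text \<open>Structure constants lowered with the metric \<open>g\<close>; in contrast to
  \<open>Q (br x y) z\<close>, in general only the skewness in the first two slots is left, see
  \<open>cc_swap\<close>.\<close>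

definition cc :: "'a \<Rightarrow> 'a \<Rightarrow> 'a \<Rightarrow> real" where "cc x y z = g (Pm (br x y)) z"

lemma mm_sub: "subspace mm"
  by (rule subspace_perp)

lemma gip: "inner_product_on mm g" and ginv: "Ad_invariant_on G H mm g"
  using g unfolding invariant_metrics_def by auto

sublocale g: ip_space mm g
  using gip mm_sub by unfold_locales

lemma Pm_in: "Pm x \<in> mm" and Ph_in: "Ph x \<in> hh"
  by (rule proj_in[OF mm_sub], rule proj_in[OF hh_sub])

lemma Ph_Pm: "x = Ph x + Pm x"
proof -
  have "x - Ph x \<in> mm" by (rule proj_perp[OF hh_sub])
  moreover have "x - (x - Ph x) \<in> perp Q mm"
    using Ph_in[of x] perp_perp[OF hh_sub] by simp
  ultimately have "Pm x = x - Ph x" by (rule proj_eq[OF mm_sub])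
  then show ?thesis by simp
qed

lemmas Pm_lin = proj_linear[OF mm_sub]
lemmas Ph_lin = proj_linear[OF hh_sub]

lemma br_hh_mm: "u \<in> hh \<Longrightarrow> x \<in> mm \<Longrightarrow> br u x \<in> mm"
  by (rule br_perp[OF subalg_hh_self])

lemma Ad_mm: "a \<in> H \<Longrightarrow> x \<in> mm \<Longrightarrow> Ad G a x \<in> mm"
  by (rule Ad_H_preserves(2)[OF subalg_hh_self])

lemma Ad_Ph: assumes a: "a \<in> H" shows "Ph (Ad G a x) = Ad G a (Ph x)" "Pm (Ad G a x) = Ad G a (Pm x)"
proof -
  note lin = Ad_linear[OF H_car[OF a]]
  have d: "Ad G a x - Ad G a (Ph x) = Ad G a (x - Ph x)" by (simp add: linear_diff[OF lin])
  have "x - Ph x \<in> mm" by (rule proj_perp[OF hh_sub])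
  then show 1: "Ph (Ad G a x) = Ad G a (Ph x)"
    using Ad_mm[OF a] Ad_lie_alg[OF H_sub a Ph_in] d by (intro proj_eq[OF hh_sub]) auto
  have "Pm (Ad G a x) = Ad G a x - Ph (Ad G a x)" using Ph_Pm[of "Ad G a x"] by (simp add: algebra_simps)
  also have "\<dots> = Ad G a (x - Ph x)" unfolding 1 by (rule d)
  also have "x - Ph x = Pm x" using Ph_Pm[of x] by (simp add: algebra_simps)
  finally show "Pm (Ad G a x) = Ad G a (Pm x)" .
qed

lemma cc_swap: "z \<in> mm \<Longrightarrow> cc x y z = - cc y x z"
  unfolding cc_def using br_skew[of x y] linear_neg[OF Pm_lin, of "br y x"]
    g.scale_left[OF Pm_in, of z "-1" "br y x"] by simp

lemma cc_add:
  "z \<in> mm \<Longrightarrow> cc (x + x') y z = cc x y z + cc x' y z"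
  "z \<in> mm \<Longrightarrow> cc y (x + x') z = cc y x z + cc y x' z"
  "z \<in> mm \<Longrightarrow> z' \<in> mm \<Longrightarrow> cc x y (z + z') = cc x y z + cc x y z'"
  unfolding cc_def
  by (simp_all add: br_add_left br_add_right linear_add[OF Pm_lin] g.add_left Pm_in g.add_right)

lemma cc_scale:
  "z \<in> mm \<Longrightarrow> cc (r *\<^sub>R x) y z = r * cc x y z"
  "z \<in> mm \<Longrightarrow> cc y (r *\<^sub>R x) z = r * cc y x z"
  "z \<in> mm \<Longrightarrow> cc x y (r *\<^sub>R z) = r * cc x y z"
  unfolding cc_def
  by (simp_all add: br_scale_left br_scale_right linear_scale[OF Pm_lin] g.scale_left Pm_in g.scale_right)

lemma cc_lin:
  "z \<in> mm \<Longrightarrow> lin_on V (\<lambda>x. cc x y z)" "z \<in> mm \<Longrightarrow> lin_on V (\<lambda>x. cc y x z)" "lin_on mm (\<lambda>x. cc y z x)"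
  unfolding lin_on_def by (simp_all add: cc_add cc_scale)

text \<open>The Koszul expression for the inner product of the covariant derivative of
  \<open>y\<close> along \<open>x\<close> with \<open>z\<close>.\<close>

definition lam :: "'a \<Rightarrow> 'a \<Rightarrow> 'a \<Rightarrow> real" where
  "lam x y z = (1/2) * (cc x y z + cc z x y + cc z y x)"

text \<open>Shows that the description in \<open>levi_civita\<close> denotes: existence by expanding
  the functional \<open>lam x y\<close> in an orthonormal basis, uniqueness by definiteness of
  \<open>g\<close>.\<close>

lemma lc_props:
  assumes xy: "x \<in> mm" "y \<in> mm"
  shows "lc x y \<in> mm" "z \<in> mm \<Longrightarrow> g (lc x y) z = lam x y z"
proof -
  obtain E where E: "orthonormal_basis g mm E" by (rule g.onb_exists)
  define w where "w = (\<Sum>e\<in>E. lam x y e *\<^sub>R e)"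
  have w: "w \<in> mm" unfolding w_def by (intro subspace_sum mm_sub subspace_scale g.onb_in[OF E])
  have lin: "lin_on mm (lam x y)"
    unfolding lin_on_def lam_def using xy by (simp add: cc_add cc_scale algebra_simps)
  have gw: "g w z = lam x y z" if z: "z \<in> mm" for z
  proof -
    have "g w z = (\<Sum>e\<in>E. lam x y e * g e z)"
      unfolding w_def by (rule g.sum_left) (use g.onb_in[OF E] z in auto)
    also have "\<dots> = (\<Sum>e\<in>E. g z e * lam x y e)"
      using g.symm[OF g.onb_in[OF E] z] by (intro sum.cong refl) simp
    also have "\<dots> = (\<Sum>e\<in>E. g z e *\<^sub>R lam x y e)" by simp
    also have "\<dots> = lam x y (\<Sum>e\<in>E. g z e *\<^sub>R e)"
      using lin_on_sum[OF mm_sub lin, of E "\<lambda>e. e" "g z"] g.onb_in[OF E] by simp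
    finally show ?thesis using g.onb_expand[OF E z] by simp
  qed
  have rhs: "g (Pm (br x y)) z + g (Pm (br z x)) y + g x (Pm (br z y)) = 2 * lam x y z" if "z \<in> mm" for z
    unfolding lam_def cc_def using g.symm[OF xy(1) Pm_in] by simp
  have "lc x y = w"
    unfolding levi_civita_def
  proof (rule the_equality)
    show "w \<in> mm \<and> (\<forall>z\<in>mm. 2 * g w z = g (Pm (br x y)) z + g (Pm (br z x)) y + g x (Pm (br z y)))"
      using w gw rhs by simp
    fix u assume u: "u \<in> mm \<and> (\<forall>z\<in>mm. 2 * g u z = g (Pm (br x y)) z + g (Pm (br z x)) y + g x (Pm (br z y)))"
    then have "g u z = g w z" if "z \<in> mm" for z using rhs gw that by auto
    moreover have uw: "u - w \<in> mm" using u w subspace_diff[OF mm_sub] by blast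
    ultimately have "g (u - w) (u - w) = 0" using g.diff_left[of u w "u - w"] u w by simp
    then show "u = w" using g.pos[OF uw] by force
  qed
  then show "lc x y \<in> mm" "z \<in> mm \<Longrightarrow> g (lc x y) z = lam x y z" using w gw by auto
qed

lemma g_ext:
  assumes "u \<in> mm" "w \<in> mm" "\<And>z. z \<in> mm \<Longrightarrow> g u z = g w z" shows "u = w"
proof -
  have uw: "u - w \<in> mm" using assms subspace_diff[OF mm_sub] by blast
  then have "g (u - w) (u - w) = 0" using g.diff_left[of u w "u - w"] assms by simp
  then show ?thesis using g.pos[OF uw] by force
qed

lemma lc_lin:
  assumes y: "y \<in> mm" shows "lin_on mm (\<lambda>x. lc x y)" "lin_on mm (\<lambda>x. lc y x)"
proof -
  have add: "lc (x + x') y = lc x y + lc x' y" "lc y (x + x') = lc y x + lc y x'" if "x \<in> mm" "x' \<in> mm" for x x'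
    using that y subspace_add[OF mm_sub] by (auto intro!: g_ext simp: lc_props g.add_left lam_def cc_add algebra_simps)
  have scale: "lc (r *\<^sub>R x) y = r *\<^sub>R lc x y" "lc y (r *\<^sub>R x) = r *\<^sub>R lc y x" if "x \<in> mm" for x r
    using that y subspace_scale[OF mm_sub] by (auto intro!: g_ext simp: lc_props g.scale_left lam_def cc_scale algebra_simps)
  show "lin_on mm (\<lambda>x. lc x y)" "lin_on mm (\<lambda>x. lc y x)"
    unfolding lin_on_def using add scale by auto
qed

text \<open>Metric compatibility of the connection.\<close>

lemma lam_skew: "x \<in> mm \<Longrightarrow> y \<in> mm \<Longrightarrow> z \<in> mm \<Longrightarrow> lam x y z = - lam x z y"
  unfolding lam_def using cc_swap[of z x y] cc_swap[of y z x] cc_swap[of x y z] by (simp add: field_simps)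

lemma trace_g_Q:
  assumes E: "orthonormal_basis g mm E" and U: "orthonormal_basis Q mm U"
    and f: "lin_on mm f" "\<And>x. x \<in> mm \<Longrightarrow> f x \<in> mm"
  shows "(\<Sum>e\<in>E. g (f e) e) = (\<Sum>u\<in>U. Q (f u) u)"
proof -
  interpret q: ip_space mm Q by (rule Qsub[OF mm_sub])
  show ?thesis using g.trace_on_onb[OF E f] q.trace_on_onb[OF U f] by simp
qed

text \<open>The trace of a map does not depend on the inner product. Evaluated with
  \<open>Q\<close>, every summand vanishes by total skewness.\<close>

lemma unimodular:
  assumes E: "orthonormal_basis g mm E" and u: "u \<in> mm"
  shows "(\<Sum>e\<in>E. cc e u e) = 0"
proof -
  interpret q: ip_space mm Q by (rule Qsub[OF mm_sub])
  obtain U where U: "orthonormal_basis Q mm U" by (rule q.onb_exists)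
  have lin: "lin_on mm (\<lambda>w. Pm (br w u))"
    using linear_imp_lin_on[OF linear_compose[OF bracket_linear_left[of u] Pm_lin]] by (simp add: o_def)
  have "(\<Sum>e\<in>E. cc e u e) = (\<Sum>v\<in>U. Q (Pm (br v u)) v)"
    unfolding cc_def by (rule trace_g_Q[OF E U lin Pm_in])
  also have "\<dots> = (\<Sum>v\<in>U. Q (br v u) v)"
    using proj_Q[OF mm_sub] q.onb_in[OF U] by (intro sum.cong) auto
  also have "\<dots> = 0"
  proof (rule sum.neutral, rule ballI)
    fix v
    have "Q (br v u) v = - Q (br v v) u" by (rule Q_swap23)
    then show "Q (br v u) v = 0" using bracket_self[OF comp] Qzero_left by simp
  qed
  finally show ?thesis .
qed

text \<open>The Ricci tensor in a manifestly symmetric form: squares of the parts of the structure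
  constants symmetric and skew in the two summation indices, and the isotropy term, which is kept in
  terms of \<open>Q\<close> because it involves \<open>hh\<close>.\<close>

definition ric_form :: "'a set \<Rightarrow> 'a set \<Rightarrow> 'a \<Rightarrow> 'a \<Rightarrow> real" where
  "ric_form E U p q = - (1/4) * (\<Sum>i\<in>E. \<Sum>k\<in>E. (cc p i k + cc p k i) * (cc q i k + cc q k i))
     + (1/4) * (\<Sum>i\<in>E. \<Sum>k\<in>E. cc k i p * cc k i q) + (\<Sum>u\<in>U. Q (Ph (br u p)) (Ph (br u q)))"

text \<open>Of the four terms of \<open>riemann\<close>, the first has trace zero by
  \<open>unimodular\<close>, the second is rewritten by metric compatibility, the third is expanded
  in \<open>E\<close>, and the isotropy term is traced with \<open>Q\<close>. Splitting into parts
  symmetric and skew in the indices brings the rest to the form \<open>ric_form\<close>.\<close>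

lemma ricci_form:
  assumes E: "orthonormal_basis g mm E" and U: "orthonormal_basis Q mm U" and p: "p \<in> mm" and q: "q \<in> mm"
  shows "Rc p q = ric_form E U p q"
proof -
  interpret qq: ip_space mm Q by (rule Qsub[OF mm_sub])
  have Em: "e \<in> mm" if "e \<in> E" for e by (rule g.onb_in[OF E that])
  have pr: "Pm (br w x) \<in> mm" for w x by (rule Pm_in)
  note lcm = lc_props(1)
  let ?R = "\<lambda>w. riemann G Q hh g w p q"
  have R: "?R w = lc w (lc p q) - lc p (lc w q) - lc (Pm (br w p)) q - br (Ph (br w p)) q" for w
    unfolding riemann_def Let_def ..
  have l1: "lin_on mm (\<lambda>w. lc w (lc p q))" by (rule lc_lin(1)[OF lcm[OF p q]])
  have l2: "lin_on mm (\<lambda>w. lc p (lc w q))"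
    using lc_lin(1)[OF q] lc_lin(2)[OF p] lcm[OF _ q] unfolding lin_on_def by simp
  have l3: "lin_on mm (\<lambda>w. lc (Pm (br w p)) q)"
    using lc_lin(1)[OF q] Pm_in unfolding lin_on_def
    by (simp add: br_add_left br_scale_left linear_add[OF Pm_lin] linear_scale[OF Pm_lin])
  have l4: "lin_on mm (\<lambda>w. br (Ph (br w p)) q)"
    unfolding lin_on_def by (simp add: br_add_left br_scale_left linear_add[OF Ph_lin] linear_scale[OF Ph_lin])
  have m4: "br (Ph (br w p)) q \<in> mm" for w by (rule br_hh_mm[OF Ph_in q])
  have mems: "lc w (lc p q) \<in> mm" "lc p (lc w q) \<in> mm" "lc (Pm (br w p)) q \<in> mm" if "w \<in> mm" for w
    using that p q lcm Pm_in by auto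
  have lR: "lin_on mm ?R" unfolding R using l1 l2 l3 l4 unfolding lin_on_def by (simp add: algebra_simps)
  have mR: "?R w \<in> mm" if "w \<in> mm" for w
    unfolding R by (intro subspace_diff[OF mm_sub] mems[OF that] m4)
  have "Rc p q = (\<Sum>e\<in>E. g (?R e) e)"
    unfolding ricci_def by (rule g.trace_on_onb[OF E lR mR])
  also have "\<dots> = (\<Sum>e\<in>E. lam e (lc p q) e) - (\<Sum>e\<in>E. lam p (lc e q) e) - (\<Sum>e\<in>E. lam (Pm (br e p)) q e)
      - (\<Sum>e\<in>E. g (br (Ph (br e p)) q) e)"
  proof -
    have "g (?R e) e = lam e (lc p q) e - lam p (lc e q) e - lam (Pm (br e p)) q e - g (br (Ph (br e p)) q) e"
      if e: "e \<in> E" for e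
      unfolding R using Em[OF e] mems[OF Em[OF e]] m4[of e] subspace_diff[OF mm_sub] p q lcm Pm_in
      by (simp add: g.diff_left lc_props(2))
    then show ?thesis by (simp add: sum_subtractf)
  qed
  also have "(\<Sum>e\<in>E. lam e (lc p q) e) = 0"
  proof -
    have "lam e (lc p q) e = cc e (lc p q) e" if e: "e \<in> E" for e
      unfolding lam_def using cc_swap[OF lcm[OF p q], of e e] by simp
    then show ?thesis using unimodular[OF E lcm[OF p q]] by simp
  qed
  also have "(\<Sum>e\<in>E. lam p (lc e q) e) = - (\<Sum>i\<in>E. \<Sum>k\<in>E. lam i q k * lam p i k)"
  proof -
    have "lam p (lc i q) i = - (\<Sum>k\<in>E. lam i q k * lam p i k)" if i: "i \<in> E" for i
    proof -
      have "lam p (lc i q) i = - lam p i (lc i q)" by (rule lam_skew[OF p lcm[OF Em[OF i] q] Em[OF i]])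
      also have "lam p i (lc i q) = g (lc p i) (lc i q)"
        using lc_props(2)[OF p Em[OF i] lcm[OF Em[OF i] q]] by simp
      also have "\<dots> = (\<Sum>k\<in>E. lam p i k * lam i q k)"
        using g.parseval[OF E lcm[OF p Em[OF i]] lcm[OF Em[OF i] q]] lc_props(2)[OF p Em[OF i] Em]
          lc_props(2)[OF Em[OF i] q Em] by simp
      finally show ?thesis by (simp add: mult.commute)
    qed
    then show ?thesis by (simp add: sum_negf)
  qed
  also have "(\<Sum>e\<in>E. lam (Pm (br e p)) q e) = (\<Sum>i\<in>E. \<Sum>k\<in>E. lam i q k * cc k p i)"
  proof -
    have "lam (Pm (br i p)) q i = (\<Sum>k\<in>E. cc i p k * lam k q i)" if i: "i \<in> E" for i
    proof -
      have lin: "lin_on mm (\<lambda>x. lam x q i)"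
        unfolding lin_on_def lam_def using q Em[OF i] by (simp add: cc_add cc_scale algebra_simps)
      have "lam (Pm (br i p)) q i = lam (\<Sum>k\<in>E. g (Pm (br i p)) k *\<^sub>R k) q i"
        using g.onb_expand[OF E pr] by simp
      also have "\<dots> = (\<Sum>k\<in>E. g (Pm (br i p)) k * lam k q i)"
        using lin_on_sum[OF mm_sub lin, of E "\<lambda>k. k"] Em by simp
      finally show ?thesis unfolding cc_def .
    qed
    then have "(\<Sum>e\<in>E. lam (Pm (br e p)) q e) = (\<Sum>i\<in>E. \<Sum>k\<in>E. cc i p k * lam k q i)" by simp
    also have "\<dots> = (\<Sum>k\<in>E. \<Sum>i\<in>E. cc i p k * lam k q i)" by (rule sum.swap)
    finally show ?thesis by (simp add: mult.commute)
  qed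
  also have "(\<Sum>e\<in>E. g (br (Ph (br e p)) q) e) = - (\<Sum>u\<in>U. Q (Ph (br u p)) (Ph (br u q)))"
  proof -
    have "(\<Sum>e\<in>E. g (br (Ph (br e p)) q) e) = (\<Sum>u\<in>U. Q (br (Ph (br u p)) q) u)"
      by (rule trace_g_Q[OF E U l4 m4])
    also have "\<dots> = (\<Sum>u\<in>U. - Q (Ph (br u p)) (Ph (br u q)))"
    proof (intro sum.cong refl)
      fix u
      have "Q (br (Ph (br u p)) q) u = Q (br q u) (Ph (br u p))" by (rule Q_cyc)
      also have "\<dots> = - Q (br u q) (Ph (br u p))" by (rule Q_swap12)
      also have "Q (br u q) (Ph (br u p)) = Q (Ph (br u q)) (Ph (br u p))"
        using proj_Q[OF hh_sub Ph_in] by simp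
      finally show "Q (br (Ph (br u p)) q) u = - Q (Ph (br u p)) (Ph (br u q))" using Qsym by simp
    qed
    finally show ?thesis by (simp add: sum_negf)
  qed
  finally have eq: "Rc p q = (\<Sum>i\<in>E. \<Sum>k\<in>E. lam i q k * lam p i k) - (\<Sum>i\<in>E. \<Sum>k\<in>E. lam i q k * cc k p i)
      + (\<Sum>u\<in>U. Q (Ph (br u p)) (Ph (br u q)))" by simp
  define sp where "sp = (\<lambda>i k. cc p i k + cc p k i)"
  define sq where "sq = (\<lambda>i k. cc q i k + cc q k i)"
  define ap where "ap = (\<lambda>i k. cc k i p)"
  define aq where "aq = (\<lambda>i k. cc k i q)"
  have trm: "lam i q k * lam p i k - lam i q k * cc k p i =
      (1/4) * (ap i k * aq i k - sp i k * sq i k) + (1/4) * (aq i k * sp i k - sq i k * ap i k)"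
    if ik: "i \<in> E" "k \<in> E" for i k
  proof -
    have a: "lam i q k = (1/2) * (aq i k - sq i k)"
      unfolding lam_def aq_def sq_def using cc_swap[OF Em[OF ik(2)], of i q] cc_swap[OF Em[OF ik(1)], of k q]
      by simp
    have b: "lam p i k - cc k p i = (1/2) * (sp i k + ap i k)"
      unfolding lam_def ap_def sp_def using cc_swap[OF Em[OF ik(1)], of k p] by (simp add: field_simps)
    have "lam i q k * lam p i k - lam i q k * cc k p i = lam i q k * (lam p i k - cc k p i)"
      by (simp add: algebra_simps)
    then show ?thesis unfolding a b by (simp add: algebra_simps)
  qed
  \<comment> \<open>A skew array contracted with a symmetric one gives zero, which removes the cross
    products in \<open>trm\<close>.\<close>
  have mixed: "(\<Sum>i\<in>E. \<Sum>k\<in>E. x i k * z i k) = 0"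
    if "\<And>i k. i \<in> E \<Longrightarrow> k \<in> E \<Longrightarrow> x i k = - x k i" "\<And>i k. z i k = z k i" for x z :: "'a \<Rightarrow> 'a \<Rightarrow> real"
  proof -
    have "(\<Sum>i\<in>E. \<Sum>k\<in>E. x i k * z i k) = (\<Sum>i\<in>E. \<Sum>k\<in>E. - (x k i * z k i))"
    proof (intro sum.cong refl)
      fix i k assume "i \<in> E" "k \<in> E"
      then show "x i k * z i k = - (x k i * z k i)" using that(1)[of i k] that(2)[of i k] by simp
    qed
    also have "\<dots> = - (\<Sum>i\<in>E. \<Sum>k\<in>E. x k i * z k i)" by (simp add: sum_negf)
    also have "(\<Sum>i\<in>E. \<Sum>k\<in>E. x k i * z k i) = (\<Sum>i\<in>E. \<Sum>k\<in>E. x i k * z i k)" by (rule sum.swap)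
    finally show ?thesis by simp
  qed
  have anti: "aq i k = - aq k i" "ap i k = - ap k i" for i k
    unfolding aq_def ap_def using cc_swap[OF q, of k i] cc_swap[OF p, of k i] by auto
  have sy: "sp i k = sp k i" "sq i k = sq k i" for i k unfolding sp_def sq_def by auto
  have m1: "(\<Sum>i\<in>E. \<Sum>k\<in>E. aq i k * sp i k) = 0" by (rule mixed[OF anti(1) sy(1)])
  have m2: "(\<Sum>i\<in>E. \<Sum>k\<in>E. ap i k * sq i k) = 0" by (rule mixed[OF anti(2) sy(2)])
  have "(\<Sum>i\<in>E. \<Sum>k\<in>E. lam i q k * lam p i k) - (\<Sum>i\<in>E. \<Sum>k\<in>E. lam i q k * cc k p i) =
      (\<Sum>i\<in>E. \<Sum>k\<in>E. lam i q k * lam p i k - lam i q k * cc k p i)" by (simp add: sum_subtractf)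
  also have "\<dots> = (\<Sum>i\<in>E. \<Sum>k\<in>E. (1/4) * (ap i k * aq i k - sp i k * sq i k) + (1/4) * (aq i k * sp i k - sq i k * ap i k))"
    by (intro sum.cong refl trm)
  also have "\<dots> = (1/4) * (\<Sum>i\<in>E. \<Sum>k\<in>E. ap i k * aq i k) - (1/4) * (\<Sum>i\<in>E. \<Sum>k\<in>E. sp i k * sq i k)
      + (1/4) * (\<Sum>i\<in>E. \<Sum>k\<in>E. aq i k * sp i k) - (1/4) * (\<Sum>i\<in>E. \<Sum>k\<in>E. ap i k * sq i k)"
    by (simp add: sum.distrib sum_subtractf sum_distrib_left algebra_simps)
  finally show ?thesis
    using m1 m2 unfolding eq ric_form_def sp_def sq_def ap_def aq_def by linarith
qed

text \<open>Symmetry is visible only in \<open>ric_form\<close>; it allows the spectral theorem to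
  be applied to the variation direction built from the Ricci tensor.\<close>

lemma ricci_symmetric_bilinear: "sym_bilinear_on mm Rc"
proof -
  interpret q: ip_space mm Q by (rule Qsub[OF mm_sub])
  obtain U where U: "orthonormal_basis Q mm U" by (rule q.onb_exists)
  obtain E where E: "orthonormal_basis g mm E" by (rule g.onb_exists)
  have Em: "e \<in> mm" if "e \<in> E" for e by (rule g.onb_in[OF E that])
  note f = ricci_form[OF E U]
  have s1: "\<And>x x' y. x \<in> mm \<Longrightarrow> x' \<in> mm \<Longrightarrow> y \<in> mm \<Longrightarrow>
     (\<Sum>i\<in>E. \<Sum>k\<in>E. (cc (x + x') i k + cc (x + x') k i) * (cc y i k + cc y k i)) =
     (\<Sum>i\<in>E. \<Sum>k\<in>E. (cc x i k + cc x k i) * (cc y i k + cc y k i)) +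
     (\<Sum>i\<in>E. \<Sum>k\<in>E. (cc x' i k + cc x' k i) * (cc y i k + cc y k i))"
    unfolding sum.distrib[symmetric] by (intro sum.cong refl) (simp add: cc_add Em algebra_simps)
  have s2: "\<And>x x' y. x \<in> mm \<Longrightarrow> x' \<in> mm \<Longrightarrow> y \<in> mm \<Longrightarrow>
     (\<Sum>i\<in>E. \<Sum>k\<in>E. cc k i (x + x') * cc k i y) =
     (\<Sum>i\<in>E. \<Sum>k\<in>E. cc k i x * cc k i y) + (\<Sum>i\<in>E. \<Sum>k\<in>E. cc k i x' * cc k i y)"
    unfolding sum.distrib[symmetric] by (intro sum.cong refl) (simp add: cc_add algebra_simps)
  have s3: "(\<Sum>u\<in>U. Q (Ph (br u (x + x'))) (Ph (br u y))) =
     (\<Sum>u\<in>U. Q (Ph (br u x)) (Ph (br u y))) + (\<Sum>u\<in>U. Q (Ph (br u x')) (Ph (br u y)))" for x x' y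
    unfolding sum.distrib[symmetric]
    by (intro sum.cong refl) (simp add: br_add_right linear_add[OF Ph_lin] Qadd_left)
  have t1: "\<And>x r y. x \<in> mm \<Longrightarrow> y \<in> mm \<Longrightarrow>
     (\<Sum>i\<in>E. \<Sum>k\<in>E. (cc (r *\<^sub>R x) i k + cc (r *\<^sub>R x) k i) * (cc y i k + cc y k i)) =
     r * (\<Sum>i\<in>E. \<Sum>k\<in>E. (cc x i k + cc x k i) * (cc y i k + cc y k i))"
    unfolding sum_distrib_left by (intro sum.cong refl) (simp add: cc_scale Em algebra_simps)
  have t2: "\<And>x r y. x \<in> mm \<Longrightarrow> y \<in> mm \<Longrightarrow>
     (\<Sum>i\<in>E. \<Sum>k\<in>E. cc k i (r *\<^sub>R x) * cc k i y) = r * (\<Sum>i\<in>E. \<Sum>k\<in>E. cc k i x * cc k i y)"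
    unfolding sum_distrib_left by (intro sum.cong refl) (simp add: cc_scale algebra_simps)
  have t3: "(\<Sum>u\<in>U. Q (Ph (br u (r *\<^sub>R x))) (Ph (br u y))) = r * (\<Sum>u\<in>U. Q (Ph (br u x)) (Ph (br u y)))" for x r y
    unfolding sum_distrib_left
    by (intro sum.cong refl) (simp add: br_scale_right linear_scale[OF Ph_lin] Qscale_left)
  show ?thesis
    unfolding sym_bilinear_on_def
  proof (intro conjI ballI allI)
    fix x y assume xy: "x \<in> mm" "y \<in> mm"
    show "Rc x y = Rc y x"
      unfolding f[OF xy] f[OF xy(2,1)] ric_form_def by (simp add: mult.commute Qsym)
    show "Rc (r *\<^sub>R x) y = r * Rc x y" for r
      unfolding f[OF xy] f[OF subspace_scale[OF mm_sub xy(1)] xy(2)] ric_form_def t1[OF xy] t2[OF xy] t3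
      by (simp add: algebra_simps)
    show "Rc (x + y) z = Rc x z + Rc y z" if z: "z \<in> mm" for z
      unfolding f[OF xy(1) z] f[OF xy(2) z] f[OF subspace_add[OF mm_sub xy] z] ric_form_def
        s1[OF xy z] s2[OF xy z] s3 by (simp add: algebra_simps)
  qed
qed

lemma Ad_image_onb:
  assumes a: "a \<in> H" and b: "inner_product_on mm b" "Ad_invariant_on G H mm b" and E: "orthonormal_basis b mm E"
  shows "orthonormal_basis b mm (Ad G a ` E)" "inj_on (Ad G a) E"
proof -
  note ac = H_car[OF a]
  note lin = Ad_linear[OF ac]
  have injA: "inj (Ad G a)" using Ad_inv_cancel(2)[OF ac] by (metis injI)
  then show "inj_on (Ad G a) E" using inj_on_subset by blast
  have Em: "E \<subseteq> mm" "span E = mm" using E unfolding orthonormal_basis_def by auto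
  have "Ad G a ` mm = mm"
  proof
    show "Ad G a ` mm \<subseteq> mm" using Ad_mm[OF a] by blast
    show "mm \<subseteq> Ad G a ` mm"
    proof
      fix x assume "x \<in> mm"
      then have "Ad G (inv a) x \<in> mm" using Ad_mm subgroup.m_inv_closed[OF H_sub a] by blast
      then show "x \<in> Ad G a ` mm" using Ad_inv_cancel(1)[OF ac, of x] by (metis image_eqI)
    qed
  qed
  then have sp: "span (Ad G a ` E) = mm" using linear_span_image[OF lin, of E] Em by simp
  have "b (Ad G a x) (Ad G a y) = (if Ad G a x = Ad G a y then 1 else 0)" if "x \<in> E" "y \<in> E" for x y
    using that E b(2) a Em injA unfolding Ad_invariant_on_def orthonormal_basis_def
    by (metis (no_types, lifting) injD subsetD)
  then show "orthonormal_basis b mm (Ad G a ` E)"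
    unfolding orthonormal_basis_def using sp Em Ad_mm[OF a] by auto
qed

lemma cc_Ad:
  assumes a: "a \<in> H" and z: "z \<in> mm" shows "cc (Ad G a x) (Ad G a y) (Ad G a z) = cc x y z"
  unfolding cc_def Ad_bracket[OF H_car[OF a], symmetric] Ad_Ph[OF a]
  using ginv a Pm_in z unfolding Ad_invariant_on_def by blast

text \<open>\<open>ricci_form\<close> holds for every pair of bases. Moving both by
  \<open>Ad G a\<close> leaves all structure constants unchanged.\<close>

lemma ricci_Ad_invariant: "Ad_invariant_on G H mm Rc"
  unfolding Ad_invariant_on_def
proof (intro ballI)
  fix a p q assume a: "a \<in> H" and p: "p \<in> mm" and q: "q \<in> mm"
  interpret q: ip_space mm Q by (rule Qsub[OF mm_sub])
  obtain U where U: "orthonormal_basis Q mm U" by (rule q.onb_exists)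
  obtain E where E: "orthonormal_basis g mm E" by (rule g.onb_exists)
  have Em: "e \<in> mm" if "e \<in> E" for e by (rule g.onb_in[OF E that])
  have Qi: "inner_product_on mm Q" "Ad_invariant_on G H mm Q"
    using q.ip Q_Ad H_car unfolding Ad_invariant_on_def by auto
  note E' = Ad_image_onb[OF a gip ginv E]
  note U' = Ad_image_onb[OF a Qi U]
  have reE: "(\<Sum>e\<in>Ad G a ` E. F e) = (\<Sum>e\<in>E. F (Ad G a e))" for F :: "'a \<Rightarrow> real"
    using sum.reindex[OF E'(2)] by simp
  have reU: "(\<Sum>e\<in>Ad G a ` U. F e) = (\<Sum>e\<in>U. F (Ad G a e))" for F :: "'a \<Rightarrow> real"
    using sum.reindex[OF U'(2)] by simp
  have "Rc (Ad G a p) (Ad G a q) = ric_form (Ad G a ` E) (Ad G a ` U) (Ad G a p) (Ad G a q)"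
    by (rule ricci_form[OF E'(1) U'(1) Ad_mm[OF a p] Ad_mm[OF a q]])
  also have "\<dots> = ric_form E U p q"
    unfolding ric_form_def reE reU
    by (simp add: cc_Ad[OF a] Em p q Ad_bracket[OF H_car[OF a], symmetric] Ad_Ph[OF a] Q_Ad[OF H_car[OF a]]
        cong: sum.cong)
  also have "\<dots> = Rc p q" by (rule ricci_form[OF E U p q, symmetric])
  finally show "Rc (Ad G a p) (Ad G a q) = Rc p q" .
qed

text \<open>The shape that matches the derivative of \<open>scal_g_diag\<close> in the inverse
  eigenvalues. The isotropy term is absorbed through
  \<open>killing_form G UNIV x x = - PP - 2 * HH\<close>.\<close>

lemma ricci_diag:
  assumes E: "orthonormal_basis g mm E" and x: "x \<in> mm"
  shows "Rc x x = - (1/2) * killing_form G UNIV x x - (1/2) * (\<Sum>i\<in>E. \<Sum>k\<in>E. (cc x i k)\<^sup>2)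
     + (1/4) * (\<Sum>i\<in>E. \<Sum>k\<in>E. (cc i k x)\<^sup>2)"
proof -
  interpret q: ip_space mm Q by (rule Qsub[OF mm_sub])
  interpret hq: ip_space hh Q by (rule Qsub[OF hh_sub])
  obtain U where U: "orthonormal_basis Q mm U" by (rule q.onb_exists)
  obtain F where F: "orthonormal_basis Q hh F" by (rule hq.onb_exists)
  have Em: "e \<in> mm" if "e \<in> E" for e by (rule g.onb_in[OF E that])
  have Um: "e \<in> mm" if "e \<in> U" for e by (rule q.onb_in[OF U that])
  have Fh: "e \<in> hh" if "e \<in> F" for e by (rule hq.onb_in[OF F that])
  have fin: "finite U" "finite F" by (rule q.onb_finite[OF U], rule hq.onb_finite[OF F])
  have un: "orthonormal_basis Q UNIV (U \<union> F)" "U \<inter> F = {}"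
    using onb_union[OF hh_sub subspace_UNIV _ _ F, of U] U by auto
  have UN: "lie_subalgebra G UNIV" unfolding lie_subalgebra_def by simp
  have QP: "Q u u = Q (Pm u) (Pm u) + Q (Ph u) (Ph u)" for u
  proof -
    have z: "Q (Pm u) (Ph u) = 0" "Q (Ph u) (Pm u) = 0"
      using Pm_in[of u] Ph_in[of u] Qsym[of "Ph u"] unfolding perp_def by auto
    have "Q u u = Q (Ph u + Pm u) (Ph u + Pm u)" using Ph_Pm[of u] by simp
    then show ?thesis using z by (simp add: Qadd_left Qadd_right)
  qed
  define PP where "PP = (\<Sum>u\<in>U. Q (Pm (br x u)) (Pm (br x u)))"
  define HH where "HH = (\<Sum>u\<in>U. Q (Ph (br x u)) (Ph (br x u)))"
  have "(\<Sum>f\<in>F. Q (br x f) (br x f)) = (\<Sum>f\<in>F. \<Sum>u\<in>U. (Q (br x f) u)\<^sup>2)"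
  proof (intro sum.cong refl)
    fix f assume f: "f \<in> F"
    have "br x f \<in> mm" using br_hh_mm[OF Fh[OF f] x] br_skew[of x f] subspace_neg[OF mm_sub] by simp
    then show "Q (br x f) (br x f) = (\<Sum>u\<in>U. (Q (br x f) u)\<^sup>2)"
      using q.parseval[OF U] by (simp add: power2_eq_square)
  qed
  also have "\<dots> = (\<Sum>u\<in>U. \<Sum>f\<in>F. (Q (br x f) u)\<^sup>2)" by (rule sum.swap)
  also have "\<dots> = HH"
    unfolding HH_def
  proof (intro sum.cong refl)
    fix u
    have "(Q (br x f) u)\<^sup>2 = (Q (Ph (br x u)) f)\<^sup>2" if "f \<in> F" for f
      using Q_swap23[of x f u] proj_Q[OF hh_sub Fh[OF that], of "br x u"] by simp
    then show "(\<Sum>f\<in>F. (Q (br x f) u)\<^sup>2) = Q (Ph (br x u)) (Ph (br x u))"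
      using hq.parseval[OF F Ph_in Ph_in] by (simp add: power2_eq_square)
  qed
  finally have FH: "(\<Sum>f\<in>F. Q (br x f) (br x f)) = HH" .
  have "killing_form G UNIV x x = - (\<Sum>f\<in>U \<union> F. Q (br x f) (br x f))"
    by (rule killing_onb[OF UN un(1)]) auto
  also have "\<dots> = - ((\<Sum>u\<in>U. Q (br x u) (br x u)) + HH)"
    using sum.union_disjoint[OF fin un(2), of "\<lambda>f. Q (br x f) (br x f)"] FH by simp
  also have "(\<Sum>u\<in>U. Q (br x u) (br x u)) = PP + HH"
    unfolding PP_def HH_def sum.distrib[symmetric] by (intro sum.cong refl QP)
  finally have K: "killing_form G UNIV x x = - PP - 2 * HH" by simp
  have "(\<Sum>i\<in>E. \<Sum>k\<in>E. cc x i k * cc x k i) = (\<Sum>i\<in>E. g (Pm (br x (Pm (br x i)))) i)"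
  proof (intro sum.cong refl)
    fix i assume i: "i \<in> E"
    have "cc x (Pm (br x i)) i = cc x (\<Sum>k\<in>E. g (Pm (br x i)) k *\<^sub>R k) i"
      using g.onb_expand[OF E Pm_in] by simp
    also have "\<dots> = (\<Sum>k\<in>E. g (Pm (br x i)) k * cc x k i)"
      using lin_on_sum[OF mm_sub cc_lin(2)[OF Em[OF i]], of E "\<lambda>k. k"] Em by simp
    finally show "(\<Sum>k\<in>E. cc x i k * cc x k i) = g (Pm (br x (Pm (br x i)))) i" unfolding cc_def by simp
  qed
  also have "\<dots> = (\<Sum>u\<in>U. Q (Pm (br x (Pm (br x u)))) u)"
  proof (rule trace_g_Q[OF E U])
    show "lin_on mm (\<lambda>i. Pm (br x (Pm (br x i))))"
      unfolding lin_on_def by (simp add: br_add_right br_scale_right linear_add[OF Pm_lin] linear_scale[OF Pm_lin])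
  qed (rule Pm_in)
  also have "\<dots> = (\<Sum>u\<in>U. - Q (Pm (br x u)) (Pm (br x u)))"
  proof (intro sum.cong refl)
    fix u assume u: "u \<in> U"
    have "Q (Pm (br x (Pm (br x u)))) u = Q (br x (Pm (br x u))) u" by (rule proj_Q[OF mm_sub Um[OF u]])
    also have "\<dots> = - Q (br x u) (Pm (br x u))" by (rule Q_swap23)
    also have "Q (br x u) (Pm (br x u)) = Q (Pm (br x u)) (Pm (br x u))"
      using proj_Q[OF mm_sub Pm_in] by simp
    finally show "Q (Pm (br x (Pm (br x u)))) u = - Q (Pm (br x u)) (Pm (br x u))" .
  qed
  finally have CC: "(\<Sum>i\<in>E. \<Sum>k\<in>E. cc x i k * cc x k i) = - PP" by (simp add: PP_def sum_negf)
  have "(\<Sum>u\<in>U. Q (Ph (br u x)) (Ph (br u x))) = HH"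
    unfolding HH_def
  proof (intro sum.cong refl)
    fix u
    have "Ph (br u x) = - Ph (br x u)" using br_skew[of u x] linear_neg[OF Ph_lin] by simp
    then show "Q (Ph (br u x)) (Ph (br u x)) = Q (Ph (br x u)) (Ph (br x u))" by (simp add: Q_minus)
  qed
  moreover have "(\<Sum>i\<in>E. \<Sum>k\<in>E. (cc x i k + cc x k i) * (cc x i k + cc x k i)) =
      2 * (\<Sum>i\<in>E. \<Sum>k\<in>E. (cc x i k)\<^sup>2) + 2 * (\<Sum>i\<in>E. \<Sum>k\<in>E. cc x i k * cc x k i)"
  proof -
    have sw: "(\<Sum>i\<in>E. \<Sum>k\<in>E. (cc x k i)\<^sup>2) = (\<Sum>i\<in>E. \<Sum>k\<in>E. (cc x i k)\<^sup>2)" by (rule sum.swap)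
    have "(\<Sum>i\<in>E. \<Sum>k\<in>E. (cc x i k + cc x k i) * (cc x i k + cc x k i)) =
      (\<Sum>i\<in>E. \<Sum>k\<in>E. (cc x i k)\<^sup>2 + (cc x k i)\<^sup>2 + 2 * (cc x i k * cc x k i))"
      by (intro sum.cong refl) (simp add: power2_eq_square algebra_simps)
    also have "\<dots> = (\<Sum>i\<in>E. \<Sum>k\<in>E. (cc x i k)\<^sup>2) + (\<Sum>i\<in>E. \<Sum>k\<in>E. (cc x k i)\<^sup>2)
        + 2 * (\<Sum>i\<in>E. \<Sum>k\<in>E. cc x i k * cc x k i)"
      by (simp add: sum.distrib sum_distrib_left)
    finally show ?thesis unfolding sw by simp
  qed
  moreover have "(\<Sum>i\<in>E. \<Sum>k\<in>E. cc k i x * cc k i x) = (\<Sum>i\<in>E. \<Sum>k\<in>E. (cc i k x)\<^sup>2)"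
    by (subst sum.swap) (simp add: power2_eq_square)
  ultimately show ?thesis
    unfolding ricci_form[OF E U x x] ric_form_def K CC by (simp add: field_simps)
qed

lemma scal_g_diag:
  assumes E: "orthonormal_basis g mm E" and h: "inner_product_on mm h"
    and d: "\<And>a b. a \<in> E \<Longrightarrow> b \<in> E \<Longrightarrow> h a b = (if a = b then x a else 0)"
  shows "scal G Q UNIV hh h = - (1/2) * (\<Sum>e\<in>E. killing_form G UNIV e e / x e)
     - (1/4) * (\<Sum>a\<in>E. \<Sum>b\<in>E. \<Sum>c\<in>E. x c / (x a * x b) * (cc a b c)\<^sup>2)"
proof -
  have U: "lie_subalgebra G UNIV" unfolding lie_subalgebra_def by simp
  have m: "mm = UNIV \<inter> mm" by simp
  show ?thesis unfolding cc_def by (rule scal_diag_general[OF U m hh_sub h gip E d])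
qed

lemma ratio_derivative:
  "((\<lambda>t. (1 + t * a) * (1 + t * b) / (1 + t * c) * q) has_real_derivative (a + b - c) * q) (at 0)"
  for a b c q :: real
  by (auto intro!: derivative_eq_intros simp: algebra_simps)

text \<open>Vary \<open>g\<close> in the direction \<open>Ric - S(g) T\<close>, along metrics that are diagonal in a
  \<open>g\<close>-orthonormal frame diagonalising this direction.  By homogeneity the maximum property reads
  \<open>S(h) \<le> S(g) tr\<^sub>h T\<close> for all invariant \<open>h\<close>, and the derivative of the difference is the squared norm
  of \<open>Ric - S(g) T\<close>.\<close>

lemma ricci_of_maximum:
  assumes T: "inner_product_on mm T" "Ad_invariant_on G H mm T" and tr: "metric_trace g mm T = 1"
    and max: "\<And>h. h \<in> invariant_metrics G H mm \<Longrightarrow> metric_trace h mm T = 1 \<Longrightarrow>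
      scal G Q UNIV hh h \<le> scal G Q UNIV hh g"
    and xy: "x \<in> mm" "y \<in> mm"
  shows "Rc x y = scal G Q UNIV hh g * T x y"
proof -
  define c where "c = scal G Q UNIV hh g"
  interpret T: ip_space mm T using T(1) mm_sub by unfold_locales
  have Ts: "sym_bilinear_on mm T" using T(1) inner_product_on_def by blast
  define v where "v = (\<lambda>x y. Rc x y - c * T x y)"
  have vs: "sym_bilinear_on mm v"
    using ricci_symmetric_bilinear Ts unfolding sym_bilinear_on_def v_def by (simp add: algebra_simps)
  note vb = sym_bilinear_imp_bilin[OF vs mm_sub]
  have vinv: "v (Ad G k x) (Ad G k y) = v x y" if "k \<in> H" "x \<in> mm" "y \<in> mm" for k x y
    using ricci_Ad_invariant T(2) that unfolding Ad_invariant_on_def v_def by simp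
  have vsym: "v x y = v y x" if "x \<in> mm" "y \<in> mm" for x y
    using vs that unfolding sym_bilinear_on_def by blast
  have gsp: "ip_space mm g" by unfold_locales
  obtain E where E: "orthonormal_basis g mm E" "\<And>e f. e \<in> E \<Longrightarrow> f \<in> E \<Longrightarrow> e \<noteq> f \<Longrightarrow> v e f = 0"
    using spectral_theorem[OF gsp vs] by metis
  have Em: "e \<in> mm" if "e \<in> E" for e by (rule g.onb_in[OF E(1) that])
  note fin = g.onb_finite[OF E(1)]
  define \<mu> where "\<mu> = (\<lambda>e. v e e)"
  have vE: "v u b = \<mu> b * g u b" if u: "u \<in> mm" and b: "b \<in> E" for u b
  proof -
    have "v u b = v (\<Sum>e\<in>E. g u e *\<^sub>R e) b" using g.onb_expand[OF E(1) u] by simp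
    also have "\<dots> = (\<Sum>e\<in>E. g u e * v e b)"
      using lin_on_sum[OF mm_sub bilin_on_left[OF vb Em[OF b]], of E "\<lambda>e. e"] Em by simp
    also have "\<dots> = (\<Sum>e\<in>E. if e = b then g u b * \<mu> b else 0)"
      using E(2) b by (intro sum.cong refl) (auto simp: \<mu>_def)
    also have "\<dots> = \<mu> b * g u b" using fin b by simp
    finally show ?thesis .
  qed
  \<comment> \<open>Invariance of \<open>v\<close> makes \<open>Ad\<close> respect its eigenspaces,
    so a metric diagonal in \<open>E\<close> whose eigenvalues depend on \<open>\<mu>\<close> alone
    is invariant.\<close>
  have com: "(\<mu> a - \<mu> b) * g (Ad G k a) b = 0" if ab: "a \<in> E" "b \<in> E" and k: "k \<in> H" for a b k
  proof -
    have ki: "inv k \<in> H" using subgroup.m_inv_closed[OF H_sub k] .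
    have Aa: "Ad G k a \<in> mm" and Ab: "Ad G (inv k) b \<in> mm" using Ad_mm k ki Em ab by auto
    note canc = Ad_inv_cancel(1)[OF H_car[OF k], of b]
    have "\<mu> b * g (Ad G k a) b = v (Ad G k a) b" using vE[OF Aa ab(2)] by simp
    also have "\<dots> = v (Ad G k a) (Ad G k (Ad G (inv k) b))" by (simp only: canc)
    also have "\<dots> = v a (Ad G (inv k) b)" by (rule vinv[OF k Em[OF ab(1)] Ab])
    also have "\<dots> = v (Ad G (inv k) b) a" by (rule vsym[OF Em[OF ab(1)] Ab])
    also have "\<dots> = \<mu> a * g (Ad G (inv k) b) a" by (rule vE[OF Ab ab(1)])
    also have "g (Ad G (inv k) b) a = g (Ad G k (Ad G (inv k) b)) (Ad G k a)"
      using ginv k Ab Em[OF ab(1)] unfolding Ad_invariant_on_def by simp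
    also have "\<dots> = g b (Ad G k a)" by (simp only: canc)
    also have "\<dots> = g (Ad G k a) b" by (rule g.symm[OF Em[OF ab(2)] Aa])
    finally show ?thesis by auto
  qed
  define K where "K = (\<lambda>e. killing_form G UNIV e e)"
  \<comment> \<open>\<open>N\<close> and \<open>\<Phi>\<close> are the trace of \<open>T\<close> and
    the scalar curvature for inverse eigenvalues \<open>1 + t * \<mu> e\<close>. Scaling the metric
    by \<open>N t\<close> restores trace one and divides the scalar curvature by
    \<open>N t\<close>.\<close>
  define N where "N = (\<lambda>t. \<Sum>e\<in>E. (1 + t * \<mu> e) * T e e)"
  define \<Phi> where "\<Phi> = (\<lambda>t. - (1/2) * (\<Sum>e\<in>E. (1 + t * \<mu> e) * K e)
    - (1/4) * (\<Sum>a\<in>E. \<Sum>b\<in>E. \<Sum>e\<in>E. (1 + t * \<mu> a) * (1 + t * \<mu> b) / (1 + t * \<mu> e) * (cc a b e)\<^sup>2))"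
  define f where "f = (\<lambda>t. \<Phi> t - c * N t)"
  have N0: "N 0 = 1"
    using tr g.metric_trace_onb[OF E(1) T.bil] by (simp add: N_def)
  have \<Phi>0: "\<Phi> 0 = c"
    using scal_g_diag[OF E(1) gip, of "\<lambda>_. 1"] g.onb_eq[OF E(1)] by (simp add: \<Phi>_def c_def K_def)
  have f0: "f 0 = 0" by (simp add: f_def N0 \<Phi>0)
  \<comment> \<open>For \<open>t\<close> of absolute value below \<open>d\<close> all inverse
    eigenvalues \<open>1 + t * \<mu> e\<close> are positive.\<close>
  define d where "d = 1 / (1 + (\<Sum>e\<in>E. \<bar>\<mu> e\<bar>))"
  have den: "1 + (\<Sum>e\<in>E. \<bar>\<mu> e\<bar>) > 0" by (intro add_pos_nonneg sum_nonneg) auto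
  have d: "d > 0" unfolding d_def using den by simp
  have Tpos: "T e e > 0" if "e \<in> E" for e
  proof -
    have "e \<noteq> 0" using g.onb_eq[OF E(1) that that] g.zero_left[OF Em[OF that]] by force
    then show ?thesis by (rule T.pos[OF Em[OF that]])
  qed
  have Ene: "E \<noteq> {}" using N0 by (auto simp: N_def)
  have fle: "f t \<le> 0" if t: "\<bar>t\<bar> < d" for t
  proof -
    define y where "y = (\<lambda>e. 1 + t * \<mu> e)"
    have y: "y e > 0" if e: "e \<in> E" for e
    proof -
      have "\<bar>\<mu> e\<bar> \<le> (\<Sum>e\<in>E. \<bar>\<mu> e\<bar>)" using fin e by (intro member_le_sum) auto
      then have "\<bar>t\<bar> * \<bar>\<mu> e\<bar> \<le> \<bar>t\<bar> * (1 + (\<Sum>e\<in>E. \<bar>\<mu> e\<bar>))" by (intro mult_left_mono) auto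
      also have "\<dots> < 1" using t den unfolding d_def by (simp add: pos_less_divide_eq)
      finally have "\<bar>t * \<mu> e\<bar> < 1" by (simp add: abs_mult)
      then show ?thesis unfolding y_def by linarith
    qed
    have Npos: "N t > 0" unfolding N_def using y Tpos fin Ene by (intro sum_pos) (auto simp: y_def)
    define x where "x = (\<lambda>e. N t / y e)"
    have xpos: "x e > 0" if "e \<in> E" for e unfolding x_def using Npos y[OF that] by simp
    have xcom: "(x a - x b) * g (Ad G k a) b = 0" if "a \<in> E" "b \<in> E" "k \<in> H" for a b k
      using com[OF that] by (auto simp: x_def y_def)
    define h where "h = (\<lambda>u w. \<Sum>e\<in>E. x e * (g u e * g w e))"
    have h: "h \<in> invariant_metrics G H mm" "\<And>a b. a \<in> E \<Longrightarrow> b \<in> E \<Longrightarrow> h a b = (if a = b then x a else 0)"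
      using diagonal_metric[OF mm_sub Ad_mm g E(1), of x] xpos xcom unfolding h_def by blast+
    have hip: "inner_product_on mm h" using h(1) unfolding invariant_metrics_def by blast
    interpret h: ip_space mm h using hip mm_sub by unfold_locales
    have "metric_trace h mm T = (\<Sum>e\<in>some_onb h mm. T e e)"
      by (rule h.metric_trace_onb[OF h.some_onb T.bil])
    also have "\<dots> = (\<Sum>e\<in>E. T e e / x e)"
      by (rule h.sum_onb_diag[OF gsp E(1) h(2) h.some_onb T.bil])
    also have "\<dots> = (\<Sum>e\<in>E. y e * T e e) / N t"
      unfolding x_def sum_divide_distrib by (intro sum.cong refl) simp
    also have "\<dots> = 1" using Npos unfolding N_def y_def by simp
    finally have "scal G Q UNIV hh h \<le> c" unfolding c_def by (intro max h(1))
    moreover have "scal G Q UNIV hh h = \<Phi> t / N t"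
    proof -
      have "scal G Q UNIV hh h = - (1/2) * (\<Sum>e\<in>E. K e / x e)
         - (1/4) * (\<Sum>a\<in>E. \<Sum>b\<in>E. \<Sum>e\<in>E. x e / (x a * x b) * (cc a b e)\<^sup>2)"
        unfolding K_def by (rule scal_g_diag[OF E(1) hip h(2)])
      also have "(\<Sum>e\<in>E. K e / x e) = (\<Sum>e\<in>E. y e * K e) / N t"
        unfolding x_def sum_divide_distrib by (intro sum.cong refl) simp
      also have "(\<Sum>a\<in>E. \<Sum>b\<in>E. \<Sum>e\<in>E. x e / (x a * x b) * (cc a b e)\<^sup>2) =
          (\<Sum>a\<in>E. \<Sum>b\<in>E. \<Sum>e\<in>E. y a * y b / y e * (cc a b e)\<^sup>2) / N t"
        unfolding sum_divide_distrib
      proof (intro sum.cong refl)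
        fix a b e
        show "x e / (x a * x b) * (cc a b e)\<^sup>2 = y a * y b / y e * (cc a b e)\<^sup>2 / N t"
          using Npos unfolding x_def by (simp add: field_simps)
      qed
      finally show ?thesis unfolding \<Phi>_def y_def by (simp add: diff_divide_distrib)
    qed
    ultimately have "\<Phi> t / N t \<le> c" by simp
    then have "\<Phi> t \<le> c * N t" using Npos by (simp add: pos_divide_le_eq)
    then show ?thesis by (simp add: f_def)
  qed
  define R1 where "R1 = (\<lambda>a. \<Sum>b\<in>E. \<Sum>e\<in>E. (cc a b e)\<^sup>2)"
  define R2 where "R2 = (\<lambda>e. \<Sum>a\<in>E. \<Sum>b\<in>E. (cc a b e)\<^sup>2)"
  have fd: "(f has_real_derivative
      (- (1/2) * (\<Sum>e\<in>E. \<mu> e * K e)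
      - (1/4) * (\<Sum>a\<in>E. \<Sum>b\<in>E. \<Sum>e\<in>E. (\<mu> a + \<mu> b - \<mu> e) * (cc a b e)\<^sup>2))
      - c * (\<Sum>e\<in>E. \<mu> e * T e e)) (at 0)"
    unfolding f_def \<Phi>_def N_def
    by (intro DERIV_diff DERIV_cmult DERIV_sum ratio_derivative) (auto intro!: derivative_eq_intros)
  have "\<forall>s. \<bar>0 - s\<bar> < d \<longrightarrow> f s \<le> f 0" using fle f0 by simp
  from DERIV_local_max[OF fd d this]
  have z: "- (1/2) * (\<Sum>e\<in>E. \<mu> e * K e)
      - (1/4) * (\<Sum>a\<in>E. \<Sum>b\<in>E. \<Sum>e\<in>E. (\<mu> a + \<mu> b - \<mu> e) * (cc a b e)\<^sup>2)
      - c * (\<Sum>e\<in>E. \<mu> e * T e e) = 0" .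
  have s1: "(\<Sum>a\<in>E. \<Sum>b\<in>E. \<Sum>e\<in>E. \<mu> a * (cc a b e)\<^sup>2) = (\<Sum>a\<in>E. \<mu> a * R1 a)"
    unfolding R1_def by (simp add: sum_distrib_left)
  have s2: "(\<Sum>a\<in>E. \<Sum>b\<in>E. \<Sum>e\<in>E. \<mu> b * (cc a b e)\<^sup>2) = (\<Sum>a\<in>E. \<mu> a * R1 a)"
  proof -
    have "(\<Sum>a\<in>E. \<Sum>b\<in>E. \<Sum>e\<in>E. \<mu> b * (cc a b e)\<^sup>2) = (\<Sum>b\<in>E. \<Sum>a\<in>E. \<Sum>e\<in>E. \<mu> b * (cc a b e)\<^sup>2)"
      by (rule sum.swap)
    also have "\<dots> = (\<Sum>b\<in>E. \<Sum>a\<in>E. \<Sum>e\<in>E. \<mu> b * (cc b a e)\<^sup>2)"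
    proof (intro sum.cong refl)
      fix a b e assume "e \<in> E"
      then show "\<mu> b * (cc a b e)\<^sup>2 = \<mu> b * (cc b a e)\<^sup>2" using cc_swap[OF Em, of e a b] by simp
    qed
    finally show ?thesis unfolding R1_def by (simp add: sum_distrib_left)
  qed
  have s3: "(\<Sum>a\<in>E. \<Sum>b\<in>E. \<Sum>e\<in>E. \<mu> e * (cc a b e)\<^sup>2) = (\<Sum>e\<in>E. \<mu> e * R2 e)"
  proof -
    have "(\<Sum>a\<in>E. \<Sum>b\<in>E. \<Sum>e\<in>E. \<mu> e * (cc a b e)\<^sup>2) = (\<Sum>a\<in>E. \<Sum>e\<in>E. \<Sum>b\<in>E. \<mu> e * (cc a b e)\<^sup>2)"
      by (intro sum.cong refl sum.swap)
    also have "\<dots> = (\<Sum>e\<in>E. \<Sum>a\<in>E. \<Sum>b\<in>E. \<mu> e * (cc a b e)\<^sup>2)" by (rule sum.swap)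
    finally show ?thesis unfolding R2_def by (simp add: sum_distrib_left)
  qed
  \<comment> \<open>Relabelling the sums, with skewness in the first two slots, isolates the
    coefficient of each \<open>\<mu> e\<close>. By \<open>ricci_diag\<close> the total coefficient
    is \<open>\<mu> e\<close> again, so the derivative is a sum of squares.\<close>
  have s123: "(\<Sum>a\<in>E. \<Sum>b\<in>E. \<Sum>e\<in>E. (\<mu> a + \<mu> b - \<mu> e) * (cc a b e)\<^sup>2) =
      2 * (\<Sum>a\<in>E. \<mu> a * R1 a) - (\<Sum>e\<in>E. \<mu> e * R2 e)"
    using s1 s2 s3 by (simp add: left_diff_distrib distrib_right sum.distrib sum_subtractf)
  have "\<mu> e * \<mu> e = - (1/2) * (\<mu> e * K e) - (1/2) * (\<mu> e * R1 e) + (1/4) * (\<mu> e * R2 e) - c * (\<mu> e * T e e)"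
    if e: "e \<in> E" for e
  proof -
    have "\<mu> e = - (1/2) * K e - (1/2) * R1 e + (1/4) * R2 e - c * T e e"
      unfolding \<mu>_def v_def ricci_diag[OF E(1) Em[OF e]] K_def R1_def R2_def ..
    then have "\<mu> e * \<mu> e = \<mu> e * (- (1/2) * K e - (1/2) * R1 e + (1/4) * R2 e - c * T e e)" by simp
    then show ?thesis by (simp add: algebra_simps)
  qed
  then have "(\<Sum>e\<in>E. \<mu> e * \<mu> e) = - (1/2) * (\<Sum>e\<in>E. \<mu> e * K e) - (1/2) * (\<Sum>e\<in>E. \<mu> e * R1 e)
      + (1/4) * (\<Sum>e\<in>E. \<mu> e * R2 e) - c * (\<Sum>e\<in>E. \<mu> e * T e e)"
    by (simp add: sum.distrib sum_subtractf sum_distrib_left sum_negf)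
  also have "\<dots> = 0" using z unfolding s123 by (simp add: diff_divide_distrib)
  finally have "(\<Sum>e\<in>E. \<mu> e * \<mu> e) = 0" .
  then have \<mu>0: "\<mu> e = 0" if "e \<in> E" for e
    using sum_nonneg_eq_0_iff[OF fin, of "\<lambda>e. \<mu> e * \<mu> e"] that by simp
  have "v x y = v x (\<Sum>e\<in>E. g y e *\<^sub>R e)" using g.onb_expand[OF E(1) xy(2)] by simp
  also have "\<dots> = (\<Sum>e\<in>E. g y e * v x e)"
    using lin_on_sum[OF mm_sub bilin_on_right[OF vb xy(1)], of E "\<lambda>e. e"] Em by simp
  also have "\<dots> = 0" using vE[OF xy(1)] \<mu>0 by simp
  finally show ?thesis by (simp add: v_def c_def)
qed

end

section \<open>The canonical variation\<close>

context hom_space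
begin

lemma proj_Ad:
  assumes k: "subalg k" and a: "a \<in> H" shows "proj Q k (Ad G a u) = Ad G a (proj Q k u)"
proof (rule proj_eq[OF subalg_sub[OF k]])
  show "Ad G a (proj Q k u) \<in> k" by (rule Ad_H_preserves(1)[OF k a proj_in[OF subalg_sub[OF k]]])
  have "Ad G a (u - proj Q k u) \<in> perp Q k" by (rule Ad_H_preserves(2)[OF k a proj_perp[OF subalg_sub[OF k]]])
  then show "Ad G a u - Ad G a (proj Q k u) \<in> perp Q k"
    by (simp add: linear_diff[OF Ad_linear[OF H_car[OF a]]])
qed

lemma perp_hh_decomp:
  assumes k: "subalg k" and u: "u \<in> perp Q hh"
  shows "proj Q k u \<in> pp k" "u - proj Q k u \<in> perp Q k"
proof -
  show p: "u - proj Q k u \<in> perp Q k" by (rule proj_perp[OF subalg_sub[OF k]])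
  then have "u - proj Q k u \<in> perp Q hh" using subalg_hh[OF k] unfolding perp_def by blast
  then have "u - (u - proj Q k u) \<in> perp Q hh" by (rule subspace_diff[OF subspace_perp u])
  then show "proj Q k u \<in> pp k" unfolding pp_def using proj_in[OF subalg_sub[OF k]] by simp
qed

text \<open>Block form for the splitting of \<open>perp Q hh\<close> into \<open>pp k\<close> and
  \<open>perp Q k\<close>; the projection commutes with \<open>Ad\<close> of \<open>H\<close> by
  \<open>proj_Ad\<close>.\<close>

lemma sum_metric_invariant:
  assumes k: "subalg k" and h: "h \<in> invariant_metrics G H (pp k)"
    and h2: "inner_product_on (perp Q k) h2" "Ad_invariant_on G H (perp Q k) h2" and r: "r > 0" "r' > 0"
  shows "(\<lambda>u w. r * h (proj Q k u) (proj Q k w) + r' * h2 (u - proj Q k u) (w - proj Q k w))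
    \<in> invariant_metrics G H (perp Q hh)" (is "?g \<in> _")
proof -
  let ?P = "proj Q k"
  have hip: "inner_product_on (pp k) h" and hinv: "Ad_invariant_on G H (pp k) h"
    using h unfolding invariant_metrics_def by auto
  interpret h: ip_space "pp k" h using hip pp_sub[OF k] by unfold_locales
  interpret h2: ip_space "perp Q k" h2 using h2(1) subspace_perp by unfold_locales
  note lin = proj_linear[OF subalg_sub[OF k]]
  have P1: "?P u \<in> pp k" and P2: "u - ?P u \<in> perp Q k" if "u \<in> perp Q hh" for u
    using perp_hh_decomp[OF k that] by auto
  have "sym_bilinear_on (perp Q hh) ?g"
    unfolding sym_bilinear_on_def
  proof (intro conjI ballI allI)
    fix u w assume u: "u \<in> perp Q hh" and w: "w \<in> perp Q hh"
    show "?g u w = ?g w u" using h.symm[OF P1[OF u] P1[OF w]] h2.symm[OF P2[OF u] P2[OF w]] by simp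
    show "?g (s *\<^sub>R u) w = s * ?g u w" for s
    proof -
      have "s *\<^sub>R u - ?P (s *\<^sub>R u) = s *\<^sub>R (u - ?P u)" by (simp add: linear_scale[OF lin] scaleR_diff_right)
      then show ?thesis
        using h.scale_left[OF P1[OF u] P1[OF w], of s] h2.scale_left[OF P2[OF u] P2[OF w], of s]
        by (simp add: linear_scale[OF lin] algebra_simps)
    qed
    show "?g (u + w) z = ?g u z + ?g w z" if z: "z \<in> perp Q hh" for z
    proof -
      have "(u + w) - ?P (u + w) = (u - ?P u) + (w - ?P w)" by (simp add: linear_add[OF lin])
      then have "?g (u + w) z = r * h (?P u + ?P w) (?P z) + r' * h2 ((u - ?P u) + (w - ?P w)) (z - ?P z)"
        by (simp only: linear_add[OF lin])
      then show ?thesis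
        using h.add_left[OF P1[OF u] P1[OF w] P1[OF z]] h2.add_left[OF P2[OF u] P2[OF w] P2[OF z]]
        by (simp add: distrib_left)
    qed
  qed
  moreover have "pos_def_on (perp Q hh) ?g"
    unfolding pos_def_on_def
  proof (intro ballI impI)
    fix u assume u: "u \<in> perp Q hh" "u \<noteq> 0"
    have nn: "h (?P u) (?P u) \<ge> 0" "h2 (u - ?P u) (u - ?P u) \<ge> 0"
      using h.nonneg[OF P1[OF u(1)]] h2.nonneg[OF P2[OF u(1)]] by auto
    have "?P u \<noteq> 0 \<or> u - ?P u \<noteq> 0" using u(2) by auto
    then have "h (?P u) (?P u) > 0 \<or> h2 (u - ?P u) (u - ?P u) > 0"
      using h.pos[OF P1[OF u(1)]] h2.pos[OF P2[OF u(1)]] by blast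
    then show "?g u u > 0" using r nn by (auto intro: add_pos_nonneg add_nonneg_pos)
  qed
  moreover have "Ad_invariant_on G H (perp Q hh) ?g"
    unfolding Ad_invariant_on_def
  proof (intro ballI)
    fix a u w assume a: "a \<in> H" and u: "u \<in> perp Q hh" and w: "w \<in> perp Q hh"
    have e: "Ad G a x - ?P (Ad G a x) = Ad G a (x - ?P x)" for x
      by (simp add: proj_Ad[OF k a] linear_diff[OF Ad_linear[OF H_car[OF a]]])
    have "h (?P (Ad G a u)) (?P (Ad G a w)) = h (?P u) (?P w)"
      using hinv a P1[OF u] P1[OF w] unfolding proj_Ad[OF k a] Ad_invariant_on_def by blast
    moreover have "h2 (Ad G a u - ?P (Ad G a u)) (Ad G a w - ?P (Ad G a w)) = h2 (u - ?P u) (w - ?P w)"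
      using h2(2) a P2[OF u] P2[OF w] unfolding e Ad_invariant_on_def by blast
    ultimately show "?g (Ad G a u) (Ad G a w) = ?g u w" by simp
  qed
  ultimately show ?thesis unfolding invariant_metrics_def inner_product_on_def by blast
qed

text \<open>Scaling inverse eigenvalues by \<open>1 - s\<close> on the fibre and by \<open>s\<close>
  on the base keeps the trace equal to one. \<open>C\<close> is the O'Neill-type term from brackets
  of base vectors into the fibre; the other cross terms cancel exactly.\<close>

lemma canonical_variation:
  assumes k: "subalg k" and T: "inner_product_on (perp Q hh) T" and h: "h \<in> unit_metrics T k"
    and h2: "h2 \<in> invariant_metrics G (connected_lie_subgroup G k) (perp Q k)"
    and tr2: "metric_trace h2 (perp Q k) T = 1"
  obtains C where "C \<ge> 0" "\<And>s. 0 < s \<Longrightarrow> s < 1 \<Longrightarrow> \<exists>g \<in> unit_metrics T UNIV.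
    scal G Q UNIV hh g = (1 - s) * scal G Q k hh h + s * scal G Q UNIV k h2 - (1/4) * (s\<^sup>2 / (1 - s)) * C"
proof -
  note ks = subalg_sub[OF k]
  let ?P = "proj Q k"
  interpret T: ip_space "perp Q hh" T using T subspace_perp by unfold_locales
  have him: "h \<in> invariant_metrics G H (pp k)" and tr1: "metric_trace h (pp k) T = 1"
    using h unfolding unit_metrics_def by auto
  have hip: "inner_product_on (pp k) h" using him unfolding invariant_metrics_def by blast
  have hs: "sym_bilinear_on (pp k) h" using hip inner_product_on_def by blast
  have h2ip: "inner_product_on (perp Q k) h2" and h2K: "Ad_invariant_on G (connected_lie_subgroup G k) (perp Q k) h2"
    using h2 unfolding invariant_metrics_def by auto
  have h2s: "sym_bilinear_on (perp Q k) h2" using h2ip inner_product_on_def by blast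
  have skew: "h2 (br v x) y + h2 x (br v y) = 0" if "v \<in> k" "x \<in> perp Q k" "y \<in> perp Q k" for v x y
    by (rule K_metric_skew[OF k h2s h2K that])
  have h2inv: "Ad_invariant_on G H (perp Q k) h2" by (rule Ad_H_metric[OF k h2s skew])
  interpret h2: ip_space "perp Q k" h2 using h2ip subspace_perp by unfold_locales
  interpret p: ip_space "pp k" Q by (rule Qsub[OF pp_sub[OF k]])
  interpret r: ip_space "perp Q k" Q by (rule Qsub[OF subspace_perp])
  interpret hq: ip_space hh Q by (rule Qsub[OF hh_sub])
  have hip': "ip_space (pp k) h" using hip pp_sub[OF k] by unfold_locales
  obtain A where A: "orthonormal_basis Q (pp k) A" "\<And>e f. e \<in> A \<Longrightarrow> f \<in> A \<Longrightarrow> e \<noteq> f \<Longrightarrow> h e f = 0"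
    using spectral_theorem[OF Qsub[OF pp_sub[OF k]] hs] by metis
  obtain B where B: "orthonormal_basis Q (perp Q k) B" "\<And>e f. e \<in> B \<Longrightarrow> f \<in> B \<Longrightarrow> e \<noteq> f \<Longrightarrow> h2 e f = 0"
    using spectral_theorem[OF Qsub[OF subspace_perp] h2s] by metis
  obtain F where F: "orthonormal_basis Q hh F" by (rule hq.onb_exists)
  have finA: "finite A" and finB: "finite B" and finF: "finite F"
    by (rule p.onb_finite[OF A(1)], rule r.onb_finite[OF B(1)], rule hq.onb_finite[OF F])
  have Ap: "a \<in> pp k" if "a \<in> A" for a by (rule p.onb_in[OF A(1) that])
  have Ak: "a \<in> k" if "a \<in> A" for a using Ap[OF that] unfolding pp_def by blast
  have Bp: "b \<in> perp Q k" if "b \<in> B" for b by (rule r.onb_in[OF B(1) that])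
  define x1 where "x1 = (\<lambda>e. h e e)"
  define x2 where "x2 = (\<lambda>e. h2 e e)"
  have d1: "h e f = (if e = f then x1 e else 0)" if "e \<in> A" "f \<in> A" for e f
    using A(2)[OF that] by (auto simp: x1_def)
  have d2: "h2 e f = (if e = f then x2 e else 0)" if "e \<in> B" "f \<in> B" for e f
    using B(2)[OF that] by (auto simp: x2_def)
  have x1: "x1 e > 0" if "e \<in> A" for e
  proof -
    have "e \<noteq> 0" using p.onb_eq[OF A(1) that that] Qzero_left by force
    then show ?thesis unfolding x1_def by (rule ip_space.pos[OF hip' Ap[OF that]])
  qed
  have x2: "x2 e > 0" if "e \<in> B" for e
  proof -
    have "e \<noteq> 0" using r.onb_eq[OF B(1) that that] Qzero_left by force
    then show ?thesis unfolding x2_def by (rule h2.pos[OF Bp[OF that]])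
  qed
  have AF: "orthonormal_basis Q k (A \<union> F)" "A \<inter> F = {}"
    using onb_union[OF hh_sub ks subalg_hh[OF k] A(1)[unfolded pp_def] F] by auto
  have BAF: "orthonormal_basis Q UNIV (B \<union> (A \<union> F))" "B \<inter> (A \<union> F) = {}"
    using onb_union[OF ks subspace_UNIV subset_UNIV _ AF(1), of B] B(1) by auto
  have pperp: "pp k \<subseteq> perp Q hh" unfolding pp_def by blast
  have kperp: "perp Q k \<subseteq> perp Q hh" using subalg_hh[OF k] unfolding perp_def by blast
  have eqp: "perp Q hh \<inter> perp Q (pp k) = perp Q k"
  proof
    show "perp Q k \<subseteq> perp Q hh \<inter> perp Q (pp k)" using kperp unfolding perp_def pp_def by blast
    show "perp Q hh \<inter> perp Q (pp k) \<subseteq> perp Q k"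
    proof
      fix u assume u: "u \<in> perp Q hh \<inter> perp Q (pp k)"
      have "proj Q k u \<in> pp k" "u - proj Q k u \<in> perp Q k" using perp_hh_decomp[OF k] u by auto
      then have "Q u (proj Q k u) = 0" "Q (u - proj Q k u) (proj Q k u) = 0"
        using u proj_in[OF ks, of u] unfolding perp_def by auto
      then have "Q (proj Q k u) (proj Q k u) = 0" by (simp add: Qdiff_left)
      then have "proj Q k u = 0" by (rule Qeq0)
      then show "u \<in> perp Q k" using \<open>u - proj Q k u \<in> perp Q k\<close> by simp
    qed
  qed
  have BA: "orthonormal_basis Q (perp Q hh) (B \<union> A)" "B \<inter> A = {}"
    using onb_union[OF pp_sub[OF k] subspace_perp pperp _ A(1), of B] B(1) unfolding eqp by auto
  let ?F = "B \<union> (A \<union> F)"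
  let ?N = "\<lambda>a b c. (Q (br a b) c)\<^sup>2"
  have U: "lie_subalgebra G UNIV" and kl: "lie_subalgebra G k"
    using k unfolding lie_subalgebra_def subalg_def by auto
  have S1: "scal G Q k hh h = (1/2) * (\<Sum>e\<in>A. (\<Sum>f\<in>A\<union>F. \<Sum>g\<in>A\<union>F. ?N e f g) / x1 e)
     - (1/4) * (\<Sum>a\<in>A. \<Sum>b\<in>A. \<Sum>c\<in>A. x1 c / (x1 a * x1 b) * ?N a b c)"
    by (rule scal_diag[OF kl pp_def hh_sub hip A(1) d1 AF(1)])
  have kp: "perp Q k = UNIV \<inter> perp Q k" by simp
  have S2: "scal G Q UNIV k h2 = (1/2) * (\<Sum>e\<in>B. (\<Sum>f\<in>?F. \<Sum>g\<in>?F. ?N e f g) / x2 e)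
     - (1/4) * (\<Sum>a\<in>B. \<Sum>b\<in>B. \<Sum>c\<in>B. x2 c / (x2 a * x2 b) * ?N a b c)"
    by (rule scal_diag[OF U kp ks h2ip B(1) d2 BAF(1)])
  have T1: "(\<Sum>e\<in>A. T e e / x1 e) = 1"
    using metric_trace_diag[OF pp_sub[OF k] hip A(1) d1 bilin_on_subset[OF T.bil pperp]] tr1 by simp
  have T2: "(\<Sum>e\<in>B. T e e / x2 e) = 1"
    using metric_trace_diag[OF subspace_perp h2ip B(1) d2 bilin_on_subset[OF T.bil kperp]] tr2 by simp
  define C where "C = (\<Sum>a\<in>B. \<Sum>b\<in>B. \<Sum>c\<in>A. x1 c / (x2 a * x2 b) * ?N a b c)"
  have C: "C \<ge> 0"
    unfolding C_def
  proof (intro sum_nonneg)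
    fix a b c assume "a \<in> B" "b \<in> B" "c \<in> A"
    then show "0 \<le> x1 c / (x2 a * x2 b) * ?N a b c" using x1[of c] x2[of a] x2[of b] by simp
  qed
  \<comment> \<open>This and the next two facts kill all structure constants with two entries in
    \<open>k\<close> and one in \<open>B\<close>: \<open>k\<close> is closed under brackets and acts
    on its complement.\<close>
  have z_in: "?N a f b = 0" if "a \<in> k" "f \<in> k" "b \<in> B" for a f b
    using subalg_br[OF k that(1,2)] Bp[OF that(3)] Qsym[of "br a f" b] unfolding perp_def by simp
  have z_out: "?N a b f = 0" if "a \<in> k" "b \<in> B" "f \<in> k" for a b f
    using br_perp[OF k that(1) Bp[OF that(2)]] that(3) unfolding perp_def by simp
  have z_out': "?N b a f = 0" if "a \<in> k" "b \<in> B" "f \<in> k" for a b f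
    using z_out[OF that] Q_swap12[of b a f] by simp
  have AFk: "f \<in> k" if "f \<in> A \<union> F" for f using AF(1) that unfolding orthonormal_basis_def by blast
  have spF: "(\<Sum>f\<in>?F. g f) = (\<Sum>f\<in>B. g f) + (\<Sum>f\<in>A\<union>F. g f)" for g :: "'a \<Rightarrow> real"
    using sum.union_disjoint[OF finB _ BAF(2), of g] finA finF by simp
  have spE: "(\<Sum>f\<in>B\<union>A. g f) = (\<Sum>f\<in>B. g f) + (\<Sum>f\<in>A. g f)" for g :: "'a \<Rightarrow> real"
    by (rule sum.union_disjoint[OF finB finA BA(2)])
  have kap: "(\<Sum>f\<in>?F. \<Sum>g\<in>?F. ?N a f g) = (\<Sum>f\<in>A\<union>F. \<Sum>g\<in>A\<union>F. ?N a f g) + (\<Sum>f\<in>B. \<Sum>g\<in>B. ?N a f g)"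
    if a: "a \<in> A" for a
  proof -
    have "(\<Sum>f\<in>B. \<Sum>g\<in>A\<union>F. ?N a f g) = 0"
      by (intro sum.neutral ballI z_out Ak[OF a] AFk)
    moreover have "(\<Sum>f\<in>A\<union>F. \<Sum>g\<in>B. ?N a f g) = 0"
      by (intro sum.neutral ballI z_in Ak[OF a] AFk)
    ultimately show ?thesis by (simp only: spF sum.distrib)
  qed
  \<comment> \<open>\<open>h2\<close> is \<open>ad\<close>-invariant under \<open>k\<close>, so \<open>ad a\<close> only links frame vectors with equal eigenvalues.\<close>
  have ratio: "x2 c / x2 b * ?N a b c = ?N a b c" if a: "a \<in> A" and b: "b \<in> B" and c: "c \<in> B" for a b c
  proof -
    have hc: "h2 u e = x2 e * Q u e" if u: "u \<in> perp Q k" and e: "e \<in> B" for u e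
    proof -
      have "h2 u e = h2 (\<Sum>f\<in>B. Q u f *\<^sub>R f) e" using r.onb_expand[OF B(1) u] by simp
      also have "\<dots> = (\<Sum>f\<in>B. Q u f * h2 f e)" by (rule h2.sum_left) (use Bp e in auto)
      also have "\<dots> = (\<Sum>f\<in>B. if f = e then Q u e * x2 e else 0)" using d2 e by (intro sum.cong refl) auto
      finally show ?thesis using finB e by simp
    qed
    have bab: "br a b \<in> perp Q k" and bac: "br a c \<in> perp Q k" using br_perp[OF k Ak[OF a]] Bp b c by auto
    have "x2 c * Q (br a b) c + x2 b * Q (br a c) b = 0"
      using skew[OF Ak[OF a] Bp[OF b] Bp[OF c]] hc[OF bab c] hc[OF bac b] h2.symm[OF Bp[OF b] bac] by simp
    then have "(x2 c - x2 b) * Q (br a b) c = 0" using Q_swap23[of a c b] by (simp add: algebra_simps)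
    then show ?thesis using x2[OF b] by auto
  qed
  have g_ex: "\<exists>g \<in> unit_metrics T UNIV.
    scal G Q UNIV hh g = (1 - s) * scal G Q k hh h + s * scal G Q UNIV k h2 - (1/4) * (s\<^sup>2 / (1 - s)) * C"
    if s: "0 < s" "s < 1" for s
  proof -
    define g where "g = (\<lambda>u w. (1 / (1 - s)) * h (?P u) (?P w) + (1 / s) * h2 (u - ?P u) (w - ?P w))"
    have gm: "g \<in> invariant_metrics G H (perp Q hh)"
      unfolding g_def by (rule sum_metric_invariant[OF k him h2ip h2inv]) (use s in auto)
    have gip: "inner_product_on (perp Q hh) g" using gm unfolding invariant_metrics_def by blast
    define x where "x = (\<lambda>e. if e \<in> A then x1 e / (1 - s) else x2 e / s)"
    have xA: "x e = x1 e / (1 - s)" if "e \<in> A" for e using that by (simp add: x_def)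
    have xB: "x e = x2 e / s" if "e \<in> B" for e using that BA(2) by (auto simp: x_def)
    have PA: "?P e = e" if "e \<in> A" for e by (rule proj_id[OF ks Ak[OF that]])
    have PB: "?P e = 0" if "e \<in> B" for e
      by (rule proj_eq[OF ks]) (use Bp[OF that] subspace_0[OF ks] in auto)
    have h0: "h 0 e = 0" "h e 0 = 0" if "e \<in> pp k" for e
      using ip_space.zero_left[OF hip' that] ip_space.symm[OF hip' that subspace_0[OF pp_sub[OF k]]] by auto
    have h20: "h2 0 e = 0" "h2 e 0 = 0" if "e \<in> perp Q k" for e
      using h2.zero_left[OF that] h2.symm[OF that subspace_0[OF subspace_perp]] by auto
    have dg: "g e f = (if e = f then x e else 0)" if e: "e \<in> B \<union> A" and f: "f \<in> B \<union> A" for e f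
    proof -
      consider "e \<in> A" "f \<in> A" | "e \<in> A" "f \<in> B" | "e \<in> B" "f \<in> A" | "e \<in> B" "f \<in> B" using e f by blast
      then show ?thesis
      proof cases
        case 1
        then show ?thesis using h20[OF subspace_0[OF subspace_perp]] d1[OF 1] by (simp add: g_def PA xA)
      next
        case 2
        then have "e \<noteq> f" using BA(2) by blast
        then show ?thesis using h0[OF Ap[OF 2(1)]] h20[OF Bp[OF 2(2)]] 2 by (simp add: g_def PA PB)
      next
        case 3
        then have "e \<noteq> f" using BA(2) by blast
        then show ?thesis using h0[OF Ap[OF 3(2)]] h20[OF Bp[OF 3(1)]] 3 by (simp add: g_def PA PB)
      next
        case 4
        then show ?thesis using h0[OF subspace_0[OF pp_sub[OF k]]] d2[OF 4] by (simp add: g_def PB xB)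
      qed
    qed
    have "metric_trace g (perp Q hh) T = (\<Sum>e\<in>B \<union> A. T e e / x e)"
      by (rule metric_trace_diag[OF subspace_perp gip BA(1) dg T.bil])
    also have "\<dots> = s * (\<Sum>e\<in>B. T e e / x2 e) + (1 - s) * (\<Sum>e\<in>A. T e e / x1 e)"
      unfolding spE sum_distrib_left using xA xB by (simp add: mult.commute)
    finally have trg: "metric_trace g (perp Q hh) T = 1" using T1 T2 by simp
    have gu: "g \<in> unit_metrics T UNIV" unfolding unit_metrics_def pp_def using gm trg by simp
    have hp: "perp Q hh = UNIV \<inter> perp Q hh" by simp
    have Sg: "scal G Q UNIV hh g = (1/2) * (\<Sum>e\<in>B \<union> A. (\<Sum>f\<in>?F. \<Sum>g\<in>?F. ?N e f g) / x e)
      - (1/4) * (\<Sum>a\<in>B \<union> A. \<Sum>b\<in>B \<union> A. \<Sum>c\<in>B \<union> A. x c / (x a * x b) * ?N a b c)"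
      by (rule scal_diag[OF U hp hh_sub gip BA(1) dg BAF(1)])
    define KA where "KA = (\<Sum>e\<in>A. (\<Sum>f\<in>A\<union>F. \<Sum>g\<in>A\<union>F. ?N e f g) / x1 e)"
    define KB where "KB = (\<Sum>e\<in>B. (\<Sum>f\<in>?F. \<Sum>g\<in>?F. ?N e f g) / x2 e)"
    \<comment> \<open>The action of the fibre on the base. It enters the Killing sum as
      \<open>(1 - s) * D\<close> and the norm sum as \<open>(1 - s) * (2 * D)\<close>; the weights
      1/2 and 1/4 make these cancel.\<close>
    define D where "D = (\<Sum>a\<in>A. (\<Sum>b\<in>B. \<Sum>c\<in>B. ?N a b c) / x1 a)"
    define AAA where "AAA = (\<Sum>a\<in>A. \<Sum>b\<in>A. \<Sum>c\<in>A. x1 c / (x1 a * x1 b) * ?N a b c)"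
    define BBB where "BBB = (\<Sum>a\<in>B. \<Sum>b\<in>B. \<Sum>c\<in>B. x2 c / (x2 a * x2 b) * ?N a b c)"
    have first: "(\<Sum>e\<in>B \<union> A. (\<Sum>f\<in>?F. \<Sum>g\<in>?F. ?N e f g) / x e) = s * KB + (1 - s) * (KA + D)"
    proof -
      have aux: "(p + q) / (z / t) = t * (p / z + q / z)" for p q z t :: real
        by (simp add: add_divide_distrib[symmetric])
      have "(\<Sum>e\<in>A. (\<Sum>f\<in>?F. \<Sum>g\<in>?F. ?N e f g) / x e) = (1 - s) * (KA + D)"
        unfolding KA_def D_def sum.distrib[symmetric] sum_distrib_left
        by (intro sum.cong refl) (simp only: kap xA aux)
      moreover have "(\<Sum>e\<in>B. (\<Sum>f\<in>?F. \<Sum>g\<in>?F. ?N e f g) / x e) = s * KB"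
        unfolding KB_def sum_distrib_left by (intro sum.cong refl) (simp add: xB)
      ultimately show ?thesis unfolding spE by simp
    qed
    let ?t = "\<lambda>a b c. x c / (x a * x b) * ?N a b c"
    have s1: "1 - s \<noteq> 0" "s \<noteq> 0" using s by auto
    have second: "(\<Sum>a\<in>B \<union> A. \<Sum>b\<in>B \<union> A. \<Sum>c\<in>B \<union> A. ?t a b c) =
        s * BBB + (s\<^sup>2 / (1 - s)) * C + (1 - s) * (2 * D) + (1 - s) * AAA"
    proof -
      have tBBB: "(\<Sum>a\<in>B. \<Sum>b\<in>B. \<Sum>c\<in>B. ?t a b c) = s * BBB"
        unfolding BBB_def sum_distrib_left
        by (intro sum.cong refl) (use s1 in \<open>simp add: xB field_simps\<close>)
      have tAAA: "(\<Sum>a\<in>A. \<Sum>b\<in>A. \<Sum>c\<in>A. ?t a b c) = (1 - s) * AAA"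
        unfolding AAA_def sum_distrib_left
        by (intro sum.cong refl) (use s1 in \<open>simp add: xA\<close>)
      have tBBA: "(\<Sum>a\<in>B. \<Sum>b\<in>B. \<Sum>c\<in>A. ?t a b c) = (s\<^sup>2 / (1 - s)) * C"
        unfolding C_def sum_distrib_left
        by (intro sum.cong refl) (use s1 in \<open>simp add: xA xB power2_eq_square\<close>)
      have tABB: "(\<Sum>a\<in>A. \<Sum>b\<in>B. \<Sum>c\<in>B. ?t a b c) = (1 - s) * D"
      proof -
        have "?t a b c = (1 - s) * (?N a b c / x1 a)" if "a \<in> A" "b \<in> B" "c \<in> B" for a b c
        proof -
          have "?t a b c = (1 - s) * ((x2 c / x2 b * ?N a b c) / x1 a)"
            using s1 that by (simp add: xA xB mult_ac)
          then show ?thesis unfolding ratio[OF that] .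
        qed
        then show ?thesis unfolding D_def by (simp add: sum_distrib_left sum_divide_distrib)
      qed
      have tBAB: "(\<Sum>a\<in>B. \<Sum>b\<in>A. \<Sum>c\<in>B. ?t a b c) = (1 - s) * D"
      proof -
        have "(\<Sum>a\<in>B. \<Sum>b\<in>A. \<Sum>c\<in>B. ?t a b c) = (\<Sum>b\<in>A. \<Sum>a\<in>B. \<Sum>c\<in>B. ?t a b c)" by (rule sum.swap)
        also have "\<dots> = (\<Sum>b\<in>A. \<Sum>a\<in>B. \<Sum>c\<in>B. ?t b a c)"
        proof (intro sum.cong refl)
          fix a b c
          show "?t a b c = ?t b a c" using Q_swap12[of a b c] by (simp add: mult.commute)
        qed
        finally show ?thesis using tABB by simp
      qed
      have zAAB: "(\<Sum>a\<in>A. \<Sum>b\<in>A. \<Sum>c\<in>B. ?t a b c) = 0"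
        by (intro sum.neutral ballI) (simp add: z_in[OF Ak Ak])
      have zABA: "(\<Sum>a\<in>A. \<Sum>b\<in>B. \<Sum>c\<in>A. ?t a b c) = 0"
        by (intro sum.neutral ballI) (simp add: z_out[OF Ak _ Ak])
      have zBAA: "(\<Sum>a\<in>B. \<Sum>b\<in>A. \<Sum>c\<in>A. ?t a b c) = 0"
        by (intro sum.neutral ballI) (simp add: z_out'[OF Ak _ Ak])
      have "(\<Sum>a\<in>B \<union> A. \<Sum>b\<in>B \<union> A. \<Sum>c\<in>B \<union> A. ?t a b c) =
        (\<Sum>a\<in>B. \<Sum>b\<in>B. \<Sum>c\<in>B. ?t a b c) + (\<Sum>a\<in>B. \<Sum>b\<in>B. \<Sum>c\<in>A. ?t a b c) +
        (\<Sum>a\<in>B. \<Sum>b\<in>A. \<Sum>c\<in>B. ?t a b c) + (\<Sum>a\<in>B. \<Sum>b\<in>A. \<Sum>c\<in>A. ?t a b c) +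
        ((\<Sum>a\<in>A. \<Sum>b\<in>B. \<Sum>c\<in>B. ?t a b c) + (\<Sum>a\<in>A. \<Sum>b\<in>B. \<Sum>c\<in>A. ?t a b c) +
        (\<Sum>a\<in>A. \<Sum>b\<in>A. \<Sum>c\<in>B. ?t a b c) + (\<Sum>a\<in>A. \<Sum>b\<in>A. \<Sum>c\<in>A. ?t a b c))"
        unfolding spE sum.distrib by (simp only: add.assoc)
      then show ?thesis unfolding tBBB tAAA tBBA tABB tBAB zAAB zABA zBAA by simp
    qed
    have "scal G Q UNIV hh g = (1 - s) * ((1/2) * KA - (1/4) * AAA) + s * ((1/2) * KB - (1/4) * BBB)
        - (1/4) * (s\<^sup>2 / (1 - s)) * C"
      unfolding Sg first second by (simp add: algebra_simps add_divide_distrib diff_divide_distrib)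
    then have "scal G Q UNIV hh g = (1 - s) * scal G Q k hh h + s * scal G Q UNIV k h2 - (1/4) * (s\<^sup>2 / (1 - s)) * C"
      unfolding S1 S2 KA_def KB_def AAA_def BBB_def .
    then show ?thesis using gu by blast
  qed
  show thesis using that[OF C g_ex] by blast
qed

text \<open>The gain is linear and the loss quadratic in \<open>s\<close>. The comparison is with
  the value of the given \<open>h\<close> itself, so inserting a metric that attains
  \<open>alpha\<close> yields a value above the supremum.\<close>

lemma scal_increases:
  assumes k: "subalg k" and T: "inner_product_on (perp Q hh) T" and h: "h \<in> unit_metrics T k"
    and h2: "h2 \<in> invariant_metrics G (connected_lie_subgroup G k) (perp Q k)"
      "metric_trace h2 (perp Q k) T = 1"
    and less: "scal G Q k hh h < scal G Q UNIV k h2"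
  obtains g where "g \<in> unit_metrics T UNIV" "scal G Q k hh h < scal G Q UNIV hh g"
proof -
  obtain C where C: "C \<ge> 0" "\<And>s. 0 < s \<Longrightarrow> s < 1 \<Longrightarrow> \<exists>g \<in> unit_metrics T UNIV.
    scal G Q UNIV hh g = (1 - s) * scal G Q k hh h + s * scal G Q UNIV k h2 - (1/4) * (s\<^sup>2 / (1 - s)) * C"
    using canonical_variation[OF k T h h2] by metis
  define \<delta> where "\<delta> = scal G Q UNIV k h2 - scal G Q k hh h"
  have \<delta>: "\<delta> > 0" using less by (simp add: \<delta>_def)
  \<comment> \<open>\<open>s \<le> 1/2\<close> bounds \<open>1 / (1 - s)\<close> by 2, and
    \<open>s * C < \<delta>\<close> then keeps the loss below half of the gain; the denominator
    \<open>C + 1\<close> covers \<open>C = 0\<close>.\<close>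
  define s where "s = min (1/2) (\<delta> / (C + 1))"
  have s: "0 < s" "s \<le> 1/2" "s \<le> \<delta> / (C + 1)"
  proof -
    show "0 < s" using \<delta> C(1) by (simp add: s_def)
    show "s \<le> 1/2" unfolding s_def by (rule min.cobounded1)
    show "s \<le> \<delta> / (C + 1)" unfolding s_def by (rule min.cobounded2)
  qed
  obtain g where g: "g \<in> unit_metrics T UNIV"
    "scal G Q UNIV hh g = (1 - s) * scal G Q k hh h + s * scal G Q UNIV k h2 - (1/4) * (s\<^sup>2 / (1 - s)) * C"
    using C(2)[of s] s by auto
  have "s * (C + 1) \<le> \<delta>" using s(3) C(1) by (simp add: pos_le_divide_eq)
  then have sC: "s * C < \<delta>" using s(1) by (simp add: distrib_left)
  have "s\<^sup>2 / (1 - s) \<le> s\<^sup>2 / (1/2)" using s by (intro divide_left_mono) auto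
  then have "(s\<^sup>2 / (1 - s)) * C \<le> (s\<^sup>2 / (1/2)) * C" using C(1) by (rule mult_right_mono)
  also have "\<dots> = 2 * s * (s * C)" by (simp add: power2_eq_square)
  also have "\<dots> < 2 * s * \<delta>" using sC s(1) by (intro mult_strict_left_mono) auto
  finally have lt: "(s\<^sup>2 / (1 - s)) * C < 2 * s * \<delta>" .
  have "(1/4) * (s\<^sup>2 / (1 - s)) * C = (1/4) * ((s\<^sup>2 / (1 - s)) * C)" by simp
  also have "\<dots> < (1/4) * (2 * s * \<delta>)" using lt by (intro mult_strict_left_mono) auto
  also have "\<dots> \<le> s * \<delta>" using s(1) \<delta> by simp
  finally have "(1/4) * (s\<^sup>2 / (1 - s)) * C < s * \<delta>" .
  then have "scal G Q k hh h < scal G Q UNIV hh g" unfolding g(2) \<delta>_def by (simp add: algebra_simps)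
  then show thesis using that g(1) by blast
qed

section \<open>Attainment of the suprema\<close>

lemma intermediate_iff: "intermediate_subalgebra G H k \<longleftrightarrow> subalg k \<and> hh \<subset> k \<and> k \<noteq> UNIV"
  unfolding intermediate_subalgebra_def subalg_def by auto

lemma dim_pp_less:
  assumes k: "subalg k" and "k \<noteq> UNIV" shows "dim (pp k) < dim (pp UNIV)"
proof -
  have "pp k \<subset> pp UNIV"
  proof
    show "pp k \<subseteq> pp UNIV" unfolding pp_def by blast
    show "pp k \<noteq> pp UNIV"
    proof
      assume eq: "pp k = pp UNIV"
      have "x \<in> k" for x
      proof -
        have "x - proj Q hh x \<in> pp k" unfolding eq unfolding pp_def using proj_perp[OF hh_sub] by simp
        then have "x - proj Q hh x \<in> k" unfolding pp_def by blast
        moreover have "proj Q hh x \<in> k" using proj_in[OF hh_sub] subalg_hh[OF k] by blast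
        ultimately have "(x - proj Q hh x) + proj Q hh x \<in> k" by (rule subspace_add[OF subalg_sub[OF k]])
        then show ?thesis by simp
      qed
      then show False using assms(2) by blast
    qed
  qed
  then show ?thesis
    using pp_sub[OF k] pp_sub[OF subalg_UNIV] by (metis dim_psubset span_eq_iff)
qed

text \<open>The limit algebra is not all of \<open>UNIV\<close>: by the dimension clause of
  \<open>limit_sup\<close>, \<open>dim (pp k')\<close> is bounded by the value for some proper
  subalgebra, which \<open>dim_pp_less\<close> separates from that of \<open>UNIV\<close>.\<close>

lemma alpha_GH_attained:
  assumes T: "inner_product_on (perp Q hh) T" and k0: "intermediate_subalgebra G H k0"
  obtains k where "intermediate_subalgebra G H k" "alpha G H Q T k = alpha_GH G H Q T"
proof -
  define X where "X = {(k, h). intermediate_subalgebra G H k \<and> h \<in> unit_metrics T k}"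
  have k0': "subalg k0" "hh \<subset> k0" using k0 intermediate_iff by auto
  obtain h0 where "h0 \<in> unit_metrics T k0" using normal_metric[OF k0' T] by metis
  then have "(k0, h0) \<in> X" using k0 unfolding X_def by blast
  then have X: "X \<noteq> {}" "\<And>k h. (k, h) \<in> X \<Longrightarrow> subalg k \<and> h \<in> unit_metrics T k"
    unfolding X_def using intermediate_iff by blast+
  obtain k' h' where kh: "subalg k'" "hh \<subset> k'" "h' \<in> unit_metrics T k'"
    "(SUP (k, h) \<in> X. ereal (scal G Q k hh h)) \<le> ereal (scal G Q k' hh h')"
    "\<exists>(k, h) \<in> X. dim (pp k') \<le> dim (pp k)"
    using limit_sup[OF X T] by metis
  obtain k h where khX: "(k, h) \<in> X" "dim (pp k') \<le> dim (pp k)" using kh(5) by blast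
  have "dim (pp k) < dim (pp UNIV)"
    using khX(1) dim_pp_less[of k] intermediate_iff unfolding X_def by auto
  then have "k' \<noteq> UNIV" using khX(2) by auto
  then have int: "intermediate_subalgebra G H k'" using kh(1,2) intermediate_iff by blast
  have "alpha_GH G H Q T \<le> (SUP (k, h) \<in> X. ereal (scal G Q k hh h))"
    unfolding alpha_GH_def alpha_eq
  proof (intro SUP_least)
    fix k h assume "k \<in> {k. intermediate_subalgebra G H k}" "h \<in> unit_metrics T k"
    then have "(k, h) \<in> X" unfolding X_def by blast
    then show "ereal (scal G Q k hh h) \<le> (SUP (k, h) \<in> X. ereal (scal G Q k hh h))"
      by (rule SUP_upper2) simp
  qed
  also have "\<dots> \<le> ereal (scal G Q k' hh h')" by (rule kh(4))
  also have "\<dots> \<le> alpha G H Q T k'" unfolding alpha_eq by (rule SUP_upper[OF kh(3)])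
  finally have "alpha_GH G H Q T \<le> alpha G H Q T k'" .
  moreover have "alpha G H Q T k' \<le> alpha_GH G H Q T" unfolding alpha_GH_def using int by (intro SUP_upper) blast
  ultimately show thesis using that int by force
qed

text \<open>The limit algebra lies inside \<open>k\<close>, and its \<open>alpha\<close> is at least
  that of \<open>k\<close>, so it is maximal as well. Minimality of \<open>dim k\<close> identifies
  the two, and the limit metric lives on \<open>k\<close>.\<close>

lemma alpha_attained:
  assumes T: "inner_product_on (perp Q hh) T" and k: "intermediate_subalgebra G H k"
    and max: "alpha G H Q T k = alpha_GH G H Q T"
    and min: "\<And>k'. intermediate_subalgebra G H k' \<Longrightarrow> alpha G H Q T k' = alpha_GH G H Q T \<Longrightarrow> dim k \<le> dim k'"
  obtains h where "h \<in> unit_metrics T k" "alpha G H Q T k = ereal (scal G Q k hh h)"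
proof -
  have ks: "subalg k" "hh \<subset> k" "k \<noteq> UNIV" using k intermediate_iff by auto
  define X where "X = {(l, h). l = k \<and> h \<in> unit_metrics T k}"
  obtain h0 where "h0 \<in> unit_metrics T k" using normal_metric[OF ks(1,2) T] by metis
  then have X: "X \<noteq> {}" "\<And>l h. (l, h) \<in> X \<Longrightarrow> subalg l \<and> h \<in> unit_metrics T l"
    using ks unfolding X_def by auto
  obtain k' h' where kh: "subalg k'" "hh \<subset> k'" "h' \<in> unit_metrics T k'"
    "(SUP (k, h) \<in> X. ereal (scal G Q k hh h)) \<le> ereal (scal G Q k' hh h')"
    "\<And>W. subspace W \<Longrightarrow> (\<And>l h. (l, h) \<in> X \<Longrightarrow> l \<subseteq> W) \<Longrightarrow> k' \<subseteq> W"
    using limit_sup[OF X T] by metis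
  have sub: "k' \<subseteq> k" by (rule kh(5)[OF subalg_sub[OF ks(1)]]) (auto simp: X_def)
  then have int: "intermediate_subalgebra G H k'" using kh(1,2) ks(3) intermediate_iff by blast
  have up: "ereal (scal G Q k' hh h') \<le> alpha G H Q T k'" unfolding alpha_eq by (rule SUP_upper[OF kh(3)])
  have "alpha G H Q T k \<le> (SUP (k, h) \<in> X. ereal (scal G Q k hh h))"
    unfolding alpha_eq
  proof (intro SUP_least)
    fix h assume "h \<in> unit_metrics T k"
    then have "(k, h) \<in> X" unfolding X_def by blast
    then show "ereal (scal G Q k hh h) \<le> (SUP (k, h) \<in> X. ereal (scal G Q k hh h))"
      by (rule SUP_upper2) simp
  qed
  also note kh(4)
  finally have le: "alpha G H Q T k \<le> ereal (scal G Q k' hh h')" .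
  have "alpha G H Q T k' \<le> alpha_GH G H Q T" unfolding alpha_GH_def using int by (intro SUP_upper) blast
  then have "alpha G H Q T k' = alpha_GH G H Q T" using le up max by (simp add: order_antisym)
  then have "dim k \<le> dim k'" by (rule min[OF int])
  then have eq: "k' = k" using subspace_dim_equal[OF subalg_sub[OF kh(1)] subalg_sub[OF ks(1)] sub] by blast
  then have "alpha G H Q T k = ereal (scal G Q k hh h')" using le up by (simp add: order_antisym)
  then show thesis using that kh(3) eq by blast
qed

text \<open>If the limit algebra were proper, the limit value would be at most
  \<open>alpha_GH\<close>; yet it bounds the scalar curvature of \<open>g\<close> from
  above.\<close>

lemma maximum_exists:
  assumes T: "inner_product_on (perp Q hh) T" and g: "g \<in> unit_metrics T UNIV"
    and less: "alpha_GH G H Q T < ereal (scal G Q UNIV hh g)"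
  obtains g' where "g' \<in> unit_metrics T UNIV"
    "\<And>h. h \<in> unit_metrics T UNIV \<Longrightarrow> scal G Q UNIV hh h \<le> scal G Q UNIV hh g'"
proof -
  define X where "X = {(l, h). l = (UNIV :: 'a set) \<and> h \<in> unit_metrics T UNIV}"
  have X: "X \<noteq> {}" "\<And>l h. (l, h) \<in> X \<Longrightarrow> subalg l \<and> h \<in> unit_metrics T l"
    using g subalg_UNIV unfolding X_def by auto
  obtain k' h' where kh: "subalg k'" "hh \<subset> k'" "h' \<in> unit_metrics T k'"
    "(SUP (k, h) \<in> X. ereal (scal G Q k hh h)) \<le> ereal (scal G Q k' hh h')"
    using limit_sup[OF X T] by metis
  have up: "ereal (scal G Q UNIV hh h) \<le> ereal (scal G Q k' hh h')" if "h \<in> unit_metrics T UNIV" for h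
  proof -
    have "(UNIV, h) \<in> X" using that unfolding X_def by blast
    then have "ereal (scal G Q UNIV hh h) \<le> (SUP (k, h) \<in> X. ereal (scal G Q k hh h))"
      by (rule SUP_upper2) simp
    then show ?thesis using kh(4) by (rule order_trans)
  qed
  have "k' = UNIV"
  proof (rule ccontr)
    assume "k' \<noteq> UNIV"
    then have int: "intermediate_subalgebra G H k'" using kh(1,2) intermediate_iff by blast
    have "ereal (scal G Q k' hh h') \<le> alpha G H Q T k'" unfolding alpha_eq by (rule SUP_upper[OF kh(3)])
    also have "\<dots> \<le> alpha_GH G H Q T" unfolding alpha_GH_def using int by (intro SUP_upper) blast
    finally have "ereal (scal G Q k' hh h') \<le> alpha_GH G H Q T" .
    moreover have "alpha_GH G H Q T < ereal (scal G Q k' hh h')" using less up[OF g] by (rule less_le_trans)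
    ultimately show False by simp
  qed
  then show thesis using that[of h'] kh(3) up by simp
qed

end

theorem mainTheorem1:
  fixes G :: "('g, 'a::euclidean_space, 'm) lie_data_scheme" and H :: "'g set"
    and Q T :: "'a \<Rightarrow> 'a \<Rightarrow> real"
  assumes "compact_homogeneous_space G H"
    and "inner_product_on UNIV Q" and "Ad_invariant_on G (carrier G) UNIV Q"
    and "sym_bilinear_on (perp Q (lie_alg G H)) T"
    and "Ad_invariant_on G H (perp Q (lie_alg G H)) T"
    and "pos_def_on (perp Q (lie_alg G H)) T"
    and "\<not> maximal_subgroup_in G H"
  shows "{K. \<exists>\<kk>. intermediate_subgroup G H K \<kk> \<and> alpha G H Q T \<kk> = alpha_GH G H Q T} \<noteq> {} \<and>
    (\<forall>K \<kk>. intermediate_subgroup G H K \<kk> \<and> alpha G H Q T \<kk> = alpha_GH G H Q T \<and>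
       (\<forall>K' \<kk>'. intermediate_subgroup G H K' \<kk>' \<and> alpha G H Q T \<kk>' = alpha_GH G H Q T
          \<longrightarrow> dim \<kk> \<le> dim \<kk>') \<and>
       beta G Q T \<kk> - alpha G H Q T \<kk> > 0 \<longrightarrow>
       (\<exists>g \<in> metrics_T G H Q T.
          (\<forall>g' \<in> metrics_T G H Q T. scal G Q UNIV (lie_alg G H) g' \<le> scal G Q UNIV (lie_alg G H) g) \<and>
          (\<exists>c>0. \<forall>x \<in> perp Q (lie_alg G H). \<forall>y \<in> perp Q (lie_alg G H).
             ricci G Q (lie_alg G H) g x y = c * T x y)))"
proof -
  interpret lie_group G using assms(1) unfolding compact_homogeneous_space_def by blast
  interpret hom_space G Q H
    using assms(1-3) unfolding compact_homogeneous_space_def by unfold_locales auto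
  have T: "inner_product_on (perp Q hh) T" using assms(4,6) unfolding inner_product_on_def by blast
  have MT: "unit_metrics T UNIV = metrics_T G H Q T"
    unfolding unit_metrics_def metrics_T_def pp_def by simp
  obtain k0 where k0: "intermediate_subalgebra G H k0"
    using assms(7) unfolding maximal_subgroup_in_def intermediate_subgroup_def by blast
  show ?thesis
  proof (intro conjI allI impI)
    obtain k where k: "intermediate_subalgebra G H k" "alpha G H Q T k = alpha_GH G H Q T"
      using alpha_GH_attained[OF T k0] by metis
    then have "connected_lie_subgroup G k \<in>
        {K. \<exists>\<kk>. intermediate_subgroup G H K \<kk> \<and> alpha G H Q T \<kk> = alpha_GH G H Q T}"
      unfolding intermediate_subgroup_def by blast
    then show "{K. \<exists>\<kk>. intermediate_subgroup G H K \<kk> \<and> alpha G H Q T \<kk> = alpha_GH G H Q T} \<noteq> {}" by blast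
  next
    fix K k
    assume a: "intermediate_subgroup G H K k \<and> alpha G H Q T k = alpha_GH G H Q T \<and>
       (\<forall>K' \<kk>'. intermediate_subgroup G H K' \<kk>' \<and> alpha G H Q T \<kk>' = alpha_GH G H Q T
          \<longrightarrow> dim k \<le> dim \<kk>') \<and> beta G Q T k - alpha G H Q T k > 0"
    then have k: "intermediate_subalgebra G H k" and max: "alpha G H Q T k = alpha_GH G H Q T"
      and pos: "beta G Q T k - alpha G H Q T k > 0"
      unfolding intermediate_subgroup_def by blast+
    have min: "dim k \<le> dim k'" if "intermediate_subalgebra G H k'" "alpha G H Q T k' = alpha_GH G H Q T" for k'
      using a that unfolding intermediate_subgroup_def by blast
    have ks: "subalg k" "hh \<subset> k" using k intermediate_iff by auto
    obtain h where h: "h \<in> unit_metrics T k" "alpha G H Q T k = ereal (scal G Q k hh h)"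
      using alpha_attained[OF T k max min] by metis
    \<comment> \<open>\<open>alpha\<close> is finite because it is attained, so the inequality
      between extended reals can be rearranged even for infinite \<open>beta\<close>. Some metric in
      the set defining \<open>beta\<close> then already exceeds this value.\<close>
    have "ereal (scal G Q k hh h) < beta G Q T k"
      using pos unfolding h(2) by (cases "beta G Q T k") auto
    then obtain h2 where h2: "h2 \<in> invariant_metrics G (connected_lie_subgroup G k) (perp Q k)"
      "metric_trace h2 (perp Q k) T = 1" "scal G Q k hh h < scal G Q UNIV k h2"
      unfolding beta_def less_SUP_iff by auto
    obtain g where g: "g \<in> unit_metrics T UNIV" "scal G Q k hh h < scal G Q UNIV hh g"
      using scal_increases[OF ks(1) T h(1) h2] by metis
    have "alpha_GH G H Q T < ereal (scal G Q UNIV hh g)" using g(2) unfolding max[symmetric] h(2) by simp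
    then obtain g' where g': "g' \<in> unit_metrics T UNIV"
      "\<And>h. h \<in> unit_metrics T UNIV \<Longrightarrow> scal G Q UNIV hh h \<le> scal G Q UNIV hh g'"
      using maximum_exists[OF T g(1)] by metis
    \<comment> \<open>Positivity of the constant: the maximum is at least the value of
      \<open>g\<close>, which exceeds \<open>alpha\<close>, and \<open>alpha\<close> is at least the
      nonnegative value of the normal metric.\<close>
    obtain h0 where h0: "h0 \<in> unit_metrics T k" "scal G Q k hh h0 \<ge> 0"
      using normal_metric[OF ks T] by metis
    have "ereal (scal G Q k hh h0) \<le> alpha G H Q T k" unfolding alpha_eq by (rule SUP_upper[OF h0(1)])
    then have c: "scal G Q UNIV hh g' > 0" using h0(2) h(2) g(2) g'(2)[OF g(1)] by simp
    have gi: "g' \<in> invariant_metrics G H (perp Q hh)" "metric_trace g' (perp Q hh) T = 1"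
      using g'(1) unfolding unit_metrics_def pp_def by auto
    interpret hom_metric G Q H g' using gi(1) by unfold_locales
    have "ricci G Q hh g' x y = scal G Q UNIV hh g' * T x y" if "x \<in> perp Q hh" "y \<in> perp Q hh" for x y
    proof (rule ricci_of_maximum[OF T assms(5) gi(2) _ that])
      show "scal G Q UNIV hh h \<le> scal G Q UNIV hh g'"
        if "h \<in> invariant_metrics G H (perp Q hh)" "metric_trace h (perp Q hh) T = 1" for h
        using g'(2)[of h] that unfolding unit_metrics_def pp_def by simp
    qed
    then show "\<exists>g \<in> metrics_T G H Q T. (\<forall>g' \<in> metrics_T G H Q T. scal G Q UNIV hh g' \<le> scal G Q UNIV hh g) \<and>
          (\<exists>c>0. \<forall>x \<in> perp Q hh. \<forall>y \<in> perp Q hh. ricci G Q hh g x y = c * T x y)"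
      using g' c unfolding MT by blast
  qed
qed

end
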